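(* Let $k$ be an algebraically closed field of characteristic $p>0$, let $\delta\in\mathbb{Z}$ and let $r,s\ge0$ be integers. Two simple modules $L_{r,s}(\lambda^L,\lambda^R)$ and $L_{r,s}(\mu^L,\mu^R)$ of $B_{r,s}(\delta)$ are in the same block only if $(\bar{\mu}^L;\mu^R)\in W_p.(\bar{\lambda}^L;\lambda^R)$.
   Context: The integer $\delta$ is regarded as an element of $k$ via $\mathbb{Z}\to k$. The walled Brauer algebra $B_{r,s}=B_{r,s}(\delta)$ has $k$-basis the diagrams defined as follows. There are northern nodes $1,\dots,r+s$ and southern nodes $\overline{1},\dots,\overline{r+s}$; a wall separates the nodes $i,\overline{i}$ with $i\le r$ (left) from those with $i>r$ (right). A diagram is a partition of all nodes into pairs such that every northern–southern pair (propagating line) has both nodes on the same side of the wall, and every pair of two northern nodes (northern arc) or two southern nodes (southern arc) has one node on each side. The product $AB$ is obtained by placing $A$ above $B$ and identifying $\overline{i}$ of $A$ with $i$ of $B$; $AB=\delta^{t}C$, where $C$ is the diagram obtained after deleting the $t$ closed components. $\Lambda^{a,b}$ is the set of pairs $(\lambda^L,\lambda^R)$ with $\lambda^L$ a partition of $a$ and $\lambda^R$ a partition of $b$; $\Lambda^{a,b}_{reg}$ is the subset with both partitions $p$-regular (no $p$ equal nonzero parts). For $(\lambda^L,\lambda^R)\in\Lambda^{r-t,s-t}$ the cell module is $\Delta_{r,s}(\lambda^L,\lambda^R)=I^t\otimes_{k(\Sigma_{r-t}\times\Sigma_{s-t})}(S^{\lambda^L}\boxtimes S^{\lambda^R})$,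 where $S^{\lambda}$ is the Specht module (James' convention, $S^{(n)}$ trivial) and $I^t$ has basis the diagrams with $r+s$ northern nodes, $r-t$ left and $s-t$ right southern nodes, exactly $t$ northern arcs (each crossing the wall), and every southern node on a propagating line not crossing the wall. $B_{r,s}$ acts on $I^t$ by concatenation from above, with factor $\delta$ for each closed loop and result zero if there are fewer than $r+s-2t$ propagating lines; $\Sigma_{r-t}\times\Sigma_{s-t}$ permutes the southern nodes. The simple $B_{r,s}$-modules are the heads $L_{r,s}(\lambda^L,\lambda^R)$ of the $\Delta_{r,s}(\lambda^L,\lambda^R)$ with $(\lambda^L,\lambda^R)\in\Lambda^{r-t,s-t}_{reg}$, $0\le t\le\min(r,s)$ (omitting $(\emptyset,\emptyset)$ when $\delta=0$ in $k$ and $r=s\geq 1$). Let $X=\bigoplus_{i=-r}^{-1}\mathbb{Z}\epsilon_i\oplus\bigoplus_{i=1}^{s}\mathbb{Z}\epsilon_i$, with elements written $(\lambda_{-r},\dots,\lambda_{-1};\lambda_1,\dots,\lambda_s)$. A pair of partitions $(\lambda^L,\lambda^R)$ with at most $r$ and $s$ parts is identified with $(\bar{\lambda}^L;\lambda^R)=(-\lambda^L_r,-\lambda^L_{r-1},\dots,-\lambda^L_1;\lambda^R_1,\dots,\lambda^R_s)\in X$. On $E=X\otimes_{\mathbb{Z}}\mathbb{R}$ take the inner product for which the $\epsilon_i$ are orthonormal and let $\Phi=\{\pm(\epsilon_i-\epsilon_j):-r\le i<j\le s,\ i,j\ne0\}$. $W_p$ is the group generated by the affine reflections $s_{\beta,mp}(\lambda)=\lambda-((\lambda,\beta)-mp)\beta$,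 $\beta\in\Phi$, $m\in\mathbb{Z}$. With $\rho=(r,r-1,\dots,1;\delta,\delta-1,\dots,\delta-s+1)$, the dot action is $w.\lambda=w(\lambda+\rho)-\rho$. *)

theory Defs
  imports
    "HOL-Algebra.Bij"
    "HOL-Algebra.Generated_Groups"
    "HOL-Algebra.Module"
    "HOL-Algebra.AbelCoset"
    "HOL-Combinatorics.Permutations"
    "HOL-Computational_Algebra.Polynomial"
    "HOL-Library.Disjoint_Sets"
    "HOL-Library.Function_Algebras"
begin

section \<open>Modules over a not necessarily commutative ring\<close>

text \<open>
  A left module over a ring \<open>R\<close> is given by a \<open>module\<close> record; its fields \<open>mult\<close> and
  \<open>one\<close> carry no information.  The locale \<^locale>\<open>module\<close> asks for commutative scalars and
  is not used, whereas the library's \<^locale>\<open>submodule\<close> makes sense over any ring.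
\<close>

definition quotient_module :: "('a, 'b) module \<Rightarrow> 'b set \<Rightarrow> ('a, 'b set) module" where
  "quotient_module M N =
     \<lparr>carrier = a_rcosets\<^bsub>M\<^esub> N,
      monoid.mult = (\<lambda>_ _. N),
      one = N,
      zero = N,
      add = set_add M,
      module.smult = (\<lambda>a Z. \<Union>x\<in>Z. N +>\<^bsub>M\<^esub> (a \<odot>\<^bsub>M\<^esub> x))\<rparr>"

definition maximal_submodule :: "'b set \<Rightarrow> 'a ring \<Rightarrow> ('a, 'b) module \<Rightarrow> bool" where
  "maximal_submodule N R M \<longleftrightarrow>
     submodule N R M \<and> N \<noteq> carrier M \<and>
     (\<forall>K. submodule K R M \<and> N \<subseteq> K \<longrightarrow> K = N \<or> K = carrier M)"

definition radical :: "'a ring \<Rightarrow> ('a, 'b) module \<Rightarrow> 'b set" where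
  "radical R M = carrier M \<inter> \<Inter>{N. maximal_submodule N R M}"

definition head :: "'a ring \<Rightarrow> ('a, 'b) module \<Rightarrow> ('a, 'b set) module" where
  "head R M = quotient_module M (radical R M)"

text \<open>
  The blocks of \<open>R\<close> are the indecomposable two-sided ideals \<open>Re\<close>, \<open>e\<close> a primitive central
  idempotent; a module lies in the block of \<open>e\<close> iff \<open>e\<close> acts on it as the identity.
\<close>

definition central_idempotent :: "'a ring \<Rightarrow> 'a \<Rightarrow> bool" where
  "central_idempotent R e \<longleftrightarrow>
     e \<in> carrier R \<and> e \<otimes>\<^bsub>R\<^esub> e = e \<and> (\<forall>x\<in>carrier R. e \<otimes>\<^bsub>R\<^esub> x = x \<otimes>\<^bsub>R\<^esub> e)"

definition primitive_central_idempotent :: "'a ring \<Rightarrow> 'a \<Rightarrow> bool" where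
  "primitive_central_idempotent R e \<longleftrightarrow>
     central_idempotent R e \<and> e \<noteq> \<zero>\<^bsub>R\<^esub> \<and>
     (\<forall>f g. central_idempotent R f \<and> central_idempotent R g \<and>
        f \<otimes>\<^bsub>R\<^esub> g = \<zero>\<^bsub>R\<^esub> \<and> e = f \<oplus>\<^bsub>R\<^esub> g \<longrightarrow> f = \<zero>\<^bsub>R\<^esub> \<or> g = \<zero>\<^bsub>R\<^esub>)"

definition in_block :: "'a ring \<Rightarrow> 'a \<Rightarrow> ('a, 'b) module \<Rightarrow> bool" where
  "in_block R e M \<longleftrightarrow> primitive_central_idempotent R e \<and> (\<forall>x\<in>carrier M. e \<odot>\<^bsub>M\<^esub> x = x)"

definition same_block :: "'a ring \<Rightarrow> ('a, 'b) module \<Rightarrow> ('a, 'c) module \<Rightarrow> bool" where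
  "same_block R M N \<longleftrightarrow> (\<exists>e. in_block R e M \<and> in_block R e N)"


section \<open>Spaces of functions\<close>

text \<open>
  Vector spaces with a distinguished basis \<open>X\<close> are realised as spaces of functions on \<open>X\<close>,
  a basis vector \<open>x\<close> being the function \<open>unit_at x\<close>.  For subspaces \<open>U\<close>, \<open>V\<close> of function
  spaces over a field, \<open>tensor_space U V\<close> is the tensor product over that field, with
  \<open>u \<otimes> v\<close> realised as the function \<open>(x, y) \<mapsto> u x * v y\<close>.
\<close>

definition fun_span :: "('x \<Rightarrow> 'k::field) set \<Rightarrow> ('x \<Rightarrow> 'k) set" where
  "fun_span = module.span (\<lambda>c f x. c * f x)"

definition supported_on :: "'x set \<Rightarrow> ('x \<Rightarrow> 'k::zero) set" where
  "supported_on S = {f. \<forall>x. x \<notin> S \<longrightarrow> f x = 0}"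

definition unit_at :: "'x \<Rightarrow> 'x \<Rightarrow> 'k::zero_neq_one" where
  "unit_at x = (\<lambda>y. if y = x then 1 else 0)"

definition pure_tensor :: "('x \<Rightarrow> 'k::field) \<Rightarrow> ('y \<Rightarrow> 'k) \<Rightarrow> 'x \<times> 'y \<Rightarrow> 'k" where
  "pure_tensor u v = (\<lambda>(x, y). u x * v y)"

definition tensor_space ::
  "('x \<Rightarrow> 'k::field) set \<Rightarrow> ('y \<Rightarrow> 'k) set \<Rightarrow> ('x \<times> 'y \<Rightarrow> 'k) set" where
  "tensor_space U V = fun_span {pure_tensor u v | u v. u \<in> U \<and> v \<in> V}"


section \<open>Partitions and Specht modules\<close>

definition partitions :: "nat \<Rightarrow> nat list set" where
  "partitions n = {l. sorted_wrt (\<ge>) l \<and> 0 \<notin> set l \<and> sum_list l = n}"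

text \<open>The \<open>i\<close>-th part, counted from 1 and equal to 0 beyond the length of the list.\<close>

definition part :: "nat list \<Rightarrow> nat \<Rightarrow> nat" where
  "part l i = (if 1 \<le> i \<and> i \<le> length l then l ! (i - 1) else 0)"

definition p_regular :: "nat \<Rightarrow> nat list \<Rightarrow> bool" where
  "p_regular p l \<longleftrightarrow> (\<forall>m. m \<noteq> 0 \<longrightarrow> count_list l m < p)"

definition bipartitions :: "nat \<Rightarrow> nat \<Rightarrow> (nat list \<times> nat list) set" where
  "bipartitions a b = partitions a \<times> partitions b"

definition bipartitions_reg :: "nat \<Rightarrow> nat \<Rightarrow> nat \<Rightarrow> (nat list \<times> nat list) set" where
  "bipartitions_reg p a b = {(l, m) \<in> bipartitions a b. p_regular p l \<and> p_regular p m}"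

definition young_diagram :: "nat list \<Rightarrow> (nat \<times> nat) set" where
  "young_diagram l = {(i, j). 1 \<le> i \<and> 1 \<le> j \<and> j \<le> part l i}"

definition tableau :: "nat list \<Rightarrow> (nat \<times> nat \<Rightarrow> nat) \<Rightarrow> bool" where
  "tableau l t \<longleftrightarrow> bij_betw t (young_diagram l) {1..sum_list l}"

text \<open>A tabloid is given by its rows: \<open>T i\<close> is the set of entries of the \<open>i\<close>-th row.\<close>

type_synonym tabloid = "nat \<Rightarrow> nat set"

definition tabloid_of :: "nat list \<Rightarrow> (nat \<times> nat \<Rightarrow> nat) \<Rightarrow> tabloid" where
  "tabloid_of l t = (\<lambda>i. {t (i, j) | j. (i, j) \<in> young_diagram l})"

definition column_stabilizer :: "nat list \<Rightarrow> (nat \<times> nat \<Rightarrow> nat) \<Rightarrow> (nat \<Rightarrow> nat) set" where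
  "column_stabilizer l t =
     {\<sigma>. \<sigma> permutes {1..sum_list l} \<and>
         (\<forall>j. \<sigma> ` {t (i, j) | i. (i, j) \<in> young_diagram l} = {t (i, j) | i. (i, j) \<in> young_diagram l})}"

definition polytabloid :: "nat list \<Rightarrow> (nat \<times> nat \<Rightarrow> nat) \<Rightarrow> tabloid \<Rightarrow> 'k::field" where
  "polytabloid l t =
     (\<lambda>T. \<Sum>\<sigma>\<in>column_stabilizer l t. of_int (sign \<sigma>) * unit_at (tabloid_of l (\<sigma> \<circ> t)) T)"

definition specht :: "nat list \<Rightarrow> (tabloid \<Rightarrow> 'k::field) set" where
  "specht l = fun_span {polytabloid l t | t. tableau l t}"

definition perm_tabloid :: "(nat \<Rightarrow> nat) \<Rightarrow> tabloid \<Rightarrow> tabloid" where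
  "perm_tabloid \<sigma> T = (\<lambda>i. \<sigma> ` T i)"

text \<open>
  Left action of \<open>(\<sigma>, \<tau>)\<close> on functions on pairs of tabloids, extending linearly
  \<open>(T, U) \<mapsto> (\<sigma>T, \<tau>U)\<close>.
\<close>

definition perm_act :: "(nat \<Rightarrow> nat) \<times> (nat \<Rightarrow> nat) \<Rightarrow>
    (tabloid \<times> tabloid \<Rightarrow> 'k) \<Rightarrow> tabloid \<times> tabloid \<Rightarrow> 'k" where
  "perm_act = (\<lambda>(\<sigma>, \<tau>) v (T, U).
     v (perm_tabloid (inv_into UNIV \<sigma>) T, perm_tabloid (inv_into UNIV \<tau>) U))"


section \<open>Walled Brauer diagrams\<close>

datatype node = is_north: North nat | is_south: South nat

type_synonym diagram = "node set set"

definition nodes :: "nat \<Rightarrow> nat \<Rightarrow> node set" where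
  "nodes m n = North ` {1..m} \<union> South ` {1..n}"

text \<open>Left of the wall are the first \<open>r\<close> northern and the first \<open>a\<close> southern nodes.\<close>

fun left_of_wall :: "nat \<Rightarrow> nat \<Rightarrow> node \<Rightarrow> bool" where
  "left_of_wall r a (North i) = (i \<le> r)"
| "left_of_wall r a (South i) = (i \<le> a)"

text \<open>
  Diagrams with \<open>r\<close> left and \<open>s\<close> right northern nodes and \<open>a\<close> left and \<open>b\<close> right
  southern nodes.
\<close>

definition walled_diagrams :: "nat \<Rightarrow> nat \<Rightarrow> nat \<Rightarrow> nat \<Rightarrow> diagram set" where
  "walled_diagrams r s a b =
     {d. partition_on (nodes (r + s) (a + b)) d \<and>
         (\<forall>P\<in>d. \<exists>u v. P = {u, v} \<and> u \<noteq> v \<and>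
            (if is_north u \<longleftrightarrow> is_north v
             then left_of_wall r a u \<noteq> left_of_wall r a v
             else left_of_wall r a u = left_of_wall r a v))}"

text \<open>The basis of \<open>I\<^sup>t\<close>.\<close>

definition half_diagrams :: "nat \<Rightarrow> nat \<Rightarrow> nat \<Rightarrow> diagram set" where
  "half_diagrams r s t =
     {d \<in> walled_diagrams r s (r - t) (s - t).
        card {P \<in> d. \<forall>u\<in>P. is_north u} = t \<and>
        (\<forall>P\<in>d. \<forall>v\<in>P. is_south v \<longrightarrow> (\<exists>u\<in>P. is_north u))}"

text \<open>
  In the graph obtained by placing \<open>A\<close> above \<open>B\<close>, \<open>Middle i\<close> is both the \<open>i\<close>-th southern
  node of \<open>A\<close> and the \<open>i\<close>-th northern node of \<open>B\<close>.
\<close>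

datatype stacked_node = Top nat | Middle nat | Bottom nat

fun in_upper :: "node \<Rightarrow> stacked_node" where
  "in_upper (North i) = Top i"
| "in_upper (South i) = Middle i"

fun in_lower :: "node \<Rightarrow> stacked_node" where
  "in_lower (North i) = Middle i"
| "in_lower (South i) = Bottom i"

fun outer_node :: "node \<Rightarrow> stacked_node" where
  "outer_node (North i) = Top i"
| "outer_node (South i) = Bottom i"

definition joined :: "diagram \<Rightarrow> diagram \<Rightarrow> (stacked_node \<times> stacked_node) set" where
  "joined A B = {(x, y). {x, y} \<in> image in_upper ` A \<union> image in_lower ` B}\<^sup>*"

definition diagram_concat :: "diagram \<Rightarrow> diagram \<Rightarrow> diagram" where
  "diagram_concat A B = {{u, v} | u v. u \<noteq> v \<and> (outer_node u, outer_node v) \<in> joined A B}"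

text \<open>The number of closed components, i.e. of those which consist of middle nodes only.\<close>

definition closed_components :: "diagram \<Rightarrow> diagram \<Rightarrow> nat" where
  "closed_components A B =
     card {joined A B `` {Middle i} | i.
             South i \<in> \<Union>A \<and> joined A B `` {Middle i} \<subseteq> range Middle}"

definition walled_brauer :: "'k::field \<Rightarrow> nat \<Rightarrow> nat \<Rightarrow> (diagram \<Rightarrow> 'k) ring" where
  "walled_brauer \<delta> r s =
     \<lparr>carrier = supported_on (walled_diagrams r s r s),
      monoid.mult = (\<lambda>x y C. \<Sum>A\<in>walled_diagrams r s r s. \<Sum>B\<in>walled_diagrams r s r s.
                x A * y B * \<delta> ^ closed_components A B * unit_at (diagram_concat A B) C),
      one = unit_at {{North i, South i} | i. i \<in> {1..r + s}},
      zero = 0,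
      add = (+)\<rparr>"


section \<open>Cell modules and simple modules\<close>

text \<open>
  Action of the walled Brauer algebra on \<open>I\<^sup>t\<close>.  A diagram with \<open>r + s\<close> northern and
  \<open>r + s - 2 * t\<close> southern nodes belongs to \<open>half_diagrams r s t\<close> iff it has
  \<open>r + s - 2 * t\<close> propagating lines, so products with fewer of them are discarded.
\<close>

definition half_act ::
  "'k::field \<Rightarrow> nat \<Rightarrow> nat \<Rightarrow> nat \<Rightarrow> (diagram \<Rightarrow> 'k) \<Rightarrow> (diagram \<Rightarrow> 'k) \<Rightarrow> diagram \<Rightarrow> 'k" where
  "half_act \<delta> r s t x f =
     (\<lambda>C. \<Sum>A\<in>walled_diagrams r s r s. \<Sum>D\<in>half_diagrams r s t.
        if diagram_concat A D \<in> half_diagrams r s t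
        then x A * f D * \<delta> ^ closed_components A D * unit_at (diagram_concat A D) C
        else 0)"

text \<open>
  Right action of \<open>\<Sigma>\<^sub>a \<times> \<Sigma>\<^sub>b\<close> on diagrams: \<open>D \<cdot> (\<sigma>, \<tau>)\<close> is \<open>D\<close> placed above the
  permutation diagram which joins the southern node \<open>j\<close> with the northern node \<open>\<sigma> j\<close>
  (for \<open>j \<le> a\<close>) and \<open>a + j\<close> with \<open>a + \<tau> j\<close>.  Hence the southern nodes of \<open>D\<close> are
  relabelled by the inverse permutations.
\<close>

fun relabel_south :: "(nat \<Rightarrow> nat) \<Rightarrow> node \<Rightarrow> node" where
  "relabel_south \<pi> (North i) = North i"
| "relabel_south \<pi> (South j) = South (\<pi> j)"

definition perm_south :: "nat \<Rightarrow> diagram \<Rightarrow> (nat \<Rightarrow> nat) \<times> (nat \<Rightarrow> nat) \<Rightarrow> diagram" where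
  "perm_south a D = (\<lambda>(\<sigma>, \<tau>).
     image (relabel_south (\<lambda>j. if j \<le> a then inv_into UNIV \<sigma> j
                               else a + inv_into UNIV \<tau> (j - a))) ` D)"

text \<open>The module \<open>I\<^sup>t \<otimes>\<^sub>k V\<close>, with the algebra acting on the first factor.\<close>

definition half_tensor_module ::
  "'k::field \<Rightarrow> nat \<Rightarrow> nat \<Rightarrow> nat \<Rightarrow> ('y \<Rightarrow> 'k) set \<Rightarrow> (diagram \<Rightarrow> 'k, diagram \<times> 'y \<Rightarrow> 'k) module" where
  "half_tensor_module \<delta> r s t V =
     \<lparr>carrier = tensor_space (supported_on (half_diagrams r s t)) V,
      monoid.mult = (\<lambda>_ _. 0),
      one = 0,
      zero = 0,
      add = (+),
      module.smult = (\<lambda>x F (C, y). half_act \<delta> r s t x (\<lambda>D. F (D, y)) C)\<rparr>"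

text \<open>
  The kernel of \<open>I\<^sup>t \<otimes>\<^sub>k V \<rightarrow> I\<^sup>t \<otimes>\<^bsub>kH\<^esub> V\<close> for
  \<open>H = \<Sigma>\<^bsub>r-t\<^esub> \<times> \<Sigma>\<^bsub>s-t\<^esub>\<close>.
\<close>

definition balancing_relations ::
  "nat \<Rightarrow> nat \<Rightarrow> nat \<Rightarrow> (tabloid \<times> tabloid \<Rightarrow> 'k::field) set \<Rightarrow> (diagram \<times> tabloid \<times> tabloid \<Rightarrow> 'k) set" where
  "balancing_relations r s t V =
     fun_span {pure_tensor (unit_at (perm_south (r - t) D h)) v - pure_tensor (unit_at D) (perm_act h v) | D h v.
       D \<in> half_diagrams r s t \<and> v \<in> V \<and>
       h \<in> {\<sigma>. \<sigma> permutes {1..r - t}} \<times> {\<tau>. \<tau> permutes {1..s - t}}}"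

text \<open>
  For a pair of partitions of \<open>r - t\<close> and \<open>s - t\<close> with \<open>t \<le> min r s\<close>, the number \<open>t\<close> is
  recovered from the pair.
\<close>

definition cell_module :: "'k::field \<Rightarrow> nat \<Rightarrow> nat \<Rightarrow> nat list \<times> nat list \<Rightarrow>
    (diagram \<Rightarrow> 'k, (diagram \<times> tabloid \<times> tabloid \<Rightarrow> 'k) set) module" where
  "cell_module \<delta> r s = (\<lambda>(l, m).
     let t = r - sum_list l; V = tensor_space (specht l) (specht m)
     in quotient_module (half_tensor_module \<delta> r s t V) (balancing_relations r s t V))"

definition simple_module :: "'k::field \<Rightarrow> nat \<Rightarrow> nat \<Rightarrow> nat list \<times> nat list \<Rightarrow>
    (diagram \<Rightarrow> 'k, (diagram \<times> tabloid \<times> tabloid \<Rightarrow> 'k) set set) module" where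
  "simple_module \<delta> r s lm = head (walled_brauer \<delta> r s) (cell_module \<delta> r s lm)"

definition simple_labels :: "'k::field \<Rightarrow> nat \<Rightarrow> nat \<Rightarrow> (nat list \<times> nat list) set" where
  "simple_labels \<delta> r s =
     (\<Union>t\<in>{0..min r s}. bipartitions_reg CHAR('k) (r - t) (s - t)) -
     (if \<delta> = 0 \<and> r = s \<and> r \<ge> 1 then {([], [])} else {})"


section \<open>The affine Weyl group\<close>

definition weight_indices :: "nat \<Rightarrow> nat \<Rightarrow> int set" where
  "weight_indices r s = {- int r..int s} - {0}"

text \<open>The Euclidean space \<open>E\<close>; the lattice \<open>X\<close> consists of its integral vectors.\<close>

definition weight_space :: "nat \<Rightarrow> nat \<Rightarrow> (int \<Rightarrow> real) set" where
  "weight_space r s = supported_on (weight_indices r s)"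

definition weight_inner :: "nat \<Rightarrow> nat \<Rightarrow> (int \<Rightarrow> real) \<Rightarrow> (int \<Rightarrow> real) \<Rightarrow> real" where
  "weight_inner r s x y = (\<Sum>i\<in>weight_indices r s. x i * y i)"

definition roots :: "nat \<Rightarrow> nat \<Rightarrow> (int \<Rightarrow> real) set" where
  "roots r s = (\<Union>i\<in>weight_indices r s. \<Union>j\<in>{j \<in> weight_indices r s. i < j}.
     {unit_at i - unit_at j, - (unit_at i - unit_at j)})"

definition affine_reflection :: "nat \<Rightarrow> nat \<Rightarrow> (int \<Rightarrow> real) \<Rightarrow> int \<Rightarrow> (int \<Rightarrow> real) \<Rightarrow> int \<Rightarrow> real" where
  "affine_reflection r s \<beta> n =
     (\<lambda>x\<in>weight_space r s. (\<lambda>i. x i - (weight_inner r s x \<beta> - of_int n) * \<beta> i))"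

definition affine_weyl_group :: "nat \<Rightarrow> nat \<Rightarrow> nat \<Rightarrow> ((int \<Rightarrow> real) \<Rightarrow> int \<Rightarrow> real) set" where
  "affine_weyl_group p r s =
     generate (BijGroup (weight_space r s))
       {affine_reflection r s \<beta> (m * int p) | \<beta> m. \<beta> \<in> roots r s}"

definition rho :: "int \<Rightarrow> nat \<Rightarrow> nat \<Rightarrow> int \<Rightarrow> real" where
  "rho \<delta> r s i =
     (if i \<notin> weight_indices r s then 0
      else if i < 0 then of_int (- i)
      else of_int (\<delta> - i + 1))"

definition dot_action ::
  "int \<Rightarrow> nat \<Rightarrow> nat \<Rightarrow> ((int \<Rightarrow> real) \<Rightarrow> int \<Rightarrow> real) \<Rightarrow> (int \<Rightarrow> real) \<Rightarrow> int \<Rightarrow> real" where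
  "dot_action \<delta> r s w x = w (x + rho \<delta> r s) - rho \<delta> r s"

text \<open>The vector identified with a pair of partitions with at most \<open>r\<close> and \<open>s\<close> parts.\<close>

definition bipartition_weight :: "nat \<Rightarrow> nat \<Rightarrow> nat list \<times> nat list \<Rightarrow> int \<Rightarrow> real" where
  "bipartition_weight r s = (\<lambda>(l, m) i.
     if i \<notin> weight_indices r s then 0
     else if i < 0 then - real (part l (nat (- i)))
     else real (part m (nat i)))"

end

theory Submission
  imports Defs "HOL-Computational_Algebra.Polynomial_FPS"
begin

text \<open>
  Choose \<open>n \<equiv> \<delta>\<close> modulo \<open>p\<close> with \<open>n > 2 (r + s)\<close>. Then \<open>B\<^sub>r\<^sub>,\<^sub>s(\<delta>)\<close> acts faithfully on the mixed tensor
  space \<open>V\<^bsup>\<otimes>r\<^esup> \<otimes> V*\<^bsup>\<otimes>s\<^esup>\<close> of \<open>gl\<^sub>n\<close>, commuting with \<open>gl\<^sub>n\<close>, and the Casimir operators \<open>tr (E\<^bsup>k\<^esup>)\<close> are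
  images of central elements of \<open>B\<^sub>r\<^sub>,\<^sub>s(\<delta>)\<close>; by Fitting's lemma such an operator has one eigenvalue on
  each block. The cell module of \<open>(\<lambda>\<^sup>L, \<lambda>\<^sup>R)\<close> maps to mixed tensor space; its image is
  obtained by applying diagrams to highest weight vectors of weight \<open>(\<lambda>\<^sup>L, 0, \<dots>, 0, -\<lambda>\<^sup>R)\<close>, and the head
  of the cell module is a subquotient of it. The Perelomov-Popov formula for the eigenvalues of the Casimir
  operators on highest weight vectors shows that they determine the multiset of residues
  modulo \<open>p\<close> of the coordinates of the weight shifted by \<open>\<rho>\<close>. As the sum of the coordinates is fixed
  as well, this multiset determines the orbit under \<open>W\<^sub>p\<close>.
\<close>

section \<open>Concatenation of walled Brauer diagrams\<close>

text \<open>Replacing the parameter by a large natural number \<open>n\<close> turns diagrams into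
  0-1 matrices indexed by colourings with \<open>n\<close> colours; a closed component contributes
  \<open>n\<close> because it can be coloured freely. Faithfulness of these matrices then supplies
  the ring axioms and centrality without a calculus of diagrams. A single Casimir eigenvalue is one
  element of \<open>k\<close> and cannot determine a multiset of residues, so the traces of all
  powers of \<open>E\<close> are used. They are obtained inside the algebra by adding one strand,
  taking powers of a Jucys-Murphy element there, and closing the strand again. About the map from a
  cell module to tensor space only nonvanishing is shown. This suffices: the image has a maximal
  proper submodule, whose preimage contains the radical, so an idempotent that is the identity on
  the head cannot kill the image. The bound \<open>2 * (r + s)\<close> leaves a separate colour for
  every pair of a diagram, and keeps the colours of left factors apart from those of right factors
  in the highest weight vectors.\<close>

lemma rtrancl_symcl_from_start:
  assumes "single_valued (R\<inverse>)" "x \<notin> Range R" "(x, y) \<in> (R \<union> R\<inverse>)\<^sup>*"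
  shows "(x, y) \<in> R\<^sup>*"
  using assms(3)
proof (induction rule: rtrancl_induct)
  case (step y z)
  show ?case
  proof (cases "(y, z) \<in> R")
    case False
    hence zy: "(z, y) \<in> R" using step by auto
    from step.IH show ?thesis
    proof (cases rule: rtranclE)
      case base
      thus ?thesis using zy assms(2) by auto
    next
      case (step w)
      hence "w = z" using zy assms(1) by (auto simp: single_valued_def)
      thus ?thesis using step by simp
    qed
  qed (use step in auto)
qed auto

text \<open>A finite partial injection decomposes into paths and cycles, and a point without
  predecessor starts a path. If every reachable point had a successor, the successor map would be
  injective on the finite reachable set, hence onto, and would hit \<open>x\<close>. Two ends
  coincide because \<open>R\<close> is confluent.\<close>

lemma ex1_end_from_start:
  assumes "finite R" "single_valued R" "single_valued (R\<inverse>)" "x \<notin> Range R"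
  shows "\<exists>!y. (x, y) \<in> (R \<union> R\<inverse>)\<^sup>* \<and> y \<notin> Domain R"
proof -
  define K where "K = R\<^sup>* `` {x}"
  have eq: "(x, y) \<in> (R \<union> R\<inverse>)\<^sup>* \<longleftrightarrow> y \<in> K" for y
    using rtrancl_symcl_from_start[OF assms(3,4)] rtrancl_mono[of R "R \<union> R\<inverse>"]
    by (auto simp: K_def)
  have "K \<subseteq> insert x (Range R)"
    unfolding K_def by (auto elim: rtranclE)
  hence finK: "finite K" using assms(1) finite_Range finite_subset by blast
  have "\<exists>y\<in>K. y \<notin> Domain R"
  proof (rule ccontr)
    assume "\<not> ?thesis"
    hence "\<forall>y\<in>K. \<exists>z. (y, z) \<in> R" by auto
    then obtain f where f: "\<And>y. y \<in> K \<Longrightarrow> (y, f y) \<in> R" by metis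
    have "f ` K \<subseteq> K" using f unfolding K_def by (auto intro: rtrancl_into_rtrancl)
    moreover have "inj_on f K"
      using f assms(3) unfolding single_valued_def inj_on_def by (metis converse.intros)
    ultimately have "f ` K = K" using finK by (simp add: endo_inj_surj)
    moreover have "x \<in> K" by (simp add: K_def)
    ultimately show False using f assms(4) by (metis Range.intros imageE)
  qed
  moreover have "y = z" if "y \<in> K" "y \<notin> Domain R" "z \<in> K" "z \<notin> Domain R" for y z
  proof -
    have "(y, z) \<in> R\<^sup>* \<or> (z, y) \<in> R\<^sup>*"
      using single_valued_confluent[OF assms(2)] that unfolding K_def by blast
    thus ?thesis using that by (metis Domain.DomainI converse_rtranclE)
  qed
  ultimately show ?thesis unfolding eq by blast
qed

text \<open>Orients all strands: downwards on the left of the wall, upwards on the right, and arcs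
  accordingly from one side to the other. Plus nodes are those where a strand starts.\<close>

definition plus_node :: "nat \<Rightarrow> nat \<Rightarrow> node \<Rightarrow> bool" where
  "plus_node r a u \<longleftrightarrow> left_of_wall r a u = is_north u"

lemma plus_node_simps [simp]:
  "plus_node r a (North i) \<longleftrightarrow> i \<le> r"
  "plus_node r a (South j) \<longleftrightarrow> a < j"
  by (auto simp: plus_node_def)

text \<open>The wall conditions say that every pair consists of a source and a sink.\<close>

lemma wall_condition_iff:
  "(if is_north u \<longleftrightarrow> is_north v then left_of_wall r a u \<noteq> left_of_wall r a v
    else left_of_wall r a u = left_of_wall r a v) \<longleftrightarrow> plus_node r a u \<noteq> plus_node r a v"
  by (cases u; cases v) auto

lemma walled_diagrams_iff:
  "D \<in> walled_diagrams r s a b \<longleftrightarrow> partition_on (nodes (r + s) (a + b)) D \<and>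
     (\<forall>P\<in>D. \<exists>u v. P = {u, v} \<and> plus_node r a u \<and> \<not> plus_node r a v)"
proof -
  have "(\<exists>u v. P = {u, v} \<and> u \<noteq> v \<and> plus_node r a u \<noteq> plus_node r a v) \<longleftrightarrow>
        (\<exists>u v. P = {u, v} \<and> plus_node r a u \<and> \<not> plus_node r a v)" for P
    by (metis insert_commute)
  thus ?thesis unfolding walled_diagrams_def wall_condition_iff by simp
qed

lemma finite_nodes [simp]: "finite (nodes m n)"
  by (simp add: nodes_def)

lemma finite_walled_diagrams [simp]: "finite (walled_diagrams r s a b)"
proof (rule finite_subset)
  show "walled_diagrams r s a b \<subseteq> Pow (Pow (nodes (r + s) (a + b)))"
    by (intro subsetI PowI) (auto simp: walled_diagrams_iff partition_on_def)
qed simp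

definition partner :: "diagram \<Rightarrow> node \<Rightarrow> node" where
  "partner D u = (THE v. {u, v} \<in> D)"

lemma walled_diagram_pair_unique:
  assumes "D \<in> walled_diagrams r s a b" "{u, v} \<in> D" "{u, w} \<in> D"
  shows "v = w"
proof -
  have "{u, v} = {u, w}"
  proof (rule ccontr)
    assume "{u, v} \<noteq> {u, w}"
    moreover have "disjoint D" using assms(1) by (simp add: walled_diagrams_iff partition_on_def)
    ultimately have "{u, v} \<inter> {u, w} = {}" using disjointD assms(2,3) by metis
    thus False by simp
  qed
  thus ?thesis by (auto simp: doubleton_eq_iff)
qed

lemma walled_diagram_obtain_pair:
  assumes "D \<in> walled_diagrams r s a b" "u \<in> nodes (r + s) (a + b)"
  obtains v where "{u, v} \<in> D" "plus_node r a v \<noteq> plus_node r a u" "v \<noteq> u"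
    "v \<in> nodes (r + s) (a + b)"
proof -
  have "u \<in> \<Union>D" using assms unfolding walled_diagrams_iff partition_on_def by auto
  then obtain P where P: "P \<in> D" "u \<in> P" by auto
  then obtain x y where xy: "P = {x, y}" "plus_node r a x" "\<not> plus_node r a y"
    using assms(1) unfolding walled_diagrams_iff by meson
  have "P \<subseteq> nodes (r + s) (a + b)"
    using assms(1) P unfolding walled_diagrams_iff partition_on_def by auto
  thus ?thesis using that P xy by (cases "u = x") (force simp: insert_commute)+
qed

lemma walled_diagram_pair_plus:
  assumes "D \<in> walled_diagrams r s a b" "{u, v} \<in> D"
  shows "plus_node r a u \<noteq> plus_node r a v"
    and "u \<in> nodes (r + s) (a + b)" and "v \<in> nodes (r + s) (a + b)"
proof -
  obtain x y where "{u, v} = {x, y}" "plus_node r a x" "\<not> plus_node r a y"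
    using assms unfolding walled_diagrams_iff by meson
  thus "plus_node r a u \<noteq> plus_node r a v" by (auto simp: doubleton_eq_iff)
  show "u \<in> nodes (r + s) (a + b)" "v \<in> nodes (r + s) (a + b)"
    using assms unfolding walled_diagrams_iff partition_on_def by auto
qed

lemma walled_diagramsI:
  assumes "\<And>P. P \<in> D \<Longrightarrow> \<exists>u v. P = {u, v} \<and> plus_node r a u \<and> \<not> plus_node r a v"
    and "\<Union>D = nodes (r + s) (a + b)"
    and "\<And>u v w. {u, v} \<in> D \<Longrightarrow> {u, w} \<in> D \<Longrightarrow> v = w"
  shows "D \<in> walled_diagrams r s a b"
proof -
  have "disjnt P Q" if "P \<in> D" "Q \<in> D" "P \<noteq> Q" for P Q
  proof (rule ccontr)
    assume "\<not> disjnt P Q"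
    then obtain x where x: "x \<in> P" "x \<in> Q" by (auto simp: disjnt_def)
    have "\<exists>y. P = {x, y}" "\<exists>z. Q = {x, z}"
      using assms(1)[OF that(1)] assms(1)[OF that(2)] x by auto
    then obtain y z where y: "P = {x, y}" and z: "Q = {x, z}" by auto
    show False using assms(3)[of x y z] y z that by auto
  qed
  moreover have "{} \<notin> D" using assms(1)[of "{}"] by auto
  ultimately show ?thesis
    unfolding walled_diagrams_iff using assms(1,2) by (auto intro!: partition_onI)
qed

section \<open>Colourings as coordinates of mixed tensor space\<close>

definition colorings :: "nat \<Rightarrow> nat \<Rightarrow> (nat \<Rightarrow> nat) set" where
  "colorings n m = {1..m} \<rightarrow>\<^sub>E {1..n}"

lemma finite_colorings [simp]: "finite (colorings n m)"
  by (simp add: colorings_def finite_PiE)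

fun node_color :: "(nat \<Rightarrow> nat) \<Rightarrow> (nat \<Rightarrow> nat) \<Rightarrow> node \<Rightarrow> nat" where
  "node_color c d (North i) = c i"
| "node_color c d (South j) = d j"

definition compatible :: "diagram \<Rightarrow> (nat \<Rightarrow> nat) \<Rightarrow> (nat \<Rightarrow> nat) \<Rightarrow> bool" where
  "compatible D c d \<longleftrightarrow> (\<forall>u v. {u, v} \<in> D \<longrightarrow> node_color c d u = node_color c d v)"

text \<open>The matrix of Brauer's action: arcs are the invariant pairings and copairings of the
  natural module with its dual, propagating lines are identities. Rows are indexed by northern,
  columns by southern colourings.\<close>

definition diagram_matrix :: "diagram \<Rightarrow> (nat \<Rightarrow> nat) \<Rightarrow> (nat \<Rightarrow> nat) \<Rightarrow> 'k::comm_ring_1" where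
  "diagram_matrix D c d = of_bool (compatible D c d)"

fun stack_color :: "(nat \<Rightarrow> nat) \<Rightarrow> (nat \<Rightarrow> nat) \<Rightarrow> (nat \<Rightarrow> nat) \<Rightarrow> stacked_node \<Rightarrow> nat" where
  "stack_color c e d (Top i) = c i"
| "stack_color c e d (Middle i) = e i"
| "stack_color c e d (Bottom i) = d i"

lemma stack_color_simps [simp]:
  "stack_color c e d (outer_node u) = node_color c d u"
  "stack_color c e d (in_upper u) = node_color c e u"
  "stack_color c e d (in_lower u) = node_color e d u"
  by (cases u; simp)+

lemma stacked_inj [simp]:
  "in_upper u = in_upper v \<longleftrightarrow> u = v"
  "in_lower u = in_lower v \<longleftrightarrow> u = v"
  "outer_node u = outer_node v \<longleftrightarrow> u = v"
  by (cases u; cases v; simp)+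

section \<open>The oriented graph of two stacked diagrams\<close>

locale stacked_diagrams =
  fixes A B :: diagram and r s a b a' b' :: nat
  assumes A: "A \<in> walled_diagrams r s a b" and B: "B \<in> walled_diagrams a b a' b'"
begin

text \<open>The orientations of \<open>A\<close> and \<open>B\<close> fit together: a middle node is
  the start of an arrow in one of the two diagrams and the end of an arrow in the other.\<close>

definition arrows :: "(stacked_node \<times> stacked_node) set" where
  "arrows = {(in_upper u, in_upper v) | u v. {u, v} \<in> A \<and> plus_node r a u}
          \<union> {(in_lower u, in_lower v) | u v. {u, v} \<in> B \<and> plus_node a a' u}"

lemma arrowsI:
  "{u, v} \<in> A \<Longrightarrow> plus_node r a u \<Longrightarrow> (in_upper u, in_upper v) \<in> arrows"
  "{u, v} \<in> B \<Longrightarrow> plus_node a a' u \<Longrightarrow> (in_lower u, in_lower v) \<in> arrows"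
  by (auto simp: arrows_def)

lemma arrows_cases:
  assumes "(x, y) \<in> arrows"
  obtains u v where "x = in_upper u" "y = in_upper v" "{u, v} \<in> A" "plus_node r a u" "\<not> plus_node r a v"
      "u \<in> nodes (r + s) (a + b)" "v \<in> nodes (r + s) (a + b)"
  | u v where "x = in_lower u" "y = in_lower v" "{u, v} \<in> B" "plus_node a a' u" "\<not> plus_node a a' v"
      "u \<in> nodes (a + b) (a' + b')" "v \<in> nodes (a + b) (a' + b')"
  using assms walled_diagram_pair_plus[OF A] walled_diagram_pair_plus[OF B]
  unfolding arrows_def by blast

lemma edges_eq: "{(x, y). {x, y} \<in> image in_upper ` A \<union> image in_lower ` B} = arrows \<union> arrows\<inverse>"
proof (intro equalityI subrelI)
  fix x y assume "(x, y) \<in> {(x, y). {x, y} \<in> image in_upper ` A \<union> image in_lower ` B}"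
  then consider P where "P \<in> A" "{x, y} = in_upper ` P" | P where "P \<in> B" "{x, y} = in_lower ` P"
    by auto
  thus "(x, y) \<in> arrows \<union> arrows\<inverse>"
  proof cases
    case 1
    then obtain u v where "P = {u, v}" "plus_node r a u" "\<not> plus_node r a v"
      using A unfolding walled_diagrams_iff by meson
    thus ?thesis using 1 by (auto simp: arrows_def doubleton_eq_iff)
  next
    case 2
    then obtain u v where "P = {u, v}" "plus_node a a' u" "\<not> plus_node a a' v"
      using B unfolding walled_diagrams_iff by meson
    thus ?thesis using 2 by (auto simp: arrows_def doubleton_eq_iff)
  qed
next
  fix x y assume "(x, y) \<in> arrows \<union> arrows\<inverse>"
  hence "(x, y) \<in> arrows \<or> (y, x) \<in> arrows" by auto
  thus "(x, y) \<in> {(x, y). {x, y} \<in> image in_upper ` A \<union> image in_lower ` B}"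
    by (auto simp: arrows_def image_iff insert_commute intro: bexI[rotated])
qed

lemma joined_eq: "joined A B = (arrows \<union> arrows\<inverse>)\<^sup>*"
  unfolding joined_def edges_eq ..

lemma joined_refl [simp]: "(x, x) \<in> joined A B"
  by (simp add: joined_eq)

lemma joined_sym: "(x, y) \<in> joined A B \<Longrightarrow> (y, x) \<in> joined A B"
  unfolding joined_eq by (metis Un_commute converse_Un converse_converse rtrancl_converseI)

lemma joined_trans: "(x, y) \<in> joined A B \<Longrightarrow> (y, z) \<in> joined A B \<Longrightarrow> (x, z) \<in> joined A B"
  unfolding joined_eq by (rule rtrancl_trans)

lemma joined_class_eq: "(x, y) \<in> joined A B \<Longrightarrow> joined A B `` {x} = joined A B `` {y}"
  by (auto dest: joined_sym joined_trans)

text \<open>Within one diagram the partner of a node is unique. Arrows of both diagrams can only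
  share a middle node \<open>j\<close>, which is a source in \<open>A\<close> for
  \<open>a < j\<close> and a source in \<open>B\<close> for \<open>j \<le> a\<close>, never in
  both.\<close>

lemma single_valued_arrows: "single_valued arrows" and single_valued_arrows': "single_valued (arrows\<inverse>)"
proof -
  have upper_lower: "\<exists>j. u = South j \<and> v = North j" if "in_upper u = in_lower v" for u v
    using that by (cases u; cases v) auto
  have uA: "u = w" if "{u, v} \<in> A" "{w, v} \<in> A" for u v w
    using walled_diagram_pair_unique[OF A, of v u w] that by (simp add: insert_commute)
  have uB: "u = w" if "{u, v} \<in> B" "{w, v} \<in> B" for u v w
    using walled_diagram_pair_unique[OF B, of v u w] that by (simp add: insert_commute)
  show "single_valued arrows"
  proof (rule single_valuedI)
    fix x y z assume "(x, y) \<in> arrows" "(x, z) \<in> arrows"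
    thus "y = z"
      by (elim arrows_cases)
        (auto dest: walled_diagram_pair_unique[OF A] walled_diagram_pair_unique[OF B]
              upper_lower upper_lower[OF sym])
  qed
  show "single_valued (arrows\<inverse>)"
  proof (rule single_valuedI, unfold converse_iff)
    fix x y z assume "(y, x) \<in> arrows" "(z, x) \<in> arrows"
    thus "y = z"
      by (elim arrows_cases)
        (auto dest: uA uB upper_lower upper_lower[OF sym])
  qed
qed

lemma finite_arrows: "finite arrows"
proof (rule finite_subset)
  let ?U = "in_upper ` nodes (r + s) (a + b)" and ?L = "in_lower ` nodes (a + b) (a' + b')"
  show "arrows \<subseteq> (?U \<union> ?L) \<times> (?U \<union> ?L)"
    by (rule subrelI) (auto elim!: arrows_cases)
qed simp

lemma Field_outer:
  assumes "outer_node u \<in> Domain arrows \<union> Range arrows"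
  shows "u \<in> nodes (r + s) (a' + b')"
proof -
  have "u \<in> nodes (r + s) (a' + b')"
    if "outer_node u = in_upper w \<and> w \<in> nodes (r + s) (a + b) \<or>
        outer_node u = in_lower w \<and> w \<in> nodes (a + b) (a' + b')" for w
    using that by (cases u; cases w) (auto simp: nodes_def)
  thus ?thesis using assms by (auto elim!: arrows_cases)
qed

text \<open>Hence a directed path neither starts nor ends at a middle node, and the ends of
  components are outer nodes.\<close>

lemma Middle_in_arrows:
  assumes "j \<in> {1..a + b}"
  shows "Middle j \<in> Domain arrows" "Middle j \<in> Range arrows"
proof -
  have S: "South j \<in> nodes (r + s) (a + b)" and N: "North j \<in> nodes (a + b) (a' + b')"
    using assms by (auto simp: nodes_def)
  obtain v where v: "{South j, v} \<in> A" "plus_node r a v \<noteq> plus_node r a (South j)"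
    using walled_diagram_obtain_pair[OF A S] by blast
  obtain w where w: "{North j, w} \<in> B" "plus_node a a' w \<noteq> plus_node a a' (North j)"
    using walled_diagram_obtain_pair[OF B N] by blast
  have "(Middle j, in_upper v) \<in> arrows \<and> (in_lower w, Middle j) \<in> arrows" if "a < j"
  proof -
    have "(in_upper (South j), in_upper v) \<in> arrows" "(in_lower w, in_lower (North j)) \<in> arrows"
      by (rule arrowsI; use that v w in \<open>simp add: insert_commute\<close>)+
    thus ?thesis by simp
  qed
  moreover have "(in_upper v, Middle j) \<in> arrows \<and> (Middle j, in_lower w) \<in> arrows" if "\<not> a < j"
  proof -
    have "(in_upper v, in_upper (South j)) \<in> arrows" "(in_lower (North j), in_lower w) \<in> arrows"
      by (rule arrowsI; use that v w in \<open>simp add: insert_commute\<close>)+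
    thus ?thesis by simp
  qed
  ultimately show "Middle j \<in> Domain arrows" "Middle j \<in> Range arrows" by blast+
qed

lemma Range_arrows_cases [consumes 1, case_names Outer Mid]:
  assumes "x \<in> Domain arrows \<union> Range arrows"
  obtains u where "x = outer_node u" "u \<in> nodes (r + s) (a' + b')"
  | j where "x = Middle j" "j \<in> {1..a + b}"
proof (cases x)
  case (Top i)
  thus ?thesis using that(1)[of "North i"] Field_outer[of "North i"] assms by auto
next
  case (Bottom i)
  thus ?thesis using that(1)[of "South i"] Field_outer[of "South i"] assms by auto
next
  case (Middle j)
  have "j \<in> {1..a + b}"
    if "Middle j = in_upper w \<and> w \<in> nodes (r + s) (a + b) \<or>
        Middle j = in_lower w \<and> w \<in> nodes (a + b) (a' + b')" for w
    using that by (cases w) (auto simp: nodes_def)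
  thus ?thesis using that(2) Middle assms by (auto elim!: arrows_cases)
qed

lemma outer_in_arrows:
  assumes "u \<in> nodes (r + s) (a' + b')"
  shows "outer_node u \<in> Domain arrows \<longleftrightarrow> plus_node r a' u"
    and "outer_node u \<in> Range arrows \<longleftrightarrow> \<not> plus_node r a' u"
proof -
  have pl: "plus_node r a' u" if "(outer_node u, y) \<in> arrows" for y
  proof -
    have "plus_node r a' u" if "outer_node u = in_upper w" "plus_node r a w" for w
      using that by (cases u; cases w) auto
    moreover have "plus_node r a' u" if "outer_node u = in_lower w" "plus_node a a' w" for w
      using that by (cases u; cases w) auto
    ultimately show ?thesis using that by (elim arrows_cases) auto
  qed
  have mi: "\<not> plus_node r a' u" if "(y, outer_node u) \<in> arrows" for y
  proof -
    have "\<not> plus_node r a' u" if "outer_node u = in_upper w" "\<not> plus_node r a w" for w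
      using that by (cases u; cases w) auto
    moreover have "\<not> plus_node r a' u" if "outer_node u = in_lower w" "\<not> plus_node a a' w" for w
      using that by (cases u; cases w) auto
    ultimately show ?thesis using that by (elim arrows_cases) auto
  qed
  have ex: "outer_node u \<in> Domain (arrows \<union> arrows\<inverse>)"
  proof (cases u)
    case (North i)
    obtain v where "{North i, v} \<in> A"
      using walled_diagram_obtain_pair[OF A, of "North i"] assms North by (auto simp: nodes_def)
    hence "{in_upper (North i), in_upper v} \<in> image in_upper ` A"
      by (auto simp: image_iff intro!: bexI[of _ "{North i, v}"])
    hence "(outer_node u, in_upper v) \<in> arrows \<union> arrows\<inverse>"
      unfolding edges_eq[symmetric] using North by simp
    thus ?thesis by blast
  next
    case (South i)
    obtain v where "{South i, v} \<in> B"
      using walled_diagram_obtain_pair[OF B, of "South i"] assms South by (auto simp: nodes_def)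
    hence "{in_lower (South i), in_lower v} \<in> image in_lower ` B"
      by (auto simp: image_iff intro!: bexI[of _ "{South i, v}"])
    hence "(outer_node u, in_lower v) \<in> arrows \<union> arrows\<inverse>"
      unfolding edges_eq[symmetric] using South by simp
    thus ?thesis by blast
  qed
  show "outer_node u \<in> Domain arrows \<longleftrightarrow> plus_node r a' u"
    using ex pl mi by blast
  show "outer_node u \<in> Range arrows \<longleftrightarrow> \<not> plus_node r a' u"
    using ex pl mi by blast
qed

lemma joined_outer_nodes:
  assumes "(outer_node u, outer_node v) \<in> joined A B" "u \<noteq> v"
  shows "u \<in> nodes (r + s) (a' + b')" "v \<in> nodes (r + s) (a' + b')"
proof -
  have "(outer_node u, outer_node v) \<in> (arrows \<union> arrows\<inverse>)\<^sup>+"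
    using assms unfolding joined_eq by (metis rtrancl_eq_or_trancl stacked_inj(3))
  hence "outer_node u \<in> Domain (arrows \<union> arrows\<inverse>)" "outer_node v \<in> Range (arrows \<union> arrows\<inverse>)"
    by (metis Domain.DomainI trancl_domain, metis Range.intros trancl_range)
  thus "u \<in> nodes (r + s) (a' + b')" "v \<in> nodes (r + s) (a' + b')"
    using Field_outer by blast+
qed

text \<open>A component that contains a source is a directed path, so it ends in exactly one sink.\<close>

lemma plus_partner:
  assumes "u \<in> nodes (r + s) (a' + b')" "plus_node r a' u"
  shows "\<exists>!v. v \<noteq> u \<and> (outer_node u, outer_node v) \<in> joined A B"
    and "v \<noteq> u \<Longrightarrow> (outer_node u, outer_node v) \<in> joined A B \<Longrightarrow> \<not> plus_node r a' v"
proof -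
  have u: "outer_node u \<notin> Range arrows" "outer_node u \<in> Domain arrows"
    using outer_in_arrows[OF assms(1)] assms(2) by auto
  have reach: "y \<in> Range arrows" if "(outer_node u, y) \<in> joined A B" "y \<noteq> outer_node u" for y
    using rtrancl_symcl_from_start[OF single_valued_arrows' u(1)] that unfolding joined_eq
    by (metis Range.intros rtranclE)
  have minus: "\<not> plus_node r a' v" "outer_node v \<notin> Domain arrows"
    if "v \<noteq> u" "(outer_node u, outer_node v) \<in> joined A B" for v
    using reach[OF that(2)] that outer_in_arrows[OF joined_outer_nodes(2)[OF that(2)]] by auto
  show "v \<noteq> u \<Longrightarrow> (outer_node u, outer_node v) \<in> joined A B \<Longrightarrow> \<not> plus_node r a' v"
    by (rule minus(1))
  obtain y where y: "(outer_node u, y) \<in> joined A B" "y \<notin> Domain arrows"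
    and y_unique: "\<And>z. (outer_node u, z) \<in> joined A B \<Longrightarrow> z \<notin> Domain arrows \<Longrightarrow> z = y"
    using ex1_end_from_start[OF finite_arrows single_valued_arrows single_valued_arrows' u(1)]
    unfolding joined_eq by blast
  have "y \<noteq> outer_node u" using y u(2) by auto
  hence "y \<in> Domain arrows \<union> Range arrows" using reach y by simp
  hence "\<exists>v. y = outer_node v"
    by (cases rule: Range_arrows_cases[of y])
      (use Middle_in_arrows(1) y(2) in auto)
  then obtain v where v: "y = outer_node v" ..
  show "\<exists>!v. v \<noteq> u \<and> (outer_node u, outer_node v) \<in> joined A B"
  proof (rule ex1I[of _ v])
    show "v \<noteq> u \<and> (outer_node u, outer_node v) \<in> joined A B" using y v u(2) by auto
    fix w assume w: "w \<noteq> u \<and> (outer_node u, outer_node w) \<in> joined A B"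
    hence "outer_node w = y" by (intro y_unique minus(2)) auto
    thus "w = v" using v by simp
  qed
qed

lemma minus_partner:
  assumes "u \<in> nodes (r + s) (a' + b')" "\<not> plus_node r a' u"
  shows "\<exists>v. v \<noteq> u \<and> (outer_node u, outer_node v) \<in> joined A B"
proof -
  have u: "outer_node u \<notin> Domain arrows" "outer_node u \<in> Range arrows"
    using outer_in_arrows[OF assms(1)] assms(2) by auto
  \<comment> \<open>Reversing all arrows turns the sink \<open>u\<close> into a source, and the
    argument for sources applies.\<close>
  have J: "joined A B = (arrows\<inverse> \<union> (arrows\<inverse>)\<inverse>)\<^sup>*"
    unfolding joined_eq by (simp add: Un_commute)
  obtain y where y: "(outer_node u, y) \<in> joined A B" "y \<notin> Range arrows"
    using ex1_end_from_start[of "arrows\<inverse>" "outer_node u"] finite_arrows single_valued_arrows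
      single_valued_arrows' u(1) unfolding J by auto
  have "y \<noteq> outer_node u" using y u by auto
  hence "(outer_node u, y) \<in> (arrows \<union> arrows\<inverse>)\<^sup>+"
    using y unfolding joined_eq by (metis rtrancl_eq_or_trancl)
  hence "y \<in> Range (arrows \<union> arrows\<inverse>)" by (metis Range.intros trancl_range)
  hence "y \<in> Domain arrows \<union> Range arrows" by auto
  hence "\<exists>v. y = outer_node v"
    by (cases rule: Range_arrows_cases[of y])
      (use Middle_in_arrows(2) y(2) in auto)
  then obtain v where v: "y = outer_node v" ..
  thus ?thesis using y \<open>y \<noteq> outer_node u\<close> by auto
qed

lemma diagram_concat_pair_iff:
  "{u, v} \<in> diagram_concat A B \<longleftrightarrow> u \<noteq> v \<and> (outer_node u, outer_node v) \<in> joined A B"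
  unfolding diagram_concat_def by (auto simp: doubleton_eq_iff dest: joined_sym)

lemma diagram_concat_walled: "diagram_concat A B \<in> walled_diagrams r s a' b'"
proof (rule walled_diagramsI)
  have plus: "plus_node r a' u \<noteq> plus_node r a' v" if "{u, v} \<in> diagram_concat A B" for u v
  proof -
    have uv: "u \<noteq> v" "(outer_node u, outer_node v) \<in> joined A B"
      using that by (auto simp: diagram_concat_pair_iff)
    note nn = joined_outer_nodes[OF uv(2,1)]
    show ?thesis
    proof (cases "plus_node r a' u")
      case True
      thus ?thesis using plus_partner(2)[OF nn(1) True, of v] uv by auto
    next
      case u: False
      obtain w where w: "w \<noteq> u" "(outer_node u, outer_node w) \<in> joined A B"
        using minus_partner[OF nn(1) u] by auto
      show ?thesis
      proof (rule ccontr)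
        assume "\<not> ?thesis"
        hence v: "\<not> plus_node r a' v" using u by simp
        \<comment> \<open>Two sinks are never joined: everything joined to \<open>u\<close> is
          reached along reversed arrows, so \<open>v\<close> would be the tail of an arrow.\<close>
        have "outer_node u \<notin> Domain arrows" "outer_node v \<notin> Domain arrows"
          using outer_in_arrows nn u v by auto
        moreover have "(outer_node u, outer_node v) \<in> (arrows\<inverse> \<union> (arrows\<inverse>)\<inverse>)\<^sup>*"
          using uv unfolding joined_eq by (simp add: Un_commute)
        ultimately have "(outer_node u, outer_node v) \<in> (arrows\<inverse>)\<^sup>*"
          using rtrancl_symcl_from_start[of "arrows\<inverse>" "outer_node u" "outer_node v"]
            single_valued_arrows by auto
        thus False using \<open>outer_node v \<notin> Domain arrows\<close> uv(1)
          by (metis Domain.DomainI converse_iff rtranclE stacked_inj(3))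
      qed
    qed
  qed
  show "\<exists>u v. P = {u, v} \<and> plus_node r a' u \<and> \<not> plus_node r a' v"
    if PC: "P \<in> diagram_concat A B" for P
  proof -
    obtain u v where P: "P = {u, v}" using PC unfolding diagram_concat_def by blast
    show ?thesis
    proof (cases "plus_node r a' u")
      case False
      hence "P = {v, u} \<and> plus_node r a' v \<and> \<not> plus_node r a' u"
        using plus[of u v] PC P by auto
      thus ?thesis by blast
    qed (use plus[of u v] PC P in blast)
  qed
  show "\<Union>(diagram_concat A B) = nodes (r + s) (a' + b')"
  proof (intro equalityI subsetI)
    fix u assume "u \<in> \<Union>(diagram_concat A B)"
    thus "u \<in> nodes (r + s) (a' + b')"
      unfolding diagram_concat_def using joined_outer_nodes by blast
  next
    fix u assume "u \<in> nodes (r + s) (a' + b')"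
    then obtain v where "v \<noteq> u" "(outer_node u, outer_node v) \<in> joined A B"
      using minus_partner plus_partner(1) by blast
    hence "{u, v} \<in> diagram_concat A B" by (simp add: diagram_concat_pair_iff)
    thus "u \<in> \<Union>(diagram_concat A B)" by blast
  qed
  fix u v w assume uv: "{u, v} \<in> diagram_concat A B" and uw: "{u, w} \<in> diagram_concat A B"
  hence j: "u \<noteq> v" "u \<noteq> w" "(outer_node u, outer_node v) \<in> joined A B"
    "(outer_node u, outer_node w) \<in> joined A B"
    by (auto simp: diagram_concat_pair_iff)
  show "v = w"
  proof (cases "plus_node r a' u")
    case True
    thus ?thesis using plus_partner(1)[OF joined_outer_nodes(1)[OF j(3,1)] True] j by metis
  next
    case False
    hence "plus_node r a' v" "plus_node r a' w" using plus uv uw by blast+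
    moreover have "(outer_node v, outer_node w) \<in> joined A B"
      using j joined_sym joined_trans by blast
    ultimately show ?thesis
      using plus_partner(2)[OF joined_outer_nodes(2)[OF j(3,1)], of w] by auto
  qed
qed


section \<open>Counting the colourings of the middle nodes\<close>

lemma stack_color_joined:
  assumes "compatible A c e" "compatible B e d" "(x, y) \<in> joined A B"
  shows "stack_color c e d x = stack_color c e d y"
proof -
  have arr: "stack_color c e d x = stack_color c e d y" if "(x, y) \<in> arrows" for x y
    using that assms(1,2) by (auto elim!: arrows_cases simp: compatible_def)
  show ?thesis using assms(3) unfolding joined_eq
    by (induction rule: rtrancl_induct) (auto dest: arr)
qed

lemma compatible_if_arrows:
  assumes "\<And>x y. (x, y) \<in> arrows \<Longrightarrow> stack_color c e d x = stack_color c e d y"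
  shows "compatible A c e" "compatible B e d"
proof -
  show "compatible A c e" unfolding compatible_def
  proof (intro allI impI)
    fix u v assume uv: "{u, v} \<in> A"
    have "(in_upper u, in_upper v) \<in> arrows \<or> (in_upper v, in_upper u) \<in> arrows"
      using walled_diagram_pair_plus(1)[OF A uv] arrowsI uv by (auto simp: insert_commute)
    thus "node_color c e u = node_color c e v" using assms by fastforce
  qed
  show "compatible B e d" unfolding compatible_def
  proof (intro allI impI)
    fix u v assume uv: "{u, v} \<in> B"
    have "(in_lower u, in_lower v) \<in> arrows \<or> (in_lower v, in_lower u) \<in> arrows"
      using walled_diagram_pair_plus(1)[OF B uv] arrowsI uv by (auto simp: insert_commute)
    thus "node_color e d u = node_color e d v" using assms by fastforce
  qed
qed

definition closed_classes :: "stacked_node set set" where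
  "closed_classes = {joined A B `` {Middle i} | i.
      South i \<in> \<Union>A \<and> joined A B `` {Middle i} \<subseteq> range Middle}"

lemma South_in_A: "South i \<in> \<Union>A \<longleftrightarrow> i \<in> {1..a + b}"
  using A by (auto simp: walled_diagrams_iff partition_on_def nodes_def)

lemma closed_classes_iff:
  "K \<in> closed_classes \<longleftrightarrow>
     (\<exists>i\<in>{1..a + b}. K = joined A B `` {Middle i} \<and> K \<subseteq> range Middle)"
  unfolding closed_classes_def South_in_A by auto

lemma closed_classes_image:
  "closed_classes \<subseteq> (\<lambda>i. joined A B `` {Middle i}) ` {1..a + b}"
  by (auto simp: closed_classes_iff)

lemma finite_closed_classes: "finite closed_classes"
  using finite_surj[OF _ closed_classes_image] by simp

text \<open>A compatible colouring is constant on the components of the stacked graph. Components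
  with an outer node have their colour prescribed by \<open>c\<close> and \<open>d\<close>,
  consistently exactly if the concatenated diagram is compatible with them; each closed component
  takes any of the \<open>n\<close> colours. So the colourings counted correspond to the functions
  on closed classes.\<close>

lemma card_middle_colorings:
  assumes c: "c \<in> colorings n (r + s)" and d: "d \<in> colorings n (a' + b')"
  shows "card {e \<in> colorings n (a + b). compatible A c e \<and> compatible B e d} =
    (if compatible (diagram_concat A B) c d then n ^ closed_components A B else 0)"
proof (cases "compatible (diagram_concat A B) c d")
  case False
  then obtain u v where uv: "u \<noteq> v" "(outer_node u, outer_node v) \<in> joined A B"
    "node_color c d u \<noteq> node_color c d v"
    by (auto simp: compatible_def diagram_concat_pair_iff)
  have "{e \<in> colorings n (a + b). compatible A c e \<and> compatible B e d} = {}"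
    using stack_color_joined[OF _ _ uv(2)] uv(3) by fastforce
  thus ?thesis using False by simp
next
  case C: True
  define S where "S = {e \<in> colorings n (a + b). compatible A c e \<and> compatible B e d}"
  \<comment> \<open>For classes that are not closed the choice of \<open>u\<close> does not matter:
    by \<open>col\<close>, joined outer nodes have the same colour.\<close>
  define h where "h g K = (if K \<in> closed_classes then g K
    else node_color c d (SOME u. outer_node u \<in> K))" for g K
  define ext where "ext g = (\<lambda>i\<in>{1..a + b}. h g (joined A B `` {Middle i}))" for g
  have col: "node_color c d u = node_color c d v" if "(outer_node u, outer_node v) \<in> joined A B" for u v
    using C that by (cases "u = v") (auto simp: compatible_def diagram_concat_pair_iff)
  have h_outer: "h g (joined A B `` {x}) = node_color c d u"
    if "(x, outer_node u) \<in> joined A B" for g x u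
  proof -
    have "outer_node u \<notin> range Middle" by (cases u) auto
    hence "joined A B `` {x} \<notin> closed_classes" using that by (auto simp: closed_classes_iff)
    moreover have "outer_node (SOME v. outer_node v \<in> joined A B `` {x}) \<in> joined A B `` {x}"
      by (rule someI[of _ u]) (use that in auto)
    ultimately show ?thesis using that unfolding h_def
      by (auto intro!: col dest: joined_sym joined_trans)
  qed
  have color_range: "node_color c d u \<in> {1..n}" if "u \<in> nodes (r + s) (a' + b')" for u
    using that c d by (cases u) (auto simp: nodes_def colorings_def)
  have outer_range: "node_color c d u \<in> {1..n}" if "(Middle i, outer_node u) \<in> joined A B" for i u
  proof (rule color_range, rule Field_outer)
    have "(Middle i, outer_node u) \<in> (arrows \<union> arrows\<inverse>)\<^sup>+"
      using that unfolding joined_eq by (cases u) (auto simp: rtrancl_eq_or_trancl)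
    hence "outer_node u \<in> Range (arrows \<union> arrows\<inverse>)" by (metis Range.intros trancl_range)
    thus "outer_node u \<in> Domain arrows \<union> Range arrows" by auto
  qed
  have not_closed: "\<exists>u. (Middle i, outer_node u) \<in> joined A B"
    if i: "i \<in> {1..a + b}" "joined A B `` {Middle i} \<notin> closed_classes" for i
  proof -
    have "\<not> joined A B `` {Middle i} \<subseteq> range Middle"
      using i unfolding closed_classes_iff by blast
    then obtain y where y: "(Middle i, y) \<in> joined A B" "y \<notin> range Middle" by blast
    show ?thesis
    proof (cases y)
      case (Top j) thus ?thesis using y by (intro exI[of _ "North j"]) auto
    next
      case (Bottom j) thus ?thesis using y by (intro exI[of _ "South j"]) auto
    qed (use y in auto)
  qed
  have inj: "inj_on ext (closed_classes \<rightarrow>\<^sub>E {1..n})"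
  proof (rule inj_onI)
    fix g g' assume g: "g \<in> closed_classes \<rightarrow>\<^sub>E {1..n}" "g' \<in> closed_classes \<rightarrow>\<^sub>E {1..n}"
      and eq: "ext g = ext g'"
    show "g = g'"
    proof (rule PiE_ext[OF g])
      fix K assume K: "K \<in> closed_classes"
      then obtain i where i: "i \<in> {1..a + b}" "K = joined A B `` {Middle i}"
        by (auto simp: closed_classes_iff)
      have "ext g i = ext g' i" using eq by simp
      thus "g K = g' K" using i K by (simp add: ext_def h_def)
    qed
  qed
  have img: "ext ` (closed_classes \<rightarrow>\<^sub>E {1..n}) = S"
  proof (intro equalityI subsetI)
    fix e assume "e \<in> ext ` (closed_classes \<rightarrow>\<^sub>E {1..n})"
    then obtain g where g: "g \<in> closed_classes \<rightarrow>\<^sub>E {1..n}" and e: "e = ext g" by auto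
    have "ext g i \<in> {1..n}" if "i \<in> {1..a + b}" for i
    proof (cases "joined A B `` {Middle i} \<in> closed_classes")
      case True
      thus ?thesis using g that by (auto simp: ext_def h_def)
    next
      case False
      from not_closed[OF that this] obtain u where u: "(Middle i, outer_node u) \<in> joined A B" ..
      show ?thesis using h_outer[OF u] outer_range[OF u] that by (simp add: ext_def)
    qed
    hence e_col: "ext g \<in> colorings n (a + b)" by (auto simp: colorings_def ext_def)
    have sc: "stack_color c (ext g) d x = h g (joined A B `` {x})"
      if "x \<in> Domain arrows \<union> Range arrows" for x
      using that
    proof (cases rule: Range_arrows_cases[of x])
      case (Outer u)
      thus ?thesis using h_outer[of x u g] by simp
    next
      case (Mid j)
      thus ?thesis by (simp add: ext_def)
    qed
    have "stack_color c (ext g) d x = stack_color c (ext g) d y" if xy: "(x, y) \<in> arrows" for x y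
    proof -
      have "(x, y) \<in> joined A B" using xy by (auto simp: joined_eq)
      hence "joined A B `` {x} = joined A B `` {y}" by (rule joined_class_eq)
      thus ?thesis using xy by (subst (1 2) sc) auto
    qed
    hence "compatible A c (ext g)" "compatible B (ext g) d"
      using compatible_if_arrows[of c "ext g" d] by blast+
    thus "e \<in> S" using e e_col by (simp add: S_def)
  next
    fix e assume "e \<in> S"
    hence e: "e \<in> colorings n (a + b)" "compatible A c e" "compatible B e d" by (auto simp: S_def)
    note const = stack_color_joined[OF e(2,3)]
    define g where "g = (\<lambda>K\<in>closed_classes. e (SOME i. i \<in> {1..a + b} \<and> K = joined A B `` {Middle i}))"
    have g_eq: "g (joined A B `` {Middle i}) = e i \<and> e i \<in> {1..n}"
      if "i \<in> {1..a + b}" "joined A B `` {Middle i} \<in> closed_classes" for i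
    proof -
      define j where "j = (SOME j. j \<in> {1..a + b} \<and> joined A B `` {Middle i} = joined A B `` {Middle j})"
      have "j \<in> {1..a + b} \<and> joined A B `` {Middle i} = joined A B `` {Middle j}"
        unfolding j_def by (rule someI[of _ i]) (use that in auto)
      hence "(Middle i, Middle j) \<in> joined A B" using joined_refl by blast
      from const[OF this] have "e i = e j" by simp
      moreover have "g (joined A B `` {Middle i}) = e j"
        unfolding g_def j_def using that by simp
      moreover have "e i \<in> {1..n}" using PiE_mem[OF _ that(1)] e(1) unfolding colorings_def by blast
      ultimately show ?thesis by simp
    qed
    have "g \<in> closed_classes \<rightarrow>\<^sub>E {1..n}"
    proof (rule PiE_I)
      fix K assume K: "K \<in> closed_classes"
      then obtain i where i: "i \<in> {1..a + b}" "K = joined A B `` {Middle i}"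
        unfolding closed_classes_iff by blast
      have "joined A B `` {Middle i} \<in> closed_classes" using K i by metis
      from g_eq[OF i(1) this] show "g K \<in> {1..n}" unfolding i(2) by metis
    qed (simp add: g_def)
    moreover have "ext g = e"
    proof
      fix i show "ext g i = e i"
      proof (cases "i \<in> {1..a + b}")
        case i: True
        show ?thesis
        proof (cases "joined A B `` {Middle i} \<in> closed_classes")
          case True
          thus ?thesis using g_eq[OF i True] i by (simp add: ext_def h_def)
        next
          case False
          from not_closed[OF i this] obtain u where u: "(Middle i, outer_node u) \<in> joined A B" ..
          show ?thesis using h_outer[OF u] const[OF u] i by (simp add: ext_def)
        qed
      next
        case False
        thus ?thesis using e(1) by (auto simp: ext_def colorings_def extensional_def)
      qed
    qed
    ultimately show "e \<in> ext ` (closed_classes \<rightarrow>\<^sub>E {1..n})" by blast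
  qed
  have "card S = card (closed_classes \<rightarrow>\<^sub>E {1..n})"
    using card_image[OF inj] img by simp
  also have "\<dots> = n ^ card closed_classes"
    using finite_closed_classes by (simp add: card_funcsetE)
  finally show ?thesis using C unfolding S_def closed_components_def closed_classes_def by simp
qed

text \<open>Matrix multiplication sums over the colourings of the middle nodes, so the loop
  parameter realised by the matrices is the number of colours.\<close>

lemma diagram_matrix_concat:
  assumes "c \<in> colorings n (r + s)" and "d \<in> colorings n (a' + b')"
  shows "(\<Sum>e\<in>colorings n (a + b). diagram_matrix A c e * diagram_matrix B e d) =
    (of_nat n ^ closed_components A B * diagram_matrix (diagram_concat A B) c d :: 'k::comm_ring_1)"
proof -
  have "(\<Sum>e\<in>colorings n (a + b). diagram_matrix A c e * diagram_matrix B e d :: 'k) =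
    (\<Sum>e\<in>colorings n (a + b). of_bool (compatible A c e \<and> compatible B e d))"
    by (simp add: diagram_matrix_def of_bool_conj)
  also have "\<dots> = of_nat (card {e \<in> colorings n (a + b). compatible A c e \<and> compatible B e d})"
    by (simp add: sum_of_bool_eq Int_def)
  finally show ?thesis unfolding card_middle_colorings[OF assms] by (simp add: diagram_matrix_def)
qed

end

section \<open>The walled Brauer algebra as an algebra of matrices\<close>

definition identity_diagram :: "nat \<Rightarrow> diagram" where
  "identity_diagram m = {{North i, South i} | i. i \<in> {1..m}}"

lemma identity_diagram_walled: "identity_diagram (r + s) \<in> walled_diagrams r s r s"
proof (rule walled_diagramsI)
  fix P assume "P \<in> identity_diagram (r + s)"
  then obtain i where i: "P = {North i, South i}" by (auto simp: identity_diagram_def)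
  show "\<exists>u v. P = {u, v} \<and> plus_node r r u \<and> \<not> plus_node r r v"
  proof (cases "i \<le> r")
    case True
    thus ?thesis using i by (intro exI[of _ "North i"] exI[of _ "South i"]) auto
  next
    case False
    thus ?thesis using i by (intro exI[of _ "South i"] exI[of _ "North i"]) auto
  qed
next
  show "\<Union>(identity_diagram (r + s)) = nodes (r + s) (r + s)"
    unfolding identity_diagram_def nodes_def by blast
qed (auto simp: identity_diagram_def doubleton_eq_iff)

lemma compatible_identity_diagram:
  assumes "c \<in> colorings n m" "d \<in> colorings n m"
  shows "compatible (identity_diagram m) c d \<longleftrightarrow> c = d"
proof
  assume *: "compatible (identity_diagram m) c d"
  have "c i = d i" if "i \<in> {1..m}" for i
  proof -
    have "{North i, South i} \<in> identity_diagram m" using that by (auto simp: identity_diagram_def)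
    with * show ?thesis unfolding compatible_def by fastforce
  qed
  thus "c = d" using assms PiE_ext unfolding colorings_def by metis
qed (auto simp: compatible_def identity_diagram_def doubleton_eq_iff)

definition element_matrix ::
  "nat \<Rightarrow> nat \<Rightarrow> (diagram \<Rightarrow> 'k::field) \<Rightarrow> (nat \<Rightarrow> nat) \<Rightarrow> (nat \<Rightarrow> nat) \<Rightarrow> 'k" where
  "element_matrix r s x c d = (\<Sum>A\<in>walled_diagrams r s r s. x A * diagram_matrix A c d)"

lemma element_matrix_diff: "element_matrix r s (x - y) c d = element_matrix r s x c d - element_matrix r s y c d"
  by (simp add: element_matrix_def left_diff_distrib sum_subtractf)

lemma element_matrix_zero [simp]: "element_matrix r s 0 c d = 0"
  by (simp add: element_matrix_def)

lemma element_matrix_scale: "element_matrix r s (\<lambda>A. a * x A) c d = a * element_matrix r s x c d"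
  by (simp add: element_matrix_def sum_distrib_left mult.assoc)

lemma element_matrix_sum:
  "element_matrix r s (\<lambda>A. \<Sum>i\<in>I. f i A) c d = (\<Sum>i\<in>I. element_matrix r s (f i) c d)"
proof -
  have "element_matrix r s (\<lambda>A. \<Sum>i\<in>I. f i A) c d
      = (\<Sum>A\<in>walled_diagrams r s r s. \<Sum>i\<in>I. f i A * diagram_matrix A c d)"
    by (simp add: element_matrix_def sum_distrib_right)
  also have "\<dots> = (\<Sum>i\<in>I. element_matrix r s (f i) c d)"
    unfolding element_matrix_def by (rule sum.swap)
  finally show ?thesis .
qed

lemma element_matrix_unit_at:
  assumes "A \<in> walled_diagrams r s r s"
  shows "element_matrix r s (unit_at A) c d = diagram_matrix A c d"
proof -
  have "element_matrix r s (unit_at A) c d =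
    (\<Sum>B\<in>walled_diagrams r s r s. if B = A then diagram_matrix B c d else 0)"
    unfolding element_matrix_def by (rule sum.cong) (auto simp: unit_at_def)
  thus ?thesis using assms by simp
qed

lemma walled_brauer_simps:
  "carrier (walled_brauer \<delta> r s) = supported_on (walled_diagrams r s r s)"
  "\<zero>\<^bsub>walled_brauer \<delta> r s\<^esub> = 0"
  "x \<oplus>\<^bsub>walled_brauer \<delta> r s\<^esub> y = x + y"
  "\<one>\<^bsub>walled_brauer \<delta> r s\<^esub> = unit_at (identity_diagram (r + s))"
  "x \<otimes>\<^bsub>walled_brauer \<delta> r s\<^esub> y = (\<lambda>C. \<Sum>A\<in>walled_diagrams r s r s. \<Sum>B\<in>walled_diagrams r s r s.
                x A * y B * \<delta> ^ closed_components A B * unit_at (diagram_concat A B) C)"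
  by (simp_all add: walled_brauer_def identity_diagram_def)

lemma supported_on_simps:
  "f \<in> supported_on S \<Longrightarrow> x \<notin> S \<Longrightarrow> f x = 0"
  "(0 :: 'x \<Rightarrow> 'k::ab_group_add) \<in> supported_on S"
  "(g :: 'x \<Rightarrow> 'k) \<in> supported_on S \<Longrightarrow> h \<in> supported_on S \<Longrightarrow> g + h \<in> supported_on S"
  "g \<in> supported_on S \<Longrightarrow> h \<in> supported_on S \<Longrightarrow> g - h \<in> supported_on S"
  "g \<in> supported_on S \<Longrightarrow> - g \<in> supported_on S"
  by (auto simp: supported_on_def)

lemma supported_on_scale:
  "(g :: 'x \<Rightarrow> 'k::mult_zero) \<in> supported_on S \<Longrightarrow> (\<lambda>x. a * g x) \<in> supported_on S"
  by (simp add: supported_on_def)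

lemma unit_at_supported: "x \<in> S \<Longrightarrow> unit_at x \<in> supported_on S"
  by (auto simp: supported_on_def unit_at_def)

lemma walled_brauer_mult_closed:
  fixes x y :: "diagram \<Rightarrow> 'k::field"
  shows "x \<otimes>\<^bsub>walled_brauer \<delta> r s\<^esub> y \<in> carrier (walled_brauer \<delta> r s)"
proof -
  have "unit_at (diagram_concat A B) C = (0 :: 'k)"
    if "A \<in> walled_diagrams r s r s" "B \<in> walled_diagrams r s r s" "C \<notin> walled_diagrams r s r s" for A B C
    using stacked_diagrams.diagram_concat_walled[of A B r s r s r s] that
    by (auto simp: stacked_diagrams_def unit_at_def)
  thus ?thesis unfolding walled_brauer_simps supported_on_def by simp
qed

lemma element_matrix_mult:
  fixes x y :: "diagram \<Rightarrow> 'k::field"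
  assumes cd: "c \<in> colorings n (r + s)" "d \<in> colorings n (r + s)"
  shows "element_matrix r s (x \<otimes>\<^bsub>walled_brauer (of_nat n) r s\<^esub> y) c d =
    (\<Sum>e\<in>colorings n (r + s). element_matrix r s x c e * element_matrix r s y e d)"
proof -
  let ?W = "walled_diagrams r s r s"
  have "element_matrix r s (x \<otimes>\<^bsub>walled_brauer (of_nat n) r s\<^esub> y) c d =
    (\<Sum>A\<in>?W. \<Sum>B\<in>?W. element_matrix r s (\<lambda>C. x A * y B * of_nat n ^ closed_components A B *
        unit_at (diagram_concat A B) C) c d)"
    unfolding walled_brauer_simps by (simp add: element_matrix_sum)
  also have "\<dots> = (\<Sum>A\<in>?W. \<Sum>B\<in>?W. x A * y B *
      (\<Sum>e\<in>colorings n (r + s). diagram_matrix A c e * diagram_matrix B e d))"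
  proof (intro sum.cong refl)
    fix A B assume AB: "A \<in> ?W" "B \<in> ?W"
    hence sd: "stacked_diagrams A B r s r s r s" by (simp add: stacked_diagrams_def)
    show "element_matrix r s (\<lambda>C. x A * y B * of_nat n ^ closed_components A B *
        unit_at (diagram_concat A B) C) c d = x A * y B *
      (\<Sum>e\<in>colorings n (r + s). diagram_matrix A c e * diagram_matrix B e d)"
      by (simp add: element_matrix_scale stacked_diagrams.diagram_matrix_concat[OF sd cd]
        element_matrix_unit_at stacked_diagrams.diagram_concat_walled[OF sd] mult.assoc)
  qed
  also have "\<dots> = (\<Sum>A\<in>?W. \<Sum>B\<in>?W. \<Sum>e\<in>colorings n (r + s).
      (x A * diagram_matrix A c e) * (y B * diagram_matrix B e d))"
    by (simp add: sum_distrib_left mult_ac)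
  also have "\<dots> = (\<Sum>e\<in>colorings n (r + s). \<Sum>A\<in>?W. \<Sum>B\<in>?W.
      (x A * diagram_matrix A c e) * (y B * diagram_matrix B e d))"
    by (subst sum.swap[of _ ?W "colorings n (r + s)"]) (simp add: sum.swap[of _ "colorings n (r + s)" ?W])
  also have "\<dots> = (\<Sum>e\<in>colorings n (r + s). element_matrix r s x c e * element_matrix r s y e d)"
    by (simp add: element_matrix_def sum_product)
  finally show ?thesis .
qed

text \<open>Every pair of \<open>A\<close> receives its own colour. A pair of another compatible
  diagram is then contained in a pair of \<open>A\<close>, hence equal to it, and both diagrams
  partition the same nodes. The number of nodes is a crude bound for the number of pairs.\<close>

lemma separating_coloring:
  assumes A: "A \<in> walled_diagrams r s a b" and n: "(r + s) + (a + b) \<le> n"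
  obtains c d where "c \<in> colorings n (r + s)" "d \<in> colorings n (a + b)"
    "\<And>B. B \<in> walled_diagrams r s a b \<Longrightarrow> compatible B c d \<longleftrightarrow> B = A"
proof -
  let ?N = "nodes (r + s) (a + b)"
  define block where "block u = (THE P. P \<in> A \<and> u \<in> P)" for u
  have part: "partition_on ?N A" using A by (simp add: walled_diagrams_iff)
  have block: "block u = P" if "P \<in> A" "u \<in> P" for u P
    unfolding block_def using part that
    by (intro the_equality) (auto simp: partition_on_def disjoint_def)
  have block_in: "block u \<in> A \<and> u \<in> block u" if "u \<in> ?N" for u
    using that part block unfolding partition_on_def by blast
  have "A \<subseteq> block ` ?N"
  proof
    fix P assume P: "P \<in> A"
    then obtain u where "u \<in> P" using part unfolding partition_on_def by (metis ex_in_conv)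
    moreover have "u \<in> ?N" using part P \<open>u \<in> P\<close> by (auto simp: partition_on_def)
    ultimately show "P \<in> block ` ?N" using block[OF P] by (metis imageI)
  qed
  hence "card A \<le> card ?N" "finite A"
    by (meson card_image_le card_mono finite_imageI finite_nodes le_trans, meson finite_surj finite_nodes)
  moreover have "card ?N \<le> (r + s) + (a + b)"
    unfolding nodes_def by (rule order_trans[OF card_Un_le]) (simp add: card_image inj_on_def)
  ultimately obtain f where f: "f ` A \<subseteq> {1..n}" "inj_on f A"
    using card_le_inj[of A "{1..n}"] n by auto
  define c where "c = (\<lambda>i\<in>{1..r + s}. f (block (North i)))"
  define d where "d = (\<lambda>i\<in>{1..a + b}. f (block (South i)))"
  have col: "node_color c d u = f (block u)" if "u \<in> ?N" for u
    using that by (auto simp: c_def d_def nodes_def)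
  have f_block: "f (block u) \<in> {1..n}" if "u \<in> ?N" for u
    using f block_in[OF that] by auto
  have "B = A" if B: "B \<in> walled_diagrams r s a b" "compatible B c d" for B
  proof -
    have partB: "partition_on ?N B" using B by (simp add: walled_diagrams_iff)
    have sub: "P \<in> A" if PB: "P \<in> B" for P
    proof -
      obtain u v where uv: "P = {u, v}" "plus_node r a u" "\<not> plus_node r a v"
        using B(1) PB unfolding walled_diagrams_iff by meson
      have uvB: "{u, v} \<in> B" using PB uv by simp
      note uvN = walled_diagram_pair_plus(2,3)[OF B(1) uvB]
      have "node_color c d u = node_color c d v" using B(2) uvB unfolding compatible_def by blast
      hence "f (block u) = f (block v)" using col uvN by metis
      hence "block u = block v" using inj_onD[OF f(2)] block_in uvN by blast
      hence *: "block u \<in> A" "u \<in> block u" "v \<in> block u"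
        using block_in[OF uvN(1)] block_in[OF uvN(2)] by simp_all
      obtain w z where "block u = {w, z}" using A *(1) unfolding walled_diagrams_iff by meson
      hence "block u = {u, v}" using * uv by auto
      thus "P \<in> A" using * uv by simp
    qed
    have "P \<in> B" if P: "P \<in> A" for P
    proof -
      obtain u where u: "u \<in> P" using part P unfolding partition_on_def by (metis ex_in_conv)
      then obtain Q where "Q \<in> B" "u \<in> Q" using part partB P unfolding partition_on_def by blast
      thus ?thesis using block sub P u by metis
    qed
    thus ?thesis using sub by blast
  qed
  moreover have "compatible A c d" unfolding compatible_def
  proof (intro allI impI)
    fix u v assume uv: "{u, v} \<in> A"
    show "node_color c d u = node_color c d v"
      using walled_diagram_pair_plus(2,3)[OF A uv] block[OF uv] by (simp add: col)
  qed
  moreover have "c \<in> colorings n (r + s)" "d \<in> colorings n (a + b)"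
    using f_block by (auto simp: colorings_def c_def d_def nodes_def)
  ultimately show ?thesis using that by blast
qed

text \<open>Faithfulness: at colourings that separate \<open>A\<close> from all other diagrams, the
  matrix entry is the coefficient of \<open>A\<close>.\<close>

lemma element_matrix_inject:
  assumes n: "2 * (r + s) \<le> n"
    and xy: "x \<in> carrier (walled_brauer \<delta> r s)" "y \<in> carrier (walled_brauer \<delta> r s)"
    and eq: "\<And>c d. c \<in> colorings n (r + s) \<Longrightarrow> d \<in> colorings n (r + s) \<Longrightarrow>
           element_matrix r s x c d = element_matrix r s y c d"
  shows "x = y"
proof
  fix A show "x A = y A"
  proof (cases "A \<in> walled_diagrams r s r s")
    case True
    obtain c d where cd: "c \<in> colorings n (r + s)" "d \<in> colorings n (r + s)"
      "\<And>B. B \<in> walled_diagrams r s r s \<Longrightarrow> compatible B c d \<longleftrightarrow> B = A"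
      using separating_coloring[OF True, of n] n by auto
    have "element_matrix r s z c d = z A" for z :: "diagram \<Rightarrow> 'a"
    proof -
      have "element_matrix r s z c d = (\<Sum>B\<in>walled_diagrams r s r s. if B = A then z B else 0)"
        unfolding element_matrix_def by (rule sum.cong) (simp_all add: diagram_matrix_def cd(3))
      thus ?thesis using True by simp
    qed
    thus ?thesis using eq[OF cd(1,2)] by simp
  qed (use xy in \<open>simp add: walled_brauer_simps supported_on_def\<close>)
qed

lemma element_matrix_one:
  assumes "c \<in> colorings n (r + s)" "d \<in> colorings n (r + s)"
  shows "element_matrix r s \<one>\<^bsub>walled_brauer \<delta> r s\<^esub> c d = of_bool (c = d)"
  using assms by (simp add: walled_brauer_simps element_matrix_unit_at identity_diagram_walled
      diagram_matrix_def compatible_identity_diagram)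

text \<open>Associativity and the unit laws are those of matrices, transported by faithfulness;
  associativity of concatenation together with its loop counts is never checked on diagrams.\<close>

lemma ring_walled_brauer:
  assumes n: "2 * (r + s) \<le> n"
  shows "ring (walled_brauer (of_nat n :: 'k::field) r s)" (is "ring ?R")
proof (rule ringI)
  show "abelian_group ?R"
  proof (rule abelian_groupI)
    fix x assume "x \<in> carrier ?R"
    thus "\<exists>y\<in>carrier ?R. y \<oplus>\<^bsub>?R\<^esub> x = \<zero>\<^bsub>?R\<^esub>"
      by (intro bexI[of _ "- x"]) (auto simp: walled_brauer_simps supported_on_simps)
  qed (simp_all add: walled_brauer_simps supported_on_simps add_ac)
  have one: "\<one>\<^bsub>?R\<^esub> \<in> carrier ?R"
    by (simp add: walled_brauer_simps unit_at_supported identity_diagram_walled)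
  note inject = element_matrix_inject[OF n, where \<delta> = "of_nat n :: 'k"]
  have bool: "of_bool (P) * z = (if P then z else 0)" "z * of_bool P = (if P then z else 0)"
    for P and z :: 'k by auto
  show "monoid ?R"
  proof (rule monoidI)
    fix x y z assume xyz: "x \<in> carrier ?R" "y \<in> carrier ?R" "z \<in> carrier ?R"
    show "x \<otimes>\<^bsub>?R\<^esub> y \<otimes>\<^bsub>?R\<^esub> z = x \<otimes>\<^bsub>?R\<^esub> (y \<otimes>\<^bsub>?R\<^esub> z)"
    proof (rule inject)
      fix c d assume "c \<in> colorings n (r + s)" "d \<in> colorings n (r + s)"
      thus "element_matrix r s (x \<otimes>\<^bsub>?R\<^esub> y \<otimes>\<^bsub>?R\<^esub> z) c d =
        element_matrix r s (x \<otimes>\<^bsub>?R\<^esub> (y \<otimes>\<^bsub>?R\<^esub> z)) c d"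
        using sum.swap[of "\<lambda>i j. element_matrix r s x c j *
          (element_matrix r s y j i * element_matrix r s z i d)" "colorings n (r + s)" "colorings n (r + s)"]
        by (simp add: element_matrix_mult sum_distrib_left sum_distrib_right mult.assoc)
    qed (simp_all add: walled_brauer_mult_closed)
  next
    fix x assume x: "x \<in> carrier ?R"
    show "\<one>\<^bsub>?R\<^esub> \<otimes>\<^bsub>?R\<^esub> x = x"
      by (rule inject) (simp_all add: walled_brauer_mult_closed x element_matrix_mult
          element_matrix_one bool)
    show "x \<otimes>\<^bsub>?R\<^esub> \<one>\<^bsub>?R\<^esub> = x"
      by (rule inject) (simp_all add: walled_brauer_mult_closed x element_matrix_mult
          element_matrix_one bool)
  qed (simp_all add: walled_brauer_mult_closed one)
  fix x y z
  show "(x \<oplus>\<^bsub>?R\<^esub> y) \<otimes>\<^bsub>?R\<^esub> z = x \<otimes>\<^bsub>?R\<^esub> z \<oplus>\<^bsub>?R\<^esub> y \<otimes>\<^bsub>?R\<^esub> z"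
    by (simp add: walled_brauer_simps fun_eq_iff distrib_right sum.distrib)
  show "z \<otimes>\<^bsub>?R\<^esub> (x \<oplus>\<^bsub>?R\<^esub> y) = z \<otimes>\<^bsub>?R\<^esub> x \<oplus>\<^bsub>?R\<^esub> z \<otimes>\<^bsub>?R\<^esub> y"
    by (simp add: walled_brauer_simps fun_eq_iff distrib_right distrib_left sum.distrib)
qed

text \<open>Matrices act on functions that vanish off the colourings.\<close>

definition matrix_op :: "nat \<Rightarrow> nat \<Rightarrow> nat \<Rightarrow> ((nat \<Rightarrow> nat) \<Rightarrow> (nat \<Rightarrow> nat) \<Rightarrow> 'k::comm_ring_1) \<Rightarrow>
    ((nat \<Rightarrow> nat) \<Rightarrow> 'k) \<Rightarrow> (nat \<Rightarrow> nat) \<Rightarrow> 'k" where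
  "matrix_op n m m' M f c = (if c \<in> colorings n m then \<Sum>d\<in>colorings n m'. M c d * f d else 0)"

lemma matrix_op_supported: "matrix_op n m m' M f \<in> supported_on (colorings n m)"
  by (simp add: supported_on_def matrix_op_def)

lemma matrix_op_scale: "matrix_op n m m' M (\<lambda>c. a * f c) = (\<lambda>c. a * matrix_op n m m' M f c)"
  by (simp add: fun_eq_iff matrix_op_def sum_distrib_left mult_ac)

definition element_op ::
  "nat \<Rightarrow> nat \<Rightarrow> nat \<Rightarrow> (diagram \<Rightarrow> 'k::field) \<Rightarrow> ((nat \<Rightarrow> nat) \<Rightarrow> 'k) \<Rightarrow> (nat \<Rightarrow> nat) \<Rightarrow> 'k" where
  "element_op n r s x = matrix_op n (r + s) (r + s) (element_matrix r s x)"

lemma element_op_mult: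
  "element_op n r s (x \<otimes>\<^bsub>walled_brauer (of_nat n) r s\<^esub> y) f =
     element_op n r s x (element_op n r s y f)"
proof
  fix c show "element_op n r s (x \<otimes>\<^bsub>walled_brauer (of_nat n) r s\<^esub> y) f c =
     element_op n r s x (element_op n r s y f) c"
  proof (cases "c \<in> colorings n (r + s)")
    case True
    thus ?thesis
      using sum.swap[of "\<lambda>i j. element_matrix r s x c j * (element_matrix r s y j i * f i)"
          "colorings n (r + s)" "colorings n (r + s)"]
      by (simp add: element_op_def matrix_op_def element_matrix_mult sum_distrib_left
          sum_distrib_right mult.assoc)
  qed (simp add: element_op_def matrix_op_def)
qed

lemma element_op_one:
  assumes "f \<in> supported_on (colorings n (r + s))"
  shows "element_op n r s \<one>\<^bsub>walled_brauer \<delta> r s\<^esub> f = f"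
proof
  fix c
  have "of_bool (P) * z = (if P then z else 0)" for P and z :: 'a by auto
  thus "element_op n r s \<one>\<^bsub>walled_brauer \<delta> r s\<^esub> f c = f c"
    using assms by (simp add: element_op_def matrix_op_def element_matrix_one supported_on_def)
qed

lemma element_op_inject:
  assumes n: "2 * (r + s) \<le> n"
    and xy: "x \<in> carrier (walled_brauer \<delta> r s)" "y \<in> carrier (walled_brauer \<delta> r s)"
    and eq: "\<And>f. f \<in> supported_on (colorings n (r + s)) \<Longrightarrow> element_op n r s x f = element_op n r s y f"
  shows "x = y"
proof (rule element_matrix_inject[OF n xy])
  fix c d assume cd: "c \<in> colorings n (r + s)" "d \<in> colorings n (r + s)"
  have "element_op n r s z (unit_at d) c = element_matrix r s z c d" for z :: "diagram \<Rightarrow> 'a"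
  proof -
    have "element_op n r s z (unit_at d) c =
      (\<Sum>e\<in>colorings n (r + s). if e = d then element_matrix r s z c e else 0)"
      unfolding element_op_def matrix_op_def if_P[OF cd(1)]
      by (rule sum.cong) (auto simp: unit_at_def)
    thus ?thesis using cd by simp
  qed
  thus "element_matrix r s x c d = element_matrix r s y c d"
    using eq[of "unit_at d"] cd by (metis unit_at_supported)
qed

section \<open>The action of the general linear Lie algebra\<close>

text \<open>
  Matrix unit \<open>E\<^bsub>ab\<^esub>\<close> on the mixed tensor space \<open>V\<^bsup>\<otimes>r\<^esup> \<otimes> V*\<^bsup>\<otimes>s\<^esup>\<close>, acting on the \<open>x\<close>-th factor only, in
  coordinates: tensors are functions of colourings.
\<close>

definition gl_at :: "nat \<Rightarrow> nat \<Rightarrow> nat \<Rightarrow> nat \<Rightarrow> ((nat \<Rightarrow> nat) \<Rightarrow> 'k::comm_ring_1) \<Rightarrow> (nat \<Rightarrow> nat) \<Rightarrow> 'k" where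
  "gl_at r x a b f c =
     (if x \<le> r then of_bool (c x = a) * f (c(x := b)) else - (of_bool (c x = b) * f (c(x := a))))"

definition gl_op :: "nat \<Rightarrow> nat \<Rightarrow> nat \<Rightarrow> nat \<Rightarrow> ((nat \<Rightarrow> nat) \<Rightarrow> 'k::comm_ring_1) \<Rightarrow> (nat \<Rightarrow> nat) \<Rightarrow> 'k" where
  "gl_op r m a b f c = (\<Sum>x\<in>{1..m}. gl_at r x a b f c)"

lemma gl_at_sum: "gl_at r x a b (\<lambda>c. \<Sum>i\<in>I. f i c) c = (\<Sum>i\<in>I. gl_at r x a b (f i) c)"
  by (simp add: gl_at_def sum_distrib_left sum_negf)

lemma gl_op_sum: "gl_op r m a b (\<lambda>c. \<Sum>i\<in>I. f i c) c = (\<Sum>i\<in>I. gl_op r m a b (f i) c)"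
  unfolding gl_op_def gl_at_sum by (rule sum.swap)

lemma gl_op_scale: "gl_op r m a b (\<lambda>c. z * f c) c = z * gl_op r m a b f c"
  unfolding gl_op_def sum_distrib_left by (rule sum.cong) (auto simp: gl_at_def)

lemma gl_op_diff: "gl_op r m a b (\<lambda>c. f c - g c) c = gl_op r m a b f c - gl_op r m a b g c"
  unfolding gl_op_def sum_subtractf[symmetric] by (rule sum.cong) (auto simp: gl_at_def algebra_simps)

lemma gl_at_commute:
  "x \<noteq> y \<Longrightarrow> gl_at r x a b (gl_at r y a' b' f) c = gl_at r y a' b' (gl_at r x a b f) c"
  by (simp add: gl_at_def fun_upd_twist)

lemma gl_at_commutator:
  "gl_at r x a b (gl_at r x a' b' f) c - gl_at r x a' b' (gl_at r x a b f) c =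
     of_bool (b = a') * gl_at r x a b' f c - of_bool (a = b') * gl_at r x a' b f c"
  by (simp add: gl_at_def)

text \<open>The defining relations of \<open>gl_n\<close>. Actions on different tensor factors
  commute, so only the diagonal of the double sum survives.\<close>

lemma gl_op_commutator:
  "gl_op r m a b (gl_op r m a' b' f) c = gl_op r m a' b' (gl_op r m a b f) c +
     of_bool (b = a') * gl_op r m a b' f c - of_bool (a = b') * gl_op r m a' b f c"
proof -
  let ?I = "{1..m}"
  have "gl_op r m a b (gl_op r m a' b' f) c = (\<Sum>x\<in>?I. \<Sum>y\<in>?I. gl_at r x a b (gl_at r y a' b' f) c)"
    unfolding gl_op_def gl_at_sum ..
  moreover have "gl_op r m a' b' (gl_op r m a b f) c =
      (\<Sum>x\<in>?I. \<Sum>y\<in>?I. gl_at r y a' b' (gl_at r x a b f) c)"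
    unfolding gl_op_def gl_at_sum by (rule sum.swap)
  moreover have "gl_at r x a b (gl_at r y a' b' f) c - gl_at r y a' b' (gl_at r x a b f) c =
      (if y = x then of_bool (b = a') * gl_at r x a b' f c - of_bool (a = b') * gl_at r x a' b f c else 0)"
    for x y
    by (cases "x = y") (simp_all add: gl_at_commute gl_at_commutator)
  ultimately have "gl_op r m a b (gl_op r m a' b' f) c - gl_op r m a' b' (gl_op r m a b f) c =
     (\<Sum>x\<in>?I. of_bool (b = a') * gl_at r x a b' f c - of_bool (a = b') * gl_at r x a' b f c)"
    by (simp add: sum_subtractf[symmetric])
  also have "\<dots> = of_bool (b = a') * gl_op r m a b' f c - of_bool (a = b') * gl_op r m a' b f c"
    by (simp add: gl_op_def sum_subtractf sum_distrib_left)
  finally show ?thesis by (simp add: algebra_simps)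
qed

lemma colorings_upd:
  "c \<in> colorings n m \<Longrightarrow> x \<in> {1..m} \<Longrightarrow> b \<in> {1..n} \<Longrightarrow> c(x := b) \<in> colorings n m"
  by (auto simp: colorings_def PiE_def extensional_def)

lemma colorings_upd_iff:
  assumes "x \<in> {1..m}" "b \<in> {1..n}" "c x \<in> {1..n}"
  shows "c(x := b) \<in> colorings n m \<longleftrightarrow> c \<in> colorings n m"
  using colorings_upd[of c n m x b] colorings_upd[of "c(x := b)" n m x "c x"] assms by auto

lemma colorings_mem: "c \<in> colorings n m \<Longrightarrow> x \<in> {1..m} \<Longrightarrow> c x \<in> {1..n}"
  unfolding colorings_def by (rule PiE_mem)

lemma gl_op_cong:
  assumes "\<And>c. c \<in> colorings n m \<Longrightarrow> f c = g c" "c \<in> colorings n m" "a \<in> {1..n}" "b \<in> {1..n}"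
  shows "gl_op r m a b f c = gl_op r m a b g c"
  unfolding gl_op_def
proof (rule sum.cong[OF refl])
  fix x assume "x \<in> {1..m}"
  thus "gl_at r x a b f c = gl_at r x a b g c"
    using assms colorings_upd[of c n m x] by (simp add: gl_at_def)
qed

lemma gl_op_supported:
  assumes "f \<in> supported_on (colorings n m)" "a \<in> {1..n}" "b \<in> {1..n}"
  shows "gl_op r m a b f \<in> supported_on (colorings n m)"
proof -
  have "gl_at r x a b f c = 0" if "c \<notin> colorings n m" "x \<in> {1..m}" for c x
    using that assms colorings_upd_iff[of x m _ n c]
    by (cases "x \<le> r"; cases "c x = a"; cases "c x = b") (auto simp: gl_at_def supported_on_def)
  thus ?thesis by (simp add: supported_on_def gl_op_def)
qed

section \<open>Diagrams commute with the Lie algebra\<close>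

lemma sum_nodes: "(\<Sum>u\<in>nodes m m'. g u) = (\<Sum>i\<in>{1..m}. g (North i)) + (\<Sum>i\<in>{1..m'}. g (South i))"
proof -
  have "sum g (North ` {1..m} \<union> South ` {1..m'}) = sum g (North ` {1..m}) + sum g (South ` {1..m'})"
    by (rule sum.union_disjoint) auto
  moreover have "inj_on North {1..m}" "inj_on South {1..m'}" by (auto simp: inj_on_def)
  ultimately show ?thesis by (simp add: nodes_def sum.reindex)
qed

definition constant_on_pairs :: "diagram \<Rightarrow> (node \<Rightarrow> nat) \<Rightarrow> bool" where
  "constant_on_pairs D g \<longleftrightarrow> (\<forall>u v. {u, v} \<in> D \<longrightarrow> g u = g v)"

lemma compatible_iff: "compatible D c d \<longleftrightarrow> constant_on_pairs D (node_color c d)"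
  by (simp add: compatible_def constant_on_pairs_def)

lemma node_color_upd [simp]:
  "node_color (c(i := b)) d = (node_color c d)(North i := b)"
  "node_color c (d(i := b)) = (node_color c d)(South i := b)"
  by (rule ext, case_tac x, auto)+

lemma partner_eq:
  assumes "D \<in> walled_diagrams r s a b" "{u, v} \<in> D"
  shows "partner D u = v"
  unfolding partner_def by (metis assms the_equality walled_diagram_pair_unique)

lemma partner:
  assumes "D \<in> walled_diagrams r s a b" "u \<in> nodes (r + s) (a + b)"
  shows "{u, partner D u} \<in> D" "partner D u \<in> nodes (r + s) (a + b)" "partner D u \<noteq> u"
    "plus_node r a (partner D u) \<longleftrightarrow> \<not> plus_node r a u" "partner D (partner D u) = u"
proof -
  obtain v where v: "{u, v} \<in> D" "plus_node r a v \<noteq> plus_node r a u" "v \<noteq> u"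
    "v \<in> nodes (r + s) (a + b)"
    using walled_diagram_obtain_pair[OF assms] by blast
  have "{v, u} \<in> D" using v by (simp add: insert_commute)
  hence "partner D u = v" "partner D v = u" using partner_eq[OF assms(1)] v(1) by blast+
  thus "{u, partner D u} \<in> D" "partner D u \<in> nodes (r + s) (a + b)" "partner D u \<noteq> u"
    "plus_node r a (partner D u) \<longleftrightarrow> \<not> plus_node r a u" "partner D (partner D u) = u"
    using v by simp_all
qed

lemma constant_on_pairs_upd:
  assumes D: "D \<in> walled_diagrams r s a' b'" and uv: "{u, v} \<in> D"
  shows "constant_on_pairs D (g(u := x)) \<longleftrightarrow> g v = x \<and> (\<forall>y z. {y, z} \<in> D - {{u, v}} \<longrightarrow> g y = g z)"
    (is "?L \<longleftrightarrow> ?R")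
proof -
  have uv_ne: "u \<noteq> v" using walled_diagram_pair_plus(1)[OF D uv] by auto
  have other: "y \<noteq> u \<and> z \<noteq> u" if "{y, z} \<in> D" "{y, z} \<noteq> {u, v}" for y z
    using walled_diagram_pair_unique[OF D uv] that by (metis insert_commute)
  show ?thesis
  proof
    assume L: ?L
    have "g v = x" using L uv uv_ne unfolding constant_on_pairs_def by (metis fun_upd_apply)
    moreover have "g y = g z" if "{y, z} \<in> D - {{u, v}}" for y z
      using L other[of y z] that unfolding constant_on_pairs_def by (metis DiffE fun_upd_apply insertI1)
    ultimately show ?R by blast
  next
    assume R: ?R
    show ?L unfolding constant_on_pairs_def
    proof (intro allI impI)
      fix y z assume yz: "{y, z} \<in> D"
      show "(g(u := x)) y = (g(u := x)) z"
      proof (cases "{y, z} = {u, v}")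
        case True
        thus ?thesis using R by (auto simp: doubleton_eq_iff)
      next
        case False
        hence "g y = g z" using R yz by blast
        thus ?thesis using other[OF yz False] by simp
      qed
    qed
  qed
qed

text \<open>The two ends of a pair contribute opposite terms.\<close>

lemma diagram_invariant:
  assumes D: "D \<in> walled_diagrams r s a' b'"
  shows "(\<Sum>u\<in>nodes (r + s) (a' + b'). if plus_node r a' u
     then of_bool (g u = a \<and> constant_on_pairs D (g(u := b)))
     else - of_bool (g u = b \<and> constant_on_pairs D (g(u := a)))) = (0 :: 'k::comm_ring_1)"
proof -
  let ?N = "nodes (r + s) (a' + b')"
  let ?T = "\<lambda>u. of_bool (g u = a \<and> constant_on_pairs D (g(u := b))) :: 'k"
  let ?T' = "\<lambda>u. of_bool (g u = b \<and> constant_on_pairs D (g(u := a))) :: 'k"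
  have "(\<Sum>u\<in>{u \<in> ?N. plus_node r a' u}. ?T u) = (\<Sum>u\<in>{u \<in> ?N. \<not> plus_node r a' u}. ?T' u)"
  proof (rule sum.reindex_bij_witness[of _ "partner D" "partner D"])
    fix u assume u: "u \<in> {u \<in> ?N. plus_node r a' u}"
    let ?v = "partner D u"
    have uv: "{u, ?v} \<in> D" and vu: "{?v, u} \<in> D"
      using partner(1)[OF D, of u] u by (auto simp: insert_commute)
    show "?T' ?v = ?T u"
      using constant_on_pairs_upd[OF D uv, of g] constant_on_pairs_upd[OF D vu, of g]
      by (auto simp: insert_commute)
  qed (simp_all add: partner[OF D])
  moreover have "(\<Sum>u\<in>?N. if plus_node r a' u then ?T u else - ?T' u) =
    (\<Sum>u\<in>{u \<in> ?N. plus_node r a' u}. ?T u) - (\<Sum>u\<in>{u \<in> ?N. \<not> plus_node r a' u}. ?T' u)"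
    by (simp add: sum.If_cases sum_negf Int_def Collect_neg_eq[symmetric])
  ultimately show ?thesis by simp
qed

definition diagram_op :: "nat \<Rightarrow> nat \<Rightarrow> nat \<Rightarrow> diagram \<Rightarrow>
    ((nat \<Rightarrow> nat) \<Rightarrow> 'k::comm_ring_1) \<Rightarrow> (nat \<Rightarrow> nat) \<Rightarrow> 'k" where
  "diagram_op n m m' D = matrix_op n m m' (diagram_matrix D)"

lemma diagram_op_supported: "diagram_op n m m' D f \<in> supported_on (colorings n m)"
  by (simp add: diagram_op_def matrix_op_supported)

text \<open>The transpose of the matrix unit \<open>(a, b)\<close> is the unit
  \<open>(b, a)\<close>. This moves the action from the argument of a diagram operator to the
  southern index of its matrix.\<close>

lemma sum_colorings_upd:
  assumes x: "x \<in> {1..m}" and ab: "a \<in> {1..n}" "b \<in> {1..n}"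
  shows "(\<Sum>d\<in>colorings n m. g d * (of_bool (d x = a) * f (d(x := b)))) =
         (\<Sum>d\<in>colorings n m. (of_bool (d x = b) * g (d(x := a))) * f d :: 'k::comm_ring_1)"
proof -
  have "(\<Sum>d\<in>{d \<in> colorings n m. d x = a}. g d * f (d(x := b))) =
        (\<Sum>d\<in>{d \<in> colorings n m. d x = b}. g (d(x := a)) * f d)"
    by (rule sum.reindex_bij_witness[of _ "\<lambda>d. d(x := a)" "\<lambda>d. d(x := b)"])
      (use x ab colorings_upd in auto)
  moreover have "(\<Sum>d\<in>colorings n m. g d * (of_bool (d x = a) * f (d(x := b)))) =
      (\<Sum>d\<in>{d \<in> colorings n m. d x = a}. g d * f (d(x := b)))"
    by (rule sum.mono_neutral_cong_right) auto
  moreover have "(\<Sum>d\<in>colorings n m. (of_bool (d x = b) * g (d(x := a))) * f d) =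
      (\<Sum>d\<in>{d \<in> colorings n m. d x = b}. g (d(x := a)) * f d)"
    by (rule sum.mono_neutral_cong_right) auto
  ultimately show ?thesis by simp
qed

text \<open>Regarded as a tensor on all its nodes, the matrix of \<open>D\<close> is annihilated by
  \<open>gl_n\<close> (\<open>diagram_invariant\<close>): left northern nodes carry the natural
  module, left southern ones its dual, and conversely on the right. Moving the southern terms to the
  other side gives the intertwining property.\<close>

lemma diagram_op_gl_op:
  fixes f :: "(nat \<Rightarrow> nat) \<Rightarrow> 'k::comm_ring_1"
  assumes D: "D \<in> walled_diagrams r s a' b'" and ab: "a \<in> {1..n}" "b \<in> {1..n}"
  shows "gl_op r (r + s) a b (diagram_op n (r + s) (a' + b') D f) =
         diagram_op n (r + s) (a' + b') D (gl_op a' (a' + b') a b f)" (is "?L = ?R")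
proof
  fix c
  show "?L c = ?R c"
  proof (cases "c \<in> colorings n (r + s)")
    case False
    thus ?thesis
      by (simp add: supported_on_simps(1)[OF gl_op_supported[OF diagram_op_supported ab]]
        supported_on_simps(1)[OF diagram_op_supported])
  next
    case c: True
    let ?m = "r + s" and ?m' = "a' + b'"
    let ?D = "\<lambda>c d. diagram_matrix D c d :: 'k"
    \<comment> \<open>\<open>N\<close> is the action at a northern node; \<open>S\<close> is the
      transposed action at a southern node, which enters the invariance sum with the opposite
      sign.\<close>
    define N where "N d x = (if x \<le> r then of_bool (c x = a) * ?D (c(x := b)) d
        else - (of_bool (c x = b) * ?D (c(x := a)) d))" for d x
    define S where "S d x = (if x \<le> a' then of_bool (d x = b) * ?D c (d(x := a))
        else - (of_bool (d x = a) * ?D c (d(x := b))))" for d x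
    have "?L c = (\<Sum>x\<in>{1..?m}. \<Sum>d\<in>colorings n ?m'. N d x * f d)"
      unfolding gl_op_def
    proof (rule sum.cong[OF refl])
      fix x assume "x \<in> {1..?m}"
      thus "gl_at r x a b (diagram_op n ?m ?m' D f) c = (\<Sum>d\<in>colorings n ?m'. N d x * f d)"
        using colorings_upd[OF c] ab
        by (simp add: gl_at_def N_def diagram_op_def matrix_op_def sum_distrib_left sum_negf mult.assoc)
    qed
    also have "\<dots> = (\<Sum>d\<in>colorings n ?m'. (\<Sum>x\<in>{1..?m}. N d x) * f d)"
      by (subst sum.swap) (simp add: sum_distrib_right)
    also have "\<dots> = (\<Sum>d\<in>colorings n ?m'. (\<Sum>x\<in>{1..?m'}. S d x) * f d)"
    proof (rule sum.cong[OF refl])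
      fix d
      let ?g = "node_color c d"
      let ?T = "\<lambda>u. if plus_node r a' u then of_bool (?g u = a \<and> constant_on_pairs D (?g(u := b)))
        else - of_bool (?g u = b \<and> constant_on_pairs D (?g(u := a))) :: 'k"
      have "N d x = ?T (North x)" "- S d x = ?T (South x)" for x
        by (simp_all add: N_def S_def diagram_matrix_def compatible_iff of_bool_conj)
      hence "(\<Sum>x\<in>{1..?m}. N d x) + (\<Sum>x\<in>{1..?m'}. - S d x) = sum ?T (nodes ?m ?m')"
        unfolding sum_nodes by simp
      also have "\<dots> = 0" by (rule diagram_invariant[OF D])
      finally have "(\<Sum>x\<in>{1..?m}. N d x) = (\<Sum>x\<in>{1..?m'}. S d x)"
        by (simp add: sum_negf)
      thus "(\<Sum>x\<in>{1..?m}. N d x) * f d = (\<Sum>x\<in>{1..?m'}. S d x) * f d" by simp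
    qed
    also have "\<dots> = (\<Sum>x\<in>{1..?m'}. \<Sum>d\<in>colorings n ?m'. S d x * f d)"
      by (subst sum.swap) (simp add: sum_distrib_right)
    also have "\<dots> = (\<Sum>x\<in>{1..?m'}. \<Sum>d\<in>colorings n ?m'. ?D c d * gl_at a' x a b f d)"
    proof (rule sum.cong[OF refl])
      fix x assume x: "x \<in> {1..?m'}"
      show "(\<Sum>d\<in>colorings n ?m'. S d x * f d) = (\<Sum>d\<in>colorings n ?m'. ?D c d * gl_at a' x a b f d)"
        using sum_colorings_upd[OF x ab, of "?D c" f] sum_colorings_upd[OF x ab(2,1), of "?D c" f]
        by (cases "x \<le> a'") (simp_all add: S_def gl_at_def sum_negf)
    qed
    also have "\<dots> = ?R c"
      using c by (simp add: diagram_op_def matrix_op_def gl_op_def sum_distrib_left) (rule sum.swap)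
    finally show ?thesis .
  qed
qed

text \<open>Entry \<open>(a, b)\<close> of the matrix power \<open>E^k\<close>. The entries of
  \<open>E\<close> do not commute, and each new factor is multiplied on the left.\<close>

primrec gl_pow :: "nat \<Rightarrow> nat \<Rightarrow> nat \<Rightarrow> nat \<Rightarrow> nat \<Rightarrow> nat \<Rightarrow> ((nat \<Rightarrow> nat) \<Rightarrow> 'k::comm_ring_1) \<Rightarrow>
    (nat \<Rightarrow> nat) \<Rightarrow> 'k" where
  "gl_pow r m n 0 a b f = (\<lambda>c. of_bool (a = b) * f c)"
| "gl_pow r m n (Suc k) a b f = (\<lambda>c. \<Sum>i\<in>{1..n}. gl_op r m a i (gl_pow r m n k i b f) c)"

text \<open>The Casimir operator \<open>tr (E\<^bsup>k\<^esup>)\<close> for the matrix \<open>E = (E\<^bsub>ab\<^esub>)\<close>.\<close>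

definition casimir :: "nat \<Rightarrow> nat \<Rightarrow> nat \<Rightarrow> nat \<Rightarrow> ((nat \<Rightarrow> nat) \<Rightarrow> 'k::comm_ring_1) \<Rightarrow> (nat \<Rightarrow> nat) \<Rightarrow> 'k" where
  "casimir r m n k f c = (\<Sum>a\<in>{1..n}. gl_pow r m n k a a f c)"

lemma diagram_op_sum:
  "diagram_op n m m' D (\<lambda>c. \<Sum>i\<in>I. f i c) = (\<lambda>c. \<Sum>i\<in>I. diagram_op n m m' D (f i) c)"
proof
  fix c
  show "diagram_op n m m' D (\<lambda>c. \<Sum>i\<in>I. f i c) c = (\<Sum>i\<in>I. diagram_op n m m' D (f i) c)"
    unfolding diagram_op_def matrix_op_def by (simp add: sum_distrib_left sum.swap[of _ I])
qed

lemma diagram_op_gl_pow: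
  assumes D: "D \<in> walled_diagrams r s a' b'" and ab: "a \<in> {1..n}" "b \<in> {1..n}"
  shows "gl_pow r (r + s) n k a b (diagram_op n (r + s) (a' + b') D f) =
         diagram_op n (r + s) (a' + b') D (gl_pow a' (a' + b') n k a b f)"
  using ab
proof (induction k arbitrary: a)
  case 0
  show ?case by (auto simp: diagram_op_def matrix_op_scale)
next
  case (Suc k)
  show ?case
    unfolding gl_pow.simps diagram_op_sum
    by (intro ext sum.cong refl) (simp only: Suc.IH[OF _ ab(2)] diagram_op_gl_op[OF D Suc.prems(1)])
qed

lemma diagram_op_casimir:
  assumes D: "D \<in> walled_diagrams r s a' b'"
  shows "casimir r (r + s) n k (diagram_op n (r + s) (a' + b') D f) =
         diagram_op n (r + s) (a' + b') D (casimir a' (a' + b') n k f)"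
proof -
  have *: "casimir r' m n k g = (\<lambda>c. \<Sum>a\<in>{1..n}. gl_pow r' m n k a a g c)" for r' m and g :: "_ \<Rightarrow> 'a"
    by (simp add: casimir_def fun_eq_iff)
  show ?thesis unfolding * diagram_op_sum
    by (intro ext sum.cong refl) (simp only: diagram_op_gl_pow[OF D])
qed

lemma gl_pow_supported:
  assumes "f \<in> supported_on (colorings n m)" "a \<in> {1..n}"
  shows "gl_pow r m n k a b f \<in> supported_on (colorings n m)"
  using assms(2)
proof (induction k arbitrary: a)
  case (Suc k)
  have "gl_op r m a i (gl_pow r m n k i b f) c = 0" if "i \<in> {1..n}" "c \<notin> colorings n m" for i c
    using supported_on_simps(1)[OF gl_op_supported[OF Suc.IH[OF that(1)] Suc.prems that(1)] that(2)] .
  thus ?case by (simp add: supported_on_def)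
qed (use assms in \<open>simp add: supported_on_def\<close>)

lemma casimir_supported:
  "f \<in> supported_on (colorings n m) \<Longrightarrow> casimir r m n k f \<in> supported_on (colorings n m)"
  unfolding supported_on_def casimir_def
  using supported_on_simps(1)[OF gl_pow_supported[of f n m _ r k]] by (simp add: supported_on_def)

section \<open>Central elements\<close>

text \<open>
  With one more strand on the right, the sum of all exchanges of that strand with the others is
  the matrix \<open>-E\<close>; its powers have partial traces in the algebra with \<open>s\<close> strands on the right.
\<close>

definition exchange_diagram :: "nat \<Rightarrow> nat \<Rightarrow> diagram" where
  "exchange_diagram m j = {{North i, South (transpose j m i)} | i. i \<in> {1..m}}"

definition hook_diagram :: "nat \<Rightarrow> nat \<Rightarrow> diagram" where
  "hook_diagram m j = insert {North j, North m} (insert {South j, South m}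
     {{North i, South i} | i. i \<in> {1..m} - {j, m}})"

lemma exchange_diagram_walled:
  assumes "j \<in> {r + 1..r + s}"
  shows "exchange_diagram (r + Suc s) j \<in> walled_diagrams r (Suc s) r (Suc s)"
proof (rule walled_diagramsI)
  let ?m = "r + Suc s"
  have tr: "transpose j ?m i \<in> {1..?m}" "transpose j ?m i \<le> r \<longleftrightarrow> i \<le> r" if "i \<in> {1..?m}" for i
    using that assms by (auto simp: transpose_def)
  fix P assume "P \<in> exchange_diagram ?m j"
  then obtain i where i: "P = {North i, South (transpose j ?m i)}" "i \<in> {1..?m}"
    by (auto simp: exchange_diagram_def)
  show "\<exists>u v. P = {u, v} \<and> plus_node r r u \<and> \<not> plus_node r r v"
  proof (cases "i \<le> r")
    case True
    thus ?thesis using i tr(2)[OF i(2)] by (intro exI[of _ "North i"] exI[of _ "South (transpose j ?m i)"]) auto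
  next
    case False
    thus ?thesis using i tr(2)[OF i(2)] by (intro exI[of _ "South (transpose j ?m i)"] exI[of _ "North i"]) auto
  qed
next
  let ?m = "r + Suc s"
  have tr: "transpose j ?m i \<in> {1..?m}" if "i \<in> {1..?m}" for i
    using that assms by (auto simp: transpose_def)
  show "\<Union>(exchange_diagram ?m j) = nodes ?m ?m"
  proof (intro equalityI subsetI)
    fix u assume u: "u \<in> nodes ?m ?m"
    show "u \<in> \<Union>(exchange_diagram ?m j)"
    proof (cases u)
      case (North i)
      hence "i \<in> {1..?m}" using u by (auto simp: nodes_def)
      hence "{u, South (transpose j ?m i)} \<in> exchange_diagram ?m j"
        unfolding exchange_diagram_def North by blast
      thus ?thesis by blast
    next
      case (South i)
      hence "i \<in> {1..?m}" using u by (auto simp: nodes_def)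
      hence "{North (transpose j ?m i), u} \<in> exchange_diagram ?m j"
        unfolding exchange_diagram_def using tr[of i] South by (intro CollectI exI[of _ "transpose j ?m i"]) auto
      thus ?thesis by blast
    qed
  qed (use tr in \<open>auto simp: exchange_diagram_def nodes_def\<close>)
qed (auto simp: exchange_diagram_def doubleton_eq_iff dest: injD[OF inj_on_transpose])

lemma hook_diagram_walled:
  assumes "j \<in> {1..r}"
  shows "hook_diagram (r + Suc s) j \<in> walled_diagrams r (Suc s) r (Suc s)"
proof (rule walled_diagramsI)
  let ?m = "r + Suc s"
  fix P assume "P \<in> hook_diagram ?m j"
  then consider "P = {North j, North ?m}" | "P = {South ?m, South j}"
    | i where "P = {North i, South i}" by (auto simp: hook_diagram_def)
  thus "\<exists>u v. P = {u, v} \<and> plus_node r r u \<and> \<not> plus_node r r v"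
  proof cases
    case 1
    thus ?thesis using assms by (intro exI[of _ "North j"] exI[of _ "North ?m"]) auto
  next
    case 2
    thus ?thesis using assms by (intro exI[of _ "South ?m"] exI[of _ "South j"]) auto
  next
    case (3 i)
    show ?thesis
    proof (cases "i \<le> r")
      case True
      thus ?thesis using 3 by (intro exI[of _ "North i"] exI[of _ "South i"]) auto
    next
      case False
      thus ?thesis using 3 by (intro exI[of _ "South i"] exI[of _ "North i"]) auto
    qed
  qed
next
  let ?m = "r + Suc s"
  show "\<Union>(hook_diagram ?m j) = nodes ?m ?m"
  proof (intro equalityI subsetI)
    fix u assume u: "u \<in> nodes ?m ?m"
    then obtain i where i: "u = North i \<or> u = South i" "i \<in> {1..?m}" by (auto simp: nodes_def)
    show "u \<in> \<Union>(hook_diagram ?m j)"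
    proof (cases "i \<in> {j, ?m}")
      case False
      hence "{North i, South i} \<in> hook_diagram ?m j" using i by (auto simp: hook_diagram_def)
      thus ?thesis using i by blast
    qed (use i in \<open>auto simp: hook_diagram_def\<close>)
  qed (use assms in \<open>auto simp: hook_diagram_def nodes_def\<close>)
qed (use assms in \<open>auto simp: hook_diagram_def doubleton_eq_iff\<close>)

lemma constant_on_pairs_insert:
  "constant_on_pairs (insert {x, y} D) g \<longleftrightarrow> g x = g y \<and> constant_on_pairs D g"
  unfolding constant_on_pairs_def by (auto simp: doubleton_eq_iff)

lemma compatible_strands:
  "compatible {{North i, South (h i)} | i. i \<in> I} c d \<longleftrightarrow> (\<forall>i\<in>I. c i = d (h i))"
proof
  assume *: "compatible {{North i, South (h i)} | i. i \<in> I} c d"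
  show "\<forall>i\<in>I. c i = d (h i)"
  proof
    fix i assume "i \<in> I"
    hence "{North i, South (h i)} \<in> {{North i, South (h i)} | i. i \<in> I}" by blast
    with * have "node_color c d (North i) = node_color c d (South (h i))"
      unfolding compatible_def by blast
    thus "c i = d (h i)" by simp
  qed
qed (auto simp: compatible_def doubleton_eq_iff)

lemma exchange_diagram_compatible:
  assumes c: "c \<in> colorings n m" and d: "d \<in> colorings n m" and j: "j \<in> {1..m}" and m: "m \<ge> 1"
  shows "compatible (exchange_diagram m j) c d \<longleftrightarrow> d = c(j := c m, m := c j)"
proof -
  have "compatible (exchange_diagram m j) c d \<longleftrightarrow> (\<forall>i\<in>{1..m}. c i = d (transpose j m i))"
    unfolding exchange_diagram_def by (rule compatible_strands)
  also have "\<dots> \<longleftrightarrow> (\<forall>i\<in>{1..m}. d i = (c(j := c m, m := c j)) i)"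
  proof
    assume *: "\<forall>i\<in>{1..m}. c i = d (transpose j m i)"
    show "\<forall>i\<in>{1..m}. d i = (c(j := c m, m := c j)) i"
    proof
      fix i assume "i \<in> {1..m}"
      hence "transpose j m i \<in> {1..m}" using j m by (auto simp: transpose_def)
      with * have "c (transpose j m i) = d i" by (metis transpose_involutory)
      thus "d i = (c(j := c m, m := c j)) i" by (auto simp: transpose_def split: if_splits)
    qed
  next
    assume *: "\<forall>i\<in>{1..m}. d i = (c(j := c m, m := c j)) i"
    show "\<forall>i\<in>{1..m}. c i = d (transpose j m i)"
    proof
      fix i assume "i \<in> {1..m}"
      hence "transpose j m i \<in> {1..m}" using j m by (auto simp: transpose_def)
      with * have "d (transpose j m i) = (c(j := c m, m := c j)) (transpose j m i)" by blast
      thus "c i = d (transpose j m i)" by (auto simp: transpose_def split: if_splits)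
    qed
  qed
  also have "\<dots> \<longleftrightarrow> d = c(j := c m, m := c j)"
  proof -
    have "c(j := c m, m := c j) \<in> colorings n m"
      using c j m by (intro colorings_upd colorings_mem[OF c]) auto
    thus ?thesis using d PiE_ext unfolding colorings_def by metis
  qed
  finally show ?thesis .
qed

lemma hook_diagram_compatible:
  assumes c: "c \<in> colorings n m" and d: "d \<in> colorings n m" and j: "j \<in> {1..m}" and m: "m \<ge> 1"
  shows "compatible (hook_diagram m j) c d \<longleftrightarrow> c j = c m \<and> d = c(j := d m, m := d m)"
proof -
  have "compatible (hook_diagram m j) c d \<longleftrightarrow>
    c j = c m \<and> d j = d m \<and> (\<forall>i\<in>{1..m} - {j, m}. c i = d i)"
    unfolding hook_diagram_def compatible_iff constant_on_pairs_insert
    unfolding compatible_iff[symmetric] compatible_strands by simp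
  also have "\<dots> \<longleftrightarrow> c j = c m \<and> (\<forall>i\<in>{1..m}. d i = (c(j := d m, m := d m)) i)"
    using j m by auto
  also have "\<dots> \<longleftrightarrow> c j = c m \<and> d = c(j := d m, m := d m)"
  proof -
    have "d m \<in> {1..n}" using m by (intro colorings_mem[OF d]) auto
    hence "c(j := d m, m := d m) \<in> colorings n m"
      using c j m by (intro colorings_upd) auto
    thus ?thesis using d PiE_ext unfolding colorings_def by metis
  qed
  finally show ?thesis .
qed

text \<open>The Jucys-Murphy element of the last strand, up to an additive constant. Hooks carry a
  minus sign because the left factors are natural modules while the new strand is dual.\<close>

definition exchange_sum :: "nat \<Rightarrow> nat \<Rightarrow> diagram \<Rightarrow> 'k::field" where
  "exchange_sum r s =
     (\<lambda>A. \<Sum>j\<in>{r + 1..r + s}. unit_at (exchange_diagram (r + Suc s) j) A) -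
     (\<lambda>A. \<Sum>j\<in>{1..r}. unit_at (hook_diagram (r + Suc s) j) A)"

lemma colorings_extend: "c \<in> colorings n m \<Longrightarrow> a \<in> {1..n} \<Longrightarrow> c(Suc m := a) \<in> colorings n (Suc m)"
  by (auto simp: colorings_def PiE_def extensional_def le_Suc_eq)

lemma colorings_restrict:
  assumes "c \<in> colorings n (Suc m)"
  shows "restrict c {1..m} \<in> colorings n m" "(restrict c {1..m})(Suc m := c (Suc m)) = c"
proof -
  show "restrict c {1..m} \<in> colorings n m" using assms by (auto simp: colorings_def)
  show "(restrict c {1..m})(Suc m := c (Suc m)) = c"
  proof
    fix x
    show "((restrict c {1..m})(Suc m := c (Suc m))) x = c x"
      using assms by (cases "x \<in> {1..Suc m}") (auto simp: colorings_def extensional_def PiE_def)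
  qed
qed

text \<open>The colour of the additional strand serves as row and column index of a matrix of
  operators. A hook gives a matrix unit on a left factor, an exchange the negative of one on a right
  factor; with the sign of the hooks both become parts of \<open>-E\<close>.\<close>

lemma exchange_sum_op:
  fixes F :: "(nat \<Rightarrow> nat) \<Rightarrow> 'k::field"
  assumes c: "c \<in> colorings n (r + s)" and a: "a \<in> {1..n}"
  shows "element_op n r (Suc s) (exchange_sum r s) F (c(Suc (r + s) := a)) =
     - (\<Sum>b\<in>{1..n}. gl_op r (r + s) a b (\<lambda>c. F (c(Suc (r + s) := b))) c)"
proof -
  let ?m = "r + s" and ?M = "Suc (r + s)"
  let ?c = "c(?M := a)" and ?C = "colorings n (Suc (r + s))"
  have c': "?c \<in> ?C" using colorings_extend[OF c a] .
  have ext: "(\<Sum>d\<in>?C. diagram_matrix (exchange_diagram ?M j) ?c d * F d) = F (c(j := a, ?M := c j))"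
    if j: "j \<in> {r + 1..r + s}" for j
  proof -
    have eq: "?c(j := ?c ?M, ?M := ?c j) = c(j := a, ?M := c j)" using j by auto
    have mem: "c(j := a, ?M := c j) \<in> ?C"
      using colorings_extend[OF colorings_upd[OF c _ a] colorings_mem[OF c], of j j] j by auto
    have "(\<Sum>d\<in>?C. diagram_matrix (exchange_diagram ?M j) ?c d * F d) =
      (\<Sum>d\<in>?C. if d = c(j := a, ?M := c j) then F d else 0)"
    proof (rule sum.cong[OF refl])
      fix d assume d: "d \<in> ?C"
      have "compatible (exchange_diagram ?M j) ?c d \<longleftrightarrow> d = c(j := a, ?M := c j)"
        using exchange_diagram_compatible[OF c' d, of j] j unfolding eq by simp
      thus "diagram_matrix (exchange_diagram ?M j) ?c d * F d =
        (if d = c(j := a, ?M := c j) then F d else 0)"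
        by (simp add: diagram_matrix_def)
    qed
    thus ?thesis using mem by simp
  qed
  have hook: "(\<Sum>d\<in>?C. diagram_matrix (hook_diagram ?M j) ?c d * F d) =
      (\<Sum>b\<in>{1..n}. of_bool (c j = a) * F (c(j := b, ?M := b)))"
    if j: "j \<in> {1..r}" for j
  proof -
    have eq: "?c(j := b, ?M := b') = c(j := b, ?M := b')" for b b' using j by auto
    have comp: "compatible (hook_diagram ?M j) ?c d \<longleftrightarrow> c j = a \<and> d = c(j := d ?M, ?M := d ?M)"
      if d: "d \<in> ?C" for d
      using hook_diagram_compatible[OF c' d, of j] j unfolding eq by simp
    have mem: "c(j := b, ?M := b) \<in> ?C" if "b \<in> {1..n}" for b
      using colorings_extend[OF colorings_upd[OF c _ that] that, of j] j by auto
    have "(\<Sum>d\<in>?C. diagram_matrix (hook_diagram ?M j) ?c d * F d) =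
      (\<Sum>d\<in>(\<lambda>b. c(j := b, ?M := b)) ` {1..n}. of_bool (c j = a) * F d)"
    proof (rule sum.mono_neutral_cong_right)
      show "(\<lambda>b. c(j := b, ?M := b)) ` {1..n} \<subseteq> ?C" using mem by auto
      show "\<forall>d\<in>?C - (\<lambda>b. c(j := b, ?M := b)) ` {1..n}.
        diagram_matrix (hook_diagram ?M j) ?c d * F d = 0"
      proof
        fix d assume d: "d \<in> ?C - (\<lambda>b. c(j := b, ?M := b)) ` {1..n}"
        hence "d ?M \<in> {1..n}" by (intro colorings_mem[of d n "Suc (r + s)"]) auto
        hence "\<not> compatible (hook_diagram ?M j) ?c d" using d comp[of d] by blast
        thus "diagram_matrix (hook_diagram ?M j) ?c d * F d = 0" by (simp add: diagram_matrix_def)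
      qed
      fix d assume "d \<in> (\<lambda>b. c(j := b, ?M := b)) ` {1..n}"
      then obtain b where b: "b \<in> {1..n}" "d = c(j := b, ?M := b)" by auto
      have "compatible (hook_diagram ?M j) ?c d \<longleftrightarrow> c j = a"
        using comp[of d] mem[OF b(1)] b(2) by auto
      thus "diagram_matrix (hook_diagram ?M j) ?c d * F d = of_bool (c j = a) * F d"
        by (simp add: diagram_matrix_def)
    qed simp
    also have "\<dots> = (\<Sum>b\<in>{1..n}. of_bool (c j = a) * F (c(j := b, ?M := b)))"
    proof (rule sum.reindex_cong[of "\<lambda>b. c(j := b, ?M := b)"])
      show "inj_on (\<lambda>b. c(j := b, ?M := b)) {1..n}"
        by (rule inj_onI) (metis fun_upd_same)
    qed simp_all
    finally show ?thesis .
  qed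
  have mat: "element_matrix r (Suc s) (exchange_sum r s) ?c d =
      (\<Sum>j\<in>{r + 1..r + s}. diagram_matrix (exchange_diagram ?M j) ?c d) -
      (\<Sum>j\<in>{1..r}. diagram_matrix (hook_diagram ?M j) ?c d :: 'k)" for d
  proof -
    have "(\<Sum>j\<in>{r + 1..r + s}. element_matrix r (Suc s) (unit_at (exchange_diagram ?M j)) ?c d) =
      (\<Sum>j\<in>{r + 1..r + s}. diagram_matrix (exchange_diagram ?M j) ?c d :: 'k)"
      by (intro sum.cong refl) (use element_matrix_unit_at[OF exchange_diagram_walled] in force)
    moreover have "(\<Sum>j\<in>{1..r}. element_matrix r (Suc s) (unit_at (hook_diagram ?M j)) ?c d) =
      (\<Sum>j\<in>{1..r}. diagram_matrix (hook_diagram ?M j) ?c d :: 'k)"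
      by (intro sum.cong refl) (use element_matrix_unit_at[OF hook_diagram_walled] in force)
    ultimately show ?thesis
      unfolding exchange_sum_def element_matrix_diff element_matrix_sum by simp
  qed
  have "element_op n r (Suc s) (exchange_sum r s) F ?c =
     (\<Sum>d\<in>?C. element_matrix r (Suc s) (exchange_sum r s) ?c d * F d)"
    using c' by (simp add: element_op_def matrix_op_def)
  also have "\<dots> = (\<Sum>j\<in>{r + 1..r + s}. \<Sum>d\<in>?C. diagram_matrix (exchange_diagram ?M j) ?c d * F d) -
     (\<Sum>j\<in>{1..r}. \<Sum>d\<in>?C. diagram_matrix (hook_diagram ?M j) ?c d * F d)"
    unfolding mat left_diff_distrib sum_subtractf sum_distrib_right
    by (intro arg_cong2[of _ _ _ _ "(-)"] sum.swap)
  also have "\<dots> = (\<Sum>j\<in>{r + 1..r + s}. F (c(j := a, ?M := c j))) -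
     (\<Sum>j\<in>{1..r}. \<Sum>b\<in>{1..n}. of_bool (c j = a) * F (c(j := b, ?M := b)))"
    by (intro arg_cong2[of _ _ _ _ "(-)"] sum.cong refl ext hook)
  also have "(\<Sum>j\<in>{r + 1..r + s}. F (c(j := a, ?M := c j))) =
      (\<Sum>j\<in>{r + 1..r + s}. \<Sum>b\<in>{1..n}. of_bool (c j = b) * F (c(j := a, ?M := b)))"
  proof (rule sum.cong[OF refl])
    fix j assume "j \<in> {r + 1..r + s}"
    hence "c j \<in> {1..n}" using colorings_mem[OF c, of j] by auto
    moreover have "(\<Sum>b\<in>{1..n}. of_bool (c j = b) * F (c(j := a, ?M := b))) =
      (\<Sum>b\<in>{1..n}. if b = c j then F (c(j := a, ?M := b)) else 0)"
      by (rule sum.cong) auto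
    ultimately show "F (c(j := a, ?M := c j)) = (\<Sum>b\<in>{1..n}. of_bool (c j = b) * F (c(j := a, ?M := b)))"
      by simp
  qed
  also have "\<dots> - (\<Sum>j\<in>{1..r}. \<Sum>b\<in>{1..n}. of_bool (c j = a) * F (c(j := b, ?M := b))) =
     - (\<Sum>j\<in>{1..?m}. \<Sum>b\<in>{1..n}. gl_at r j a b (\<lambda>c. F (c(?M := b))) c)"
  proof -
    have split: "{1..?m} = {1..r} \<union> {r + 1..r + s}" "{1..r} \<inter> {r + 1..r + s} = {}" by auto
    have "(\<Sum>j\<in>{1..?m}. \<Sum>b\<in>{1..n}. gl_at r j a b (\<lambda>c. F (c(?M := b))) c) =
      (\<Sum>j\<in>{1..r}. \<Sum>b\<in>{1..n}. gl_at r j a b (\<lambda>c. F (c(?M := b))) c) +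
      (\<Sum>j\<in>{r + 1..r + s}. \<Sum>b\<in>{1..n}. gl_at r j a b (\<lambda>c. F (c(?M := b))) c)"
      unfolding split(1) by (rule sum.union_disjoint) (use split(2) in auto)
    also have "(\<Sum>j\<in>{1..r}. \<Sum>b\<in>{1..n}. gl_at r j a b (\<lambda>c. F (c(?M := b))) c) =
       (\<Sum>j\<in>{1..r}. \<Sum>b\<in>{1..n}. of_bool (c j = a) * F (c(j := b, ?M := b)))"
      by (intro sum.cong) (auto simp: gl_at_def)
    also have "(\<Sum>j\<in>{r + 1..r + s}. \<Sum>b\<in>{1..n}. gl_at r j a b (\<lambda>c. F (c(?M := b))) c) =
       - (\<Sum>j\<in>{r + 1..r + s}. \<Sum>b\<in>{1..n}. of_bool (c j = b) * F (c(j := a, ?M := b)))"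
      unfolding sum_negf[symmetric] by (intro sum.cong) (auto simp: gl_at_def)
    finally show ?thesis by (simp only: minus_add_distrib minus_minus) (simp only: diff_conv_add_uminus add.commute)
  qed
  also have "\<dots> = - (\<Sum>b\<in>{1..n}. gl_op r ?m a b (\<lambda>c. F (c(?M := b))) c)"
    unfolding gl_op_def by (subst sum.swap) (rule refl)
  finally show ?thesis .
qed

text \<open>As \<open>exchange_sum\<close> acts like the matrix \<open>-E\<close>, repeated
  multiplication by it gives the powers of that matrix, which accounts for the sign
  \<open>(- 1) ^ k\<close>.\<close>

lemma exchange_power:
  fixes r s n k :: nat
  defines "R \<equiv> walled_brauer (of_nat n :: 'k::field) r (Suc s)"
  shows "\<exists>y\<in>carrier R. \<forall>F\<in>supported_on (colorings n (Suc (r + s))). \<forall>c\<in>colorings n (r + s). \<forall>a\<in>{1..n}.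
       element_op n r (Suc s) y F (c(Suc (r + s) := a)) =
       (- 1) ^ k * (\<Sum>b\<in>{1..n}. gl_pow r (r + s) n k a b (\<lambda>c. F (c(Suc (r + s) := b))) c)"
proof -
  let ?R = "walled_brauer (of_nat n :: 'k) r (Suc s)" and ?m = "r + s" and ?M = "Suc (r + s)"
  show ?thesis unfolding R_def
  proof (induction k)
    case 0
    show ?case
    proof (intro bexI[of _ "\<one>\<^bsub>?R\<^esub>"] ballI)
      fix F :: "(nat \<Rightarrow> nat) \<Rightarrow> 'k" and c a
      assume F: "F \<in> supported_on (colorings n ?M)" and a: "a \<in> {1..n}"
      have "(\<Sum>b\<in>{1..n}. of_bool (a = b) * F (c(?M := b))) =
        (\<Sum>b\<in>{1..n}. if b = a then F (c(?M := b)) else 0)" by (rule sum.cong) auto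
      thus "element_op n r (Suc s) \<one>\<^bsub>?R\<^esub> F (c(?M := a)) =
        (- 1) ^ 0 * (\<Sum>b\<in>{1..n}. gl_pow r ?m n 0 a b (\<lambda>c. F (c(?M := b))) c)"
        using element_op_one[of F n r "Suc s"] F a by simp
    next
      show "\<one>\<^bsub>?R\<^esub> \<in> carrier ?R"
        by (simp only: walled_brauer_simps unit_at_supported identity_diagram_walled)
    qed
  next
    case (Suc k)
    then obtain y where y: "y \<in> carrier ?R"
      and IH: "\<And>F c a. F \<in> supported_on (colorings n ?M) \<Longrightarrow> c \<in> colorings n ?m \<Longrightarrow> a \<in> {1..n} \<Longrightarrow>
       element_op n r (Suc s) y F (c(?M := a)) =
       (- 1) ^ k * (\<Sum>b\<in>{1..n}. gl_pow r ?m n k a b (\<lambda>c. F (c(?M := b))) c)" by blast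
    show ?case
    proof (intro bexI[of _ "exchange_sum r s \<otimes>\<^bsub>?R\<^esub> y"] ballI)
      fix F :: "(nat \<Rightarrow> nat) \<Rightarrow> 'k" and c a
      assume F: "F \<in> supported_on (colorings n ?M)" and c: "c \<in> colorings n ?m" and a: "a \<in> {1..n}"
      let ?F = "\<lambda>b c. F (c(?M := b))"
      have "element_op n r (Suc s) (exchange_sum r s \<otimes>\<^bsub>?R\<^esub> y) F (c(?M := a)) =
        - (\<Sum>i\<in>{1..n}. gl_op r ?m a i (\<lambda>c. element_op n r (Suc s) y F (c(?M := i))) c)"
        unfolding element_op_mult exchange_sum_op[OF c a] ..
      also have "(\<Sum>i\<in>{1..n}. gl_op r ?m a i (\<lambda>c. element_op n r (Suc s) y F (c(?M := i))) c) =
        (\<Sum>i\<in>{1..n}. gl_op r ?m a i (\<lambda>c. (- 1) ^ k * (\<Sum>b\<in>{1..n}. gl_pow r ?m n k i b (?F b) c)) c)"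
        by (intro sum.cong refl gl_op_cong[OF _ c a] IH[OF F]) auto
      also have "\<dots> = (\<Sum>i\<in>{1..n}. \<Sum>b\<in>{1..n}. (- 1) ^ k * gl_op r ?m a i (gl_pow r ?m n k i b (?F b)) c)"
        by (simp only: gl_op_scale gl_op_sum sum_distrib_left)
      also have "\<dots> = (- 1) ^ k * (\<Sum>b\<in>{1..n}. gl_pow r ?m n (Suc k) a b (?F b) c)"
        by (subst sum.swap) (simp add: sum_distrib_left)
      finally show "element_op n r (Suc s) (exchange_sum r s \<otimes>\<^bsub>?R\<^esub> y) F (c(?M := a)) =
        (- 1) ^ Suc k * (\<Sum>b\<in>{1..n}. gl_pow r ?m n (Suc k) a b (?F b) c)"
        by (simp only: power_Suc mult_1_left mult_minus_left mult.assoc)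
    qed (rule walled_brauer_mult_closed)
  qed
qed

text \<open>Closing the last strand. If its two ends are paired with each other, a free loop
  remains, whence a factor \<open>n\<close>; otherwise the colour \<open>a\<close> is forced by the
  partners of the two ends, and these partners become joined.\<close>

lemma partial_trace_diagram:
  assumes A: "A \<in> walled_diagrams r (Suc s) r (Suc s)"
  obtains w where "w \<in> carrier (walled_brauer \<delta> r s)"
    "\<And>c d. c \<in> colorings n (r + s) \<Longrightarrow> d \<in> colorings n (r + s) \<Longrightarrow>
      element_matrix r s w c d =
      (\<Sum>a\<in>{1..n}. diagram_matrix A (c(Suc (r + s) := a)) (d(Suc (r + s) := a)) :: 'k::field)"
proof -
  let ?m = "r + s" and ?M = "Suc (r + s)"
  let ?N = "North ?M" and ?S = "South ?M"
  have nodes: "nodes (r + Suc s) (r + Suc s) = insert ?N (insert ?S (nodes ?m ?m))"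
    by (simp add: nodes_def atLeastAtMostSuc_conv insert_commute)
  have notin: "?N \<notin> nodes ?m ?m" "?S \<notin> nodes ?m ?m" by (auto simp: nodes_def)
  have pairs: "\<exists>u v. P = {u, v} \<and> plus_node r r u \<and> \<not> plus_node r r v" if "P \<in> A" for P
    using A that unfolding walled_diagrams_iff by blast
  have union: "\<Union>A = insert ?N (insert ?S (nodes ?m ?m))"
    using A nodes by (simp add: walled_diagrams_iff partition_on_def)
  note uniq = walled_diagram_pair_unique[OF A]
  have blocks: "P \<inter> Q = {}" if "P \<in> A" "Q \<in> A" "P \<noteq> Q" for P Q
  proof (rule disjointD)
    show "disjoint A" using A by (simp add: walled_diagrams_iff partition_on_def)
  qed (use that in auto)
  let ?g = "\<lambda>c d a. (node_color c d)(?N := a, ?S := a)"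
  have color: "node_color (c(?M := a)) (d(?M := a)) = ?g c d a" for c d a
    unfolding node_color_upd by (simp add: fun_upd_twist)
  show ?thesis
  proof (cases "{?N, ?S} \<in> A")
    case True
    define A' where "A' = A - {{?N, ?S}}"
    have no: "y \<noteq> ?N \<and> y \<noteq> ?S \<and> z \<noteq> ?N \<and> z \<noteq> ?S" if "{y, z} \<in> A'" for y z
    proof -
      have "{y, z} \<inter> {?N, ?S} = {}"
        by (rule blocks) (use that True in \<open>auto simp: A'_def\<close>)
      thus ?thesis by blast
    qed
    have A': "A' \<in> walled_diagrams r s r s"
    proof (rule walled_diagramsI)
      show "\<Union>A' = nodes ?m ?m"
      proof (intro equalityI subsetI)
        fix u assume "u \<in> \<Union>A'"
        then obtain P where P: "P \<in> A'" "u \<in> P" by blast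
        obtain y z where yz: "P = {y, z}" using pairs[of P] P(1) unfolding A'_def by blast
        have "u \<in> \<Union>A" using P unfolding A'_def by blast
        thus "u \<in> nodes ?m ?m" using no[of y z] P yz union by auto
      next
        fix u assume u: "u \<in> nodes ?m ?m"
        then obtain P where "P \<in> A" "u \<in> P" using union by blast
        moreover have "P \<noteq> {?N, ?S}" using u notin calculation by auto
        ultimately show "u \<in> \<Union>A'" unfolding A'_def by blast
      qed
    qed (use pairs uniq in \<open>auto simp: A'_def\<close>)
    have comp: "compatible A (c(?M := a)) (d(?M := a)) \<longleftrightarrow> compatible A' c d" for c d a
    proof
      assume *: "compatible A (c(?M := a)) (d(?M := a))"
      show "compatible A' c d" unfolding compatible_def
      proof (intro allI impI)
        fix y z assume yz: "{y, z} \<in> A'"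
        hence "?g c d a y = ?g c d a z" using * unfolding compatible_def color A'_def by blast
        thus "node_color c d y = node_color c d z" using no[OF yz] by simp
      qed
    next
      assume *: "compatible A' c d"
      show "compatible A (c(?M := a)) (d(?M := a))" unfolding compatible_def color
      proof (intro allI impI)
        fix y z assume yz: "{y, z} \<in> A"
        show "?g c d a y = ?g c d a z"
        proof (cases "{y, z} = {?N, ?S}")
          case False
          hence yz': "{y, z} \<in> A'" using yz by (simp add: A'_def)
          hence "node_color c d y = node_color c d z" using * unfolding compatible_def by blast
          thus ?thesis using no[OF yz'] by simp
        qed (auto simp: doubleton_eq_iff)
      qed
    qed
    show ?thesis
    proof (rule that[of "\<lambda>B. of_nat n * unit_at A' B"])
      show "(\<lambda>B. of_nat n * unit_at A' B) \<in> carrier (walled_brauer \<delta> r s)"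
        unfolding walled_brauer_simps by (intro supported_on_scale unit_at_supported A')
      show "element_matrix r s (\<lambda>B. of_nat n * unit_at A' B) c d =
        (\<Sum>a\<in>{1..n}. diagram_matrix A (c(?M := a)) (d(?M := a)))" for c d
        by (simp add: element_matrix_scale element_matrix_unit_at[OF A'] diagram_matrix_def comp)
    qed
  next
    case False
    have plus: "\<not> plus_node r r ?N" "plus_node r r ?S" by auto
    have Nn: "?N \<in> nodes (r + Suc s) (r + Suc s)" and Sn: "?S \<in> nodes (r + Suc s) (r + Suc s)"
      unfolding nodes by auto
    obtain u where u: "{?N, u} \<in> A" "plus_node r r u" "u \<in> nodes ?m ?m"
      using walled_diagram_obtain_pair[OF A Nn] False plus unfolding nodes by (metis insertE)
    obtain v where v: "{?S, v} \<in> A" "\<not> plus_node r r v" "v \<in> nodes ?m ?m"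
      using walled_diagram_obtain_pair[OF A Sn] False plus unfolding nodes
      by (metis insertE insert_commute)
    define A0 where "A0 = A - {{?N, u}, {?S, v}}"
    define A' where "A' = insert {u, v} A0"
    have A_eq: "A = insert {?N, u} (insert {?S, v} A0)" using u v by (auto simp: A0_def)
    have no: "y \<notin> {?N, ?S, u, v} \<and> z \<notin> {?N, ?S, u, v}" if "{y, z} \<in> A0" for y z
    proof -
      have "{y, z} \<inter> {?N, u} = {}" "{y, z} \<inter> {?S, v} = {}"
        by (rule blocks; use that u v in \<open>auto simp: A0_def\<close>)+
      thus ?thesis by blast
    qed
    have A': "A' \<in> walled_diagrams r s r s"
    proof (rule walled_diagramsI)
      show "\<exists>x y. P = {x, y} \<and> plus_node r r x \<and> \<not> plus_node r r y" if "P \<in> A'" for P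
        using that pairs[of P] u v unfolding A'_def A0_def by blast
      show "\<Union>A' = nodes ?m ?m"
      proof (intro equalityI subsetI)
        fix x assume "x \<in> \<Union>A'"
        then consider "x \<in> {u, v}" | P where "P \<in> A0" "x \<in> P" unfolding A'_def by blast
        thus "x \<in> nodes ?m ?m"
        proof cases
          case (2 P)
          then obtain y z where yz: "P = {y, z}" using pairs[of P] unfolding A0_def by blast
          have "x \<in> \<Union>A" using 2 unfolding A0_def by blast
          thus ?thesis using no[of y z] 2 yz union by auto
        qed (use u v in auto)
      next
        fix x assume x: "x \<in> nodes ?m ?m"
        then obtain P where P: "P \<in> A" "x \<in> P" using union by blast
        have "x \<noteq> ?N" "x \<noteq> ?S" using x notin by auto
        thus "x \<in> \<Union>A'" using P unfolding A_eq A'_def by blast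
      qed
      fix x y z assume xyz: "{x, y} \<in> A'" "{x, z} \<in> A'"
      have in0: "{x, w} \<in> A0 \<Longrightarrow> x \<noteq> u \<and> x \<noteq> v" for w using no[of x w] by auto
      show "y = z"
      proof (cases "{x, y} \<in> A0 \<or> {x, z} \<in> A0")
        case True
        hence "x \<noteq> u" "x \<noteq> v" using in0 by auto
        hence "{x, y} \<in> A0" "{x, z} \<in> A0" using xyz unfolding A'_def by auto
        thus ?thesis using uniq unfolding A0_def by blast
      next
        case False
        hence "{x, y} = {u, v}" "{x, z} = {u, v}" using xyz unfolding A'_def by auto
        thus ?thesis by (auto simp: doubleton_eq_iff)
      qed
    qed
    have uv_ne: "u \<noteq> ?N" "u \<noteq> ?S" "v \<noteq> ?N" "v \<noteq> ?S" using u v notin by auto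
    have comp: "compatible A (c(?M := a)) (d(?M := a)) \<longleftrightarrow>
      a = node_color c d u \<and> compatible A' c d" for c d a
    proof -
      have "constant_on_pairs A0 (?g c d a) \<longleftrightarrow> constant_on_pairs A0 (node_color c d)"
        unfolding constant_on_pairs_def using no by (auto 0 3)
      thus ?thesis
        unfolding compatible_iff color A_eq A'_def constant_on_pairs_insert using uv_ne by auto
    qed
    show ?thesis
    proof (rule that[of "unit_at A'"])
      show "unit_at A' \<in> carrier (walled_brauer \<delta> r s)"
        unfolding walled_brauer_simps by (intro unit_at_supported A')
      fix c d assume cd: "c \<in> colorings n ?m" "d \<in> colorings n ?m"
      have "node_color c d u \<in> {1..n}"
        using u(3) colorings_mem[OF cd(1)] colorings_mem[OF cd(2)] by (cases u) (auto simp: nodes_def)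
      moreover have "(\<Sum>a\<in>{1..n}. diagram_matrix A (c(?M := a)) (d(?M := a)) :: 'k) =
        (\<Sum>a\<in>{1..n}. if a = node_color c d u then diagram_matrix A' c d else 0)"
        by (rule sum.cong) (auto simp: diagram_matrix_def comp)
      ultimately show "element_matrix r s (unit_at A') c d =
        (\<Sum>a\<in>{1..n}. diagram_matrix A (c(?M := a)) (d(?M := a)) :: 'k)"
        by (simp add: element_matrix_unit_at[OF A'])
    qed
  qed
qed

lemma partial_trace:
  fixes y :: "diagram \<Rightarrow> 'k::field"
  shows "\<exists>w\<in>carrier (walled_brauer \<delta> r s). \<forall>c\<in>colorings n (r + s). \<forall>d\<in>colorings n (r + s).
      element_matrix r s w c d =
      (\<Sum>a\<in>{1..n}. element_matrix r (Suc s) y (c(Suc (r + s) := a)) (d(Suc (r + s) := a)))"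
proof -
  let ?W = "walled_diagrams r (Suc s) r (Suc s)" and ?M = "Suc (r + s)"
  define Q where "Q A w \<longleftrightarrow> w \<in> carrier (walled_brauer \<delta> r s) \<and>
      (\<forall>c\<in>colorings n (r + s). \<forall>d\<in>colorings n (r + s). element_matrix r s w c d =
      (\<Sum>a\<in>{1..n}. diagram_matrix A (c(?M := a)) (d(?M := a)) :: 'k))" for A w
  have "\<forall>A\<in>?W. \<exists>w. Q A w"
  proof
    fix A assume A: "A \<in> ?W"
    show "\<exists>w. Q A w"
      by (rule partial_trace_diagram[OF A, of \<delta> n]) (auto simp: Q_def)
  qed
  from bchoice[OF this] obtain w where Q: "\<And>A. A \<in> ?W \<Longrightarrow> Q A (w A)" by blast
  have w: "\<And>A. A \<in> ?W \<Longrightarrow> w A \<in> carrier (walled_brauer \<delta> r s)"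
    "\<And>A c d. A \<in> ?W \<Longrightarrow> c \<in> colorings n (r + s) \<Longrightarrow> d \<in> colorings n (r + s) \<Longrightarrow>
      element_matrix r s (w A) c d = (\<Sum>a\<in>{1..n}. diagram_matrix A (c(?M := a)) (d(?M := a)) :: 'k)"
    using Q unfolding Q_def by blast+
  show ?thesis
  proof (intro bexI[of _ "\<lambda>B. \<Sum>A\<in>?W. y A * w A B"] ballI)
    show "(\<lambda>B. \<Sum>A\<in>?W. y A * w A B) \<in> carrier (walled_brauer \<delta> r s)"
      using w(1) by (simp add: walled_brauer_simps supported_on_def)
    fix c d assume cd: "c \<in> colorings n (r + s)" "d \<in> colorings n (r + s)"
    have "element_matrix r s (\<lambda>B. \<Sum>A\<in>?W. y A * w A B) c d =
      (\<Sum>A\<in>?W. \<Sum>a\<in>{1..n}. y A * diagram_matrix A (c(?M := a)) (d(?M := a)))"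
      unfolding element_matrix_sum element_matrix_scale
      by (intro sum.cong refl) (simp add: w(2) cd sum_distrib_left)
    also have "\<dots> = (\<Sum>a\<in>{1..n}. element_matrix r (Suc s) y (c(?M := a)) (d(?M := a)))"
      unfolding element_matrix_def by (rule sum.swap)
    finally show "element_matrix r s (\<lambda>B. \<Sum>A\<in>?W. y A * w A B) c d =
      (\<Sum>a\<in>{1..n}. element_matrix r (Suc s) y (c(?M := a)) (d(?M := a)))" .
  qed
qed

lemma gl_pow_cong:
  assumes "\<And>c. c \<in> colorings n m \<Longrightarrow> f c = g c" "c \<in> colorings n m" "a \<in> {1..n}"
  shows "gl_pow r m n k a b f c = gl_pow r m n k a b g c"
  using assms(2,3)
proof (induction k arbitrary: a c)
  case (Suc k)
  thus ?case unfolding gl_pow.simps by (intro sum.cong refl gl_op_cong) auto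
qed (simp add: assms(1))

lemma gl_pow_scale: "gl_pow r m n k a b (\<lambda>c. z * f c) c = z * gl_pow r m n k a b f c"
proof (induction k arbitrary: a c)
  case (Suc k)
  have "gl_pow r m n k i b (\<lambda>c. z * f c) = (\<lambda>c. z * gl_pow r m n k i b f c)" for i
    by (rule ext) (rule Suc.IH)
  thus ?case by (simp only: gl_pow.simps gl_op_scale sum_distrib_left)
qed simp

text \<open>The element \<open>y\<close> of the larger algebra acts as the matrix
  \<open>(-E)^k\<close> indexed by the colour of the extra strand, so its partial trace acts as the
  trace of that matrix; the scalar \<open>(- 1) ^ k\<close> removes the sign.\<close>

lemma casimir_element:
  "\<exists>z\<in>carrier (walled_brauer (of_nat n :: 'k::field) r s).
     \<forall>f\<in>supported_on (colorings n (r + s)). element_op n r s z f = casimir r (r + s) n k f"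
proof -
  let ?m = "r + s" and ?M = "Suc (r + s)"
  from exchange_power[of n r s k, where 'k = 'k]
  obtain y where "y \<in> carrier (walled_brauer (of_nat n :: 'k) r (Suc s))" and y_op: "\<forall>F\<in>supported_on (colorings n ?M). \<forall>c\<in>colorings n ?m. \<forall>a\<in>{1..n}.
       element_op n r (Suc s) y F (c(?M := a)) =
       (- 1) ^ k * (\<Sum>b\<in>{1..n}. gl_pow r ?m n k a b (\<lambda>c. F (c(?M := b))) c)"
    ..
  note y = y_op[rule_format]
  from partial_trace[of "of_nat n" r s n y]
  obtain w where w: "w \<in> carrier (walled_brauer (of_nat n :: 'k) r s)"
    and w_mat: "\<forall>c\<in>colorings n ?m. \<forall>d\<in>colorings n ?m. element_matrix r s w c d =
      (\<Sum>a\<in>{1..n}. element_matrix r (Suc s) y (c(?M := a)) (d(?M := a)))"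
    ..
  show ?thesis
  proof (intro bexI[of _ "\<lambda>A. (- 1) ^ k * w A"] ballI)
    show "(\<lambda>A. (- 1) ^ k * w A) \<in> carrier (walled_brauer (of_nat n :: 'k) r s)"
      using w unfolding walled_brauer_simps by (rule supported_on_scale)
    fix f :: "(nat \<Rightarrow> nat) \<Rightarrow> 'k" assume f: "f \<in> supported_on (colorings n ?m)"
    show "element_op n r s (\<lambda>A. (- 1) ^ k * w A) f = casimir r ?m n k f"
    proof
      fix c
      show "element_op n r s (\<lambda>A. (- 1) ^ k * w A) f c = casimir r ?m n k f c"
      proof (cases "c \<in> colorings n ?m")
        case False
        thus ?thesis using supported_on_simps(1)[OF casimir_supported[OF f] False]
          by (simp add: element_op_def matrix_op_def)
      next
        case c: True
        \<comment> \<open>\<open>F a\<close> is \<open>f\<close> on colourings whose extra strand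
          has colour \<open>a\<close>, and zero elsewhere. Applying \<open>y\<close> and evaluating
          at colour \<open>a\<close> isolates the diagonal entry \<open>(a, a)\<close>.\<close>
        define F where "F a d = (if d \<in> colorings n ?M \<and> d ?M = a then f (restrict d {1..?m}) else 0)" for a d
        have F_supp: "F a \<in> supported_on (colorings n ?M)" for a
          by (simp add: F_def supported_on_def)
        have restr: "restrict (d(?M := b)) {1..?m} = d" if "d \<in> colorings n ?m" for d b
          using that by (auto simp: colorings_def PiE_def extensional_def restrict_def)
        have F_ext: "F a (d(?M := b)) = of_bool (a = b) * f d" if "d \<in> colorings n ?m" "b \<in> {1..n}" for a b d
          using that colorings_extend[OF that] restr[OF that(1)] by (simp add: F_def)
        have trace_a: "(\<Sum>d\<in>colorings n ?m. element_matrix r (Suc s) y (c(?M := a)) (d(?M := a)) * f d) =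
          (- 1) ^ k * gl_pow r ?m n k a a f c" if a: "a \<in> {1..n}" for a
        proof -
          have inj: "inj_on (\<lambda>d. d(?M := a)) (colorings n ?m)"
            by (rule inj_onI) (metis restr)
          have "(\<Sum>d\<in>colorings n ?m. element_matrix r (Suc s) y (c(?M := a)) (d(?M := a)) * f d) =
            (\<Sum>d\<in>colorings n ?m. element_matrix r (Suc s) y (c(?M := a)) (d(?M := a)) * F a (d(?M := a)))"
            using F_ext[OF _ a] by (intro sum.cong) simp_all
          also have "\<dots> = (\<Sum>d\<in>(\<lambda>d. d(?M := a)) ` colorings n ?m.
              element_matrix r (Suc s) y (c(?M := a)) d * F a d)"
            by (simp add: sum.reindex[OF inj])
          also have "\<dots> = (\<Sum>d\<in>colorings n ?M. element_matrix r (Suc s) y (c(?M := a)) d * F a d)"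
          proof (rule sum.mono_neutral_left)
            show "(\<lambda>d. d(?M := a)) ` colorings n ?m \<subseteq> colorings n ?M"
              using colorings_extend a by blast
            show "\<forall>d\<in>colorings n ?M - (\<lambda>d. d(?M := a)) ` colorings n ?m.
              element_matrix r (Suc s) y (c(?M := a)) d * F a d = 0"
            proof
              fix d assume d: "d \<in> colorings n ?M - (\<lambda>d. d(?M := a)) ` colorings n ?m"
              have "d ?M \<noteq> a"
              proof
                assume "d ?M = a"
                hence "d = (restrict d {1..?m})(?M := a)" "restrict d {1..?m} \<in> colorings n ?m"
                  using colorings_restrict[of d n ?m] d by auto
                thus False using d by blast
              qed
              thus "element_matrix r (Suc s) y (c(?M := a)) d * F a d = 0" by (simp add: F_def)
            qed
          qed simp
          also have "\<dots> = element_op n r (Suc s) y (F a) (c(?M := a))"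
            using colorings_extend[OF c a] by (simp add: element_op_def matrix_op_def)
          also have "\<dots> = (- 1) ^ k * (\<Sum>b\<in>{1..n}. gl_pow r ?m n k a b (\<lambda>c. F a (c(?M := b))) c)"
            by (rule y[OF F_supp c a])
          also have "(\<Sum>b\<in>{1..n}. gl_pow r ?m n k a b (\<lambda>c. F a (c(?M := b))) c) =
            (\<Sum>b\<in>{1..n}. if b = a then gl_pow r ?m n k a b f c else 0)"
          proof (rule sum.cong[OF refl])
            fix b assume b: "b \<in> {1..n}"
            have "gl_pow r ?m n k a b (\<lambda>c. F a (c(?M := b))) c =
              gl_pow r ?m n k a b (\<lambda>c. of_bool (a = b) * f c) c"
              by (rule gl_pow_cong[OF _ c a]) (rule F_ext[OF _ b])
            thus "gl_pow r ?m n k a b (\<lambda>c. F a (c(?M := b))) c =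
              (if b = a then gl_pow r ?m n k a b f c else 0)"
              unfolding gl_pow_scale by simp
          qed
          also have "\<dots> = gl_pow r ?m n k a a f c" using a by simp
          finally show ?thesis .
        qed
        have "element_op n r s (\<lambda>A. (- 1) ^ k * w A) f c =
          (- 1) ^ k * (\<Sum>d\<in>colorings n ?m. \<Sum>a\<in>{1..n}.
            element_matrix r (Suc s) y (c(?M := a)) (d(?M := a)) * f d)"
          using c by (simp add: element_op_def matrix_op_def element_matrix_scale w_mat
              sum_distrib_left sum_distrib_right mult.assoc)
        also have "\<dots> = (- 1) ^ k * (\<Sum>a\<in>{1..n}. (- 1) ^ k * gl_pow r ?m n k a a f c)"
          by (subst sum.swap) (simp add: trace_a)
        also have "\<dots> = ((- 1) ^ k * (- 1) ^ k) * casimir r ?m n k f c"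
          by (simp add: casimir_def sum_distrib_left mult.assoc)
        also have "(- 1) ^ k * (- 1) ^ k = (1 :: 'k)"
          by (simp flip: power_mult_distrib)
        finally show ?thesis by simp
      qed
    qed
  qed
qed

section \<open>Highest weight vectors\<close>

lemma gl_op_add: "gl_op r m a b (\<lambda>c. f c + g c) c = gl_op r m a b f c + gl_op r m a b g c"
  unfolding gl_op_def sum.distrib[symmetric] by (rule sum.cong) (auto simp: gl_at_def algebra_simps)

lemma gl_op_zero: "gl_op r m a b (\<lambda>c. 0) c = 0"
  unfolding gl_op_def by (rule sum.neutral) (simp add: gl_at_def)

lemma gl_pow_zero: "gl_pow r m n k a b (\<lambda>c. 0) c = 0"
  using gl_pow_scale[of r m n k a b 0 "\<lambda>c. 0" c] by simp

text \<open>Under commutators the entries of \<open>E^k\<close> transform like those of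
  \<open>E\<close> itself. In the induction, the two terms in which \<open>E i b\<close> is applied
  to entry \<open>(a, j)\<close> of the lower power cancel.\<close>

lemma gl_op_gl_pow_commutator:
  assumes "a \<in> {1..n}" "b \<in> {1..n}" "i \<in> {1..n}"
  shows "gl_op r m a b (gl_pow r m n k i j f) c = gl_pow r m n k i j (gl_op r m a b f) c +
    of_bool (b = i) * gl_pow r m n k a j f c - of_bool (a = j) * gl_pow r m n k i b f c"
  using assms(3)
proof (induction k arbitrary: i c)
  case 0
  show ?case by (simp only: gl_pow.simps gl_op_scale) auto
next
  case (Suc k)
  let ?E = "gl_op r m" and ?P = "gl_pow r m n k"
  have IH: "?E a b (?P l j f) =
    (\<lambda>c. ?P l j (?E a b f) c + of_bool (b = l) * ?P a j f c - of_bool (a = j) * ?P l b f c)"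
    if "l \<in> {1..n}" for l
    by (rule ext) (rule Suc.IH[OF that])
  have E_IH: "?E i l (?E a b (?P l j f)) c = ?E i l (?P l j (?E a b f)) c +
      of_bool (b = l) * ?E i l (?P a j f) c - of_bool (a = j) * ?E i l (?P l b f) c"
    if "l \<in> {1..n}" for l
    unfolding IH[OF that] gl_op_diff gl_op_add gl_op_scale ..
  have pick: "(\<Sum>l\<in>{1..n}. of_bool (x = l) * g l) = (g x :: 'a)" if "x \<in> {1..n}" for x and g :: "nat \<Rightarrow> 'a"
  proof -
    have "(\<Sum>l\<in>{1..n}. of_bool (x = l) * g l) = (\<Sum>l\<in>{1..n}. if l = x then g l else 0)"
      by (rule sum.cong) auto
    thus ?thesis using that by simp
  qed
  have "?E a b (gl_pow r m n (Suc k) i j f) c = (\<Sum>l\<in>{1..n}. ?E a b (?E i l (?P l j f)) c)"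
    by (simp only: gl_pow.simps gl_op_sum)
  also have "\<dots> = (\<Sum>l\<in>{1..n}. ?E i l (?E a b (?P l j f)) c + of_bool (b = i) * ?E a l (?P l j f) c
      - of_bool (a = l) * ?E i b (?P l j f) c)"
    by (simp only: gl_op_commutator[of r m a b])
  also have "\<dots> = (\<Sum>l\<in>{1..n}. (?E i l (?P l j (?E a b f)) c + of_bool (b = l) * ?E i l (?P a j f) c
      - of_bool (a = j) * ?E i l (?P l b f) c) + of_bool (b = i) * ?E a l (?P l j f) c
      - of_bool (a = l) * ?E i b (?P l j f) c)"
    by (intro sum.cong refl) (simp only: E_IH)
  also have "\<dots> = (\<Sum>l\<in>{1..n}. ?E i l (?P l j (?E a b f)) c) + ?E i b (?P a j f) c
      - of_bool (a = j) * (\<Sum>l\<in>{1..n}. ?E i l (?P l b f) c)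
      + of_bool (b = i) * (\<Sum>l\<in>{1..n}. ?E a l (?P l j f) c) - ?E i b (?P a j f) c"
    by (simp only: sum.distrib sum_subtractf sum_distrib_left[symmetric] pick[OF assms(1)] pick[OF assms(2)])
  also have "\<dots> = gl_pow r m n (Suc k) i j (?E a b f) c +
    of_bool (b = i) * gl_pow r m n (Suc k) a j f c - of_bool (a = j) * gl_pow r m n (Suc k) i b f c"
    by (simp only: gl_pow.simps algebra_simps)
  finally show ?case .
qed

text \<open>The weight takes values in the ground ring, so in characteristic \<open>p\<close> only
  the residues of an integral weight are seen.\<close>

definition highest_weight_vector ::
  "nat \<Rightarrow> nat \<Rightarrow> nat \<Rightarrow> (nat \<Rightarrow> 'k::comm_ring_1) \<Rightarrow> ((nat \<Rightarrow> nat) \<Rightarrow> 'k) \<Rightarrow> bool" where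
  "highest_weight_vector r m n w f \<longleftrightarrow>
     (\<forall>a\<in>{1..n}. \<forall>b\<in>{1..n}. a < b \<longrightarrow> gl_op r m a b f = (\<lambda>c. 0)) \<and>
     (\<forall>a\<in>{1..n}. gl_op r m a a f = (\<lambda>c. w a * f c))"

text \<open>The diagonal entries of \<open>E\<^bsup>k\<^esup>\<close> act on a highest weight vector by these scalars.\<close>

primrec diagonal_scalar :: "nat \<Rightarrow> (nat \<Rightarrow> 'k::comm_ring_1) \<Rightarrow> nat \<Rightarrow> nat \<Rightarrow> 'k" where
  "diagonal_scalar n w 0 i = 1"
| "diagonal_scalar n w (Suc k) i = (w i + of_nat (n - i)) * diagonal_scalar n w k i -
     (\<Sum>a\<in>{Suc i..n}. diagonal_scalar n w k a)"

text \<open>When \<open>E a b\<close> is applied to entry \<open>(b, i)\<close> of a power and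
  \<open>a < b\<close>, the commutator leaves entry \<open>(a, i)\<close> of the same power, as
  \<open>E a b\<close> kills \<open>f\<close>; for \<open>b \<le> a\<close> the entry
  \<open>(b, i)\<close> is itself above the diagonal. Both vanish by induction.\<close>

lemma gl_pow_highest_weight_upper:
  assumes hw: "highest_weight_vector r m n w f" and "a < i" "i \<in> {1..n}" "a \<in> {1..n}"
  shows "gl_pow r m n k a i f = (\<lambda>c. 0)"
  using assms(2,4)
proof (induction k arbitrary: a)
  case (Suc k)
  have "gl_op r m a b (gl_pow r m n k b i f) c = 0" if b: "b \<in> {1..n}" for b c
  proof (cases "a < b")
    case True
    have "gl_op r m a b f = (\<lambda>c. 0)" using hw True b Suc.prems by (simp add: highest_weight_vector_def)
    thus ?thesis using gl_op_gl_pow_commutator[OF Suc.prems(2) b b, of r m k i f c] Suc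
      by (simp add: gl_pow_zero)
  next
    case False
    hence "gl_pow r m n k b i f = (\<lambda>c. 0)" using Suc b by simp
    thus ?thesis by (simp add: gl_op_zero)
  qed
  thus ?case by simp
qed auto

text \<open>Expand entry \<open>(i, i)\<close> of \<open>E * E^k\<close> over the middle index
  \<open>b\<close>. Terms with \<open>b < i\<close> contain an entry above the diagonal and vanish,
  \<open>b = i\<close> gives the weight, and \<open>b > i\<close> gives the difference of the
  diagonal entries \<open>i\<close> and \<open>b\<close> by the commutator. There are
  \<open>n - i\<close> of the last kind, which explains the recursion of
  \<open>diagonal_scalar\<close>.\<close>

lemma gl_pow_highest_weight_diagonal:
  assumes hw: "highest_weight_vector r m n w f" and "i \<in> {1..n}"
  shows "gl_pow r m n k i i f = (\<lambda>c. diagonal_scalar n w k i * f c)"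
  using assms(2)
proof (induction k arbitrary: i)
  case (Suc k)
  let ?x = "diagonal_scalar n w k"
  show ?case
  proof
    fix c
    have term_b: "gl_op r m i b (gl_pow r m n k b i f) c =
      (if b = i then ?x i * w i * f c else if i < b then (?x i - ?x b) * f c else 0)"
      if b: "b \<in> {1..n}" for b
    proof -
      consider "b < i" | "b = i" | "i < b" by linarith
      thus ?thesis
      proof cases
        case 1
        thus ?thesis using gl_pow_highest_weight_upper[OF hw 1 Suc.prems b] by (simp add: gl_op_zero)
      next
        case 2
        have "gl_op r m i i f = (\<lambda>c. w i * f c)"
          using hw Suc.prems by (simp add: highest_weight_vector_def)
        thus ?thesis using 2 Suc.IH[OF Suc.prems] by (simp add: gl_op_scale mult.assoc)
      next
        case 3
        have "gl_op r m i b f = (\<lambda>c. 0)" using hw 3 b Suc.prems by (simp add: highest_weight_vector_def)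
        thus ?thesis using 3 gl_op_gl_pow_commutator[OF Suc.prems b b, of r m k i f c]
            Suc.IH[OF Suc.prems] Suc.IH[OF b]
          by (simp add: gl_pow_zero left_diff_distrib)
      qed
    qed
    have "gl_pow r m n (Suc k) i i f c = (\<Sum>b\<in>{1..n}. if b = i then ?x i * w i * f c
        else if i < b then (?x i - ?x b) * f c else 0)"
      by (simp only: gl_pow.simps) (intro sum.cong refl term_b)
    also have "\<dots> = ?x i * w i * f c + (\<Sum>b\<in>{1..n} - {i}. if i < b then (?x i - ?x b) * f c else 0)"
      using Suc.prems by (subst sum.remove[of _ i]) auto
    also have "(\<Sum>b\<in>{1..n} - {i}. if i < b then (?x i - ?x b) * f c else 0) =
      (\<Sum>b\<in>{Suc i..n}. (?x i - ?x b) * f c)"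
      by (rule sum.mono_neutral_cong_right) (use Suc.prems in auto)
    also have "\<dots> = (of_nat (n - i) * ?x i - (\<Sum>b\<in>{Suc i..n}. ?x b)) * f c"
      by (simp add: sum_distrib_right[symmetric] sum_subtractf)
    finally show "gl_pow r m n (Suc k) i i f c = diagonal_scalar n w (Suc k) i * f c"
      by (simp add: algebra_simps)
  qed
qed simp

lemma casimir_highest_weight:
  assumes "highest_weight_vector r m n w f"
  shows "casimir r m n k f = (\<lambda>c. (\<Sum>i\<in>{1..n}. diagonal_scalar n w k i) * f c)"
  by (rule ext) (simp add: casimir_def gl_pow_highest_weight_diagonal[OF assms] sum_distrib_right)

text \<open>
  With \<open>l\<^sub>i = w\<^sub>i + n - i\<close>, the generating function of the scalars is
  \<open>1 - X * (\<Sum>k. \<chi>\<^sub>k * X^k) = (\<Prod>i. (1 - (l\<^sub>i + 1) * X) / (1 - l\<^sub>i * X))\<close> (Perelomov and Popov).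
\<close>

lemma diagonal_scalar_generating_function:
  fixes w :: "nat \<Rightarrow> 'k::comm_ring_1" and n :: nat
  defines "l \<equiv> \<lambda>i. w i + of_nat (n - i)"
  shows "(\<Prod>i\<in>{1..n}. 1 - fps_const (l i) * fps_X) *
       (1 - fps_X * Abs_fps (\<lambda>k. \<Sum>i\<in>{1..n}. diagonal_scalar n w k i)) =
     (\<Prod>i\<in>{1..n}. 1 - fps_const (l i + 1) * fps_X)"
proof -
  define y :: "nat \<Rightarrow> 'k fps" where "y i = Abs_fps (\<lambda>k. diagonal_scalar n w k i)" for i
  \<comment> \<open>The tails interpolate between \<open>T (n + 1) = 1\<close> and the series of the
    claim, \<open>T 1\<close>. Consecutive tails differ by one linear factor in the numerator and
    one in the denominator, so the product telescopes.\<close>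
  define T :: "nat \<Rightarrow> 'k fps" where "T j = 1 - fps_X * (\<Sum>a\<in>{j..n}. y a)" for j
  have y: "y i = 1 + fps_X * (fps_const (l i) * y i - (\<Sum>a\<in>{Suc i..n}. y a))" for i
  proof (rule fps_ext)
    fix k
    show "fps_nth (y i) k = fps_nth (1 + fps_X * (fps_const (l i) * y i - (\<Sum>a\<in>{Suc i..n}. y a))) k"
      by (cases k) (simp_all add: y_def l_def fps_sum_nth)
  qed
  have T: "(1 - fps_const (l i) * fps_X) * T i = (1 - fps_const (l i + 1) * fps_X) * T (Suc i)"
    if "i \<le> n" for i
  proof -
    have split: "{i..n} = insert i {Suc i..n}" using that by auto
    have "T i = T (Suc i) - fps_X * y i" by (simp add: T_def split algebra_simps)
    moreover have "(1 - fps_const (l i) * fps_X) * y i = T (Suc i)"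
      using y[of i] by (simp add: T_def algebra_simps)
    ultimately have "(1 - fps_const (l i) * fps_X) * T i =
      (1 - fps_const (l i) * fps_X) * T (Suc i) - fps_X * T (Suc i)"
      by (metis (no_types, lifting) mult.left_commute right_diff_distrib)
    also have "\<dots> = (1 - fps_const (l i + 1) * fps_X) * T (Suc i)"
      by (simp add: algebra_simps flip: fps_const_add)
    finally show ?thesis .
  qed
  have "(\<Prod>i\<in>{j..n}. 1 - fps_const (l i) * fps_X) * T j = (\<Prod>i\<in>{j..n}. 1 - fps_const (l i + 1) * fps_X)"
    if "j \<le> Suc n" for j
    using that
  proof (induction j rule: inc_induct)
    case base
    show ?case by (simp add: T_def)
  next
    case (step j)
    have split: "{j..n} = insert j {Suc j..n}" using step by auto
    have Tj: "(1 - fps_const (l j) * fps_X) * T j = (1 - fps_const (l j + 1) * fps_X) * T (Suc j)"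
      by (rule T) (use step in simp)
    have "(\<Prod>i\<in>{j..n}. 1 - fps_const (l i) * fps_X) * T j =
      (\<Prod>i\<in>{Suc j..n}. 1 - fps_const (l i) * fps_X) * ((1 - fps_const (l j) * fps_X) * T j)"
      unfolding split by (simp add: mult_ac)
    also have "\<dots> = (1 - fps_const (l j + 1) * fps_X) *
      ((\<Prod>i\<in>{Suc j..n}. 1 - fps_const (l i) * fps_X) * T (Suc j))"
      unfolding Tj by (simp only: mult_ac)
    also have "\<dots> = (\<Prod>i\<in>{j..n}. 1 - fps_const (l i + 1) * fps_X)"
      unfolding split by (simp add: step.IH)
    finally show ?case .
  qed
  from this[of 1] have "(\<Prod>i\<in>{1..n}. 1 - fps_const (l i) * fps_X) * T 1 =
     (\<Prod>i\<in>{1..n}. 1 - fps_const (l i + 1) * fps_X)" by simp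
  moreover have "(\<Sum>a\<in>{1..n}. y a) = Abs_fps (\<lambda>k. \<Sum>i\<in>{1..n}. diagonal_scalar n w k i)"
    by (rule fps_ext) (simp add: y_def fps_sum_nth)
  ultimately show ?thesis by (simp add: T_def)
qed

text \<open>The linear factors are reversed, \<open>1 - l X\<close> instead of \<open>X - l\<close>,
  as they come from a generating function. A value \<open>l\<close> shows up as the root
  \<open>inverse l\<close>, while \<open>l = 0\<close> leaves no trace; hence \<open>z\<close> is
  nonzero.\<close>

lemma order_prod_linear:
  fixes l :: "'i \<Rightarrow> 'k::field"
  assumes "finite I" "z \<noteq> 0"
  shows "order (inverse z) (\<Prod>i\<in>I. [:1, - l i:]) = card {i \<in> I. l i = z}"
  using assms(1)
proof (induction I rule: finite_induct)
  case (insert x I)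
  have "order (inverse z) [:1, - l x:] = of_bool (l x = z)"
  proof (cases "l x = z")
    case True
    have "[:1, - z:] = smult (- z) [:- inverse z, 1:]" using assms(2) by simp
    hence "order (inverse z) [:1, - z:] = order (inverse z) [:- inverse z, 1:]"
      using assms(2) by (metis neg_equal_0_iff_equal order_smult)
    also have "\<dots> = 1" using order_power_n_n[of "inverse z" 1] by simp
    finally show ?thesis using True by simp
  next
    case False
    hence "poly [:1, - l x:] (inverse z) \<noteq> 0" using assms(2) by (simp add: field_simps)
    thus ?thesis using False by (simp add: order_0I)
  qed
  moreover have "{i \<in> insert x I. l i = z} =
    (if l x = z then insert x {i \<in> I. l i = z} else {i \<in> I. l i = z})" by auto
  moreover have "[:1, - l x:] * (\<Prod>i\<in>I. [:1, - l i:]) \<noteq> 0" 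
    using insert.hyps by (simp only: mult_eq_0_iff) (simp add: prod_zero_iff)
  ultimately show ?case using insert.hyps insert.IH
    by (simp del: mult_pCons_left add: order_mult)
qed simp

text \<open>The scalars determine the quotient of the products of \<open>1 - (l i + 1) X\<close> and
  of \<open>1 - l i X\<close>. Comparing the multiplicities of roots, \<open>N z - N' z\<close> does
  not change from \<open>z - 1\<close> to \<open>z\<close> as long as \<open>z\<close> is nonzero,
  so it is constant on the prime field. Both multiplicities add up to \<open>n\<close> there, so the
  constant is zero.\<close>

lemma scalars_determine_residues:
  fixes L L' :: "nat \<Rightarrow> int"
  assumes p: "CHAR('k::field) = p" "p > 0"
    and w: "\<And>i. i \<in> {1..n} \<Longrightarrow> w i + of_nat (n - i) = (of_int (L i) :: 'k)"
    and w': "\<And>i. i \<in> {1..n} \<Longrightarrow> w' i + of_nat (n - i) = (of_int (L' i) :: 'k)"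
    and eq: "\<And>k. (\<Sum>i\<in>{1..n}. diagonal_scalar n w k i) = (\<Sum>i\<in>{1..n}. diagonal_scalar n w' k i)"
  shows "card {i \<in> {1..n}. L i mod int p = j mod int p} = card {i \<in> {1..n}. L' i mod int p = j mod int p}"
proof -
  let ?I = "{1..n}"
  define l where "l i = (of_int (L i) :: 'k)" for i
  define l' where "l' i = (of_int (L' i) :: 'k)" for i
  let ?F = "\<lambda>l :: nat \<Rightarrow> 'k. \<Prod>i\<in>?I. [:1, - l i:]"
  have lin: "fps_of_poly [:1, - a:] = 1 - fps_const a * fps_X" for a :: 'k
    using fps_of_poly_linear'[of "- a"] by (simp flip: fps_const_neg)
  have F: "fps_of_poly (?F l) = (\<Prod>i\<in>?I. 1 - fps_const (l i) * fps_X)" for l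
    by (simp add: fps_of_poly_prod lin)
  let ?T = "1 - fps_X * Abs_fps (\<lambda>k. \<Sum>i\<in>?I. diagonal_scalar n w k i)"
  have gen: "fps_of_poly (?F (\<lambda>i. of_int (M i))) *
      (1 - fps_X * Abs_fps (\<lambda>k. \<Sum>i\<in>?I. diagonal_scalar n v k i)) =
      fps_of_poly (?F (\<lambda>i. of_int (M i) + 1))"
    if v: "\<And>i. i \<in> ?I \<Longrightarrow> v i + of_nat (n - i) = (of_int (M i) :: 'k)" for v M
  proof -
    have "(\<Prod>i\<in>?I. 1 - fps_const (v i + of_nat (n - i)) * fps_X) =
      (\<Prod>i\<in>?I. 1 - fps_const (of_int (M i) :: 'k) * fps_X)"
      "(\<Prod>i\<in>?I. 1 - fps_const (v i + of_nat (n - i) + 1) * fps_X) =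
      (\<Prod>i\<in>?I. 1 - fps_const (of_int (M i) + 1 :: 'k) * fps_X)"
      by (intro prod.cong refl; simp only: v)+
    thus ?thesis using diagonal_scalar_generating_function[of v n] unfolding F by simp
  qed
  have e: "fps_of_poly (?F l) * ?T = fps_of_poly (?F (\<lambda>i. l i + 1))"
    unfolding l_def by (rule gen) (rule w)
  have e': "fps_of_poly (?F l') * ?T = fps_of_poly (?F (\<lambda>i. l' i + 1))"
    unfolding l'_def eq by (rule gen) (rule w')
  have "fps_of_poly (?F l * ?F (\<lambda>i. l' i + 1)) = fps_of_poly (?F l' * ?F (\<lambda>i. l i + 1))"
    unfolding fps_of_poly_mult e[symmetric] e'[symmetric] by (simp only: mult_ac)
  hence poly_eq: "?F l * ?F (\<lambda>i. l' i + 1) = ?F l' * ?F (\<lambda>i. l i + 1)"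
    by (simp only: fps_of_poly_eq_iff)
  define N where "N z = card {i \<in> ?I. l i = z}" for z
  define N' where "N' z = card {i \<in> ?I. l' i = z}" for z
  have nonzero: "?F l \<noteq> 0" for l by (simp add: prod_zero_iff)
  have shift: "{i \<in> ?I. l i + 1 = z} = {i \<in> ?I. l i = z - 1}" for z and l :: "nat \<Rightarrow> 'k" by (auto simp: algebra_simps)
  have N_eq: "N z + N' (z - 1) = N' z + N (z - 1)" if "z \<noteq> 0" for z
  proof -
    have mult: "order (inverse z) (?F f * ?F g) = order (inverse z) (?F f) + order (inverse z) (?F g)" for f g
      by (rule order_mult) (rule no_zero_divisors[OF nonzero nonzero])
    show ?thesis
      using arg_cong[OF poly_eq, of "order (inverse z)"]
      unfolding mult order_prod_linear[OF finite_atLeastAtMost that] shift N_def N'_def .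
  qed
  have const: "int (N (of_nat j)) - int (N' (of_nat j)) = int (N 0) - int (N' 0)" if "j < p" for j
    using that
  proof (induction j)
    case (Suc j)
    have "(of_nat (Suc j) :: 'k) \<noteq> 0"
      using Suc.prems p of_nat_eq_0_iff_char_dvd[of "Suc j", where 'a = 'k] by (auto dest: dvd_imp_le)
    from N_eq[OF this] show ?case using Suc by simp
  qed simp
  have cong: "of_int a = (of_int b :: 'k) \<longleftrightarrow> a mod int p = b mod int p" for a b
    using of_int_eq_0_iff_char_dvd[of "a - b", where 'a = 'k] p by (simp add: mod_eq_dvd_iff)
  have total: "(\<Sum>j<p. card {i \<in> ?I. (of_int (M i) :: 'k) = of_nat j}) = n" for M :: "nat \<Rightarrow> int"
  proof -
    have "card (\<Union>j\<in>{..<p}. {i \<in> ?I. (of_int (M i) :: 'k) = of_nat j}) =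
      (\<Sum>j<p. card {i \<in> ?I. (of_int (M i) :: 'k) = of_nat j})"
    proof (rule card_UN_disjoint)
      show "\<forall>i\<in>{..<p}. \<forall>j\<in>{..<p}. i \<noteq> j \<longrightarrow>
        {x \<in> ?I. (of_int (M x) :: 'k) = of_nat i} \<inter> {x \<in> ?I. of_int (M x) = (of_nat j :: 'k)} = {}"
      proof (intro ballI impI)
        fix i j assume "i \<in> {..<p}" "j \<in> {..<p}" "i \<noteq> j"
        hence "(of_int (int i) :: 'k) \<noteq> of_int (int j)" unfolding cong by simp
        thus "{x \<in> ?I. (of_int (M x) :: 'k) = of_nat i} \<inter> {x \<in> ?I. of_int (M x) = (of_nat j :: 'k)} = {}"
          by auto
      qed
    qed auto
    moreover have "(\<Union>j\<in>{..<p}. {i \<in> ?I. (of_int (M i) :: 'k) = of_nat j}) = ?I"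
    proof -
      have "\<exists>j\<in>{..<p}. (of_int (M i) :: 'k) = of_nat j" for i
      proof (rule bexI)
        show "nat (M i mod int p) \<in> {..<p}" using p(2) by (simp add: nat_less_iff)
        have "(of_int (M i) :: 'k) = of_int (M i mod int p)" unfolding cong by simp
        thus "(of_int (M i) :: 'k) = of_nat (nat (M i mod int p))" using p(2) by simp
      qed
      thus ?thesis by auto
    qed
    ultimately show ?thesis by simp
  qed
  have "int p * (int (N 0) - int (N' 0)) = (\<Sum>j<p. int (N (of_nat j)) - int (N' (of_nat j)))"
    by (simp add: const)
  also have "\<dots> = int (\<Sum>j<p. N (of_nat j)) - int (\<Sum>j<p. N' (of_nat j))"
    by (simp add: sum_subtractf)
  also have "\<dots> = 0" using total[of L] total[of L'] by (simp add: N_def N'_def l_def l'_def)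
  finally have N0: "int (N 0) = int (N' 0)" using p(2) by simp
  define j' where "j' = nat (j mod int p)"
  have j': "j' < p" "int j' = j mod int p" using p(2) by (simp_all add: j'_def nat_less_iff)
  have "of_int a = (of_nat j' :: 'k) \<longleftrightarrow> a mod int p = j mod int p" for a
  proof -
    have "(of_nat j' :: 'k) = of_int (int j')" by simp
    thus ?thesis unfolding cong using j'(2) by (metis cong mod_mod_trivial)
  qed
  thus ?thesis using const[OF j'(1)] N0 by (simp add: N_def N'_def l_def l'_def)
qed

section \<open>Specht modules consist of highest weight vectors\<close>

interpretation function_space: vector_space "\<lambda>(z :: 'k::field) f (x :: 'x). z * f x"
  by unfold_locales (auto simp: fun_eq_iff algebra_simps)

lemma fun_span_eq: "fun_span S = function_space.span S"
  by (simp add: fun_span_def)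

text \<open>Reads a word as a tabloid by taking its letters as row numbers. Tabloids of a given
  shape are the words of that content, so a Specht module sits inside a weight space of tensor
  space.\<close>

definition row_sets :: "nat \<Rightarrow> (nat \<Rightarrow> nat) \<Rightarrow> tabloid" where
  "row_sets a e = (\<lambda>i. {x \<in> {1..a}. e x = i})"

lemma row_sets_cong: "(\<And>x. x \<in> {1..a} \<Longrightarrow> e x = e' x) \<Longrightarrow> row_sets a e = row_sets a e'"
  by (auto simp: row_sets_def)

lemma young_diagram_eq: "young_diagram l = (SIGMA i:{1..length l}. {1..part l i})"
  by (auto simp: young_diagram_def part_def split: if_splits)

lemma finite_young_diagram [simp]: "finite (young_diagram l)"
  by (simp add: young_diagram_eq)

lemma card_young_diagram: "card (young_diagram l) = sum_list l"
proof -
  have "card (young_diagram l) = (\<Sum>i\<in>{1..length l}. part l i)"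
    by (simp add: young_diagram_eq)
  also have "\<dots> = (\<Sum>i<length l. l ! i)"
    by (rule sum.reindex_bij_witness[of _ Suc "\<lambda>i. i - 1"]) (auto simp: part_def)
  finally show ?thesis by (simp add: sum_list_sum_nth atLeast0LessThan)
qed

lemma part_antimono:
  assumes "l \<in> partitions a" "1 \<le> i" "i \<le> j"
  shows "part l j \<le> part l i"
proof -
  have "sorted_wrt (\<ge>) l" using assms by (simp add: partitions_def)
  hence "l ! j' \<le> l ! i'" if "i' \<le> j'" "j' < length l" for i' j'
    using that sorted_wrt_nth_less[of "(\<ge>)" l i' j'] by (cases "i' = j'") auto
  thus ?thesis using assms by (auto simp: part_def)
qed

lemma tableau_exists: "\<exists>t. tableau l t"
  unfolding tableau_def using finite_same_card_bij[of "young_diagram l" "{1..sum_list l}"]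
  by (simp add: card_young_diagram)

lemma tabloid_eq_row_sets_iff:
  assumes "tableau l t"
  shows "row_sets (sum_list l) e = tabloid_of l t \<longleftrightarrow> (\<forall>q\<in>young_diagram l. e (t q) = fst q)"
proof -
  have bij: "inj_on t (young_diagram l)" "t ` young_diagram l = {1..sum_list l}"
    using assms by (auto simp: tableau_def bij_betw_def)
  show ?thesis
  proof
    assume eq: "row_sets (sum_list l) e = tabloid_of l t"
    show "\<forall>q\<in>young_diagram l. e (t q) = fst q"
    proof
      fix q assume q: "q \<in> young_diagram l"
      obtain i j where ij: "q = (i, j)" by (cases q)
      have "t (i, j) \<in> tabloid_of l t i" using q ij by (auto simp: tabloid_of_def)
      hence "t (i, j) \<in> row_sets (sum_list l) e i" using eq by simp
      thus "e (t q) = fst q" using ij by (simp add: row_sets_def)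
    qed
  next
    assume *: "\<forall>q\<in>young_diagram l. e (t q) = fst q"
    show "row_sets (sum_list l) e = tabloid_of l t"
    proof (rule ext, intro equalityI subsetI)
      fix i x assume x: "x \<in> row_sets (sum_list l) e i"
      hence "x \<in> t ` young_diagram l" unfolding bij(2) by (simp add: row_sets_def)
      then obtain q where q: "q \<in> young_diagram l" "x = t q" by auto
      hence "fst q = i" using * x by (auto simp: row_sets_def)
      thus "x \<in> tabloid_of l t i" using q by (cases q) (auto simp: tabloid_of_def)
    next
      fix i x assume "x \<in> tabloid_of l t i"
      then obtain j where j: "x = t (i, j)" "(i, j) \<in> young_diagram l" by (auto simp: tabloid_of_def)
      hence "x \<in> {1..sum_list l}" using bij(2) by blast
      moreover have "e x = i" using * j by fastforce
      ultimately show "x \<in> row_sets (sum_list l) e i" by (simp add: row_sets_def)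
    qed
  qed
qed

lemma tableau_permutes:
  assumes "tableau l t" "\<sigma> permutes {1..sum_list l}"
  shows "tableau l (\<sigma> \<circ> t)"
  using assms unfolding tableau_def by (meson bij_betw_trans permutes_imp_bij)

lemma finite_column_stabilizer [simp]: "finite (column_stabilizer l t)"
  by (rule finite_subset[OF _ finite_permutations[of "{1..sum_list l}"]]) (auto simp: column_stabilizer_def)

lemma polytabloid_row_sets:
  assumes "tableau l t"
  shows "polytabloid l t (row_sets (sum_list l) e) = (\<Sum>\<sigma>\<in>column_stabilizer l t.
     of_int (sign \<sigma>) * of_bool (\<forall>q\<in>young_diagram l. e (\<sigma> (t q)) = fst q))"
  unfolding polytabloid_def
proof (rule sum.cong[OF refl])
  fix \<sigma> assume "\<sigma> \<in> column_stabilizer l t"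
  hence "tableau l (\<sigma> \<circ> t)" using assms by (auto simp: column_stabilizer_def intro: tableau_permutes)
  from tabloid_eq_row_sets_iff[OF this, of e]
  show "of_int (sign \<sigma>) * unit_at (tabloid_of l (\<sigma> \<circ> t)) (row_sets (sum_list l) e) =
    of_int (sign \<sigma>) * of_bool (\<forall>q\<in>young_diagram l. e (\<sigma> (t q)) = fst q)"
    by (simp add: unit_at_def)
qed

text \<open>Right multiplication by the transposition is a sign-reversing involution of
  \<open>C\<close> under which \<open>g\<close> is invariant. The terms cancel in pairs, so the
  argument is valid in characteristic 2 as well.\<close>

lemma sum_sign_eq_0:
  fixes g :: "('a \<Rightarrow> 'a) \<Rightarrow> 'k::comm_ring_1"
  assumes "finite C" and C: "\<And>\<sigma>. \<sigma> \<in> C \<Longrightarrow> permutation \<sigma> \<and> \<sigma> \<circ> transpose x y \<in> C \<and> g (\<sigma> \<circ> transpose x y) = g \<sigma>"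
    and "x \<noteq> y"
  shows "(\<Sum>\<sigma>\<in>C. of_int (sign \<sigma>) * g \<sigma>) = 0"
proof -
  let ?\<tau> = "transpose x y"
  have tau: "permutation ?\<tau>" "\<not> evenperm ?\<tau>"
    using assms(3) by (simp_all add: permutation_swap_id evenperm_swap)
  have inv: "\<sigma> \<circ> ?\<tau> \<circ> ?\<tau> = \<sigma>" for \<sigma> :: "'a \<Rightarrow> 'a" by (simp add: fun_eq_iff)
  have flip: "evenperm (\<sigma> \<circ> ?\<tau>) \<longleftrightarrow> \<not> evenperm \<sigma>" if "\<sigma> \<in> C" for \<sigma>
    using C[OF that] tau by (simp add: evenperm_comp)
  have "(\<Sum>\<sigma>\<in>{\<sigma> \<in> C. evenperm \<sigma>}. g \<sigma>) = (\<Sum>\<sigma>\<in>{\<sigma> \<in> C. \<not> evenperm \<sigma>}. g \<sigma>)"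
    by (rule sum.reindex_bij_witness[of _ "\<lambda>\<sigma>. \<sigma> \<circ> ?\<tau>" "\<lambda>\<sigma>. \<sigma> \<circ> ?\<tau>"]) (use C flip inv in auto)
  moreover have "(\<Sum>\<sigma>\<in>C. of_int (sign \<sigma>) * g \<sigma>) = (\<Sum>\<sigma>\<in>C. if evenperm \<sigma> then g \<sigma> else - g \<sigma>)"
    by (rule sum.cong) (auto simp: sign_def)
  ultimately show ?thesis
    using assms(1) by (simp add: sum.If_cases sum_negf Int_def Collect_neg_eq[symmetric])
qed

lemma column_stabilizer_transpose:
  assumes t: "tableau l t" and ij: "(i, j) \<in> young_diagram l" "(i', j) \<in> young_diagram l"
    and \<sigma>: "\<sigma> \<in> column_stabilizer l t"
  shows "\<sigma> \<circ> transpose (t (i, j)) (t (i', j)) \<in> column_stabilizer l t"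
proof -
  let ?x = "t (i, j)" and ?y = "t (i', j)" and ?C = "\<lambda>j. {t (i, j) | i. (i, j) \<in> young_diagram l}"
  have bij: "inj_on t (young_diagram l)" "t ` young_diagram l = {1..sum_list l}"
    using t by (auto simp: tableau_def bij_betw_def)
  have mem: "?x \<in> {1..sum_list l}" "?y \<in> {1..sum_list l}" using bij(2) ij by blast+
  have perm: "transpose ?x ?y permutes {1..sum_list l}" using mem by (rule permutes_swap_id)
  have img: "transpose ?x ?y ` ?C j' = ?C j'" for j'
  proof (cases "j' = j")
    case True
    have "?x \<in> ?C j" "?y \<in> ?C j" using ij by blast+
    hence "transpose ?x ?y permutes ?C j" by (rule permutes_swap_id)
    thus ?thesis unfolding True by (rule permutes_image)
  next
    case False
    have "?x \<notin> ?C j'" "?y \<notin> ?C j'" using False ij by (auto simp: inj_on_eq_iff[OF bij(1)])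
    hence fixed: "transpose ?x ?y z = z" if "z \<in> ?C j'" for z
      using that by (intro transpose_apply_other) (metis, metis)
    have "transpose ?x ?y ` ?C j' = id ` ?C j'"
      by (rule image_cong[OF refl]) (simp only: fixed id_apply)
    thus ?thesis by simp
  qed
  have "\<sigma> permutes {1..sum_list l}" and cols: "\<And>j. \<sigma> ` ?C j = ?C j"
    using \<sigma> unfolding column_stabilizer_def by blast+
  hence "\<sigma> \<circ> transpose ?x ?y permutes {1..sum_list l}" by (intro permutes_compose[OF perm])
  moreover have "(\<sigma> \<circ> transpose ?x ?y) ` ?C j = ?C j" for j
    by (simp only: image_comp[symmetric] img cols)
  ultimately show ?thesis unfolding column_stabilizer_def by blast
qed

text \<open>The sum is the raising operator \<open>E i j\<close> applied to a polytabloid. A nonzero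
  contribution puts the entry of some box \<open>(j, m)\<close> into row \<open>i\<close>, where the
  entry of the box \<open>(i, m)\<close> of the same column is as well; exchanging the two entries
  stays in the column stabiliser and reverses the sign.\<close>

lemma polytabloid_raise:
  assumes l: "l \<in> partitions a" and t: "tableau l t" and ij: "1 \<le> i" "i < j"
  shows "(\<Sum>x\<in>{1..a}. of_bool (e x = i) * polytabloid l t (row_sets a (e(x := j)))) = (0 :: 'k::field)"
proof -
  let ?Y = "young_diagram l" and ?C = "column_stabilizer l t"
  have a: "a = sum_list l" using l by (simp add: partitions_def)
  have bij: "inj_on t ?Y" "t ` ?Y = {1..a}"
    using t by (auto simp: tableau_def bij_betw_def a)
  \<comment> \<open>The contribution in which \<open>x\<close> is the entry of
    \<open>\<sigma> \<circ> t\<close> in box \<open>q\<close>: recolouring \<open>x\<close> with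
    \<open>j\<close> has to produce the rows, so \<open>q\<close> lies in row \<open>j\<close> and
    all other boxes are right already.\<close>
  define G where "G q \<sigma> \<longleftrightarrow> e (\<sigma> (t q)) = i \<and> fst q = j \<and> (\<forall>q'\<in>?Y - {q}. e (\<sigma> (t q')) = fst q')"
    for q \<sigma>
  have "(\<Sum>x\<in>{1..a}. of_bool (e x = i) * polytabloid l t (row_sets a (e(x := j)))) =
    (\<Sum>\<sigma>\<in>?C. \<Sum>x\<in>{1..a}. of_int (sign \<sigma>) *
      of_bool (e x = i \<and> (\<forall>q\<in>?Y. (e(x := j)) (\<sigma> (t q)) = fst q)) :: 'k)"
    unfolding a polytabloid_row_sets[OF t] sum_distrib_left of_bool_conj
    by (subst sum.swap) (simp only: mult_ac)
  also have "\<dots> = (\<Sum>\<sigma>\<in>?C. \<Sum>q\<in>?Y. of_int (sign \<sigma>) * of_bool (G q \<sigma>))"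
  proof (rule sum.cong[OF refl])
    fix \<sigma> assume "\<sigma> \<in> ?C"
    hence \<sigma>: "\<sigma> permutes {1..a}" by (simp add: column_stabilizer_def a)
    have inj: "inj_on (\<lambda>q. \<sigma> (t q)) ?Y"
      using bij(1) by (simp add: inj_on_def permutes_inj[OF \<sigma>, THEN inj_eq])
    have img: "(\<lambda>q. \<sigma> (t q)) ` ?Y = {1..a}"
      using bij(2) permutes_image[OF \<sigma>] by (metis image_image)
    have "(\<Sum>x\<in>(\<lambda>q. \<sigma> (t q)) ` ?Y. of_int (sign \<sigma>) *
        of_bool (e x = i \<and> (\<forall>q\<in>?Y. (e(x := j)) (\<sigma> (t q)) = fst q)) :: 'k) =
      (\<Sum>q\<in>?Y. of_int (sign \<sigma>) * of_bool (e (\<sigma> (t q)) = i \<and>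
          (\<forall>q'\<in>?Y. (e(\<sigma> (t q) := j)) (\<sigma> (t q')) = fst q')))"
      by (simp only: sum.reindex[OF inj] o_def)
    also have "\<dots> = (\<Sum>q\<in>?Y. of_int (sign \<sigma>) * of_bool (G q \<sigma>))"
    proof (rule sum.cong[OF refl])
      fix q assume q: "q \<in> ?Y"
      have "(\<forall>q'\<in>?Y. (e(\<sigma> (t q) := j)) (\<sigma> (t q')) = fst q') \<longleftrightarrow>
        fst q = j \<and> (\<forall>q'\<in>?Y - {q}. e (\<sigma> (t q')) = fst q')"
        using q by (auto simp: inj_on_eq_iff[OF inj])
      thus "of_int (sign \<sigma>) * of_bool (e (\<sigma> (t q)) = i \<and>
          (\<forall>q'\<in>?Y. (e(\<sigma> (t q) := j)) (\<sigma> (t q')) = fst q')) = (of_int (sign \<sigma>) * of_bool (G q \<sigma>) :: 'k)"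
        unfolding G_def by simp
    qed
    finally show "(\<Sum>x\<in>{1..a}. of_int (sign \<sigma>) *
      of_bool (e x = i \<and> (\<forall>q\<in>?Y. (e(x := j)) (\<sigma> (t q)) = fst q))) =
      (\<Sum>q\<in>?Y. of_int (sign \<sigma>) * of_bool (G q \<sigma>) :: 'k)" unfolding img .
  qed
  also have "\<dots> = (\<Sum>q\<in>?Y. \<Sum>\<sigma>\<in>?C. of_int (sign \<sigma>) * of_bool (G q \<sigma>))"
    by (rule sum.swap)
  also have "\<dots> = 0"
  proof (rule sum.neutral, rule ballI)
    fix q assume q: "q \<in> ?Y"
    show "(\<Sum>\<sigma>\<in>?C. of_int (sign \<sigma>) * of_bool (G q \<sigma>)) = (0 :: 'k)"
    proof (cases "fst q = j")
      case True
      then obtain m where m: "q = (j, m)" by (cases q) auto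
      \<comment> \<open>Here the shape is used: row \<open>i\<close> lies above row \<open>j\<close>
        and is at least as long.\<close>
      have q': "(i, m) \<in> ?Y"
        using q m ij part_antimono[OF l ij(1), of j] by (auto simp: young_diagram_def)
      let ?\<tau> = "transpose (t (j, m)) (t (i, m))"
      have ne: "(j, m) \<noteq> (i, m)" using ij by simp
      have t_ne: "t (j, m) \<noteq> t (i, m)" using ne q q' m by (simp add: inj_on_eq_iff[OF bij(1)])
      have tq': "?\<tau> (t q') = t q'" if "q' \<in> ?Y" "q' \<noteq> (j, m)" "q' \<noteq> (i, m)" for q'
        using that q q' m by (intro transpose_apply_other) (simp_all add: inj_on_eq_iff[OF bij(1)])
      have split: "?Y - {q} = insert (i, m) (?Y - {(j, m), (i, m)})" using m q' ne by auto
      have G: "G q \<sigma> \<longleftrightarrow> e (\<sigma> (t (j, m))) = i \<and> e (\<sigma> (t (i, m))) = i \<and>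
          (\<forall>q'\<in>?Y - {(j, m), (i, m)}. e (\<sigma> (t q')) = fst q')" for \<sigma>
        unfolding G_def split using m by auto
      show ?thesis
      proof (rule sum_sign_eq_0[OF _ _ t_ne])
        fix \<sigma> assume \<sigma>: "\<sigma> \<in> ?C"
        have "permutation \<sigma>"
          using \<sigma> unfolding column_stabilizer_def permutation_permutes by auto
        moreover have "\<sigma> \<circ> ?\<tau> \<in> ?C"
          using column_stabilizer_transpose[OF t _ q' \<sigma>, of j] q m by simp
        moreover have "G q (\<sigma> \<circ> ?\<tau>) \<longleftrightarrow> G q \<sigma>"
          unfolding G using tq' by auto
        ultimately show "permutation \<sigma> \<and> \<sigma> \<circ> ?\<tau> \<in> ?C \<and> of_bool (G q (\<sigma> \<circ> ?\<tau>)) = (of_bool (G q \<sigma>) :: 'k)"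
          by simp
      qed simp
    next
      case False
      thus ?thesis by (simp add: G_def)
    qed
  qed
  finally show ?thesis .
qed

text \<open>The tabloid of \<open>t\<close> itself has coefficient 1, since only the identity
  preserves all rows and all columns of \<open>t\<close>. Such a coefficient survives in every
  characteristic.\<close>

lemma polytabloid_nonzero:
  assumes t: "tableau l t"
  obtains e where "\<And>x. x \<in> {1..sum_list l} \<Longrightarrow> e x \<in> {1..length l}"
    "polytabloid l t (row_sets (sum_list l) e) = (1 :: 'k::field)"
proof -
  let ?Y = "young_diagram l" and ?C = "column_stabilizer l t"
  have bij: "inj_on t ?Y" "t ` ?Y = {1..sum_list l}"
    using t by (auto simp: tableau_def bij_betw_def)
  define e where "e x = fst (inv_into ?Y t x)" for x
  have e: "e (t q) = fst q" if "q \<in> ?Y" for q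
    using that bij(1) by (simp add: e_def)
  have "id \<in> ?C" by (simp add: column_stabilizer_def permutes_id)
  moreover have "\<sigma> = id" if \<sigma>: "\<sigma> \<in> ?C" and fix_rows: "\<forall>q\<in>?Y. e (\<sigma> (t q)) = fst q" for \<sigma>
  proof
    fix x
    show "\<sigma> x = id x"
    proof (cases "x \<in> {1..sum_list l}")
      case True
      hence "x \<in> t ` ?Y" by (simp only: bij(2))
      then obtain i j where q: "(i, j) \<in> ?Y" "x = t (i, j)" by (elim imageE) (metis surj_pair)
      have "\<sigma> ` {t (i, j) | i. (i, j) \<in> ?Y} = {t (i, j) | i. (i, j) \<in> ?Y}"
        using \<sigma> by (simp add: column_stabilizer_def)
      moreover have "\<sigma> x \<in> \<sigma> ` {t (i, j) | i. (i, j) \<in> ?Y}" using q by blast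
      ultimately have "\<sigma> x \<in> {t (i, j) | i. (i, j) \<in> ?Y}" by simp
      then obtain i' where i': "\<sigma> x = t (i', j)" "(i', j) \<in> ?Y" by auto
      have "e (\<sigma> x) = i" using fix_rows q by force
      hence "i' = i" using e[OF i'(2)] i'(1) by simp
      thus ?thesis using i' q by simp
    next
      case False
      moreover have "\<sigma> permutes {1..sum_list l}" using \<sigma> unfolding column_stabilizer_def by blast
      ultimately show ?thesis using permutes_not_in by fastforce
    qed
  qed
  ultimately have "(\<Sum>\<sigma>\<in>?C. of_int (sign \<sigma>) * of_bool (\<forall>q\<in>?Y. e (\<sigma> (t q)) = fst q)) =
    (\<Sum>\<sigma>\<in>?C. if \<sigma> = id then 1 else 0 :: 'k)"
    using e by (intro sum.cong) (auto simp: sign_id)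
  also have "\<dots> = 1" using \<open>id \<in> ?C\<close> by simp
  finally have "polytabloid l t (row_sets (sum_list l) e) = (1 :: 'k)"
    unfolding polytabloid_row_sets[OF t] .
  moreover have "e x \<in> {1..length l}" if "x \<in> {1..sum_list l}" for x
  proof -
    have "x \<in> t ` ?Y" using that by (simp only: bij(2))
    then obtain q where "q \<in> ?Y" "x = t q" by (elim imageE)
    thus ?thesis using e by (auto simp: young_diagram_eq)
  qed
  ultimately show ?thesis using that by blast
qed

lemma specht_raise:
  assumes l: "l \<in> partitions a" and u: "u \<in> specht l" and ij: "1 \<le> i" "i < j"
  shows "(\<Sum>x\<in>{1..a}. of_bool (e x = i) * u (row_sets a (e(x := j)))) = (0 :: 'k::field)"
  using u unfolding specht_def fun_span_eq
proof (induction rule: function_space.span_induct)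
  show "function_space.subspace
    {u. (\<Sum>x\<in>{1..a}. of_bool (e x = i) * u (row_sets a (e(x := j)))) = (0 :: 'k)}"
    by (rule function_space.subspaceI)
      (auto simp: distrib_left sum.distrib mult.left_commute sum_distrib_left[symmetric])
  fix u :: "tabloid \<Rightarrow> 'k" assume "u \<in> {polytabloid l t | t. tableau l t}"
  then obtain t where t: "tableau l t" and u: "u = polytabloid l t" by auto
  show "(\<Sum>x\<in>{1..a}. of_bool (e x = i) * u (row_sets a (e(x := j)))) = 0"
    unfolding u by (rule polytabloid_raise[OF l t ij])
qed

lemma specht_support:
  assumes u: "u \<in> specht l" and "u T \<noteq> (0 :: 'k::field)"
  shows "\<exists>t. tableau l t \<and> T = tabloid_of l t"
proof -
  have "\<forall>T. u T \<noteq> 0 \<longrightarrow> (\<exists>t. tableau l t \<and> T = tabloid_of l t)"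
    using u unfolding specht_def fun_span_eq
  proof (induction rule: function_space.span_induct)
    show "function_space.subspace {u. \<forall>T. u T \<noteq> (0 :: 'k) \<longrightarrow> (\<exists>t. tableau l t \<and> T = tabloid_of l t)}"
      by (rule function_space.subspaceI) (auto, (metis add.left_neutral)+)
    fix u :: "tabloid \<Rightarrow> 'k" assume "u \<in> {polytabloid l t | t. tableau l t}"
    then obtain t where t: "tableau l t" "u = polytabloid l t" by auto
    show "\<forall>T. u T \<noteq> 0 \<longrightarrow> (\<exists>t. tableau l t \<and> T = tabloid_of l t)"
    proof (intro allI impI)
      fix T assume "u T \<noteq> 0"
      then obtain \<sigma> where "\<sigma> \<in> column_stabilizer l t" "T = tabloid_of l (\<sigma> \<circ> t)"
        unfolding t polytabloid_def by (auto elim!: sum.not_neutral_contains_not_neutral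
          simp: unit_at_def split: if_splits)
      thus "\<exists>t. tableau l t \<and> T = tabloid_of l t"
        using tableau_permutes[OF t(1)] by (auto simp: column_stabilizer_def)
    qed
  qed
  thus ?thesis using assms(2) by blast
qed

lemma specht_row_sets:
  assumes l: "l \<in> partitions a" and u: "u \<in> specht l" "u (row_sets a e) \<noteq> (0 :: 'k::field)"
  shows "card {x \<in> {1..a}. e x = i} = part l i"
    and "x \<in> {1..a} \<Longrightarrow> e x \<in> {1..length l}"
proof -
  have a: "a = sum_list l" using l by (simp add: partitions_def)
  obtain t where t: "tableau l t" "row_sets a e = tabloid_of l t" using specht_support[OF u] by auto
  have bij: "inj_on t (young_diagram l)" "t ` young_diagram l = {1..a}"
    using t by (auto simp: tableau_def bij_betw_def a)
  have e: "e (t q) = fst q" if "q \<in> young_diagram l" for q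
    using tabloid_eq_row_sets_iff[OF t(1), of e] t(2) that a by simp
  have "{x \<in> {1..a}. e x = i} = tabloid_of l t i"
    using fun_cong[OF t(2), of i] by (simp add: row_sets_def)
  also have "\<dots> = (\<lambda>j. t (i, j)) ` {j. (i, j) \<in> young_diagram l}" by (auto simp: tabloid_of_def)
  also have "card \<dots> = card {j. (i, j) \<in> young_diagram l}"
    by (rule card_image) (use bij(1) in \<open>auto simp: inj_on_def\<close>)
  also have "{j. (i, j) \<in> young_diagram l} = {1..part l i}"
    by (auto simp: young_diagram_def part_def)
  finally show "card {x \<in> {1..a}. e x = i} = part l i" by simp
  assume "x \<in> {1..a}"
  hence "x \<in> t ` young_diagram l" by (simp only: bij(2))
  then obtain q where "q \<in> young_diagram l" "x = t q" by (elim imageE)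
  thus "e x \<in> {1..length l}" using e by (auto simp: young_diagram_eq)
qed

text \<open>
  A function of pairs of tabloids becomes a tensor: left factors are coloured by rows, right ones
  by rows counted downwards from \<open>n\<close>.
\<close>

definition right_rows :: "nat \<Rightarrow> nat \<Rightarrow> (nat \<Rightarrow> nat) \<Rightarrow> nat \<Rightarrow> nat" where
  "right_rows n a c = (\<lambda>y. n + 1 - c (a + y))"

definition tensor_of :: "nat \<Rightarrow> nat \<Rightarrow> nat \<Rightarrow> (tabloid \<times> tabloid \<Rightarrow> 'k::zero) \<Rightarrow> (nat \<Rightarrow> nat) \<Rightarrow> 'k" where
  "tensor_of n a b v c =
     (if c \<in> colorings n (a + b) then v (row_sets a c, row_sets b (right_rows n a c)) else 0)"

lemma tensor_of_supported: "tensor_of n a b v \<in> supported_on (colorings n (a + b))"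
  by (simp add: supported_on_def tensor_of_def)

definition bipartition_gl_weight :: "nat \<Rightarrow> nat list \<Rightarrow> nat list \<Rightarrow> nat \<Rightarrow> 'k::comm_ring_1" where
  "bipartition_gl_weight n l m i = of_nat (part l i) - of_nat (part m (n + 1 - i))"

text \<open>On left factors \<open>E i j\<close> with \<open>i < j\<close> is a raising operator; on
  dual factors the roles of \<open>i\<close> and \<open>j\<close> are exchanged, and counting rows
  downwards from \<open>n\<close> reverses the order once more, so \<open>specht_raise\<close> kills
  both parts. The diagonal operators count the occurrences of a colour, and on the support of a
  Specht vector these numbers are the parts.\<close>

lemma highest_weight_vector_pure_tensor:
  fixes u u' :: "tabloid \<Rightarrow> 'k::field"
  assumes l: "l \<in> partitions a" and m: "m \<in> partitions b" and u: "u \<in> specht l" and u': "u' \<in> specht m"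
  shows "highest_weight_vector a (a + b) n (bipartition_gl_weight n l m) (tensor_of n a b (pure_tensor u u'))"
proof -
  let ?f = "tensor_of n a b (pure_tensor u u')"
  have gl: "gl_op a (a + b) i j ?f c =
     (\<Sum>x\<in>{1..a}. of_bool (c x = i) * u (row_sets a (c(x := j)))) * u' (row_sets b (right_rows n a c)) -
     u (row_sets a c) * (\<Sum>y\<in>{1..b}. of_bool (right_rows n a c y = n + 1 - j) *
        u' (row_sets b ((right_rows n a c)(y := n + 1 - i))))"
    if c: "c \<in> colorings n (a + b)" and ij: "i \<in> {1..n}" "j \<in> {1..n}" for c i j
  proof -
    have L: "gl_at a x i j ?f c =
      of_bool (c x = i) * u (row_sets a (c(x := j))) * u' (row_sets b (right_rows n a c))"
      if x: "x \<in> {1..a}" for x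
    proof -
      have "row_sets b (right_rows n a (c(x := j))) = row_sets b (right_rows n a c)"
        by (rule row_sets_cong) (use x in \<open>auto simp: right_rows_def\<close>)
      thus ?thesis using x colorings_upd[OF c _ ij(2), of x]
        by (simp add: gl_at_def tensor_of_def pure_tensor_def)
    qed
    have R: "gl_at a (a + y) i j ?f c = - (u (row_sets a c) * (of_bool (right_rows n a c y = n + 1 - j) *
        u' (row_sets b ((right_rows n a c)(y := n + 1 - i)))))" if y: "y \<in> {1..b}" for y
    proof -
      have "row_sets b (right_rows n a (c(a + y := i))) = row_sets b ((right_rows n a c)(y := n + 1 - i))"
        by (rule row_sets_cong) (auto simp: right_rows_def)
      moreover have "row_sets a (c(a + y := i)) = row_sets a c"
        by (rule row_sets_cong) (use y in auto)
      moreover have "c (a + y) = j \<longleftrightarrow> right_rows n a c y = n + 1 - j"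
        using colorings_mem[OF c, of "a + y"] y ij by (auto simp: right_rows_def)
      ultimately show ?thesis using y colorings_upd[OF c _ ij(1), of "a + y"]
        by (simp add: gl_at_def tensor_of_def pure_tensor_def)
    qed
    have "gl_op a (a + b) i j ?f c = (\<Sum>x\<in>{1..a}. gl_at a x i j ?f c) + (\<Sum>x\<in>{a + 1..a + b}. gl_at a x i j ?f c)"
      unfolding gl_op_def by (subst sum.union_disjoint[symmetric]) (auto intro!: sum.cong)
    also have "(\<Sum>x\<in>{a + 1..a + b}. gl_at a x i j ?f c) = (\<Sum>y\<in>{1..b}. gl_at a (a + y) i j ?f c)"
      by (rule sum.reindex_bij_witness[of _ "\<lambda>y. a + y" "\<lambda>x. x - a"]) auto
    also have "(\<Sum>x\<in>{1..a}. gl_at a x i j ?f c) = (\<Sum>x\<in>{1..a}. of_bool (c x = i) *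
        u (row_sets a (c(x := j)))) * u' (row_sets b (right_rows n a c))"
      unfolding sum_distrib_right by (intro sum.cong refl L)
    also have "(\<Sum>y\<in>{1..b}. gl_at a (a + y) i j ?f c) =
      - (u (row_sets a c) * (\<Sum>y\<in>{1..b}. of_bool (right_rows n a c y = n + 1 - j) *
        u' (row_sets b ((right_rows n a c)(y := n + 1 - i)))))"
      unfolding sum_distrib_left sum_negf[symmetric] by (intro sum.cong refl R)
    finally show ?thesis by (simp only: diff_conv_add_uminus)
  qed
  have out: "gl_op a (a + b) i j ?f c = 0" if "c \<notin> colorings n (a + b)" "i \<in> {1..n}" "j \<in> {1..n}" for c i j
    using supported_on_simps(1)[OF gl_op_supported[OF tensor_of_supported that(2,3)] that(1)] .
  show ?thesis unfolding highest_weight_vector_def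
  proof (intro conjI ballI impI ext)
    fix i j c assume ij: "i \<in> {1..n}" "j \<in> {1..n}" "i < j"
    show "gl_op a (a + b) i j ?f c = 0"
    proof (cases "c \<in> colorings n (a + b)")
      case True
      have "1 \<le> i" "1 \<le> n + 1 - j" "n + 1 - j < n + 1 - i" using ij by auto
      thus ?thesis unfolding gl[OF True ij(1,2)]
        using specht_raise[OF l u, of i j c] ij(3) specht_raise[OF m u', of "n + 1 - j" "n + 1 - i"]
        by (simp only: mult_zero_left mult_zero_right diff_self)
    qed (use out ij in simp)
  next
    fix i c assume i: "i \<in> {1..n}"
    show "gl_op a (a + b) i i ?f c = bipartition_gl_weight n l m i * ?f c"
    proof (cases "c \<in> colorings n (a + b)")
      case c: True
      let ?d = "right_rows n a c"
      have "(\<Sum>x\<in>{1..a}. of_bool (c x = i) * u (row_sets a (c(x := i)))) =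
        (\<Sum>x\<in>{1..a}. of_bool (c x = i) * u (row_sets a c))"
        by (rule sum.cong) auto
      also have "\<dots> = of_nat (card {x \<in> {1..a}. c x = i}) * u (row_sets a c)"
        by (simp add: Int_def)
      also have "\<dots> = of_nat (part l i) * u (row_sets a c)"
        using specht_row_sets(1)[OF l u, of c i] by (cases "u (row_sets a c) = 0") auto
      finally have L: "(\<Sum>x\<in>{1..a}. of_bool (c x = i) * u (row_sets a (c(x := i)))) =
        of_nat (part l i) * u (row_sets a c)" .
      have "(\<Sum>y\<in>{1..b}. of_bool (?d y = n + 1 - i) * u' (row_sets b (?d(y := n + 1 - i)))) =
        (\<Sum>y\<in>{1..b}. of_bool (?d y = n + 1 - i) * u' (row_sets b ?d))"
        by (rule sum.cong) (auto simp: fun_upd_idem)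
      also have "\<dots> = of_nat (card {y \<in> {1..b}. ?d y = n + 1 - i}) * u' (row_sets b ?d)"
        by (simp add: Int_def)
      also have "\<dots> = of_nat (part m (n + 1 - i)) * u' (row_sets b ?d)"
        using specht_row_sets(1)[OF m u', of ?d "n + 1 - i"] by (cases "u' (row_sets b ?d) = 0") auto
      finally have R: "(\<Sum>y\<in>{1..b}. of_bool (?d y = n + 1 - i) * u' (row_sets b (?d(y := n + 1 - i)))) =
        of_nat (part m (n + 1 - i)) * u' (row_sets b ?d)" .
      show ?thesis unfolding gl[OF c i i] L R using c
        by (simp add: tensor_of_def pure_tensor_def bipartition_gl_weight_def algebra_simps)
    qed (use out i in \<open>simp add: tensor_of_def\<close>)
  qed
qed

lemma highest_weight_vector_tensor:
  fixes v :: "tabloid \<times> tabloid \<Rightarrow> 'k::field"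
  assumes l: "l \<in> partitions a" and m: "m \<in> partitions b"
    and v: "v \<in> tensor_space (specht l) (specht m)"
  shows "highest_weight_vector a (a + b) n (bipartition_gl_weight n l m) (tensor_of n a b v)"
  using v unfolding tensor_space_def fun_span_eq
proof (induction rule: function_space.span_induct)
  let ?hw = "highest_weight_vector a (a + b) n (bipartition_gl_weight n l m :: nat \<Rightarrow> 'k)"
  have add: "tensor_of n a b (v + v') = (\<lambda>c. tensor_of n a b v c + tensor_of n a b v' c)"
    for v v' :: "tabloid \<times> tabloid \<Rightarrow> 'k" by (auto simp: tensor_of_def)
  have scale: "tensor_of n a b (\<lambda>x. z * v x) = (\<lambda>c. z * tensor_of n a b v c)"
    for z and v :: "tabloid \<times> tabloid \<Rightarrow> 'k" by (auto simp: tensor_of_def)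
  have zero: "tensor_of n a b 0 = (\<lambda>c. 0 :: 'k)" by (auto simp: tensor_of_def)
  show "function_space.subspace {v. ?hw (tensor_of n a b v)}"
    by (rule function_space.subspaceI)
      (auto simp: highest_weight_vector_def add scale zero gl_op_add gl_op_scale gl_op_zero fun_eq_iff
        algebra_simps)
qed (use highest_weight_vector_pure_tensor[OF l m] in blast)

section \<open>Cell modules in mixed tensor space\<close>

lemma finite_half_diagrams [simp]: "finite (half_diagrams r s t)"
  by (rule finite_subset[OF _ finite_walled_diagrams[of r s "r - t" "s - t"]]) (auto simp: half_diagrams_def)

lemma half_diagram_walled: "D \<in> half_diagrams r s t \<Longrightarrow> D \<in> walled_diagrams r s (r - t) (s - t)"
  by (simp add: half_diagrams_def)

text \<open>Without southern arcs the number of northern arcs is determined by counting left nodes.\<close>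

lemma half_diagramsI:
  assumes t: "t \<le> r" and D: "D \<in> walled_diagrams r s (r - t) (s - t)"
    and no_arc: "\<And>i j. {South i, South j} \<notin> D"
  shows "D \<in> half_diagrams r s t"
proof -
  let ?a = "r - t" and ?b = "s - t"
  let ?N = "nodes (r + s) (?a + ?b)"
  have sn: "is_north (partner D (South j))" if "South j \<in> ?N" for j
    using partner(1)[OF D that] no_arc by (cases "partner D (South j)") auto
  define L where "L = North ` {1..r}"
  \<comment> \<open>The left northern nodes on propagating lines. They correspond to the
    \<open>r - t\<close> left southern nodes, which leaves \<open>t\<close> left northern nodes, one
    for each northern arc.\<close>
  define X where "X = {u \<in> L. is_south (partner D u)}"
  have L: "u \<in> ?N" "plus_node r ?a u" "is_north u" if "u \<in> L" for u
    using that by (auto simp: L_def nodes_def)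
  have in_L: "u \<in> L" if "u \<in> ?N" "plus_node r ?a u" "is_north u" for u
    using that by (cases u) (auto simp: L_def nodes_def)
  have "card X = card (South ` {1..?a})"
  proof (rule bij_betw_same_card[OF bij_betwI[of "partner D" _ _ "partner D"]])
    show "partner D \<in> X \<rightarrow> South ` {1..?a}"
    proof
      fix u assume u: "u \<in> X"
      hence uL: "u \<in> L" by (simp add: X_def)
      have "partner D u \<in> ?N" "\<not> plus_node r ?a (partner D u)" "is_south (partner D u)"
        using partner[OF D L(1)[OF uL]] L(2)[OF uL] u by (auto simp: X_def)
      thus "partner D u \<in> South ` {1..?a}" by (cases "partner D u") (auto simp: nodes_def)
    qed
    show "partner D \<in> South ` {1..?a} \<rightarrow> X"
    proof
      fix v assume "v \<in> South ` {1..?a}"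
      then obtain j where j: "v = South j" "j \<in> {1..?a}" by auto
      have v: "South j \<in> ?N" "\<not> plus_node r ?a (South j)" using j by (auto simp: nodes_def)
      have "partner D v \<in> L"
        using in_L[of "partner D v"] partner[OF D v(1)] v sn j by simp
      thus "partner D v \<in> X" using partner(5)[OF D v(1)] j by (simp add: X_def)
    qed
    show "partner D (partner D u) = u" if "u \<in> X" for u
      using partner(5)[OF D L(1)] that by (auto simp: X_def)
    show "partner D (partner D v) = v" if "v \<in> South ` {1..?a}" for v
    proof (rule partner(5)[OF D])
      show "v \<in> ?N" using that by (auto simp: nodes_def)
    qed
  qed
  hence card_X: "card X = ?a" by (simp add: card_image inj_on_def)
  have finL: "finite L" and card_L: "card L = r" by (simp_all add: L_def card_image inj_on_def)
  have XL: "X \<subseteq> L" by (auto simp: X_def)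
  have "card {P \<in> D. \<forall>u\<in>P. is_north u} = card (L - X)"
  proof (rule bij_betw_same_card[symmetric], rule bij_betw_imageI)
    show "inj_on (\<lambda>u. {u, partner D u}) (L - X)"
    proof (rule inj_onI)
      fix u w assume u: "u \<in> L - X" and w: "w \<in> L - X" and eq: "{u, partner D u} = {w, partner D w}"
      have "\<not> plus_node r ?a (partner D w)" "plus_node r ?a u"
        using partner(4)[OF D L(1), of w] L(2) u w by auto
      thus "u = w" using eq by (metis doubleton_eq_iff)
    qed
    show "(\<lambda>u. {u, partner D u}) ` (L - X) = {P \<in> D. \<forall>u\<in>P. is_north u}"
    proof (intro equalityI subsetI)
      fix P assume "P \<in> (\<lambda>u. {u, partner D u}) ` (L - X)"
      then obtain u where u: "u \<in> L - X" "P = {u, partner D u}" by auto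
      hence "is_north (partner D u)" by (cases "partner D u") (auto simp: X_def)
      thus "P \<in> {P \<in> D. \<forall>u\<in>P. is_north u}"
        using u partner(1)[OF D L(1), of u] L(3)[of u] by auto
    next
      fix P assume P: "P \<in> {P \<in> D. \<forall>u\<in>P. is_north u}"
      then obtain u v where uv: "P = {u, v}" "plus_node r ?a u"
        using D unfolding walled_diagrams_iff by (metis (no_types, lifting) mem_Collect_eq)
      hence pair: "{u, v} \<in> D" "is_north u" "is_north v" using P by auto
      have "u \<in> L" using in_L walled_diagram_pair_plus(2)[OF D pair(1)] uv pair by blast
      moreover have "partner D u = v" by (rule partner_eq[OF D pair(1)])
      ultimately show "P \<in> (\<lambda>u. {u, partner D u}) ` (L - X)"
        using uv pair by (auto simp: X_def image_iff intro!: bexI[of _ u])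
    qed
  qed
  also have "\<dots> = t" using card_Diff_subset[OF finite_subset[OF XL finL] XL] card_X card_L t by simp
  finally have card: "card {P \<in> D. \<forall>u\<in>P. is_north u} = t" .
  have "\<exists>u\<in>P. is_north u" if P: "P \<in> D" "v \<in> P" "is_south v" for P v
  proof (rule ccontr)
    assume no: "\<not> ?thesis"
    obtain x y where xy: "P = {x, y}" using P(1) D unfolding walled_diagrams_iff by metis
    obtain i j where "x = South i" "y = South j" using no xy by (cases x; cases y) auto
    thus False using no_arc P xy by auto
  qed
  thus ?thesis unfolding half_diagrams_def using D card by blast
qed

lemma half_diagram_no_arc: "D \<in> half_diagrams r s t \<Longrightarrow> {South i, South j} \<notin> D"
  unfolding half_diagrams_def by fastforce

lemma nodes_iff:
  "North i \<in> nodes m m' \<longleftrightarrow> 1 \<le> i \<and> i \<le> m" "South i \<in> nodes m m' \<longleftrightarrow> 1 \<le> i \<and> i \<le> m'"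
  by (auto simp: nodes_def)

lemma half_diagrams_nonempty:
  assumes "t \<le> r" "t \<le> s"
  shows "half_diagrams r s t \<noteq> {}"
proof -
  let ?a = "r - t" and ?b = "s - t"
  \<comment> \<open>Straight lines for the first \<open>r - t\<close> left and the first
    \<open>s - t\<close> right nodes; the remaining \<open>t\<close> nodes on either side are joined
    by arcs.\<close>
  define D where "D = {{North i, South i} | i. i \<in> {1..?a}} \<union>
    {{South (?a + j), North (r + j)} | j. j \<in> {1..?b}} \<union>
    {{North (?a + i), North (r + ?b + i)} | i. i \<in> {1..t}}"
  have "D \<in> walled_diagrams r s ?a ?b"
  proof (rule walled_diagramsI)
    fix P assume "P \<in> D"
    then consider i where "i \<in> {1..?a}" "P = {North i, South i}"
      | j where "j \<in> {1..?b}" "P = {South (?a + j), North (r + j)}"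
      | i where "i \<in> {1..t}" "P = {North (?a + i), North (r + ?b + i)}"
      unfolding D_def by blast
    thus "\<exists>u v. P = {u, v} \<and> plus_node r ?a u \<and> \<not> plus_node r ?a v"
    proof cases
      case (1 i)
      thus ?thesis by (intro exI[of _ "North i"] exI[of _ "South i"]) auto
    next
      case (2 j)
      thus ?thesis by (intro exI[of _ "South (?a + j)"] exI[of _ "North (r + j)"]) auto
    next
      case (3 i)
      thus ?thesis using assms
        by (intro exI[of _ "North (?a + i)"] exI[of _ "North (r + ?b + i)"]) auto
    qed
  next
    show "\<Union>D = nodes (r + s) (?a + ?b)"
    proof (intro equalityI subsetI)
      fix u assume "u \<in> \<Union>D"
      thus "u \<in> nodes (r + s) (?a + ?b)" using assms by (auto simp: D_def nodes_iff)
    next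
      fix u assume u: "u \<in> nodes (r + s) (?a + ?b)"
      show "u \<in> \<Union>D"
      proof (cases u)
        case (North i)
        consider "i \<in> {1..?a}" | "i - ?a \<in> {1..t}" "i = ?a + (i - ?a)" | "i - r \<in> {1..?b}" "i = r + (i - r)"
          | "i - (r + ?b) \<in> {1..t}" "i = r + ?b + (i - (r + ?b))"
          using North u assms by (force simp: nodes_iff)
        thus ?thesis
        proof cases
          case 1
          hence "{North i, South i} \<in> D" unfolding D_def by blast
          thus ?thesis using North by blast
        next
          case 2
          hence "{u, North (r + ?b + (i - ?a))} \<in> D" unfolding D_def North by fastforce
          thus ?thesis by blast
        next
          case 3
          hence "{South (?a + (i - r)), u} \<in> D" unfolding D_def North by fastforce
          thus ?thesis by blast
        next
          case 4
          hence "{North (?a + (i - (r + ?b))), u} \<in> D" unfolding D_def North by fastforce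
          thus ?thesis by blast
        qed
      next
        case (South j)
        consider "j \<in> {1..?a}" | "j - ?a \<in> {1..?b}" "j = ?a + (j - ?a)"
          using South u by (force simp: nodes_iff)
        thus ?thesis
        proof cases
          case 1
          hence "{North j, South j} \<in> D" unfolding D_def by blast
          thus ?thesis using South by blast
        next
          case 2
          hence "{u, North (r + (j - ?a))} \<in> D" unfolding D_def South by fastforce
          thus ?thesis by blast
        qed
      qed
    qed
  next
    fix u v w assume "{u, v} \<in> D" "{u, w} \<in> D"
    thus "v = w" unfolding D_def using assms by (elim UnE CollectE exE conjE) (auto simp: doubleton_eq_iff)
  qed
  moreover have "{South i, South j} \<notin> D" for i j
    unfolding D_def by (auto simp: doubleton_eq_iff)
  ultimately show ?thesis using half_diagramsI[OF assms(1)] by blast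
qed

lemma diagram_op_concat:
  fixes f :: "(nat \<Rightarrow> nat) \<Rightarrow> 'k::comm_ring_1"
  assumes A: "A \<in> walled_diagrams r s a b" and B: "B \<in> walled_diagrams a b a' b'"
  shows "diagram_op n (r + s) (a + b) A (diagram_op n (a + b) (a' + b') B f) c =
    of_nat n ^ closed_components A B * diagram_op n (r + s) (a' + b') (diagram_concat A B) f c"
proof (cases "c \<in> colorings n (r + s)")
  case c: True
  interpret stacked_diagrams A B r s a b a' b' using A B by unfold_locales
  let ?M = "\<lambda>D c d. diagram_matrix D c d :: 'k"
  have "diagram_op n (r + s) (a + b) A (diagram_op n (a + b) (a' + b') B f) c =
    (\<Sum>e\<in>colorings n (a + b). \<Sum>d\<in>colorings n (a' + b'). ?M A c e * ?M B e d * f d)"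
    using c by (simp add: diagram_op_def matrix_op_def sum_distrib_left mult.assoc)
  also have "\<dots> = (\<Sum>d\<in>colorings n (a' + b'). (\<Sum>e\<in>colorings n (a + b). ?M A c e * ?M B e d) * f d)"
    by (subst sum.swap) (simp add: sum_distrib_right)
  also have "\<dots> = (\<Sum>d\<in>colorings n (a' + b'). of_nat n ^ closed_components A B *
      ?M (diagram_concat A B) c d * f d)"
    by (intro sum.cong refl) (simp only: diagram_matrix_concat[OF c])
  finally show ?thesis using c by (simp add: diagram_op_def matrix_op_def sum_distrib_left mult.assoc)
qed (simp add: diagram_op_def matrix_op_def)

lemma element_op_eq_sum:
  "element_op n r s x f c = (\<Sum>A\<in>walled_diagrams r s r s. x A * diagram_op n (r + s) (r + s) A f c)"
proof (cases "c \<in> colorings n (r + s)")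
  case True
  thus ?thesis
    by (simp add: element_op_def diagram_op_def matrix_op_def element_matrix_def sum_distrib_left
        sum_distrib_right mult.assoc sum.swap[of _ "walled_diagrams r s r s"])
qed (simp add: element_op_def diagram_op_def matrix_op_def)

lemma tensor_space_row_sets:
  assumes l: "l \<in> partitions a" and m: "m \<in> partitions b"
    and v: "v \<in> tensor_space (specht l) (specht m)" and "v (row_sets a e, row_sets b e') \<noteq> (0 :: 'k::field)"
  shows "x \<in> {1..a} \<Longrightarrow> e x \<in> {1..length l}" and "y \<in> {1..b} \<Longrightarrow> e' y \<in> {1..length m}"
proof -
  let ?P = "(\<forall>x\<in>{1..a}. e x \<in> {1..length l}) \<and> (\<forall>y\<in>{1..b}. e' y \<in> {1..length m})"
  have "v (row_sets a e, row_sets b e') \<noteq> 0 \<longrightarrow> ?P"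
    using v unfolding tensor_space_def fun_span_eq
  proof (induction rule: function_space.span_induct)
    show "function_space.subspace {v :: tabloid \<times> tabloid \<Rightarrow> 'k. v (row_sets a e, row_sets b e') \<noteq> 0 \<longrightarrow> ?P}"
      by (rule function_space.subspaceI) (auto simp del: atLeastAtMost_iff)
    fix v :: "tabloid \<times> tabloid \<Rightarrow> 'k" assume "v \<in> {pure_tensor u v | u v. u \<in> specht l \<and> v \<in> specht m}"
    then obtain u u' where "u \<in> specht l" "u' \<in> specht m" "v = pure_tensor u u'" by auto
    thus "v (row_sets a e, row_sets b e') \<noteq> 0 \<longrightarrow> ?P"
      using specht_row_sets(2)[OF l, of u e] specht_row_sets(2)[OF m, of u' e']
      by (auto simp: pure_tensor_def simp del: atLeastAtMost_iff)
  qed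
  thus "x \<in> {1..a} \<Longrightarrow> e x \<in> {1..length l}" "y \<in> {1..b} \<Longrightarrow> e' y \<in> {1..length m}"
    using assms(4) by blast+
qed

lemma length_partition: "l \<in> partitions a \<Longrightarrow> length l \<le> a"
proof -
  have "length l \<le> sum_list l" if "0 \<notin> set l" for l :: "nat list"
    using that by (induction l) auto
  thus "l \<in> partitions a \<Longrightarrow> length l \<le> a" by (auto simp: partitions_def)
qed

text \<open>A diagram with a southern arc kills these tensors, as left and right factors have different colours.\<close>

lemma diagram_op_south_arc:
  fixes v :: "tabloid \<times> tabloid \<Rightarrow> 'k::field"
  assumes l: "l \<in> partitions a" and m: "m \<in> partitions b" and n: "a + b \<le> n"
    and v: "v \<in> tensor_space (specht l) (specht m)"
    and D: "D \<in> walled_diagrams r s a b" and arc: "{South i, South j} \<in> D"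
  shows "diagram_op n (r + s) (a + b) D (tensor_of n a b v) = (\<lambda>c. 0)"
proof -
  have arc': "{South j, South i} \<in> D" using arc by (simp add: insert_commute)
  obtain i j where arc: "{South i, South j} \<in> D" "i \<le> a" "a < j"
    using walled_diagram_pair_plus(1)[OF D arc] arc arc' by (cases "a < i") auto
  have ij: "i \<in> {1..a}" "j \<in> {a + 1..a + b}"
    using walled_diagram_pair_plus(2,3)[OF D arc(1)] arc by (auto simp: nodes_def)
  have zero: "diagram_matrix D c d * tensor_of n a b v d = 0" for c d
  proof (rule ccontr)
    assume "diagram_matrix D c d * tensor_of n a b v d \<noteq> 0"
    hence comp: "compatible D c d" and d: "d \<in> colorings n (a + b)"
      and nz: "v (row_sets a d, row_sets b (right_rows n a d)) \<noteq> 0"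
      by (auto simp: diagram_matrix_def tensor_of_def split: if_splits)
    \<comment> \<open>The colour \<open>d i\<close> is a row of \<open>l\<close>, so at most
      \<open>a\<close>, whereas \<open>d j\<close> is \<open>n + 1\<close> minus a row of
      \<open>m\<close>, so at least \<open>n + 1 - b\<close>, which is larger than
      \<open>a\<close>.\<close>
    have "d i = d j" using comp arc(1) unfolding compatible_def by fastforce
    moreover have "d i \<in> {1..length l}" by (rule tensor_space_row_sets(1)[OF l m v nz ij(1)])
    moreover have "right_rows n a d (j - a) \<in> {1..length m}"
      by (rule tensor_space_row_sets(2)[OF l m v nz]) (use ij in auto)
    ultimately show False
      using length_partition[OF l] length_partition[OF m] n ij by (auto simp: right_rows_def)
  qed
  show ?thesis
    unfolding diagram_op_def matrix_op_def by (rule ext) (simp only: zero sum.neutral_const if_cancel)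
qed

section \<open>Permutations of the southern nodes\<close>

definition south_perm :: "nat \<Rightarrow> (nat \<Rightarrow> nat) \<times> (nat \<Rightarrow> nat) \<Rightarrow> nat \<Rightarrow> nat" where
  "south_perm a = (\<lambda>(\<sigma>, \<tau>) j. if j \<le> a then inv_into UNIV \<sigma> j else a + inv_into UNIV \<tau> (j - a))"

lemma perm_south_eq: "perm_south a D h = image (relabel_south (south_perm a h)) ` D"
  by (simp add: perm_south_def south_perm_def split_beta)

lemma relabel_south_inj: "inj \<pi> \<Longrightarrow> inj (relabel_south \<pi>)"
proof (rule injI)
  fix u v assume "inj \<pi>" "relabel_south \<pi> u = relabel_south \<pi> v"
  thus "u = v" by (cases u; cases v) (auto dest: injD)
qed

lemma south_perm:
  assumes "\<sigma> permutes {1..a}" "\<tau> permutes {1..b}"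
  shows "south_perm a (\<sigma>, \<tau>) permutes {1..a + b}" and "south_perm a (\<sigma>, \<tau>) j \<le> a \<longleftrightarrow> j \<le> a"
    and "x \<in> {1..a} \<Longrightarrow> south_perm a (\<sigma>, \<tau>) x = inv_into UNIV \<sigma> x"
    and "y \<in> {1..b} \<Longrightarrow> south_perm a (\<sigma>, \<tau>) (a + y) = a + inv_into UNIV \<tau> y"
proof -
  let ?\<pi> = "south_perm a (\<sigma>, \<tau>)" and ?\<sigma> = "inv_into UNIV \<sigma>" and ?\<tau> = "inv_into UNIV \<tau>"
  have \<sigma>: "?\<sigma> permutes {1..a}" and \<tau>: "?\<tau> permutes {1..b}" using assms by (auto intro: permutes_inv)
  \<comment> \<open>Index 0 falls into the left branch of \<open>south_perm\<close>; it is fixed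
    because it lies outside \<open>{1..a}\<close>.\<close>
  have \<sigma>0: "?\<sigma> 0 = 0" using permutes_not_in[OF \<sigma>, of 0] by simp
  have \<sigma>_le: "?\<sigma> j \<le> a" if "j \<le> a" for j
    using permutes_in_image[OF \<sigma>, of j] \<sigma>0 that by (cases "j = 0") auto
  have \<tau>_pos: "?\<tau> y \<ge> 1" if "y \<ge> 1" for y
  proof (cases "y \<le> b")
    case True
    thus ?thesis using permutes_in_image[OF \<tau>, of y] that by auto
  next
    case False
    thus ?thesis using permutes_not_in[OF \<tau>, of y] that by auto
  qed
  have le: "?\<pi> j \<le> a \<longleftrightarrow> j \<le> a" for j
  proof (cases "j \<le> a")
    case False
    hence "1 \<le> inv_into UNIV \<tau> (j - a)" by (intro \<tau>_pos) simp
    thus ?thesis using False by (simp add: south_perm_def)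
  qed (simp add: south_perm_def \<sigma>_le)
  thus "?\<pi> j \<le> a \<longleftrightarrow> j \<le> a" .
  show "x \<in> {1..a} \<Longrightarrow> ?\<pi> x = ?\<sigma> x" by (simp add: south_perm_def)
  show "y \<in> {1..b} \<Longrightarrow> ?\<pi> (a + y) = a + ?\<tau> y" by (simp add: south_perm_def)
  have inj: "inj_on ?\<pi> {1..a + b}"
  proof (rule inj_onI)
    fix x y assume eq: "?\<pi> x = ?\<pi> y"
    have same: "x \<le> a \<longleftrightarrow> y \<le> a" using le[of x] le[of y] eq by simp
    show "x = y"
    proof (cases "x \<le> a")
      case True
      hence "?\<sigma> x = ?\<sigma> y" using eq same by (simp add: south_perm_def)
      thus ?thesis using permutes_inj[OF \<sigma>] by (simp add: inj_eq)
    next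
      case False
      hence "?\<tau> (x - a) = ?\<tau> (y - a)" using eq same by (simp add: south_perm_def)
      hence "x - a = y - a" using permutes_inj[OF \<tau>] by (simp add: inj_eq)
      thus ?thesis using False same by simp
    qed
  qed
  have "?\<pi> ` {1..a + b} \<subseteq> {1..a + b}"
  proof (rule image_subsetI)
    fix j assume j: "j \<in> {1..a + b}"
    show "?\<pi> j \<in> {1..a + b}"
    proof (cases "j \<le> a")
      case True
      thus ?thesis using j permutes_in_image[OF \<sigma>, of j] by (auto simp: south_perm_def)
    next
      case False
      thus ?thesis using j permutes_in_image[OF \<tau>, of "j - a"] by (auto simp: south_perm_def)
    qed
  qed
  hence "?\<pi> ` {1..a + b} = {1..a + b}" using endo_inj_surj[OF _ _ inj] by simp
  hence "bij_betw ?\<pi> {1..a + b} {1..a + b}" using inj by (simp add: bij_betw_def)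
  thus "?\<pi> permutes {1..a + b}"
  proof (rule bij_imp_permutes)
    fix j assume j: "j \<notin> {1..a + b}"
    show "?\<pi> j = j"
    proof (cases "j = 0")
      case False
      hence "j - a \<notin> {1..b}" "a < j" using j by auto
      thus ?thesis using permutes_not_in[OF \<tau>, of "j - a"] by (simp add: south_perm_def)
    qed (simp add: south_perm_def \<sigma>0)
  qed
qed

lemma compatible_relabel_south:
  assumes D: "D \<in> walled_diagrams r s a b"
  shows "compatible (image (relabel_south \<pi>) ` D) c d \<longleftrightarrow> compatible D c (d \<circ> \<pi>)"
proof -
  have col: "node_color c d (relabel_south \<pi> u) = node_color c (d \<circ> \<pi>) u" for u by (cases u) auto
  show ?thesis
  proof
    assume *: "compatible (image (relabel_south \<pi>) ` D) c d"
    show "compatible D c (d \<circ> \<pi>)" unfolding compatible_def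
    proof (intro allI impI)
      fix u v assume "{u, v} \<in> D"
      hence "relabel_south \<pi> ` {u, v} \<in> image (relabel_south \<pi>) ` D" by (rule imageI)
      hence "node_color c d (relabel_south \<pi> u) = node_color c d (relabel_south \<pi> v)"
        using * unfolding compatible_def by simp
      thus "node_color c (d \<circ> \<pi>) u = node_color c (d \<circ> \<pi>) v" by (simp only: col)
    qed
  next
    assume *: "compatible D c (d \<circ> \<pi>)"
    show "compatible (image (relabel_south \<pi>) ` D) c d" unfolding compatible_def
    proof (intro allI impI)
      fix u v assume "{u, v} \<in> image (relabel_south \<pi>) ` D"
      then obtain P where P: "P \<in> D" "{u, v} = relabel_south \<pi> ` P" by auto
      obtain x y where xy: "P = {x, y}" using P(1) D unfolding walled_diagrams_iff by meson
      have "node_color c d (relabel_south \<pi> x) = node_color c d (relabel_south \<pi> y)"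
        using * P(1) xy unfolding compatible_def col by blast
      thus "node_color c d u = node_color c d v" using P(2) xy by (auto simp: doubleton_eq_iff)
    qed
  qed
qed

lemma relabel_south_walled:
  assumes D: "D \<in> walled_diagrams r s a b" and \<pi>: "\<pi> permutes {1..a + b}" "\<And>j. \<pi> j \<le> a \<longleftrightarrow> j \<le> a"
  shows "image (relabel_south \<pi>) ` D \<in> walled_diagrams r s a b"
proof (rule walled_diagramsI)
  let ?\<rho> = "relabel_south \<pi>"
  have inj: "inj ?\<rho>" by (rule relabel_south_inj) (rule permutes_inj[OF \<pi>(1)])
  have plus: "plus_node r a (?\<rho> u) \<longleftrightarrow> plus_node r a u" for u
    using \<pi>(2) by (cases u) (auto simp flip: not_le)
  show "\<exists>u v. P = {u, v} \<and> plus_node r a u \<and> \<not> plus_node r a v" if P: "P \<in> image ?\<rho> ` D" for P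
  proof -
    obtain Q where Q: "Q \<in> D" "P = ?\<rho> ` Q" using P by auto
    then obtain u v where "Q = {u, v}" "plus_node r a u" "\<not> plus_node r a v"
      using D unfolding walled_diagrams_iff by meson
    hence "P = {?\<rho> u, ?\<rho> v} \<and> plus_node r a (?\<rho> u) \<and> \<not> plus_node r a (?\<rho> v)"
      using Q by (simp add: plus)
    thus ?thesis by blast
  qed
  have "\<Union>(image ?\<rho> ` D) = ?\<rho> ` \<Union>D" by auto
  also have "\<Union>D = nodes (r + s) (a + b)" using D by (simp add: walled_diagrams_iff partition_on_def)
  also have "?\<rho> ` nodes (r + s) (a + b) = North ` {1..r + s} \<union> South ` \<pi> ` {1..a + b}"
    by (simp add: nodes_def image_Un image_image)
  also have "\<dots> = nodes (r + s) (a + b)" by (simp only: permutes_image[OF \<pi>(1)] nodes_def)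
  finally show "\<Union>(image ?\<rho> ` D) = nodes (r + s) (a + b)" .
  fix u v w assume uv: "{u, v} \<in> image ?\<rho> ` D" and uw: "{u, w} \<in> image ?\<rho> ` D"
  then obtain P Q where P: "P \<in> D" "{u, v} = ?\<rho> ` P" and Q: "Q \<in> D" "{u, w} = ?\<rho> ` Q" by auto
  have "u \<in> ?\<rho> ` P" "u \<in> ?\<rho> ` Q" using P(2) Q(2) by auto
  then obtain x where x: "x \<in> P" "x \<in> Q" using inj by (auto dest: injD)
  have "disjoint D" using D by (simp add: walled_diagrams_iff partition_on_def)
  hence "P = Q" using disjointD[of D P Q] P(1) Q(1) x by blast
  hence "{u, v} = {u, w}" using P Q by simp
  thus "v = w" by (auto simp: doubleton_eq_iff)
qed

lemma relabel_south_half_iff: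
  assumes t: "t \<le> r" and D: "D \<in> walled_diagrams r s (r - t) (s - t)"
    and \<pi>: "\<pi> permutes {1..(r - t) + (s - t)}" "\<And>j. \<pi> j \<le> r - t \<longleftrightarrow> j \<le> r - t"
  shows "image (relabel_south \<pi>) ` D \<in> half_diagrams r s t \<longleftrightarrow> D \<in> half_diagrams r s t"
proof
  assume *: "image (relabel_south \<pi>) ` D \<in> half_diagrams r s t"
  show "D \<in> half_diagrams r s t"
  proof (rule half_diagramsI[OF t D])
    fix i j show "{South i, South j} \<notin> D"
    proof
      assume "{South i, South j} \<in> D"
      hence "relabel_south \<pi> ` {South i, South j} \<in> image (relabel_south \<pi>) ` D" by (rule imageI)
      thus False using half_diagram_no_arc[OF *] by simp
    qed
  qed
next
  assume *: "D \<in> half_diagrams r s t"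
  show "image (relabel_south \<pi>) ` D \<in> half_diagrams r s t"
  proof (rule half_diagramsI[OF t relabel_south_walled[OF D \<pi>]])
    fix i j show "{South i, South j} \<notin> image (relabel_south \<pi>) ` D"
    proof
      assume "{South i, South j} \<in> image (relabel_south \<pi>) ` D"
      then obtain P where P: "P \<in> D" "{South i, South j} = relabel_south \<pi> ` P" by auto
      obtain x y where xy: "P = {x, y}" using P(1) D unfolding walled_diagrams_iff by meson
      have "South i = relabel_south \<pi> x \<and> South j = relabel_south \<pi> y \<or>
          South i = relabel_south \<pi> y \<and> South j = relabel_south \<pi> x"
        using P(2) xy by (auto simp: doubleton_eq_iff)
      thus False using half_diagram_no_arc[OF *] P(1) xy by (cases x; cases y) auto
    qed
  qed
qed

lemma colorings_permute:
  assumes "\<pi> permutes {1..m}" "d \<in> colorings n m"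
  shows "d \<circ> \<pi> \<in> colorings n m"
  using assms(2) permutes_in_image[OF assms(1)] permutes_not_in[OF assms(1)]
  unfolding colorings_def PiE_def extensional_def by (auto simp: Pi_iff)

text \<open>
  Both sides of each equation are read off from the number of compatible colourings of the middle
  nodes, for colourings that determine the concatenated diagram.
\<close>

lemma concat_relabel_south:
  assumes A: "A \<in> walled_diagrams r s r s" and D: "D \<in> walled_diagrams r s a b"
    and \<pi>: "\<pi> permutes {1..a + b}" "\<And>j. \<pi> j \<le> a \<longleftrightarrow> j \<le> a"
  shows "diagram_concat A (image (relabel_south \<pi>) ` D) = image (relabel_south \<pi>) ` diagram_concat A D"
    and "closed_components A (image (relabel_south \<pi>) ` D) = closed_components A D"
proof -
  let ?\<rho> = "\<lambda>D. image (relabel_south \<pi>) ` D"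
  \<comment> \<open>The first two summands give enough colours to separate diagrams; the last one
    ensures \<open>n > 1\<close>, so that a power of \<open>n\<close> determines its
    exponent.\<close>
  define n where "n = (r + s) + (a + b) + 2"
  interpret AD: stacked_diagrams A D r s r s a b using A D by unfold_locales
  interpret AD': stacked_diagrams A "?\<rho> D" r s r s a b
    using A relabel_south_walled[OF D \<pi>] by unfold_locales
  have n: "(r + s) + (a + b) \<le> n" "n > 1" by (simp_all add: n_def)
  obtain c d where cd: "c \<in> colorings n (r + s)" "d \<in> colorings n (a + b)"
    and sep: "\<And>B. B \<in> walled_diagrams r s a b \<Longrightarrow> compatible B c d \<longleftrightarrow> B = diagram_concat A (?\<rho> D)"
    using separating_coloring[OF AD'.diagram_concat_walled n(1)] by metis
  have "(if compatible (diagram_concat A (?\<rho> D)) c d then n ^ closed_components A (?\<rho> D) else 0) =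
    (if compatible (diagram_concat A D) c (d \<circ> \<pi>) then n ^ closed_components A D else 0)"
    using AD'.card_middle_colorings[OF cd] AD.card_middle_colorings[OF cd(1) colorings_permute[OF \<pi>(1) cd(2)]]
    by (simp only: compatible_relabel_south[OF D])
  moreover have "compatible (diagram_concat A (?\<rho> D)) c d"
    using sep[OF AD'.diagram_concat_walled] by simp
  ultimately have "compatible (diagram_concat A D) c (d \<circ> \<pi>)"
    and "n ^ closed_components A (?\<rho> D) = n ^ closed_components A D"
    using n(2) by (auto split: if_splits)
  thus "diagram_concat A (?\<rho> D) = ?\<rho> (diagram_concat A D)"
    and "closed_components A (?\<rho> D) = closed_components A D"
    using sep[OF relabel_south_walled[OF AD.diagram_concat_walled \<pi>]]
      compatible_relabel_south[OF AD.diagram_concat_walled] n(2) by (auto simp: power_inject_exp)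
qed

lemma perm_tabloid_row_sets:
  assumes p: "p permutes {1..a}" and e: "\<And>x. x \<in> {1..a} \<Longrightarrow> e x = e' (p x)"
  shows "perm_tabloid p (row_sets a e) = row_sets a e'"
proof (rule ext)
  fix i
  have "p ` {x \<in> {1..a}. e x = i} = p ` {x \<in> {1..a}. e' (p x) = i}" using e by (intro arg_cong[of _ _ "image p"]) auto
  also have "\<dots> = {z \<in> p ` {1..a}. e' z = i}" by auto
  finally show "perm_tabloid p (row_sets a e) i = row_sets a e' i"
    by (simp only: perm_tabloid_def row_sets_def permutes_image[OF p])
qed

text \<open>Substituting \<open>d \<circ> \<pi>\<close> for the southern colouring moves the
  permutation from the diagram to the tensor. This makes the map to tensor space respect the tensor
  product over the group algebra.\<close>

lemma diagram_op_relabel_south: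
  fixes v :: "tabloid \<times> tabloid \<Rightarrow> 'k::comm_ring_1"
  assumes D: "D \<in> walled_diagrams r s a b" and \<sigma>: "\<sigma> permutes {1..a}" and \<tau>: "\<tau> permutes {1..b}"
  shows "diagram_op n (r + s) (a + b) (perm_south a D (\<sigma>, \<tau>)) (tensor_of n a b v) =
         diagram_op n (r + s) (a + b) D (tensor_of n a b (perm_act (\<sigma>, \<tau>) v))"
proof
  fix c
  let ?\<pi> = "south_perm a (\<sigma>, \<tau>)"
  note \<pi> = south_perm[OF \<sigma> \<tau>]
  have tensor: "tensor_of n a b (perm_act (\<sigma>, \<tau>) v) (d \<circ> ?\<pi>) = tensor_of n a b v d"
    if d: "d \<in> colorings n (a + b)" for d
  proof -
    have "perm_tabloid (inv_into UNIV \<sigma>) (row_sets a (d \<circ> ?\<pi>)) = row_sets a d"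
      by (rule perm_tabloid_row_sets) (use permutes_inv[OF \<sigma>] \<pi>(3) in auto)
    moreover have "perm_tabloid (inv_into UNIV \<tau>) (row_sets b (right_rows n a (d \<circ> ?\<pi>))) =
      row_sets b (right_rows n a d)"
      by (rule perm_tabloid_row_sets) (use permutes_inv[OF \<tau>] \<pi>(4) in \<open>auto simp: right_rows_def\<close>)
    ultimately show ?thesis using d colorings_permute[OF \<pi>(1) d]
      by (simp add: tensor_of_def perm_act_def)
  qed
  have "(\<Sum>d\<in>colorings n (a + b). diagram_matrix (perm_south a D (\<sigma>, \<tau>)) c d * tensor_of n a b v d) =
    (\<Sum>d\<in>colorings n (a + b). diagram_matrix D c d * tensor_of n a b (perm_act (\<sigma>, \<tau>) v) d)"
  proof (rule sum.reindex_bij_witness[of _ "\<lambda>d. d \<circ> inv_into UNIV ?\<pi>" "\<lambda>d. d \<circ> ?\<pi>"])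
    fix d assume d: "d \<in> colorings n (a + b)"
    show "d \<circ> ?\<pi> \<circ> inv_into UNIV ?\<pi> = d" "d \<circ> inv_into UNIV ?\<pi> \<circ> ?\<pi> = d"
      using permutes_inv_o[OF \<pi>(1)] by (simp_all add: o_assoc[symmetric] comp_assoc)
    show "d \<circ> ?\<pi> \<in> colorings n (a + b)" "d \<circ> inv_into UNIV ?\<pi> \<in> colorings n (a + b)"
      using colorings_permute[OF \<pi>(1) d] colorings_permute[OF permutes_inv[OF \<pi>(1)] d] by auto
    show "diagram_matrix D c (d \<circ> ?\<pi>) * tensor_of n a b (perm_act (\<sigma>, \<tau>) v) (d \<circ> ?\<pi>) =
      diagram_matrix (perm_south a D (\<sigma>, \<tau>)) c d * tensor_of n a b v d"
      unfolding tensor[OF d] by (simp add: diagram_matrix_def perm_south_eq compatible_relabel_south[OF D])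
  qed
  thus "diagram_op n (r + s) (a + b) (perm_south a D (\<sigma>, \<tau>)) (tensor_of n a b v) c =
         diagram_op n (r + s) (a + b) D (tensor_of n a b (perm_act (\<sigma>, \<tau>) v)) c"
    by (simp add: diagram_op_def matrix_op_def)
qed

section \<open>Heads of quotient modules\<close>

lemma independent_supported_on:
  fixes B :: "('x \<Rightarrow> 'k::field) set"
  assumes X: "finite X" and B: "function_space.independent B" "B \<subseteq> supported_on X"
  shows "finite B \<and> card B \<le> card X"
proof -
  have "supported_on X \<subseteq> function_space.span ((unit_at :: 'x \<Rightarrow> 'x \<Rightarrow> 'k) ` X)"
  proof
    fix f :: "'x \<Rightarrow> 'k" assume f: "f \<in> supported_on X"
    have "f = (\<Sum>x\<in>X. (\<lambda>y. f x * unit_at x y))"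
    proof
      fix y
      have "(\<Sum>x\<in>X. (\<lambda>y. f x * unit_at x y)) y = (\<Sum>x\<in>X. f x * unit_at x y)"
        using X by (induction X rule: finite_induct) auto
      also have "\<dots> = (\<Sum>x\<in>X. if x = y then f x else 0)" by (rule sum.cong) (auto simp: unit_at_def)
      also have "\<dots> = f y" using f X by (auto simp: supported_on_def)
      finally show "f y = (\<Sum>x\<in>X. (\<lambda>y. f x * unit_at x y)) y" ..
    qed
    also have "\<dots> \<in> function_space.span (unit_at ` X)"
      by (intro function_space.span_sum function_space.span_scale function_space.span_base) auto
    finally show "f \<in> function_space.span (unit_at ` X)" .
  qed
  hence "finite B \<and> card B \<le> card ((unit_at :: 'x \<Rightarrow> 'x \<Rightarrow> 'k) ` X)"
    using function_space.independent_span_bound[OF _ B(1)] X B(2) by (meson finite_imageI order_trans)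
  thus ?thesis using card_image_le[OF X] by (meson order_trans)
qed

text \<open>The dimension of a subspace of a finite-dimensional space of functions, used as a
  bounded and strictly monotone measure on chains of subspaces.\<close>

definition function_rank :: "('x \<Rightarrow> 'k::field) set \<Rightarrow> nat" where
  "function_rank U = Max {card B | B. function_space.independent B \<and> B \<subseteq> U}"

lemma function_rank_bounded:
  assumes X: "finite X" and U: "U \<subseteq> supported_on X"
  shows "finite {card B | B. function_space.independent B \<and> B \<subseteq> U}"
    and "function_rank U \<le> card X"
proof -
  let ?C = "{card B | B. function_space.independent B \<and> B \<subseteq> U}"
  have sub: "?C \<subseteq> {..card X}" using independent_supported_on[OF X] U by blast
  thus fin: "finite ?C" by (rule finite_subset) simp
  have "0 \<in> ?C" using function_space.independent_empty by (intro CollectI exI[of _ "{}"]) auto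
  hence "Max ?C \<in> ?C" using fin by (intro Max_in) auto
  thus "function_rank U \<le> card X" using sub by (auto simp: function_rank_def)
qed

lemma function_rank_less:
  assumes X: "finite X" and V: "V \<subseteq> supported_on X" and UV: "U \<subset> V"
    and U: "function_space.subspace U"
  shows "function_rank U < function_rank V"
proof -
  let ?C = "\<lambda>U. {card B | B. function_space.independent B \<and> B \<subseteq> U}"
  have "U \<subseteq> supported_on X" using UV V by auto
  hence fin: "finite (?C U)" "finite (?C V)"
    using function_rank_bounded(1)[OF X, of U] function_rank_bounded(1)[OF X V] by simp_all
  have "0 \<in> ?C U" using function_space.independent_empty by (intro CollectI exI[of _ "{}"]) auto
  hence "Max (?C U) \<in> ?C U" using fin by (intro Max_in) auto
  then obtain B where B: "function_space.independent B" "B \<subseteq> U" "card B = function_rank U"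
    by (auto simp: function_rank_def)
  obtain x where x: "x \<in> V" "x \<notin> U" using UV by auto
  have "function_space.span B \<subseteq> U" using function_space.span_minimal[OF B(2) U] .
  hence "x \<notin> function_space.span B" using x by auto
  hence "function_space.independent (insert x B)"
    using function_space.independent_insertI B(1) by blast
  moreover have "insert x B \<subseteq> V" using x B UV by auto
  ultimately have "card (insert x B) \<in> ?C V" by blast
  hence "card (insert x B) \<le> function_rank V" unfolding function_rank_def using fin by (intro Max_ge)
  moreover have "card (insert x B) = Suc (card B)"
    using x B UV V independent_supported_on[OF X B(1)] by (subst card_insert_disjoint) auto
  ultimately show ?thesis using B(3) by simp
qed

text \<open>The model for \<open>M / N\<close> is a cell module, with \<open>\<Psi>\<close> its map
  to tensor space. A \<open>submodule\<close> is an additive subgroup stable under \<open>R\<close>;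
  the assumption \<open>scalars\<close> makes its preimage stable under the field too. It asks for
  scalars only modulo the kernel of \<open>\<Psi>\<close>, where they can be verified on
  matrices.\<close>

locale quotient_with_image =
  fixes R :: "'a ring" and M :: "('a, 'y \<Rightarrow> 'k::field) module" and N :: "('y \<Rightarrow> 'k) set"
    and \<Psi> :: "('y \<Rightarrow> 'k) \<Rightarrow> 'c \<Rightarrow> 'k" and X :: "'c set"
  assumes zero: "\<zero>\<^bsub>M\<^esub> = 0" and add: "\<And>x y. x \<oplus>\<^bsub>M\<^esub> y = x + y"
    and subspace_M: "function_space.subspace (carrier M)" and subspace_N: "function_space.subspace N"
    and smult_closed: "\<And>a x. a \<in> carrier R \<Longrightarrow> x \<in> carrier M \<Longrightarrow> a \<odot>\<^bsub>M\<^esub> x \<in> carrier M"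
    and smult_N: "\<And>a x. a \<in> carrier R \<Longrightarrow> x \<in> N \<Longrightarrow> a \<odot>\<^bsub>M\<^esub> x \<in> N"
    and smult_add: "\<And>a x y. a \<in> carrier R \<Longrightarrow> a \<odot>\<^bsub>M\<^esub> (x + y) = a \<odot>\<^bsub>M\<^esub> x + a \<odot>\<^bsub>M\<^esub> y"
    and image_add: "\<And>x y. \<Psi> (x + y) = \<Psi> x + \<Psi> y"
    and image_scale: "\<And>z x. \<Psi> (\<lambda>y. z * x y) = (\<lambda>c. z * \<Psi> x c)"
    and image_N: "\<And>x. x \<in> N \<Longrightarrow> \<Psi> x = 0"
    and image_smult_0: "\<And>a x. a \<in> carrier R \<Longrightarrow> x \<in> carrier M \<Longrightarrow> \<Psi> x = 0 \<Longrightarrow> \<Psi> (a \<odot>\<^bsub>M\<^esub> x) = 0"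
    and scalars: "\<And>z. \<exists>\<zeta>\<in>carrier R. \<forall>x\<in>carrier M. \<Psi> (\<zeta> \<odot>\<^bsub>M\<^esub> x) = (\<lambda>c. z * \<Psi> x c)"
    and image_supported: "\<And>x. \<Psi> x \<in> supported_on X" and finite_X: "finite X"
    and image_nonzero: "\<exists>x\<in>carrier M. \<Psi> x \<noteq> 0"
begin

abbreviation coset :: "('y \<Rightarrow> 'k) \<Rightarrow> ('y \<Rightarrow> 'k) set" where
  "coset x \<equiv> N +>\<^bsub>M\<^esub> x"

abbreviation "Q \<equiv> quotient_module M N"

lemma N_zero: "0 \<in> N" and N_add: "x \<in> N \<Longrightarrow> y \<in> N \<Longrightarrow> x + y \<in> N" and N_neg: "x \<in> N \<Longrightarrow> - x \<in> N"
  and N_diff: "x \<in> N \<Longrightarrow> y \<in> N \<Longrightarrow> x - y \<in> N"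
  using subspace_N function_space.subspace_0 function_space.subspace_add function_space.subspace_neg
    function_space.subspace_diff by blast+

lemma mem_coset: "y \<in> coset x \<longleftrightarrow> y - x \<in> N"
  unfolding a_r_coset_def' add by (auto intro: bexI[of _ "y - x"])

lemma coset_eq_iff: "coset x = coset y \<longleftrightarrow> x - y \<in> N"
proof
  assume "coset x = coset y"
  hence "x \<in> coset y" using mem_coset[of x x] N_zero by simp
  thus "x - y \<in> N" by (simp add: mem_coset)
next
  assume xy: "x - y \<in> N"
  have "z - x \<in> N \<longleftrightarrow> z - y \<in> N" for z
    using N_add[of "z - x" "x - y"] N_diff[of "z - y" "x - y"] xy by auto
  thus "coset x = coset y" by (auto simp: mem_coset)
qed

lemma coset_0: "coset 0 = N"
  by (auto simp: mem_coset)

lemma carrier_Q: "carrier Q = coset ` carrier M"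
  by (auto simp: quotient_module_def A_RCOSETS_def')

lemma add_Q: "coset x \<oplus>\<^bsub>Q\<^esub> coset y = coset (x + y)"
proof -
  have "z \<in> coset x <+>\<^bsub>M\<^esub> coset y \<longleftrightarrow> z \<in> coset (x + y)" for z
  proof
    assume "z \<in> coset x <+>\<^bsub>M\<^esub> coset y"
    then obtain u v where uv: "u - x \<in> N" "v - y \<in> N" "z = u + v"
      unfolding set_add_def' add by (auto simp: mem_coset)
    thus "z \<in> coset (x + y)" using N_add[OF uv(1,2)] by (simp add: mem_coset algebra_simps)
  next
    assume "z \<in> coset (x + y)"
    hence "z - y \<in> coset x" "y \<in> coset y" using N_zero by (simp_all add: mem_coset algebra_simps)
    moreover have "z = (z - y) + y" by simp
    ultimately show "z \<in> coset x <+>\<^bsub>M\<^esub> coset y" unfolding set_add_def' add by blast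
  qed
  thus ?thesis by (auto simp: quotient_module_def)
qed

lemma smult_Q:
  assumes "a \<in> carrier R"
  shows "a \<odot>\<^bsub>Q\<^esub> coset x = coset (a \<odot>\<^bsub>M\<^esub> x)"
proof -
  have const: "coset (a \<odot>\<^bsub>M\<^esub> y) = coset (a \<odot>\<^bsub>M\<^esub> x)" if "y \<in> coset x" for y
  proof -
    have "a \<odot>\<^bsub>M\<^esub> y = a \<odot>\<^bsub>M\<^esub> x + a \<odot>\<^bsub>M\<^esub> (y - x)" using smult_add[OF assms, of x "y - x"] by simp
    thus ?thesis using smult_N[OF assms] that by (simp add: coset_eq_iff mem_coset)
  qed
  have "x \<in> coset x" using N_zero by (simp add: mem_coset)
  have "a \<odot>\<^bsub>Q\<^esub> coset x = (\<Union>y\<in>coset x. coset (a \<odot>\<^bsub>M\<^esub> y))" by (simp add: quotient_module_def)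
  also have "\<dots> = (\<Union>y\<in>coset x. coset (a \<odot>\<^bsub>M\<^esub> x))" by (rule SUP_cong[OF refl]) (rule const)
  also have "\<dots> = coset (a \<odot>\<^bsub>M\<^esub> x)" using \<open>x \<in> coset x\<close> by blast
  finally show ?thesis .
qed

lemma zero_Q: "\<zero>\<^bsub>Q\<^esub> = coset 0"
  by (simp add: quotient_module_def coset_0)

lemma M_diff: "x \<in> carrier M \<Longrightarrow> y \<in> carrier M \<Longrightarrow> x - y \<in> carrier M"
  by (rule function_space.subspace_diff[OF subspace_M])

lemma M_add: "x \<in> carrier M \<Longrightarrow> y \<in> carrier M \<Longrightarrow> x + y \<in> carrier M"
  by (rule function_space.subspace_add[OF subspace_M])

lemma M_neg: "x \<in> carrier M \<Longrightarrow> - x \<in> carrier M"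
  by (rule function_space.subspace_neg[OF subspace_M])

lemma M_zero: "0 \<in> carrier M"
  by (rule function_space.subspace_0[OF subspace_M])

lemma M_scale: "x \<in> carrier M \<Longrightarrow> (\<lambda>y. z * x y) \<in> carrier M"
  by (rule function_space.subspace_scale[OF subspace_M])

lemma inv_Q:
  assumes "x \<in> carrier M"
  shows "inv\<^bsub>add_monoid Q\<^esub> (coset x) = coset (- x)"
proof -
  have "(THE y. y \<in> carrier Q \<and> coset x \<oplus>\<^bsub>Q\<^esub> y = \<zero>\<^bsub>Q\<^esub> \<and> y \<oplus>\<^bsub>Q\<^esub> coset x = \<zero>\<^bsub>Q\<^esub>) = coset (- x)"
  proof (rule the_equality)
    show "coset (- x) \<in> carrier Q \<and> coset x \<oplus>\<^bsub>Q\<^esub> coset (- x) = \<zero>\<^bsub>Q\<^esub> \<and> coset (- x) \<oplus>\<^bsub>Q\<^esub> coset x = \<zero>\<^bsub>Q\<^esub>"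
      using M_neg[OF assms] by (auto simp: carrier_Q add_Q zero_Q)
    fix y assume y: "y \<in> carrier Q \<and> coset x \<oplus>\<^bsub>Q\<^esub> y = \<zero>\<^bsub>Q\<^esub> \<and> y \<oplus>\<^bsub>Q\<^esub> coset x = \<zero>\<^bsub>Q\<^esub>"
    then obtain z where z: "y = coset z" by (auto simp: carrier_Q)
    have "x + z \<in> N" using y by (simp add: z add_Q zero_Q coset_eq_iff)
    thus "y = coset (- x)" by (simp add: z coset_eq_iff add.commute)
  qed
  thus ?thesis by (simp add: m_inv_def)
qed

text \<open>Submodules of the quotient, in terms of their preimages.\<close>

definition stable :: "('y \<Rightarrow> 'k) set \<Rightarrow> bool" where
  "stable U \<longleftrightarrow> function_space.subspace U \<and> {x \<in> carrier M. \<Psi> x = 0} \<subseteq> U \<and> U \<subseteq> carrier M \<and>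
     (\<forall>a\<in>carrier R. \<forall>x\<in>U. a \<odot>\<^bsub>M\<^esub> x \<in> U)"

lemma submodule_coset_image:
  assumes "stable U"
  shows "submodule (coset ` U) R Q"
proof -
  have U: "function_space.subspace U" "U \<subseteq> carrier M" "\<And>a x. a \<in> carrier R \<Longrightarrow> x \<in> U \<Longrightarrow> a \<odot>\<^bsub>M\<^esub> x \<in> U"
    using assms by (auto simp: stable_def)
  note sub = function_space.subspace_0[OF U(1)] function_space.subspace_add[OF U(1)]
    function_space.subspace_neg[OF U(1)]
  show ?thesis
  proof (intro submodule.intro subgroup.intro submodule_axioms.intro)
    show "coset ` U \<subseteq> carrier (add_monoid Q)" using U(2) by (auto simp: carrier_Q)
    show "x \<otimes>\<^bsub>add_monoid Q\<^esub> y \<in> coset ` U" if "x \<in> coset ` U" "y \<in> coset ` U" for x y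
      using that sub(2) by (auto simp: add_Q)
    show "\<one>\<^bsub>add_monoid Q\<^esub> \<in> coset ` U" using sub(1) by (auto simp: zero_Q)
    show "inv\<^bsub>add_monoid Q\<^esub> x \<in> coset ` U" if "x \<in> coset ` U" for x
      using that U(2) sub(3) inv_Q by (auto simp: subset_iff)
    show "a \<odot>\<^bsub>Q\<^esub> x \<in> coset ` U" if "a \<in> carrier R" "x \<in> coset ` U" for a x
      using that U(3) by (auto simp: smult_Q)
  qed
qed

lemma submodule_preimage:
  assumes K: "submodule K R Q" and U: "stable U" "coset ` U \<subseteq> K"
  shows "stable {x \<in> carrier M. coset x \<in> K}" (is "stable ?V")
    and "coset ` {x \<in> carrier M. coset x \<in> K} = K"
proof -
  interpret K: submodule K R Q by (rule K)
  have UV: "U \<subseteq> ?V" using U by (auto simp: stable_def)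
  have ker: "{x \<in> carrier M. \<Psi> x = 0} \<subseteq> ?V" using U UV by (auto simp: stable_def)
  have V_add: "x + y \<in> ?V" if "x \<in> ?V" "y \<in> ?V" for x y
    using that K.m_closed[of "coset x" "coset y"] M_add by (simp add: add_Q)
  have V_smult: "a \<odot>\<^bsub>M\<^esub> x \<in> ?V" if "a \<in> carrier R" "x \<in> ?V" for a x
    using that K.smult_closed[of a "coset x"] smult_closed by (simp add: smult_Q)
  have V_scale: "(\<lambda>y. z * x y) \<in> ?V" if x: "x \<in> ?V" for z x
  proof -
    obtain \<zeta> where \<zeta>: "\<zeta> \<in> carrier R" "\<forall>x\<in>carrier M. \<Psi> (\<zeta> \<odot>\<^bsub>M\<^esub> x) = (\<lambda>c. z * \<Psi> x c)"
      using scalars by blast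
    \<comment> \<open>\<open>\<zeta>\<close> acts as the scalar \<open>z\<close> only after applying
      \<open>\<Psi>\<close>; the error \<open>d\<close> lies in the kernel of \<open>\<Psi>\<close>,
      which the preimage contains.\<close>
    define d where "d = (\<lambda>y. z * x y) - \<zeta> \<odot>\<^bsub>M\<^esub> x"
    have xM: "x \<in> carrier M" using x by simp
    have neg: "\<Psi> (- y) = - \<Psi> y" for y
      using image_scale[of "- 1" y] by (simp add: fun_eq_iff fun_Compl_def)
    have "\<Psi> d = \<Psi> (\<lambda>y. z * x y) + \<Psi> (- (\<zeta> \<odot>\<^bsub>M\<^esub> x))"
      unfolding d_def diff_conv_add_uminus by (rule image_add)
    hence "\<Psi> d = 0" using \<zeta>(2) xM by (simp add: neg image_scale fun_eq_iff)
    moreover have "d \<in> carrier M"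
      unfolding d_def using M_diff[OF M_scale[OF xM] smult_closed[OF \<zeta>(1) xM]] .
    ultimately have "d \<in> ?V" using ker by blast
    hence "d + \<zeta> \<odot>\<^bsub>M\<^esub> x \<in> ?V" by (rule V_add[OF _ V_smult[OF \<zeta>(1) x]])
    moreover have "d + \<zeta> \<odot>\<^bsub>M\<^esub> x = (\<lambda>y. z * x y)" by (simp add: d_def)
    ultimately show ?thesis by (simp only:)
  qed
  have "0 \<in> U" by (rule function_space.subspace_0) (use U(1) in \<open>simp add: stable_def\<close>)
  hence "0 \<in> ?V" using UV by blast
  hence "function_space.subspace ?V"
    by (rule function_space.subspaceI) (fact V_add, fact V_scale)
  thus "stable ?V" unfolding stable_def using ker V_smult by blast
  have "K \<subseteq> carrier Q" using K.subset by simp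
  thus "coset ` ?V = K" unfolding carrier_Q by auto
qed

lemma image_of_subspace:
  assumes "function_space.subspace U"
  shows "function_space.subspace (\<Psi> ` U)"
proof (rule function_space.subspaceI)
  show "0 \<in> \<Psi> ` U"
    using imageI[OF function_space.subspace_0[OF assms], of \<Psi>] image_N[OF N_zero] by simp
  show "x + y \<in> \<Psi> ` U" if "x \<in> \<Psi> ` U" "y \<in> \<Psi> ` U" for x y
  proof -
    obtain x' y' where "x' \<in> U" "y' \<in> U" "x = \<Psi> x'" "y = \<Psi> y'" using \<open>x \<in> \<Psi> ` U\<close> \<open>y \<in> \<Psi> ` U\<close> by auto
    thus ?thesis using imageI[OF function_space.subspace_add[OF assms, of x' y'], of \<Psi>]
      by (simp add: image_add)
  qed
  show "(\<lambda>c. z * x c) \<in> \<Psi> ` U" if "x \<in> \<Psi> ` U" for z x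
  proof -
    obtain x' where "x' \<in> U" "x = \<Psi> x'" using \<open>x \<in> \<Psi> ` U\<close> by auto
    thus ?thesis using imageI[OF function_space.subspace_scale[OF assms, of x' z], of \<Psi>]
      by (simp add: image_scale)
  qed
qed

text \<open>Both sets contain the kernel of \<open>\<Psi>\<close>, so strictness of the inclusion
  survives in the image, where dimensions are finite.\<close>

lemma stable_image_less:
  assumes "stable U" "stable V" "U \<subset> V"
  shows "function_rank (\<Psi> ` U) < function_rank (\<Psi> ` V)"
proof (rule function_rank_less[OF finite_X])
  show "\<Psi> ` V \<subseteq> supported_on X" using image_supported by auto
  show "function_space.subspace (\<Psi> ` U)"
    using assms(1) by (simp add: stable_def image_of_subspace)
  show "\<Psi> ` U \<subset> \<Psi> ` V"
  proof
    show "\<Psi> ` U \<subseteq> \<Psi> ` V" using assms(3) by auto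
    show "\<Psi> ` U \<noteq> \<Psi> ` V"
    proof
      assume eq: "\<Psi> ` U = \<Psi> ` V"
      obtain x where x: "x \<in> V" "x \<notin> U" using assms(3) by auto
      then obtain y where y: "y \<in> U" "\<Psi> x = \<Psi> y" using eq by blast
      have "\<Psi> (x - y) + \<Psi> y = \<Psi> x" using image_add[of "x - y" y] by simp
      hence "\<Psi> (x - y) = 0" using y(2) by simp
      moreover have "x - y \<in> carrier M" using x y assms by (intro M_diff) (auto simp: stable_def)
      ultimately have "x - y \<in> U" using assms(1) by (auto simp: stable_def)
      moreover have sub: "function_space.subspace U" using assms(1) by (simp add: stable_def)
      ultimately have "(x - y) + y \<in> U" using y(1) function_space.subspace_add by blast
      thus False using x by simp
    qed
  qed
qed

text \<open>The kernel of \<open>\<Psi>\<close> is a proper stable set because \<open>\<Psi>\<close>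
  is nonzero on \<open>M\<close>; among the proper stable sets, one whose image has the largest rank
  is maximal.\<close>

lemma maximal_stable:
  obtains U where "stable U" "U \<noteq> carrier M"
    "\<And>V. stable V \<Longrightarrow> U \<subseteq> V \<Longrightarrow> V = U \<or> V = carrier M"
proof -
  let ?P = "\<lambda>U. stable U \<and> U \<noteq> carrier M"
  have "?P {x \<in> carrier M. \<Psi> x = 0}"
  proof
    have "function_space.subspace {x \<in> carrier M. \<Psi> x = 0}"
      using image_N[OF N_zero] M_zero M_add M_scale
      by (intro function_space.subspaceI) (auto simp: image_add image_scale)
    thus "stable {x \<in> carrier M. \<Psi> x = 0}"
      unfolding stable_def using smult_closed image_smult_0 by auto
  qed (use image_nonzero in auto)
  moreover have "function_rank (\<Psi> ` U) \<le> card X" for U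
    by (rule function_rank_bounded(2)[OF finite_X]) (use image_supported in auto)
  ultimately obtain U where U: "?P U" and max: "\<And>V. ?P V \<Longrightarrow> function_rank (\<Psi> ` V) \<le> function_rank (\<Psi> ` U)"
    using ex_has_greatest_nat[of ?P _ "\<lambda>U. function_rank (\<Psi> ` U)" "Suc (card X)"]
    by (metis (no_types, lifting) le_imp_less_Suc)
  have "V = U \<or> V = carrier M" if "stable V" "U \<subseteq> V" for V
    using max[of V] stable_image_less[of U V] U that by (cases "U = V") (auto simp: psubset_eq)
  thus ?thesis using that U by blast
qed

text \<open>If \<open>e\<close> killed the image, then \<open>e M\<close> would lie in the kernel of
  \<open>\<Psi>\<close>, hence in a maximal proper stable set \<open>U\<close>. The radical of
  \<open>Q\<close> is contained in the image of \<open>U\<close> in \<open>Q\<close>, so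
  \<open>e\<close> would act both as zero and as the identity on the nonzero quotient
  \<open>M / U\<close>.\<close>

lemma head_identity_imp_image_nonzero:
  assumes e: "e \<in> carrier R" and id: "\<And>x. x \<in> carrier (head R Q) \<Longrightarrow> e \<odot>\<^bsub>head R Q\<^esub> x = x"
  shows "\<exists>x\<in>carrier M. \<Psi> (e \<odot>\<^bsub>M\<^esub> x) \<noteq> 0"
proof (rule ccontr)
  assume "\<not> ?thesis"
  hence kill: "\<And>x. x \<in> carrier M \<Longrightarrow> \<Psi> (e \<odot>\<^bsub>M\<^esub> x) = 0" by blast
  obtain U where U: "stable U" "U \<noteq> carrier M"
    and max: "\<And>V. stable V \<Longrightarrow> U \<subseteq> V \<Longrightarrow> V = U \<or> V = carrier M" using maximal_stable by blast
  have UM: "U \<subseteq> carrier M" and ker: "{x \<in> carrier M. \<Psi> x = 0} \<subseteq> U"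
    and Usub: "function_space.subspace U" using U by (auto simp: stable_def)
  have coset_U: "x \<in> U" if x: "coset x \<in> coset ` U" "x \<in> carrier M" for x
  proof -
    obtain y where "y \<in> U" "coset x = coset y" using x(1) by blast
    hence y: "y \<in> U" "x - y \<in> N" by (simp_all add: coset_eq_iff)
    hence "x - y \<in> {x \<in> carrier M. \<Psi> x = 0}" using image_N M_diff x(2) UM by auto
    hence "(x - y) + y \<in> U" using ker y(1) function_space.subspace_add[OF Usub] by blast
    thus ?thesis by simp
  qed
  have "maximal_submodule (coset ` U) R Q"
    unfolding maximal_submodule_def
  proof (intro conjI allI impI)
    show "submodule (coset ` U) R Q" by (rule submodule_coset_image[OF U(1)])
    show "coset ` U \<noteq> carrier Q"
    proof
      assume eq: "coset ` U = carrier Q"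
      have "carrier M \<subseteq> U"
      proof
        fix x assume x: "x \<in> carrier M"
        hence "coset x \<in> coset ` U" unfolding eq carrier_Q by (rule imageI)
        thus "x \<in> U" using x by (rule coset_U)
      qed
      thus False using U(2) UM by blast
    qed
    fix K assume K: "submodule K R Q \<and> coset ` U \<subseteq> K"
    let ?V = "{x \<in> carrier M. coset x \<in> K}"
    have V: "stable ?V" "coset ` ?V = K" using submodule_preimage[of K U] K U(1) by auto
    have "U \<subseteq> ?V" using K UM by blast
    from max[OF V(1) this] show "K = coset ` U \<or> K = carrier Q"
    proof
      assume "?V = U"
      hence "coset ` ?V = coset ` U" by (simp only:)
      thus ?thesis unfolding V(2) ..
    next
      assume "?V = carrier M"
      hence "coset ` ?V = coset ` carrier M" by (simp only:)
      thus ?thesis unfolding V(2) carrier_Q ..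
    qed
  qed
  hence rad_sub: "Defs.radical R Q \<subseteq> coset ` U" unfolding Defs.radical_def by blast
  have N_rad: "N \<in> Defs.radical R Q"
  proof -
    have "N \<in> K" if "submodule K R Q" for K
      using subgroup.one_closed[OF submodule.axioms(1)[OF that]] by (simp add: quotient_module_def)
    moreover have "N \<in> carrier Q" using imageI[OF M_zero, of coset] unfolding carrier_Q coset_0 .
    ultimately show ?thesis unfolding Defs.radical_def maximal_submodule_def by blast
  qed
  have carrier_head: "carrier (head R Q) = (\<lambda>x. Defs.radical R Q +>\<^bsub>Q\<^esub> x) ` carrier Q"
    by (auto simp: head_def quotient_module_def[of Q] A_RCOSETS_def')
  have smult_head: "a \<odot>\<^bsub>head R Q\<^esub> Z = (\<Union>x\<in>Z. Defs.radical R Q +>\<^bsub>Q\<^esub> (a \<odot>\<^bsub>Q\<^esub> x))" for a Z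
    by (simp add: head_def quotient_module_def[of Q])
  have "x \<in> U" if x: "x \<in> carrier M" for x
  proof -
    let ?H = "head R Q" and ?X = "Defs.radical R Q +>\<^bsub>Q\<^esub> coset x"
    have "?X \<in> carrier ?H" unfolding carrier_head carrier_Q using x by blast
    hence eX: "e \<odot>\<^bsub>?H\<^esub> ?X = ?X" by (rule id)
    have "N \<oplus>\<^bsub>Q\<^esub> coset x \<in> ?X" unfolding a_r_coset_def'[of Q] using N_rad by blast
    hence x_mem: "coset x \<in> ?X" using add_Q[of 0 x] by (simp add: coset_0)
    have sub: "Defs.radical R Q +>\<^bsub>Q\<^esub> (e \<odot>\<^bsub>Q\<^esub> coset x) \<subseteq> e \<odot>\<^bsub>?H\<^esub> ?X"
      unfolding smult_head using x_mem by (rule UN_upper)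
    have mem: "N \<oplus>\<^bsub>Q\<^esub> (e \<odot>\<^bsub>Q\<^esub> coset x) \<in> Defs.radical R Q +>\<^bsub>Q\<^esub> (e \<odot>\<^bsub>Q\<^esub> coset x)"
      unfolding a_r_coset_def'[of Q] using N_rad by blast
    have eq: "N \<oplus>\<^bsub>Q\<^esub> (e \<odot>\<^bsub>Q\<^esub> coset x) = coset (e \<odot>\<^bsub>M\<^esub> x)"
      using add_Q[of 0 "e \<odot>\<^bsub>M\<^esub> x"] by (simp add: coset_0 smult_Q[OF e])
    have "coset (e \<odot>\<^bsub>M\<^esub> x) \<in> ?X" using subsetD[OF sub mem] unfolding eX eq .
    then obtain k where k: "k \<in> Defs.radical R Q" "coset (e \<odot>\<^bsub>M\<^esub> x) = k \<oplus>\<^bsub>Q\<^esub> coset x"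
      unfolding a_r_coset_def' by blast
    then obtain u where u: "u \<in> U" "k = coset u" using rad_sub by blast
    have ex: "e \<odot>\<^bsub>M\<^esub> x \<in> carrier M" using smult_closed[OF e x] .
    have "e \<odot>\<^bsub>M\<^esub> x \<in> U" using kill[OF x] ex ker by blast
    \<comment> \<open>\<open>e x\<close> agrees with \<open>u + x\<close> modulo \<open>N\<close>,
      where \<open>u\<close> comes from the radical. \<open>U\<close> contains \<open>u\<close> and
      absorbs \<open>N\<close>; as it contains \<open>e x\<close>, it contains
      \<open>x\<close>.\<close>
    moreover have n: "e \<odot>\<^bsub>M\<^esub> x - (u + x) \<in> N" using k u by (simp add: add_Q coset_eq_iff)
    have "e \<odot>\<^bsub>M\<^esub> x - (u + x) \<in> U"
      using image_N[OF n] M_diff[OF ex M_add[of u x]] u UM x ker by blast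
    ultimately have "e \<odot>\<^bsub>M\<^esub> x - (e \<odot>\<^bsub>M\<^esub> x - (u + x)) - u \<in> U"
      using function_space.subspace_diff[OF Usub] u(1) by blast
    thus ?thesis by simp
  qed
  thus False using U(2) UM by blast
qed

end

section \<open>Orbits of the affine Weyl group\<close>

definition int_vector :: "(int \<Rightarrow> int) \<Rightarrow> int \<Rightarrow> real" where
  "int_vector a = (\<lambda>k. of_int (a k))"

lemma finite_weight_indices [simp]: "finite (weight_indices r s)"
  by (simp add: weight_indices_def)

lemma affine_reflection_eq:
  assumes "i \<in> weight_indices r s" "j \<in> weight_indices r s" "i \<noteq> j" "x \<in> weight_space r s"
  shows "affine_reflection r s (unit_at i - unit_at j) N x = x(i := x j + of_int N, j := x i - of_int N)"
proof -
  let ?I = "weight_indices r s"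
  have "weight_inner r s x (unit_at i - unit_at j) =
    (\<Sum>k\<in>?I. (if k = i then x k else 0) - (if k = j then x k else 0))"
    unfolding weight_inner_def by (rule sum.cong) (auto simp: unit_at_def)
  also have "\<dots> = x i - x j" using assms by (simp add: sum_subtractf)
  finally show ?thesis using assms by (auto simp: affine_reflection_def unit_at_def fun_eq_iff)
qed

lemma root_mem:
  assumes "i \<in> weight_indices r s" "j \<in> weight_indices r s" "i \<noteq> j"
  shows "unit_at i - unit_at j \<in> roots r s"
proof (cases "i < j")
  case True
  thus ?thesis using assms unfolding roots_def by blast
next
  case False
  hence "j < i" using assms by simp
  moreover have "unit_at i - unit_at j = - (unit_at j - unit_at i :: int \<Rightarrow> real)" by simp
  ultimately show ?thesis using assms unfolding roots_def by blast
qed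

lemma affine_reflection_Bij:
  assumes "\<beta> \<in> roots r s"
  shows "affine_reflection r s \<beta> N \<in> Bij (weight_space r s)"
proof -
  obtain i j where ij: "i \<in> weight_indices r s" "j \<in> weight_indices r s" "i \<noteq> j"
    "\<beta> = unit_at i - unit_at j"
  proof -
    obtain i j where "i \<in> weight_indices r s" "j \<in> weight_indices r s" "i < j"
      "\<beta> = unit_at i - unit_at j \<or> \<beta> = unit_at j - unit_at i"
      using assms unfolding roots_def by auto
    thus ?thesis using that[of i j] that[of j i] by auto
  qed
  let ?S = "weight_space r s" and ?f = "affine_reflection r s \<beta> N"
  have eq: "?f x = x(i := x j + of_int N, j := x i - of_int N)" if "x \<in> ?S" for x
    unfolding ij(4) by (rule affine_reflection_eq[OF ij(1-3) that])
  have mem: "?f x \<in> ?S" if "x \<in> ?S" for x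
    using that ij unfolding eq[OF that] by (auto simp: weight_space_def supported_on_def)
  have "?f (?f x) = x" if "x \<in> ?S" for x
    unfolding eq[OF mem[OF that]] unfolding eq[OF that] using ij(3) by (auto simp: fun_eq_iff)
  hence "bij_betw ?f ?S ?S"
    using mem by (intro bij_betwI[of _ _ _ ?f]) auto
  thus ?thesis by (simp add: Bij_def affine_reflection_def)
qed

definition in_orbit :: "nat \<Rightarrow> nat \<Rightarrow> nat \<Rightarrow> (int \<Rightarrow> real) \<Rightarrow> (int \<Rightarrow> real) \<Rightarrow> bool" where
  "in_orbit p r s x y \<longleftrightarrow> (\<exists>w\<in>affine_weyl_group p r s. w x = y)"

lemma in_orbit_refl:
  assumes "x \<in> weight_space r s"
  shows "in_orbit p r s x x"
proof -
  have "\<one>\<^bsub>BijGroup (weight_space r s)\<^esub> \<in> affine_weyl_group p r s"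
    unfolding affine_weyl_group_def by (rule generate.one)
  thus ?thesis using assms unfolding in_orbit_def by (intro bexI) (auto simp: BijGroup_def)
qed

lemma in_orbit_step:
  assumes x: "x \<in> weight_space r s" and orb: "in_orbit p r s x (int_vector a)"
    and ij: "i \<in> weight_indices r s" "j \<in> weight_indices r s" "i \<noteq> j"
  shows "in_orbit p r s x (int_vector (a(i := a j + m * int p, j := a i - m * int p)))"
proof -
  let ?S = "weight_space r s" and ?G = "BijGroup (weight_space r s)"
  let ?H = "{affine_reflection r s \<beta> (m * int p) | \<beta> m. \<beta> \<in> roots r s}"
  let ?f = "affine_reflection r s (unit_at i - unit_at j) (m * int p)"
  obtain w where w: "w \<in> affine_weyl_group p r s" "w x = int_vector a"
    using orb by (auto simp: in_orbit_def)
  have carrier: "carrier ?G = Bij ?S" by (simp add: BijGroup_def)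
  have H: "?H \<subseteq> carrier ?G" unfolding carrier using affine_reflection_Bij by blast
  have wB: "w \<in> Bij ?S"
    using group.generate_in_carrier[OF group_BijGroup H, of w] w(1)
    by (simp only: affine_weyl_group_def carrier)
  have f: "?f \<in> ?H" using root_mem[OF ij] by blast
  hence fB: "?f \<in> Bij ?S" using subsetD[OF H] by (simp only: carrier)
  have "?f \<otimes>\<^bsub>?G\<^esub> w \<in> affine_weyl_group p r s"
    unfolding affine_weyl_group_def
    by (rule generate.eng[OF generate.incl[OF f] w(1)[unfolded affine_weyl_group_def]])
  moreover have "(?f \<otimes>\<^bsub>?G\<^esub> w) x = ?f (int_vector a)"
    using wB fB x w(2) by (simp add: BijGroup_def compose_def)
  moreover have "bij_betw w ?S ?S" using wB by (simp add: Bij_def)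
  hence "int_vector a \<in> ?S" using bij_betw_apply[of w ?S ?S x] x w(2) by simp
  hence "?f (int_vector a) = int_vector (a(i := a j + m * int p, j := a i - m * int p))"
    by (subst affine_reflection_eq[OF ij]) (auto simp: int_vector_def fun_eq_iff)
  ultimately show ?thesis unfolding in_orbit_def by metis
qed

text \<open>
  Coordinates are corrected one by one; the reflection in \<open>\<epsilon>\<^sub>i - \<epsilon>\<^sub>j\<close> exchanges two coordinates and
  moves a multiple of \<open>p\<close> from one to the other.
\<close>

lemma in_orbit_if_residues_eq:
  assumes x: "x \<in> weight_space r s" and "in_orbit p r s x (int_vector a)"
    and "S \<subseteq> weight_indices r s" and "\<And>k. k \<notin> S \<Longrightarrow> a k = b k"
    and "image_mset (\<lambda>k. a k mod int p) (mset_set S) = image_mset (\<lambda>k. b k mod int p) (mset_set S)"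
    and "sum a S = sum b S"
  shows "in_orbit p r s x (int_vector b)"
  using assms(2-6)
proof (induction "card S" arbitrary: S a)
  case 0
  have "finite S" using 0 finite_subset[OF _ finite_weight_indices] by blast
  hence "S = {}" using 0 by simp
  hence "a = b" using 0 by auto
  thus ?case using 0 by simp
next
  case (Suc n)
  have fin: "finite S" using Suc.prems finite_subset[OF _ finite_weight_indices] by blast
  then obtain i where i: "i \<in> S" using Suc.hyps(2) by (metis card.empty ex_in_conv nat.distinct(1))
  note I = subsetD[OF Suc.prems(2)]
  have mset_S: "mset_set S = add_mset i (mset_set (S - {i}))" using fin i by (rule mset_set.remove)
  \<comment> \<open>Once coordinate \<open>i\<close> has its final value, it is removed from
    \<open>S\<close> and the induction hypothesis applies.\<close>
  have finish: ?case if a': "in_orbit p r s x (int_vector a')" "a' i = b i"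
    "\<And>k. k \<notin> S \<Longrightarrow> a' k = a k"
    "image_mset (\<lambda>k. a' k mod int p) (mset_set S) = image_mset (\<lambda>k. a k mod int p) (mset_set S)"
    "sum a' S = sum a S" for a'
  proof (rule Suc.hyps(1)[of "S - {i}" a'])
    show "n = card (S - {i})" using Suc.hyps(2) i fin by simp
    show "S - {i} \<subseteq> weight_indices r s" using Suc.prems by blast
    show "a' k = b k" if "k \<notin> S - {i}" for k using that a' Suc.prems by auto
    show "image_mset (\<lambda>k. a' k mod int p) (mset_set (S - {i})) =
      image_mset (\<lambda>k. b k mod int p) (mset_set (S - {i}))"
      using a'(2,4) Suc.prems(4) unfolding mset_S by simp
    show "sum a' (S - {i}) = sum b (S - {i})"
      using a'(2,5) Suc.prems(5) i fin by (simp add: sum_diff1)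
  qed (rule a')
  have swap: "in_orbit p r s x (int_vector c') \<and> (\<forall>k. k \<notin> S \<longrightarrow> c' k = c k) \<and>
    image_mset (\<lambda>k. c' k mod int p) (mset_set S) = image_mset (\<lambda>k. c k mod int p) (mset_set S) \<and>
    sum c' S = sum c S"
    if c: "in_orbit p r s x (int_vector c)" "j \<in> S" "j \<noteq> i"
      "c' = c(i := c j + m * int p, j := c i - m * int p)" for c c' j m
  proof (intro conjI allI impI)
    show "in_orbit p r s x (int_vector c')"
      unfolding c(4) by (rule in_orbit_step[OF x c(1)]) (use I i c in auto)
    show "c' k = c k" if "k \<notin> S" for k using that i c by auto
    have split: "mset_set S = add_mset i (add_mset j (mset_set (S - {i} - {j})))"
      unfolding mset_S using fin c by (simp add: mset_set.remove)
    have rest: "image_mset f (mset_set (S - {i} - {j})) = image_mset g (mset_set (S - {i} - {j}))"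
      if "\<And>k. k \<noteq> i \<Longrightarrow> k \<noteq> j \<Longrightarrow> f k = g k" for f g :: "int \<Rightarrow> int"
      by (rule image_mset_cong) (use that fin in auto)
    show "image_mset (\<lambda>k. c' k mod int p) (mset_set S) = image_mset (\<lambda>k. c k mod int p) (mset_set S)"
      unfolding split using c(3) rest[of "\<lambda>k. c' k mod int p" "\<lambda>k. c k mod int p"]
        mod_mult_self1[of "c i" "- m" "int p"]
      by (simp add: c(4) add_mset_commute)
    have "sum c' S = c' i + (c' j + sum c' (S - {i} - {j}))" "sum c S = c i + (c j + sum c (S - {i} - {j}))"
      using fin i c by (simp_all add: sum.remove)
    moreover have "sum c' (S - {i} - {j}) = sum c (S - {i} - {j})"
      by (rule sum.cong) (auto simp: c(4))
    ultimately show "sum c' S = sum c S" using c(3) by (simp add: c(4))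
  qed
  \<comment> \<open>If coordinate \<open>j\<close> has the residue wanted at \<open>i\<close>, one
    reflection moves it to \<open>i\<close> and corrects it by a multiple of \<open>p\<close>, at
    the expense of coordinate \<open>j\<close>.\<close>
  have shift: ?case if c: "in_orbit p r s x (int_vector c)" "\<And>k. k \<notin> S \<Longrightarrow> c k = a k"
    "image_mset (\<lambda>k. c k mod int p) (mset_set S) = image_mset (\<lambda>k. a k mod int p) (mset_set S)"
    "sum c S = sum a S" and j: "j \<in> S" "j \<noteq> i" "c j mod int p = b i mod int p" for c j
  proof -
    obtain m where m: "b i = c j + m * int p"
      using j(3) by (metis add.commute diff_add_cancel dvd_def mod_eq_dvd_iff mult.commute)
    define c' where "c' = c(i := c j + m * int p, j := c i - m * int p)"
    show ?case
      using swap[OF c(1) j(1,2) c'_def] c j m by (intro finish[of c']) (auto simp: c'_def)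
  qed
  have "b i mod int p \<in># image_mset (\<lambda>k. b k mod int p) (mset_set S)" using i fin by auto
  hence "b i mod int p \<in># image_mset (\<lambda>k. a k mod int p) (mset_set S)" using Suc.prems(4) by simp
  then obtain j where j: "j \<in> S" "a j mod int p = b i mod int p" using fin by auto
  show ?case
  proof (cases "j = i")
    case False
    thus ?thesis using shift[of a j] Suc.prems(1) j by simp
  next
    case ji: True
    show ?thesis
    proof (cases "a i = b i")
      case True
      thus ?thesis using finish[of a] Suc.prems(1) by simp
    next
      case False
      \<comment> \<open>Here the coordinate with the right residue is \<open>i\<close> itself, but
        its value is wrong. Equal sums exclude that it is the only one left; a plain exchange parks
        it at another coordinate \<open>l\<close>, and \<open>shift\<close> brings it back
        corrected.\<close>
      have "S \<noteq> {i}" using False Suc.prems(5) by auto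
      then obtain l where l: "l \<in> S" "l \<noteq> i" using i by blast
      define c where "c = a(i := a l + 0 * int p, l := a i - 0 * int p)"
      show ?thesis
        using swap[OF Suc.prems(1) l c_def] l j ji by (intro shift[of c l]) (auto simp: c_def)
    qed
  qed
qed

definition shifted_weight :: "int \<Rightarrow> nat \<Rightarrow> nat \<Rightarrow> nat list \<times> nat list \<Rightarrow> int \<Rightarrow> int" where
  "shifted_weight \<delta> r s = (\<lambda>(l, m) k.
     if k \<notin> weight_indices r s then 0
     else if k < 0 then - int (part l (nat (- k))) - k
     else int (part m (nat k)) + \<delta> - k + 1)"

lemma int_vector_shifted_weight:
  "int_vector (shifted_weight \<delta> r s lm) = bipartition_weight r s lm + rho \<delta> r s"
  by (auto simp: int_vector_def shifted_weight_def bipartition_weight_def rho_def fun_eq_iff split: prod.splits)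

lemma sum_part: "length l \<le> r \<Longrightarrow> (\<Sum>i\<in>{1..r}. part l i) = sum_list l"
proof -
  assume "length l \<le> r"
  hence "(\<Sum>i\<in>{1..r}. part l i) = (\<Sum>i\<in>{1..length l}. part l i)"
    by (intro sum.mono_neutral_right) (auto simp: part_def)
  also have "\<dots> = card (young_diagram l)" by (simp add: young_diagram_eq)
  finally show ?thesis by (simp add: card_young_diagram)
qed

lemma weight_indices_split:
  "weight_indices r s = (\<lambda>i. - int i) ` {1..r} \<union> int ` {1..s}"
proof (intro equalityI subsetI)
  fix k assume k: "k \<in> weight_indices r s"
  show "k \<in> (\<lambda>i. - int i) ` {1..r} \<union> int ` {1..s}"
  proof (cases "k < 0")
    case True
    hence "k = - int (nat (- k))" "nat (- k) \<in> {1..r}" using k by (auto simp: weight_indices_def)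
    thus ?thesis by blast
  next
    case False
    hence "k = int (nat k)" "nat k \<in> {1..s}" using k by (auto simp: weight_indices_def)
    thus ?thesis by blast
  qed
qed (auto simp: weight_indices_def)

lemma sum_shifted_weight:
  assumes "length l \<le> r" "length m \<le> s"
  shows "sum (shifted_weight \<delta> r s (l, m)) (weight_indices r s) =
    int (sum_list m) - int (sum_list l) + (\<Sum>i\<in>{1..r}. int i) + (\<Sum>j\<in>{1..s}. \<delta> - int j + 1)"
proof -
  let ?f = "shifted_weight \<delta> r s (l, m)"
  have "sum ?f (weight_indices r s) = sum ?f ((\<lambda>i. - int i) ` {1..r}) + sum ?f (int ` {1..s})"
    unfolding weight_indices_split by (rule sum.union_disjoint) auto
  also have "sum ?f ((\<lambda>i. - int i) ` {1..r}) = (\<Sum>i\<in>{1..r}. ?f (- int i))"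
    by (subst sum.reindex) (auto simp: inj_on_def)
  also have "\<dots> = (\<Sum>i\<in>{1..r}. int i - int (part l i))"
    by (rule sum.cong) (auto simp: shifted_weight_def weight_indices_def)
  also have "\<dots> = (\<Sum>i\<in>{1..r}. int i) - int (sum_list l)"
    by (simp add: sum_subtractf flip: sum_part[OF assms(1)])
  also have "sum ?f (int ` {1..s}) = (\<Sum>j\<in>{1..s}. ?f (int j))"
    by (subst sum.reindex) (auto simp: inj_on_def)
  also have "\<dots> = (\<Sum>j\<in>{1..s}. (\<delta> - int j + 1) + int (part m j))"
    by (rule sum.cong) (auto simp: shifted_weight_def weight_indices_def)
  also have "\<dots> = (\<Sum>j\<in>{1..s}. \<delta> - int j + 1) + int (sum_list m)"
    unfolding sum.distrib sum_part[OF assms(2), symmetric] of_nat_sum ..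
  finally show ?thesis by simp
qed

text \<open>
  Up to sign and a shift, the coordinates \<open>w\<^sub>i + n - i\<close> of a weight of \<open>gl\<^sub>n\<close> are those of
  \<open>\<lambda> + \<rho>\<close>, together with \<open>n - i\<close> for \<open>r < i \<le> n - s\<close>.
\<close>

lemma card_gl_weight_residues:
  assumes lm: "length l \<le> r" "length m \<le> s" and n: "r + s \<le> n" "int n mod int p = \<delta> mod int p"
  defines "L \<equiv> \<lambda>i. int (part l i) - int (part m (n + 1 - i)) + int (n - i)"
  shows "card {i \<in> {1..n}. L i mod int p = v mod int p} =
    card {k \<in> weight_indices r s. (\<delta> - shifted_weight \<delta> r s (l, m) k) mod int p = v mod int p} +
    card {i \<in> {r + 1..n - s}. int (n - i) mod int p = v mod int p}"
proof -
  let ?P = "\<lambda>z. z mod int p = v mod int p"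
  \<comment> \<open>The first \<open>r\<close> coordinates of the weight of \<open>gl_n\<close>
    belong to the left partition, the last \<open>s\<close>, read backwards, to the right one; in
    between both partitions contribute zero.\<close>
  let ?f = "\<lambda>i. if i \<le> r then - int i else int (n + 1 - i)"
  let ?O = "{1..r} \<union> {n - s + 1..n}"
  have "{i \<in> {1..n}. ?P (L i)} = {i \<in> ?O. ?P (L i)} \<union> {i \<in> {r + 1..n - s}. ?P (L i)}"
    using n by auto
  hence "card {i \<in> {1..n}. ?P (L i)} = card {i \<in> ?O. ?P (L i)} + card {i \<in> {r + 1..n - s}. ?P (L i)}"
    using n by (auto intro: card_Un_disjoint)
  moreover have "{i \<in> {r + 1..n - s}. ?P (L i)} = {i \<in> {r + 1..n - s}. ?P (int (n - i))}"
    using lm by (auto simp: L_def part_def)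
  moreover have "bij_betw ?f {i \<in> ?O. ?P (L i)}
    {k \<in> weight_indices r s. ?P (\<delta> - shifted_weight \<delta> r s (l, m) k)}"
  proof (rule bij_betwI[where g = "\<lambda>k. if k < 0 then nat (- k) else n + 1 - nat k"])
    have shift: "(int n + z) mod int p = (\<delta> + z) mod int p" for z
      using n(2) by (metis mod_add_cong)
    have right: "shifted_weight \<delta> r s (l, m) (int q) = int (part m q) + \<delta> - int q + 1"
      if "1 \<le> q" "q \<le> s" for q
      using that by (simp add: shifted_weight_def weight_indices_def)
    have L_mod: "L i mod int p = (\<delta> - shifted_weight \<delta> r s (l, m) (?f i)) mod int p" if "i \<in> ?O" for i
    proof (cases "i \<le> r")
      case True
      have sw: "shifted_weight \<delta> r s (l, m) (?f i) = int i - int (part l i)"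
        using True that n by (auto simp: shifted_weight_def weight_indices_def)
      have "length m < n + 1 - i" using True lm n by linarith
      hence "part m (n + 1 - i) = 0" by (simp add: part_def)
      hence L: "L i = int n + (int (part l i) - int i)" using True n by (simp add: L_def)
      have "\<delta> - (int i - int (part l i)) = \<delta> + (int (part l i) - int i)" by simp
      thus ?thesis unfolding sw L shift by (simp only:)
    next
      case False
      hence i: "i \<in> {n - s + 1..n}" using that by auto
      hence i': "i \<le> n" "n + 1 - i \<le> s" "n + 1 - i \<ge> 1" by auto
      have f: "?f i = int (n + 1 - i)" using False by simp
      have sw: "shifted_weight \<delta> r s (l, m) (?f i) = int (part m (n + 1 - i)) + \<delta> - int (n + 1 - i) + 1"
        unfolding f by (rule right) (use i' in auto)
      have "part l i = 0" using False lm by (simp add: part_def)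
      moreover have "int (n - i) = int (n + 1 - i) - 1" using i' by (simp add: of_nat_diff)
      ultimately have "L i = \<delta> - (int (part m (n + 1 - i)) + \<delta> - int (n + 1 - i) + 1)" by (simp add: L_def)
      thus ?thesis unfolding sw by (simp only:)
    qed
    have eq: "?P (L i) \<longleftrightarrow> ?P (\<delta> - shifted_weight \<delta> r s (l, m) (?f i))" if "i \<in> ?O" for i
      unfolding L_mod[OF that] ..
    have f_mem: "?f i \<in> weight_indices r s" if "i \<in> ?O" for i
      using that n by (auto simp: weight_indices_def)
    show "?f \<in> {i \<in> ?O. ?P (L i)} \<rightarrow> {k \<in> weight_indices r s. ?P (\<delta> - shifted_weight \<delta> r s (l, m) k)}"
    proof (rule Pi_I)
      fix i assume "i \<in> {i \<in> ?O. ?P (L i)}"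
      hence i: "i \<in> ?O" "?P (L i)" by blast+
      show "?f i \<in> {k \<in> weight_indices r s. ?P (\<delta> - shifted_weight \<delta> r s (l, m) k)}"
        using f_mem[OF i(1)] eq[OF i(1)] i(2) by blast
    qed
    let ?g = "\<lambda>k. if k < 0 then nat (- k) else n + 1 - nat k"
    have g: "?g k \<in> ?O" "?f (?g k) = k" if "k \<in> weight_indices r s" for k
      using that n by (auto simp: weight_indices_def)
    show "?g \<in> {k \<in> weight_indices r s. ?P (\<delta> - shifted_weight \<delta> r s (l, m) k)} \<rightarrow> {i \<in> ?O. ?P (L i)}"
    proof (rule Pi_I)
      fix k assume "k \<in> {k \<in> weight_indices r s. ?P (\<delta> - shifted_weight \<delta> r s (l, m) k)}"
      hence k: "k \<in> weight_indices r s" "?P (\<delta> - shifted_weight \<delta> r s (l, m) k)" by blast+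
      have "?P (L (?g k))" using eq[OF g(1)[OF k(1)]] k(2) unfolding g(2)[OF k(1)] by blast
      thus "?g k \<in> {i \<in> ?O. ?P (L i)}" using g(1)[OF k(1)] by blast
    qed
    show "?g (?f i) = i" if "i \<in> {i \<in> ?O. ?P (L i)}" for i
      using that n by (auto split: if_splits)
    show "?f (?g k) = k" if "k \<in> {k \<in> weight_indices r s. ?P (\<delta> - shifted_weight \<delta> r s (l, m) k)}" for k
      by (rule g(2)) (use that in blast)
  qed
  ultimately show ?thesis by (simp only: bij_betw_same_card)
qed

text \<open>The middle coordinates are the same for both labels and cancel, and \<open>z\<close> to
  \<open>\<delta> - z\<close> is a bijection on residues. So the two vectors shifted by \<rho> have
  the same multiset of residues; \<open>sums\<close> makes their coordinate sums agree, and the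
  criterion for orbits applies.\<close>

lemma dot_orbit_if_gl_residues_eq:
  fixes lam mu :: "nat list \<times> nat list"
  assumes lam: "lam = (l, m)" "length l \<le> r" "length m \<le> s"
    and mu: "mu = (l', m')" "length l' \<le> r" "length m' \<le> s"
    and sums: "int (sum_list m) - int (sum_list l) = int (sum_list m') - int (sum_list l')"
    and n: "r + s \<le> n" "int n mod int p = \<delta> mod int p"
    and res: "\<And>v. card {i \<in> {1..n}. (int (part l i) - int (part m (n + 1 - i)) + int (n - i)) mod int p = v mod int p}
      = card {i \<in> {1..n}. (int (part l' i) - int (part m' (n + 1 - i)) + int (n - i)) mod int p = v mod int p}"
  shows "bipartition_weight r s mu \<in>
    (\<lambda>w. dot_action \<delta> r s w (bipartition_weight r s lam)) ` affine_weyl_group p r s"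
proof -
  let ?I = "weight_indices r s" and ?a = "shifted_weight \<delta> r s lam" and ?b = "shifted_weight \<delta> r s mu"
  have cards': "card {k \<in> ?I. (\<delta> - ?a k) mod int p = v mod int p} = card {k \<in> ?I. (\<delta> - ?b k) mod int p = v mod int p}" for v
    using res[of v] unfolding lam(1) mu(1) card_gl_weight_residues[OF lam(2,3) n]
      card_gl_weight_residues[OF mu(2,3) n] by (simp only: add_right_cancel)
  have reflect: "(\<delta> - z) mod int p = (\<delta> - v) mod int p \<longleftrightarrow> z mod int p = v mod int p" for z v
    unfolding mod_eq_dvd_iff using dvd_diff_commute[of "int p" z v] by simp
  have cards: "card {k \<in> ?I. ?a k mod int p = v mod int p} = card {k \<in> ?I. ?b k mod int p = v mod int p}" for v
    using cards'[of "\<delta> - v"] unfolding reflect .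
  have "count (image_mset (\<lambda>k. ?a k mod int p) (mset_set ?I)) v = count (image_mset (\<lambda>k. ?b k mod int p) (mset_set ?I)) v" for v
  proof (cases "v mod int p = v")
    case True
    show ?thesis using cards[of v] unfolding True by (simp add: count_image_mset_eq_card_vimage)
  next
    case False
    hence "{k \<in> ?I. ?a k mod int p = v} = {}" "{k \<in> ?I. ?b k mod int p = v} = {}" by auto
    thus ?thesis by (simp only: count_image_mset_eq_card_vimage finite_weight_indices)
  qed
  hence msets: "image_mset (\<lambda>k. ?a k mod int p) (mset_set ?I) = image_mset (\<lambda>k. ?b k mod int p) (mset_set ?I)"
    by (rule multiset_eqI)
  have mem: "int_vector ?a \<in> weight_space r s"
    by (auto simp: int_vector_def shifted_weight_def weight_space_def supported_on_def split: prod.splits)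
  have "in_orbit p r s (int_vector ?a) (int_vector ?b)"
  proof (rule in_orbit_if_residues_eq[OF mem in_orbit_refl[OF mem] subset_refl _ msets])
    show "?a k = ?b k" if "k \<notin> ?I" for k
      using that by (simp add: shifted_weight_def split: prod.splits)
    show "sum ?a ?I = sum ?b ?I"
      unfolding lam(1) mu(1) sum_shifted_weight[OF lam(2,3)] sum_shifted_weight[OF mu(2,3)] sums ..
  qed
  then obtain w where w: "w \<in> affine_weyl_group p r s" "w (int_vector ?a) = int_vector ?b"
    by (auto simp: in_orbit_def)
  have "dot_action \<delta> r s w (bipartition_weight r s lam) = bipartition_weight r s mu"
    using w(2) unfolding dot_action_def int_vector_shifted_weight by simp
  thus ?thesis using w(1) by (metis image_eqI)
qed

section \<open>The map from cell modules to mixed tensor space\<close>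

lemma tensor_of_add: "tensor_of n a b (\<lambda>y. v y + v' y) = (\<lambda>c. tensor_of n a b v c + tensor_of n a b v' c :: 'k::monoid_add)"
  by (auto simp: tensor_of_def)

lemma tensor_of_scale: "tensor_of n a b (\<lambda>y. z * v y) = (\<lambda>c. z * tensor_of n a b v c :: 'k::mult_zero)"
  by (auto simp: tensor_of_def)

lemma diagram_op_add: "diagram_op n m m' D (\<lambda>c. f c + g c) = (\<lambda>c. diagram_op n m m' D f c + diagram_op n m m' D g c)"
  by (auto simp: diagram_op_def matrix_op_def distrib_left sum.distrib fun_eq_iff)

lemma diagram_op_scale: "diagram_op n m m' D (\<lambda>c. z * f c) = (\<lambda>c. z * diagram_op n m m' D f c)"
  by (auto simp: diagram_op_def matrix_op_scale)

lemma gl_pow_sum: "gl_pow r m n k a b (\<lambda>c. \<Sum>i\<in>I. f i c) = (\<lambda>c. \<Sum>i\<in>I. gl_pow r m n k a b (f i) c)"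
proof (induction k arbitrary: a)
  case 0
  show ?case by (simp add: sum_distrib_left)
next
  case (Suc k)
  show ?case unfolding gl_pow.simps Suc.IH gl_op_sum by (rule ext) (rule sum.swap)
qed

lemma casimir_sum: "casimir r m n k (\<lambda>c. \<Sum>i\<in>I. f i c) c = (\<Sum>i\<in>I. casimir r m n k (f i) c)"
  unfolding casimir_def gl_pow_sum by (rule sum.swap)

lemma casimir_scale: "casimir r m n k (\<lambda>c. z * f c) c = z * casimir r m n k f c"
  unfolding casimir_def gl_pow_scale sum_distrib_left ..

lemma element_op_scale: "element_op n r s x (\<lambda>c. z * f c) = (\<lambda>c. z * element_op n r s x f c)"
  by (simp add: element_op_def matrix_op_scale)

lemma element_op_supported: "element_op n r s x f \<in> supported_on (colorings n (r + s))"
  by (simp add: element_op_def matrix_op_supported)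

text \<open>The image of a cell module in mixed tensor space: half diagrams act on tensors of tabloids.\<close>

definition cell_tensor :: "nat \<Rightarrow> nat \<Rightarrow> nat \<Rightarrow> nat \<Rightarrow> (diagram \<times> tabloid \<times> tabloid \<Rightarrow> 'k::field) \<Rightarrow>
    (nat \<Rightarrow> nat) \<Rightarrow> 'k" where
  "cell_tensor n r s t F = (\<lambda>c. \<Sum>D\<in>half_diagrams r s t.
     diagram_op n (r + s) ((r - t) + (s - t)) D (tensor_of n (r - t) (s - t) (\<lambda>y. F (D, y))) c)"

lemma cell_tensor_add: "cell_tensor n r s t (F + G) = cell_tensor n r s t F + cell_tensor n r s t G"
  by (simp add: cell_tensor_def fun_eq_iff tensor_of_add diagram_op_add sum.distrib)

lemma cell_tensor_scale: "cell_tensor n r s t (\<lambda>y. z * F y) = (\<lambda>c. z * cell_tensor n r s t F c)"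
  by (simp add: cell_tensor_def fun_eq_iff tensor_of_scale diagram_op_scale sum_distrib_left)

lemma cell_tensor_supported: "cell_tensor n r s t F \<in> supported_on (colorings n (r + s))"
  unfolding supported_on_def cell_tensor_def
  using supported_on_simps(1)[OF diagram_op_supported] by (auto intro!: sum.neutral)

lemma cell_tensor_unit:
  assumes D: "D \<in> half_diagrams r s t"
  shows "cell_tensor n r s t (pure_tensor (unit_at D) v) =
    diagram_op n (r + s) ((r - t) + (s - t)) D (tensor_of n (r - t) (s - t) v)"
proof
  fix c
  have "cell_tensor n r s t (pure_tensor (unit_at D) v) c = (\<Sum>D'\<in>half_diagrams r s t.
    if D' = D then diagram_op n (r + s) ((r - t) + (s - t)) D' (tensor_of n (r - t) (s - t) v) c else 0)"
    unfolding cell_tensor_def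
  proof (rule sum.cong[OF refl])
    fix D'
    show "diagram_op n (r + s) ((r - t) + (s - t)) D'
        (tensor_of n (r - t) (s - t) (\<lambda>y. pure_tensor (unit_at D) v (D', y))) c =
      (if D' = D then diagram_op n (r + s) ((r - t) + (s - t)) D' (tensor_of n (r - t) (s - t) v) c else 0)"
      by (simp add: pure_tensor_def tensor_of_scale diagram_op_scale unit_at_def)
  qed
  thus "cell_tensor n r s t (pure_tensor (unit_at D) v) c =
    diagram_op n (r + s) ((r - t) + (s - t)) D (tensor_of n (r - t) (s - t) v) c" using D by simp
qed

lemma half_act_add: "half_act \<delta> r s t x (\<lambda>D. f D + g D) C = half_act \<delta> r s t x f C + half_act \<delta> r s t x g C"
  unfolding half_act_def sum.distrib[symmetric] by (intro sum.cong refl) (simp add: algebra_simps)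

lemma half_act_scale: "half_act \<delta> r s t x (\<lambda>D. z * f D) C = z * half_act \<delta> r s t x f C"
  unfolding half_act_def sum_distrib_left by (intro sum.cong refl) (simp add: algebra_simps)

lemma half_act_zero: "half_act \<delta> r s t x (\<lambda>D. 0) C = 0"
  unfolding half_act_def by (intro sum.neutral ballI) simp

lemma half_act_supported: "half_act \<delta> r s t x f \<in> supported_on (half_diagrams r s t)"
  unfolding supported_on_def half_act_def by (auto intro!: sum.neutral simp: unit_at_def)

lemma half_act_unit:
  assumes D: "D \<in> half_diagrams r s t"
  shows "half_act \<delta> r s t x (unit_at D) C = (\<Sum>A\<in>walled_diagrams r s r s.
    if diagram_concat A D \<in> half_diagrams r s t
    then x A * \<delta> ^ closed_components A D * unit_at (diagram_concat A D) C else 0)"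
  unfolding half_act_def
proof (rule sum.cong[OF refl])
  fix A
  have "(\<Sum>D'\<in>half_diagrams r s t. if diagram_concat A D' \<in> half_diagrams r s t
      then x A * unit_at D D' * \<delta> ^ closed_components A D' * unit_at (diagram_concat A D') C else 0) =
    (\<Sum>D'\<in>half_diagrams r s t. if D' = D then (if diagram_concat A D' \<in> half_diagrams r s t
      then x A * \<delta> ^ closed_components A D' * unit_at (diagram_concat A D') C else 0) else 0)"
    by (rule sum.cong) (auto simp: unit_at_def)
  thus "(\<Sum>D'\<in>half_diagrams r s t. if diagram_concat A D' \<in> half_diagrams r s t
      then x A * unit_at D D' * \<delta> ^ closed_components A D' * unit_at (diagram_concat A D') C else 0) =
    (if diagram_concat A D \<in> half_diagrams r s t
     then x A * \<delta> ^ closed_components A D * unit_at (diagram_concat A D) C else 0)"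
    using D by simp
qed

lemma half_tensor_module_simps:
  "carrier (half_tensor_module \<delta> r s t V) = tensor_space (supported_on (half_diagrams r s t)) V"
  "\<zero>\<^bsub>half_tensor_module \<delta> r s t V\<^esub> = 0"
  "F \<oplus>\<^bsub>half_tensor_module \<delta> r s t V\<^esub> G = F + G"
  "x \<odot>\<^bsub>half_tensor_module \<delta> r s t V\<^esub> F = (\<lambda>(C, y). half_act \<delta> r s t x (\<lambda>D. F (D, y)) C)"
  by (simp_all add: half_tensor_module_def)

lemma half_smult_add:
  "x \<odot>\<^bsub>half_tensor_module \<delta> r s t V\<^esub> (F + G) =
   x \<odot>\<^bsub>half_tensor_module \<delta> r s t V\<^esub> F + x \<odot>\<^bsub>half_tensor_module \<delta> r s t V\<^esub> G"
  by (simp add: half_tensor_module_simps fun_eq_iff half_act_add)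

lemma half_smult_scale:
  "x \<odot>\<^bsub>half_tensor_module \<delta> r s t V\<^esub> (\<lambda>y. z * F y) =
   (\<lambda>y. z * (x \<odot>\<^bsub>half_tensor_module \<delta> r s t V\<^esub> F) y)"
  by (simp add: half_tensor_module_simps fun_eq_iff half_act_scale)

lemma half_smult_zero: "x \<odot>\<^bsub>half_tensor_module \<delta> r s t V\<^esub> 0 = 0"
  by (simp add: half_tensor_module_simps fun_eq_iff half_act_zero)

lemma half_smult_sum_stable:
  assumes S: "\<And>F. F \<in> S \<Longrightarrow> x \<odot>\<^bsub>half_tensor_module \<delta> r s t V\<^esub> F \<in> fun_span S"
    and F: "F \<in> fun_span S"
  shows "x \<odot>\<^bsub>half_tensor_module \<delta> r s t V\<^esub> F \<in> fun_span S"
  using F unfolding fun_span_eq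
proof (induction rule: function_space.span_induct)
  show "function_space.subspace {F. x \<odot>\<^bsub>half_tensor_module \<delta> r s t V\<^esub> F \<in> function_space.span S}"
    by (rule function_space.subspaceI)
      (simp_all add: half_smult_add half_smult_scale half_smult_zero function_space.span_add
        function_space.span_scale function_space.span_zero)
qed (use S in \<open>simp add: fun_span_eq\<close>)

lemma half_smult_closed:
  assumes "F \<in> carrier (half_tensor_module \<delta> r s t V)"
  shows "x \<odot>\<^bsub>half_tensor_module \<delta> r s t V\<^esub> F \<in> carrier (half_tensor_module \<delta> r s t V)"
  using assms unfolding half_tensor_module_simps(1) tensor_space_def
proof (rule half_smult_sum_stable[rotated])
  let ?G = "{pure_tensor u v | u v. u \<in> supported_on (half_diagrams r s t) \<and> v \<in> V}"
  fix F assume "F \<in> ?G"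
  then obtain u v where uv: "F = pure_tensor u v" "v \<in> V" by blast
  have "half_act \<delta> r s t x (\<lambda>D. u D * v y) C = half_act \<delta> r s t x u C * v y" for y C
    using half_act_scale[of \<delta> r s t x "v y" u C] by (simp add: mult.commute)
  hence "x \<odot>\<^bsub>half_tensor_module \<delta> r s t V\<^esub> F = pure_tensor (half_act \<delta> r s t x u) v"
    by (simp add: uv half_tensor_module_simps pure_tensor_def fun_eq_iff)
  hence "x \<odot>\<^bsub>half_tensor_module \<delta> r s t V\<^esub> F \<in> ?G" using uv half_act_supported by blast
  thus "x \<odot>\<^bsub>half_tensor_module \<delta> r s t V\<^esub> F \<in> fun_span ?G"
    unfolding fun_span_eq by (rule function_space.span_base)
qed

lemma tensor_space_slice:
  assumes F: "F \<in> tensor_space U V" and V: "function_space.subspace V"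
  shows "(\<lambda>y. F (D, y)) \<in> V"
  using F unfolding tensor_space_def fun_span_eq
proof (induction rule: function_space.span_induct)
  show "function_space.subspace {F. (\<lambda>y. F (D, y)) \<in> V}"
    using function_space.subspace_0[OF V] function_space.subspace_add[OF V] function_space.subspace_scale[OF V]
    by (intro function_space.subspaceI) (simp_all add: zero_fun_def plus_fun_def)
  fix F assume "F \<in> {pure_tensor u v | u v. u \<in> U \<and> v \<in> V}"
  then obtain u v where "F = pure_tensor u v" "v \<in> V" by blast
  thus "(\<lambda>y. F (D, y)) \<in> V"
    using function_space.subspace_scale[OF V, of v "u D"] by (simp add: pure_tensor_def)
qed

section \<open>The cell module of a fixed label\<close>

locale cell_label =
  fixes n r s t :: nat and l m :: "nat list" and V :: "(tabloid \<times> tabloid \<Rightarrow> 'k::field) set"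
  assumes t: "t \<le> r" "t \<le> s" and l: "l \<in> partitions (r - t)" and m: "m \<in> partitions (s - t)"
    and n: "2 * (r + s) < n"
  defines "V \<equiv> tensor_space (specht l) (specht m)"
begin

abbreviation "R \<equiv> walled_brauer (of_nat n :: 'k) r s"
abbreviation "M \<equiv> half_tensor_module (of_nat n :: 'k) r s t V"
abbreviation "N \<equiv> balancing_relations r s t V"
abbreviation "\<Psi> \<equiv> cell_tensor n r s t :: _ \<Rightarrow> _ \<Rightarrow> 'k"

lemma subspace_V: "function_space.subspace V"
  by (simp add: V_def tensor_space_def fun_span_eq)

lemma slice: "F \<in> carrier M \<Longrightarrow> (\<lambda>y. F (D, y)) \<in> V"
  using tensor_space_slice[OF _ subspace_V] by (simp add: half_tensor_module_simps)

text \<open>Products with too few propagating lines are zero in \<open>I^t\<close> by definition; in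
  tensor space they vanish because a southern arc pairs colours that never coincide.\<close>

lemma diagram_op_not_half:
  assumes "D \<in> walled_diagrams r s (r - t) (s - t)" "D \<notin> half_diagrams r s t" "v \<in> V"
  shows "diagram_op n (r + s) ((r - t) + (s - t)) D (tensor_of n (r - t) (s - t) v) = (\<lambda>c. 0)"
proof -
  obtain i j where arc: "{South i, South j} \<in> D"
    using half_diagramsI[OF t(1) assms(1)] assms(2) by blast
  show ?thesis
    by (rule diagram_op_south_arc[OF l m _ _ assms(1) arc]) (use assms(3) n t in \<open>auto simp: V_def\<close>)
qed

text \<open>Composition of operators is concatenation with a factor \<open>n\<close> for each loop,
  and the products that \<open>half_act\<close> discards act as zero by
  \<open>diagram_op_not_half\<close>. So the map is a homomorphism.\<close>

lemma cell_tensor_smult: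
  assumes F: "F \<in> carrier M"
  shows "\<Psi> (x \<odot>\<^bsub>M\<^esub> F) = element_op n r s x (\<Psi> F)"
proof
  fix c
  let ?a = "r - t" and ?b = "s - t" and ?H = "half_diagrams r s t" and ?W = "walled_diagrams r s r s"
  let ?op = "diagram_op n (r + s) (?a + ?b) :: _ \<Rightarrow> _ \<Rightarrow> _ \<Rightarrow> 'k"
  define g where "g D = tensor_of n ?a ?b (\<lambda>y. F (D, y))" for D
  define k where "k A D C = (if diagram_concat A D \<in> ?H
    then x A * of_nat n ^ closed_components A D * unit_at (diagram_concat A D) C else 0)" for A D C
  have g: "tensor_of n ?a ?b (\<lambda>y. (x \<odot>\<^bsub>M\<^esub> F) (C, y)) = (\<lambda>d. \<Sum>A\<in>?W. \<Sum>D\<in>?H. k A D C * g D d)" for C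
  proof
    fix d
    show "tensor_of n ?a ?b (\<lambda>y. (x \<odot>\<^bsub>M\<^esub> F) (C, y)) d = (\<Sum>A\<in>?W. \<Sum>D\<in>?H. k A D C * g D d)"
    proof (cases "d \<in> colorings n (?a + ?b)")
      case True
      thus ?thesis unfolding half_tensor_module_simps half_act_def
        by (simp add: tensor_of_def g_def k_def) (intro sum.cong refl, simp add: mult_ac)
    qed (simp add: tensor_of_def g_def)
  qed
  have "\<Psi> (x \<odot>\<^bsub>M\<^esub> F) c = (\<Sum>C\<in>?H. \<Sum>A\<in>?W. \<Sum>D\<in>?H. k A D C * ?op C (g D) c)"
    unfolding cell_tensor_def g diagram_op_sum diagram_op_scale ..
  also have "\<dots> = (\<Sum>A\<in>?W. \<Sum>D\<in>?H. \<Sum>C\<in>?H. k A D C * ?op C (g D) c)"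
    by (subst sum.swap) (intro sum.cong refl sum.swap)
  also have "\<dots> = (\<Sum>A\<in>?W. \<Sum>D\<in>?H. x A * diagram_op n (r + s) (r + s) A (?op D (g D)) c)"
  proof (intro sum.cong refl)
    fix A D assume A: "A \<in> ?W" and D: "D \<in> ?H"
    note DW = half_diagram_walled[OF D]
    interpret stacked_diagrams A D r s r s ?a ?b using A DW by unfold_locales
    let ?E = "diagram_concat A D"
    have "x A * diagram_op n (r + s) (r + s) A (?op D (g D)) c =
      x A * of_nat n ^ closed_components A D * ?op ?E (g D) c"
      using diagram_op_concat[OF A DW, of n "g D" c] by (simp add: mult.assoc)
    also have "\<dots> = (\<Sum>C\<in>?H. k A D C * ?op C (g D) c)"
    proof (cases "?E \<in> ?H")
      case True
      have "(\<Sum>C\<in>?H. k A D C * ?op C (g D) c) =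
        (\<Sum>C\<in>?H. if C = ?E then x A * of_nat n ^ closed_components A D * ?op C (g D) c else 0)"
        by (rule sum.cong) (auto simp: k_def True unit_at_def)
      thus ?thesis using True by simp
    next
      case False
      hence "?op ?E (g D) = (\<lambda>c. 0)"
        unfolding g_def by (rule diagram_op_not_half[OF diagram_concat_walled _ slice[OF F]])
      thus ?thesis using False by (simp add: k_def)
    qed
    finally show "(\<Sum>C\<in>?H. k A D C * ?op C (g D) c) =
      x A * diagram_op n (r + s) (r + s) A (?op D (g D)) c" ..
  qed
  also have "\<dots> = element_op n r s x (\<Psi> F) c"
    unfolding element_op_eq_sum cell_tensor_def g_def[symmetric] diagram_op_sum sum_distrib_left ..
  finally show "\<Psi> (x \<odot>\<^bsub>M\<^esub> F) c = element_op n r s x (\<Psi> F) c" .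
qed

definition scalar :: "nat \<Rightarrow> 'k" where
  "scalar k = (\<Sum>i\<in>{1..n}. diagonal_scalar n (bipartition_gl_weight n l m) k i)"

text \<open>Casimir operators can be moved past half diagrams; the tensors below are highest weight
  vectors of one common weight, which gives one scalar on the whole image.\<close>

lemma casimir_cell_tensor:
  assumes F: "F \<in> carrier M"
  shows "casimir r (r + s) n k (\<Psi> F) = (\<lambda>c. scalar k * \<Psi> F c)"
proof
  fix c
  let ?a = "r - t" and ?b = "s - t"
  have "casimir r (r + s) n k (diagram_op n (r + s) (?a + ?b) D (tensor_of n ?a ?b (\<lambda>y. F (D, y)))) =
    (\<lambda>c. scalar k * diagram_op n (r + s) (?a + ?b) D (tensor_of n ?a ?b (\<lambda>y. F (D, y))) c)"
    if D: "D \<in> half_diagrams r s t" for D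
  proof -
    have "highest_weight_vector ?a (?a + ?b) n (bipartition_gl_weight n l m) (tensor_of n ?a ?b (\<lambda>y. F (D, y)))"
      using slice[OF F] by (intro highest_weight_vector_tensor[OF l m]) (simp add: V_def)
    from casimir_highest_weight[OF this, of k] show ?thesis
      unfolding diagram_op_casimir[OF half_diagram_walled[OF D]] scalar_def by (simp only: diagram_op_scale)
  qed
  thus "casimir r (r + s) n k (\<Psi> F) c = scalar k * \<Psi> F c"
    unfolding cell_tensor_def casimir_sum sum_distrib_left by (intro sum.cong refl) metis
qed

text \<open>With this the map descends to the cell module; on generators it is
  \<open>diagram_op_relabel_south\<close>.\<close>

lemma cell_tensor_balancing:
  assumes "F \<in> N"
  shows "\<Psi> F = 0"
  using assms unfolding balancing_relations_def fun_span_eq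
proof (induction rule: function_space.span_induct)
  have zero: "\<Psi> 0 = 0" using cell_tensor_scale[of n r s t 0 0] by (simp add: zero_fun_def)
  show "function_space.subspace {F. \<Psi> F = 0}"
    by (rule function_space.subspaceI) (simp_all add: zero cell_tensor_add cell_tensor_scale fun_eq_iff)
  let ?a = "r - t" and ?b = "s - t"
  fix F assume "F \<in> {pure_tensor (unit_at (perm_south ?a D h)) v - pure_tensor (unit_at D) (perm_act h v) | D h v.
       D \<in> half_diagrams r s t \<and> v \<in> V \<and> h \<in> {\<sigma>. \<sigma> permutes {1..?a}} \<times> {\<tau>. \<tau> permutes {1..?b}}}"
  then obtain D \<sigma> \<tau> v where D: "D \<in> half_diagrams r s t" and \<sigma>: "\<sigma> permutes {1..?a}"
    and \<tau>: "\<tau> permutes {1..?b}"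
    and F: "F = pure_tensor (unit_at (perm_south ?a D (\<sigma>, \<tau>))) v - pure_tensor (unit_at D) (perm_act (\<sigma>, \<tau>) v)"
    by auto
  note \<pi> = south_perm(1,2)[OF \<sigma> \<tau>]
  have D': "perm_south ?a D (\<sigma>, \<tau>) \<in> half_diagrams r s t"
    unfolding perm_south_eq using relabel_south_half_iff[OF t(1) half_diagram_walled[OF D] \<pi>] D by blast
  have "\<Psi> (pure_tensor (unit_at (perm_south ?a D (\<sigma>, \<tau>))) v) = \<Psi> (pure_tensor (unit_at D) (perm_act (\<sigma>, \<tau>) v))"
    unfolding cell_tensor_unit[OF D] cell_tensor_unit[OF D']
    by (rule diagram_op_relabel_south[OF half_diagram_walled[OF D] \<sigma> \<tau>])
  moreover have "\<Psi> F + \<Psi> (pure_tensor (unit_at D) (perm_act (\<sigma>, \<tau>) v)) =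
    \<Psi> (pure_tensor (unit_at (perm_south ?a D (\<sigma>, \<tau>))) v)"
    unfolding F cell_tensor_add[symmetric] by simp
  ultimately show "\<Psi> F = 0" by simp
qed

text \<open>Multiplication from above commutes with relabelling the southern nodes, and relabelling
  does not change which products are discarded. So a generator is mapped to a linear combination of
  generators.\<close>

lemma balancing_stable:
  assumes "F \<in> N"
  shows "x \<odot>\<^bsub>M\<^esub> F \<in> N"
  using assms unfolding balancing_relations_def
proof (rule half_smult_sum_stable[rotated])
  let ?a = "r - t" and ?b = "s - t" and ?H = "half_diagrams r s t" and ?W = "walled_diagrams r s r s"
  define gen where "gen D h v = pure_tensor (unit_at (perm_south ?a D h)) v - pure_tensor (unit_at D) (perm_act h v)"
    for D h and v :: "tabloid \<times> tabloid \<Rightarrow> 'k"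
  let ?G = "{pure_tensor (unit_at (perm_south ?a D h)) v - pure_tensor (unit_at D) (perm_act h v) | D h v.
       D \<in> ?H \<and> v \<in> V \<and> h \<in> {\<sigma>. \<sigma> permutes {1..?a}} \<times> {\<tau>. \<tau> permutes {1..?b}}}"
  fix F assume "F \<in> ?G"
  then obtain D \<sigma> \<tau> v where D: "D \<in> ?H" and v: "v \<in> V" and \<sigma>: "\<sigma> permutes {1..?a}" and \<tau>: "\<tau> permutes {1..?b}"
    and F: "F = gen D (\<sigma>, \<tau>) v"
    unfolding gen_def by auto
  let ?h = "(\<sigma>, \<tau>)"
  note \<pi> = south_perm(1,2)[OF \<sigma> \<tau>]
  note DW = half_diagram_walled[OF D]
  have D': "perm_south ?a D ?h \<in> ?H"
    unfolding perm_south_eq using relabel_south_half_iff[OF t(1) DW \<pi>] D by blast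
  define k where "k A = (if diagram_concat A D \<in> ?H then x A * of_nat n ^ closed_components A D else 0)" for A
  have act: "half_act (of_nat n) r s t x (unit_at D) C = (\<Sum>A\<in>?W. k A * unit_at (diagram_concat A D) C)" for C
    unfolding half_act_unit[OF D] by (rule sum.cong) (auto simp: k_def)
  have act': "half_act (of_nat n) r s t x (unit_at (perm_south ?a D ?h)) C =
    (\<Sum>A\<in>?W. k A * unit_at (perm_south ?a (diagram_concat A D) ?h) C)" for C
    unfolding half_act_unit[OF D']
  proof (rule sum.cong[OF refl])
    fix A assume A: "A \<in> ?W"
    interpret stacked_diagrams A D r s r s ?a ?b using A DW by unfold_locales
    have "diagram_concat A (perm_south ?a D ?h) \<in> ?H \<longleftrightarrow> diagram_concat A D \<in> ?H"
      unfolding perm_south_eq concat_relabel_south(1)[OF A DW \<pi>]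
      by (rule relabel_south_half_iff[OF t(1) diagram_concat_walled \<pi>])
    thus "(if diagram_concat A (perm_south ?a D ?h) \<in> ?H then x A * of_nat n ^ closed_components A (perm_south ?a D ?h) *
        unit_at (diagram_concat A (perm_south ?a D ?h)) C else 0) =
      k A * unit_at (perm_south ?a (diagram_concat A D) ?h) C"
      unfolding perm_south_eq concat_relabel_south[OF A DW \<pi>] by (simp add: k_def)
  qed
  have smult_pure: "x \<odot>\<^bsub>M\<^esub> pure_tensor u w = pure_tensor (half_act (of_nat n) r s t x u) w" for u w
  proof -
    have "half_act (of_nat n) r s t x (\<lambda>D. u D * w y) C = half_act (of_nat n) r s t x u C * w y" for y C
      using half_act_scale[of "of_nat n" r s t x "w y" u C] by (simp add: mult.commute)
    thus ?thesis by (simp add: half_tensor_module_simps pure_tensor_def fun_eq_iff)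
  qed
  have "x \<odot>\<^bsub>M\<^esub> F + x \<odot>\<^bsub>M\<^esub> pure_tensor (unit_at D) (perm_act ?h v) = x \<odot>\<^bsub>M\<^esub> pure_tensor (unit_at (perm_south ?a D ?h)) v"
    unfolding half_smult_add[symmetric] F gen_def by simp
  hence "x \<odot>\<^bsub>M\<^esub> F = pure_tensor (half_act (of_nat n) r s t x (unit_at (perm_south ?a D ?h))) v -
    pure_tensor (half_act (of_nat n) r s t x (unit_at D)) (perm_act ?h v)"
    unfolding smult_pure by (simp add: eq_diff_eq)
  also have "\<dots> = (\<Sum>A\<in>?W. (\<lambda>y. k A * gen (diagram_concat A D) ?h v y))"
  proof
    fix z :: "diagram \<times> tabloid \<times> tabloid"
    obtain C y where z: "z = (C, y)" by (cases z)
    have app: "(\<Sum>A\<in>?W. f A) z = (\<Sum>A\<in>?W. f A z)" for f :: "diagram \<Rightarrow> diagram \<times> tabloid \<times> tabloid \<Rightarrow> 'k"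
      by (induction rule: infinite_finite_induct) auto
    show "(pure_tensor (half_act (of_nat n) r s t x (unit_at (perm_south ?a D ?h))) v -
      pure_tensor (half_act (of_nat n) r s t x (unit_at D)) (perm_act ?h v)) z =
      (\<Sum>A\<in>?W. (\<lambda>y. k A * gen (diagram_concat A D) ?h v y)) z"
      unfolding app by (simp add: z pure_tensor_def act act' gen_def sum_distrib_right sum_subtractf right_diff_distrib mult.assoc)
  qed
  also have "\<dots> \<in> fun_span ?G" unfolding fun_span_eq
  proof (rule function_space.span_sum)
    fix A
    show "(\<lambda>y. k A * gen (diagram_concat A D) ?h v y) \<in> function_space.span ?G"
    proof (cases "diagram_concat A D \<in> ?H")
      case True
      hence "gen (diagram_concat A D) ?h v \<in> ?G" using v \<sigma> \<tau> unfolding gen_def by blast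
      thus ?thesis by (intro function_space.span_scale function_space.span_base)
    next
      case False
      hence zero: "(\<lambda>y. k A * gen (diagram_concat A D) ?h v y) = 0" by (simp add: k_def fun_eq_iff)
      show ?thesis unfolding zero by (rule function_space.span_zero)
    qed
  qed
  finally show "x \<odot>\<^bsub>M\<^esub> F \<in> fun_span ?G" .
qed

text \<open>In a half diagram every southern node lies on a propagating line, so a suitable northern
  colouring \<open>c\<close> is compatible with a single southern colouring \<open>d\<close>. With
  \<open>d\<close> chosen where a tensor of two polytabloids has value 1, the coefficient at
  \<open>c\<close> is 1.\<close>

lemma cell_tensor_nonzero: "\<exists>F\<in>carrier M. \<Psi> F \<noteq> 0"
proof -
  let ?a = "r - t" and ?b = "s - t"
  obtain D where D: "D \<in> half_diagrams r s t" using half_diagrams_nonempty[OF t] by blast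
  note DW = half_diagram_walled[OF D]
  have sum: "sum_list l = ?a" "sum_list m = ?b" using l m by (auto simp: partitions_def)
  obtain tl tm where tl: "tableau l tl" and tm: "tableau m tm" using tableau_exists by metis
  obtain e where e: "\<And>x. x \<in> {1..?a} \<Longrightarrow> e x \<in> {1..length l}" "polytabloid l tl (row_sets ?a e) = (1 :: 'k)"
    using polytabloid_nonzero[OF tl, where 'k = 'k] unfolding sum by blast
  obtain e' where e': "\<And>x. x \<in> {1..?b} \<Longrightarrow> e' x \<in> {1..length m}" "polytabloid m tm (row_sets ?b e') = (1 :: 'k)"
    using polytabloid_nonzero[OF tm, where 'k = 'k] unfolding sum by blast
  define v :: "tabloid \<times> tabloid \<Rightarrow> 'k" where "v = pure_tensor (polytabloid l tl) (polytabloid m tm)"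
  have "polytabloid l tl \<in> specht l" "polytabloid m tm \<in> specht m"
    unfolding specht_def fun_span_eq using tl tm by (auto intro: function_space.span_base)
  hence v: "v \<in> V" unfolding v_def V_def tensor_space_def fun_span_eq by (intro function_space.span_base) blast
  \<comment> \<open>Right colours are read downwards from \<open>n\<close>, so that
    \<open>right_rows\<close> recovers \<open>e'\<close>.\<close>
  define d where "d = (\<lambda>j\<in>{1..?a + ?b}. if j \<le> ?a then e j else n + 1 - e' (j - ?a))"
  have len: "length l \<le> n" "length m \<le> n" using length_partition[OF l] length_partition[OF m] n by auto
  have d_range: "d j \<in> {1..n}" if "j \<in> {1..?a + ?b}" for j
  proof (cases "j \<le> ?a")
    case True
    thus ?thesis using e(1)[of j] that len by (auto simp: d_def)
  next
    case False
    hence "j - ?a \<in> {1..?b}" using that by auto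
    from e'(1)[OF this] have "1 \<le> n + 1 - e' (j - ?a)" "n + 1 - e' (j - ?a) \<le> n"
      using len(2) unfolding atLeastAtMost_iff by linarith+
    moreover have "d j = n + 1 - e' (j - ?a)" using False that by (simp add: d_def)
    ultimately show ?thesis by simp
  qed
  have d: "d \<in> colorings n (?a + ?b)" unfolding colorings_def
    by (rule PiE_I) (use d_range in \<open>auto simp: d_def\<close>)
  have "row_sets ?a d = row_sets ?a e" by (rule row_sets_cong) (auto simp: d_def)
  moreover have "row_sets ?b (right_rows n ?a d) = row_sets ?b e'"
  proof (rule row_sets_cong)
    fix x assume x: "x \<in> {1..?b}"
    thus "right_rows n ?a d x = e' x" using e'(1)[OF x] len by (auto simp: d_def right_rows_def)
  qed
  ultimately have v_d: "tensor_of n ?a ?b v d = 1"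
    using d e(2) e'(2) by (simp add: tensor_of_def v_def pure_tensor_def)
  \<comment> \<open>A propagating line copies the colour of its southern end; the common colour 1 of
    all northern arcs is an arbitrary choice.\<close>
  define c where "c = (\<lambda>i\<in>{1..r + s}. case partner D (North i) of South j \<Rightarrow> d j | North _ \<Rightarrow> 1)"
  let ?N = "nodes (r + s) (?a + ?b)"
  have c: "c \<in> colorings n (r + s)" unfolding colorings_def
  proof (rule PiE_I)
    fix i assume i: "i \<in> {1..r + s}"
    hence iN: "North i \<in> ?N" by (simp add: nodes_iff)
    show "c i \<in> {1..n}"
    proof (cases "partner D (North i)")
      case (South j)
      hence "j \<in> {1..?a + ?b}" using partner(2)[OF DW iN] by (simp add: nodes_iff)
      thus ?thesis using d_range South i by (simp add: c_def)
    qed (use i n in \<open>auto simp: c_def\<close>)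
  next
    fix i assume "i \<notin> {1..r + s}"
    thus "c i = undefined" unfolding c_def by (rule restrict_apply[THEN trans, OF if_not_P])
  qed
  have comp: "compatible D c d' \<longleftrightarrow> d' = d" if d': "d' \<in> colorings n (?a + ?b)" for d'
  proof
    assume comp: "compatible D c d'"
    show "d' = d"
    proof (rule PiE_ext[OF d'[unfolded colorings_def] d[unfolded colorings_def]])
      fix j assume "j \<in> {1..?a + ?b}"
      hence jN: "South j \<in> ?N" by (simp add: nodes_iff)
      note pj = partner[OF DW jN]
      obtain i where i: "partner D (South j) = North i"
        using pj(1) half_diagram_no_arc[OF D] by (cases "partner D (South j)") auto
      have "node_color c d' (South j) = node_color c d' (North i)"
        using comp pj(1) unfolding compatible_def i by blast
      moreover have "c i = d j" using pj(2,5) unfolding i by (simp add: c_def nodes_iff)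
      ultimately show "d' j = d j" by simp
    qed
  next
    assume d'd: "d' = d"
    have c_val: "node_color c d u = (case partner D u of South j \<Rightarrow> d j | North i \<Rightarrow> (if is_north u then 1 else c i))"
      if "u \<in> ?N" "is_north u" for u
      using that by (cases u) (auto simp: c_def nodes_iff split: node.splits)
    show "compatible D c d'" unfolding compatible_def d'd
    proof (intro allI impI)
      fix u w assume uw: "{u, w} \<in> D"
      have wu: "{w, u} \<in> D" using uw by (simp add: insert_commute)
      note uN = walled_diagram_pair_plus(2,3)[OF DW uw]
      have p: "partner D u = w" "partner D w = u" using partner_eq[OF DW uw] partner_eq[OF DW wu] by auto
      show "node_color c d u = node_color c d w"
        using c_val[OF uN(1)] c_val[OF uN(2)] p half_diagram_no_arc[OF D] uw
        by (cases u; cases w) auto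
    qed
  qed
  have "\<Psi> (pure_tensor (unit_at D) v) c = (\<Sum>d'\<in>colorings n (?a + ?b). diagram_matrix D c d' * tensor_of n ?a ?b v d')"
    unfolding cell_tensor_unit[OF D] diagram_op_def matrix_op_def using c by simp
  also have "\<dots> = (\<Sum>d'\<in>colorings n (?a + ?b). if d' = d then tensor_of n ?a ?b v d' else 0)"
    by (rule sum.cong) (simp_all add: diagram_matrix_def comp)
  also have "\<dots> = 1" using d v_d by simp
  finally have "\<Psi> (pure_tensor (unit_at D) v) \<noteq> 0" by (metis zero_fun_apply zero_neq_one)
  moreover have "pure_tensor (unit_at D) v \<in> carrier M"
    unfolding half_tensor_module_simps tensor_space_def fun_span_eq
    using unit_at_supported[OF D] v by (intro function_space.span_base) blast
  ultimately show ?thesis by blast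
qed

lemma quotient_with_image: "quotient_with_image R M N \<Psi> (colorings n (r + s))"
proof
  show "\<exists>\<zeta>\<in>carrier R. \<forall>x\<in>carrier M. \<Psi> (\<zeta> \<odot>\<^bsub>M\<^esub> x) = (\<lambda>c. z * \<Psi> x c)" for z
  proof (intro bexI ballI)
    \<comment> \<open>The multiple of the unit acts on tensor space as a scalar, since the unit acts
      there as the identity matrix.\<close>
    let ?\<zeta> = "\<lambda>A. z * \<one>\<^bsub>R\<^esub> A"
    show "?\<zeta> \<in> carrier R"
      unfolding walled_brauer_simps
      by (intro supported_on_scale unit_at_supported identity_diagram_walled)
    fix x assume x: "x \<in> carrier M"
    have "element_op n r s ?\<zeta> w = (\<lambda>c. z * element_op n r s \<one>\<^bsub>R\<^esub> w c)" for w
      by (auto simp: element_op_def matrix_op_def element_matrix_scale sum_distrib_left mult.assoc)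
    thus "\<Psi> (?\<zeta> \<odot>\<^bsub>M\<^esub> x) = (\<lambda>c. z * \<Psi> x c)"
      by (simp only: cell_tensor_smult[OF x] element_op_one[OF cell_tensor_supported])
  qed
  have op0: "element_op n r s x 0 = 0" for x :: "diagram \<Rightarrow> 'k"
    by (auto simp: element_op_def matrix_op_def)
  show "\<Psi> (a \<odot>\<^bsub>M\<^esub> x) = 0" if "x \<in> carrier M" "\<Psi> x = 0" for a x
    using cell_tensor_smult[OF that(1), of a] that(2) op0 by simp
  show "function_space.subspace (carrier M)" "function_space.subspace N"
    by (simp_all add: half_tensor_module_simps tensor_space_def balancing_relations_def fun_span_eq)
qed (simp_all add: half_tensor_module_simps(2,3) half_smult_add half_smult_closed balancing_stable
  cell_tensor_add cell_tensor_scale cell_tensor_balancing cell_tensor_supported cell_tensor_nonzero)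

lemma simple_module_eq: "simple_module (of_nat n) r s (l, m) = head R (quotient_module M N)"
proof -
  have "sum_list l = r - t" using l by (simp add: partitions_def)
  hence "r - sum_list l = t" using t by simp
  thus ?thesis by (simp add: simple_module_def cell_module_def V_def Let_def)
qed

text \<open>Supplies one joint eigenvector of all Casimir operators on which the block idempotent
  does not vanish. It is the image of an element of the module on which \<open>e\<close>
  survives.\<close>

lemma block_witness:
  assumes "in_block R e (simple_module (of_nat n) r s (l, m))"
  obtains w where "w \<in> supported_on (colorings n (r + s))" "element_op n r s e w \<noteq> 0"
    "\<And>k. casimir r (r + s) n k w = (\<lambda>c. scalar k * w c)"
proof -
  interpret quotient_with_image R M N \<Psi> "colorings n (r + s)" by (rule quotient_with_image)
  have e: "e \<in> carrier R"
    using assms by (simp add: in_block_def primitive_central_idempotent_def central_idempotent_def)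
  have "\<exists>x\<in>carrier M. \<Psi> (e \<odot>\<^bsub>M\<^esub> x) \<noteq> 0"
    by (rule head_identity_imp_image_nonzero[OF e])
      (use assms in \<open>simp add: in_block_def simple_module_eq\<close>)
  then obtain x where x: "x \<in> carrier M" "\<Psi> (e \<odot>\<^bsub>M\<^esub> x) \<noteq> 0" by blast
  show ?thesis
  proof (rule that)
    show "\<Psi> x \<in> supported_on (colorings n (r + s))" by (rule cell_tensor_supported)
    show "element_op n r s e (\<Psi> x) \<noteq> 0" using x(2) by (simp only: cell_tensor_smult[OF x(1)] not_False_eq_True)
    show "casimir r (r + s) n k (\<Psi> x) = (\<lambda>c. scalar k * \<Psi> x c)" for k
      by (rule casimir_cell_tensor[OF x(1)])
  qed
qed

end

section \<open>Blocks\<close>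

definition ring_center :: "('a, 'b) ring_scheme \<Rightarrow> 'a set" where
  "ring_center R = {x \<in> carrier R. \<forall>y\<in>carrier R. x \<otimes>\<^bsub>R\<^esub> y = y \<otimes>\<^bsub>R\<^esub> x}"

context ring
begin

lemma ring_center_closed:
  "x \<in> ring_center R \<Longrightarrow> x \<in> carrier R"
  "x \<in> ring_center R \<Longrightarrow> y \<in> ring_center R \<Longrightarrow> x \<otimes> y \<in> ring_center R"
  "x \<in> ring_center R \<Longrightarrow> y \<in> ring_center R \<Longrightarrow> x \<ominus> y \<in> ring_center R"
  "\<one> \<in> ring_center R"
proof -
  show "x \<in> ring_center R \<Longrightarrow> x \<in> carrier R" "\<one> \<in> ring_center R" by (auto simp: ring_center_def)
  assume xy: "x \<in> ring_center R" "y \<in> ring_center R"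
  hence carr: "x \<in> carrier R" "y \<in> carrier R" and comm: "\<And>z. z \<in> carrier R \<Longrightarrow> x \<otimes> z = z \<otimes> x"
    "\<And>z. z \<in> carrier R \<Longrightarrow> y \<otimes> z = z \<otimes> y" by (auto simp: ring_center_def)
  show "x \<otimes> y \<in> ring_center R"
    unfolding ring_center_def
  proof (intro CollectI conjI ballI)
    fix z assume z: "z \<in> carrier R"
    have "x \<otimes> y \<otimes> z = x \<otimes> (z \<otimes> y)" using carr z comm(2)[OF z] by (simp add: m_assoc)
    also have "\<dots> = z \<otimes> (x \<otimes> y)" using carr z comm(1)[OF z] by (simp add: m_assoc[symmetric])
    finally show "x \<otimes> y \<otimes> z = z \<otimes> (x \<otimes> y)" .
  qed (use carr in simp)
  show "x \<ominus> y \<in> ring_center R"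
    unfolding ring_center_def using carr comm by (auto simp: a_minus_def l_distr r_distr l_minus r_minus)
qed

lemma ring_center_comm: "x \<in> ring_center R \<Longrightarrow> y \<in> carrier R \<Longrightarrow> x \<otimes> y = y \<otimes> x"
  by (simp add: ring_center_def)

lemma ring_center_pow: "x \<in> ring_center R \<Longrightarrow> x [^] (k :: nat) \<in> ring_center R"
  by (induction k) (auto intro: ring_center_closed)

lemma ring_center_rearrange:
  assumes "x \<in> ring_center R" "y \<in> ring_center R" "z \<in> ring_center R"
  shows "x \<otimes> y \<otimes> z = x \<otimes> (y \<otimes> z)" "x \<otimes> y = y \<otimes> x" "x \<otimes> (y \<otimes> z) = y \<otimes> (x \<otimes> z)"
proof -
  note c = ring_center_closed(1)[OF assms(1)] ring_center_closed(1)[OF assms(2)] ring_center_closed(1)[OF assms(3)]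
  show "x \<otimes> y \<otimes> z = x \<otimes> (y \<otimes> z)" using c by (simp add: m_assoc)
  show comm: "x \<otimes> y = y \<otimes> x" by (rule ring_center_comm[OF assms(1) c(2)])
  have "x \<otimes> (y \<otimes> z) = x \<otimes> y \<otimes> z" using c by (simp add: m_assoc)
  also have "\<dots> = y \<otimes> (x \<otimes> z)" unfolding comm using c by (simp add: m_assoc)
  finally show "x \<otimes> (y \<otimes> z) = y \<otimes> (x \<otimes> z)" .
qed

end

text \<open>Fitting's lemma for \<open>x\<close> acting on a block: \<open>x^m h e\<close> is an idempotent below \<open>e\<close>.\<close>

lemma primitive_central_idempotent_fitting:
  fixes R :: "'a ring" (structure)
  assumes R: "ring R" and e: "primitive_central_idempotent R e" and x: "x \<in> ring_center R" and h: "h \<in> ring_center R"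
    and pow: "x [^] m = x [^] m \<otimes> (x [^] m \<otimes> h)"
  shows "x [^] (m :: nat) \<otimes> e = \<zero> \<or> e = x [^] m \<otimes> (h \<otimes> e)"
proof -
  interpret ring R by (rule R)
  let ?x = "x [^] m"
  define f where "f = ?x \<otimes> (h \<otimes> e)"
  have e': "e \<in> ring_center R" "e \<otimes> e = e"
    using e by (auto simp: primitive_central_idempotent_def central_idempotent_def ring_center_def)
  have x': "?x \<in> ring_center R" by (rule ring_center_pow[OF x])
  note closed = ring_center_closed
  have f: "f \<in> ring_center R" unfolding f_def by (intro closed x' h e')
  note carr = closed(1)[OF e'(1)] closed(1)[OF x'] closed(1)[OF h] closed(1)[OF f]
  have he: "h \<otimes> e \<in> ring_center R" by (intro closed h e')
  have fe: "f \<otimes> e = f" unfolding f_def using carr e'(2) by (simp add: m_assoc)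
  \<comment> \<open>By \<open>pow\<close>, the products of \<open>x^m\<close> with \<open>f\<close>
    and with \<open>e\<close> agree; this is what makes \<open>f\<close> idempotent.\<close>
  have xf: "?x \<otimes> f = ?x \<otimes> e"
  proof -
    have "?x \<otimes> f = ?x \<otimes> (?x \<otimes> h) \<otimes> e" unfolding f_def using carr by (simp add: m_assoc)
    thus ?thesis using pow by simp
  qed
  have ff: "f \<otimes> f = f"
  proof -
    have "f = (h \<otimes> e) \<otimes> ?x" unfolding f_def using ring_center_comm[OF x', of "h \<otimes> e"] carr by simp
    hence "f \<otimes> f = (h \<otimes> e) \<otimes> ?x \<otimes> f" by simp
    also have "\<dots> = (h \<otimes> e) \<otimes> (?x \<otimes> f)" using carr by (simp add: m_assoc)
    also have "\<dots> = (h \<otimes> e) \<otimes> (e \<otimes> ?x)" using xf ring_center_comm[OF x' carr(1)] by simp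
    also have "\<dots> = h \<otimes> ((e \<otimes> e) \<otimes> ?x)" using carr by (simp add: m_assoc)
    also have "\<dots> = (h \<otimes> e) \<otimes> ?x" unfolding e'(2) using carr by (simp add: m_assoc)
    also have "\<dots> = f" unfolding f_def using ring_center_comm[OF he carr(2)] by simp
    finally show ?thesis .
  qed
  have ef: "e \<otimes> f = f" using fe ring_center_comm[OF e'(1) carr(4)] by simp
  \<comment> \<open>\<open>e\<close> splits into the orthogonal central idempotents \<open>f\<close>
    and \<open>g\<close>, and primitivity makes one of them zero. If it is \<open>f\<close>, then
    \<open>x^m e = x^m f\<close> vanishes; if it is \<open>g\<close>, then
    \<open>e = f\<close>.\<close>
  define g where "g = e \<ominus> f"
  have g: "g \<in> ring_center R" unfolding g_def by (intro closed e' f)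
  have g_carr: "g \<in> carrier R" by (rule closed(1)[OF g])
  have minus_l: "(u \<ominus> v) \<otimes> w = u \<otimes> w \<ominus> v \<otimes> w" and minus_r: "w \<otimes> (u \<ominus> v) = w \<otimes> u \<ominus> w \<otimes> v"
    if "u \<in> carrier R" "v \<in> carrier R" "w \<in> carrier R" for u v w
    using that by (simp_all add: a_minus_def l_distr r_distr l_minus r_minus)
  have gf: "g \<otimes> f = \<zero>" unfolding g_def minus_l[OF carr(1,4,4)] ef ff using carr(4) by (simp add: a_minus_def r_neg)
  have ge: "g \<otimes> e = g" unfolding g_def minus_l[OF carr(1,4,1)] e'(2) fe ..
  have "g \<otimes> (e \<ominus> f) = \<zero> \<oplus> g"
    unfolding minus_r[OF carr(1,4) g_carr] gf ge using g_carr by (simp add: a_minus_def)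
  hence "g \<otimes> g = g" using g_carr unfolding g_def[symmetric] by simp
  hence gg: "central_idempotent R g" using g unfolding central_idempotent_def ring_center_def by blast
  have ff': "central_idempotent R f" using f ff unfolding central_idempotent_def ring_center_def by blast
  have fg: "f \<otimes> g = \<zero>" unfolding ring_center_comm[OF f g_carr] by (rule gf)
  have "f \<oplus> g = e \<oplus> (f \<oplus> \<ominus> f)"
    unfolding g_def a_minus_def by (rule a_lcomm) (use carr in auto)
  hence sum: "e = f \<oplus> g" unfolding r_neg[OF carr(4)] r_zero[OF carr(1)] by (rule sym)
  have "\<forall>f g. central_idempotent R f \<and> central_idempotent R g \<and> f \<otimes> g = \<zero> \<and> e = f \<oplus> g \<longrightarrow>
      f = \<zero> \<or> g = \<zero>"
    using e unfolding primitive_central_idempotent_def by (elim conjE)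
  from this[rule_format, OF conjI[OF ff' conjI[OF gg conjI[OF fg sum]]]] have "f = \<zero> \<or> g = \<zero>" .
  thus ?thesis
  proof
    assume "f = \<zero>"
    thus ?thesis using xf carr by simp
  next
    assume "g = \<zero>"
    hence "e = f" using sum carr(4) by simp
    thus ?thesis unfolding f_def ..
  qed
qed

lemma walled_brauer_scale:
  fixes x y :: "diagram \<Rightarrow> 'k::field"
  shows "x \<otimes>\<^bsub>walled_brauer \<delta> r s\<^esub> (\<lambda>A. z * y A) = (\<lambda>A. z * (x \<otimes>\<^bsub>walled_brauer \<delta> r s\<^esub> y) A)"
    and "(\<lambda>A. z * x A) \<otimes>\<^bsub>walled_brauer \<delta> r s\<^esub> y = (\<lambda>A. z * (x \<otimes>\<^bsub>walled_brauer \<delta> r s\<^esub> y) A)"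
  by (simp_all add: walled_brauer_simps sum_distrib_left mult_ac)

text \<open>The descending chain of the ideals \<open>x^j C\<close> of the center \<open>C\<close> is stationary.\<close>

lemma central_power_stable:
  fixes x :: "diagram \<Rightarrow> 'k::field"
  assumes n: "2 * (r + s) \<le> n"
  defines "R \<equiv> walled_brauer (of_nat n :: 'k) r s"
  assumes x: "x \<in> ring_center R"
  shows "\<exists>m\<ge>1. \<exists>h\<in>ring_center R. x [^]\<^bsub>R\<^esub> (m :: nat) = x [^]\<^bsub>R\<^esub> m \<otimes>\<^bsub>R\<^esub> (x [^]\<^bsub>R\<^esub> m \<otimes>\<^bsub>R\<^esub> h)"
proof -
  interpret R: ring R unfolding R_def by (rule ring_walled_brauer[OF n])
  let ?C = "ring_center R" and ?W = "walled_diagrams r s r s"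
  \<comment> \<open>The exponents start at 1, so that the stationary exponent \<open>m\<close> is
    positive and \<open>x^m\<close> kills every vector killed by \<open>x\<close>.\<close>
  define I where "I j = (\<lambda>h. x [^]\<^bsub>R\<^esub> Suc j \<otimes>\<^bsub>R\<^esub> h) ` ?C" for j
  note closed = R.ring_center_closed
  have pow: "x [^]\<^bsub>R\<^esub> j \<in> ?C" for j :: nat by (rule R.ring_center_pow[OF x])
  have carr: "carrier R = supported_on ?W" by (simp add: R_def walled_brauer_simps)
  have I_supp: "I j \<subseteq> supported_on ?W" for j
    unfolding I_def carr[symmetric] using closed(1,2) pow by blast
  have add_R: "y \<oplus>\<^bsub>R\<^esub> z = y + z" for y z by (simp add: R_def walled_brauer_simps)
  have C_add: "y + z \<in> ?C" if "y \<in> ?C" "z \<in> ?C" for y z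
    using that unfolding ring_center_def add_R[symmetric] by (auto simp: R.l_distr R.r_distr)
  have C_scale: "(\<lambda>A. c * y A) \<in> ?C" if y: "y \<in> ?C" for c y
  proof -
    have "(\<lambda>A. c * y A) \<in> carrier R"
      using closed(1)[OF y] unfolding carr by (rule supported_on_scale)
    moreover have "(\<lambda>A. c * y A) \<otimes>\<^bsub>R\<^esub> z = z \<otimes>\<^bsub>R\<^esub> (\<lambda>A. c * y A)" if "z \<in> carrier R" for z
      using R.ring_center_comm[OF y that] unfolding R_def walled_brauer_scale by simp
    ultimately show ?thesis by (simp add: ring_center_def)
  qed
  have C_zero: "0 \<in> ?C" using C_scale[OF x, of 0] by (simp add: zero_fun_def)
  have subspace: "function_space.subspace (I j)" for j
  proof (rule function_space.subspaceI)
    let ?y = "x [^]\<^bsub>R\<^esub> Suc j"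
    have y: "?y \<in> carrier R" using closed(1)[OF pow] .
    have "?y \<otimes>\<^bsub>R\<^esub> 0 = 0" using R.r_null[OF y] by (simp add: R_def walled_brauer_simps(2))
    thus "0 \<in> I j" unfolding I_def using imageI[OF C_zero, of "\<lambda>h. ?y \<otimes>\<^bsub>R\<^esub> h"] by simp
    fix f g assume "f \<in> I j" "g \<in> I j"
    then obtain f' g' where fg: "f' \<in> ?C" "g' \<in> ?C" "f = ?y \<otimes>\<^bsub>R\<^esub> f'" "g = ?y \<otimes>\<^bsub>R\<^esub> g'"
      unfolding I_def by blast
    have "f + g = ?y \<otimes>\<^bsub>R\<^esub> (f' + g')"
      using R.r_distr[OF closed(1)[OF fg(1)] closed(1)[OF fg(2)] y] unfolding add_R fg by simp
    thus "f + g \<in> I j" unfolding I_def using C_add[OF fg(1,2)] by blast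
    fix c
    have "(\<lambda>A. c * f A) = ?y \<otimes>\<^bsub>R\<^esub> (\<lambda>A. c * f' A)" unfolding fg R_def walled_brauer_scale ..
    thus "(\<lambda>A. c * f A) \<in> I j" unfolding I_def using C_scale[OF fg(1)] by blast
  qed
  have decreasing: "I (Suc j) \<subseteq> I j" for j
  proof
    fix f assume "f \<in> I (Suc j)"
    then obtain h where h: "h \<in> ?C" "f = x [^]\<^bsub>R\<^esub> Suc (Suc j) \<otimes>\<^bsub>R\<^esub> h" unfolding I_def by blast
    hence "f = x [^]\<^bsub>R\<^esub> Suc j \<otimes>\<^bsub>R\<^esub> (x \<otimes>\<^bsub>R\<^esub> h)"
      using closed(1)[OF x] closed(1)[OF pow[of "Suc j"]] closed(1)[OF h(1)] by (simp add: R.m_assoc)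
    thus "f \<in> I j" unfolding I_def using closed(2)[OF x h(1)] by blast
  qed
  have "\<exists>j. I (Suc j) = I j"
  proof (rule ccontr)
    assume "\<not> ?thesis"
    hence "I (Suc j) \<subset> I j" for j using decreasing by blast
    hence less: "function_rank (I (Suc j)) < function_rank (I j)" for j
      by (intro function_rank_less[OF finite_walled_diagrams I_supp _ subspace])
    have "function_rank (I j) + j \<le> function_rank (I 0)" for j
    proof (induction j)
      case (Suc j)
      thus ?case using less[of j] by simp
    qed simp
    from this[of "Suc (function_rank (I 0))"] show False by simp
  qed
  then obtain j where j: "I (Suc j) = I j" ..
  let ?m = "Suc j"
  have "x [^]\<^bsub>R\<^esub> ?m \<otimes>\<^bsub>R\<^esub> \<one>\<^bsub>R\<^esub> \<in> I j" unfolding I_def using closed(4) by blast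
  hence "x [^]\<^bsub>R\<^esub> ?m \<in> I (Suc j)" using j R.r_one[OF closed(1)[OF pow[of ?m]]] by simp
  \<comment> \<open>Iterating \<open>x^m = x^(m+1) h\<close> gives \<open>x^m = x^m x^i h^i\<close>
    for every \<open>i\<close>; the claim is the case \<open>i = m\<close>, with \<open>h^m\<close>
    as witness.\<close>
  then obtain h where h: "h \<in> ?C" "x [^]\<^bsub>R\<^esub> ?m = x [^]\<^bsub>R\<^esub> Suc ?m \<otimes>\<^bsub>R\<^esub> h" unfolding I_def by blast
  have xc: "x \<in> carrier R" and hc: "h \<in> carrier R" by (intro closed(1) x h)+
  have "x [^]\<^bsub>R\<^esub> ?m = x [^]\<^bsub>R\<^esub> ?m \<otimes>\<^bsub>R\<^esub> (x [^]\<^bsub>R\<^esub> i \<otimes>\<^bsub>R\<^esub> h [^]\<^bsub>R\<^esub> i)" for i :: nat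
  proof (induction i)
    case 0
    show ?case using xc by simp
  next
    case (Suc i)
    let ?y = "x [^]\<^bsub>R\<^esub> ?m" and ?xi = "x [^]\<^bsub>R\<^esub> i" and ?hi = "h [^]\<^bsub>R\<^esub> i"
    have c: "?y \<in> ?C" "?xi \<in> ?C" "?hi \<in> ?C" by (intro pow R.ring_center_pow h(1))+
    have "x [^]\<^bsub>R\<^esub> Suc ?m \<otimes>\<^bsub>R\<^esub> h = ?y \<otimes>\<^bsub>R\<^esub> (x \<otimes>\<^bsub>R\<^esub> h)"
      unfolding R.nat_pow_Suc[of x ?m] by (rule R.m_assoc[OF closed(1)[OF c(1)] xc hc])
    with h(2) have y: "?y = ?y \<otimes>\<^bsub>R\<^esub> (x \<otimes>\<^bsub>R\<^esub> h)" by (rule trans)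
    have "?y = ?y \<otimes>\<^bsub>R\<^esub> (?xi \<otimes>\<^bsub>R\<^esub> ?hi)" by (rule Suc)
    also have "\<dots> = (?y \<otimes>\<^bsub>R\<^esub> (x \<otimes>\<^bsub>R\<^esub> h)) \<otimes>\<^bsub>R\<^esub> (?xi \<otimes>\<^bsub>R\<^esub> ?hi)"
      by (rule arg_cong[OF y, of "\<lambda>u. u \<otimes>\<^bsub>R\<^esub> (?xi \<otimes>\<^bsub>R\<^esub> ?hi)"])
    also have "\<dots> = ?y \<otimes>\<^bsub>R\<^esub> ((x \<otimes>\<^bsub>R\<^esub> h) \<otimes>\<^bsub>R\<^esub> (?xi \<otimes>\<^bsub>R\<^esub> ?hi))"
      using xc hc closed(1)[OF c(1)] closed(1)[OF c(2)] closed(1)[OF c(3)] by (simp add: R.m_assoc)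
    also have "(x \<otimes>\<^bsub>R\<^esub> h) \<otimes>\<^bsub>R\<^esub> (?xi \<otimes>\<^bsub>R\<^esub> ?hi) = (?xi \<otimes>\<^bsub>R\<^esub> x) \<otimes>\<^bsub>R\<^esub> (?hi \<otimes>\<^bsub>R\<^esub> h)"
    proof -
      have "(x \<otimes>\<^bsub>R\<^esub> h) \<otimes>\<^bsub>R\<^esub> (?xi \<otimes>\<^bsub>R\<^esub> ?hi) = x \<otimes>\<^bsub>R\<^esub> (?xi \<otimes>\<^bsub>R\<^esub> (h \<otimes>\<^bsub>R\<^esub> ?hi))"
        using R.ring_center_rearrange[OF h(1) c(2,3)] xc hc closed(1)[OF c(2)] closed(1)[OF c(3)]
        by (simp add: R.m_assoc)
      also have "\<dots> = (x \<otimes>\<^bsub>R\<^esub> ?xi) \<otimes>\<^bsub>R\<^esub> (h \<otimes>\<^bsub>R\<^esub> ?hi)"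
        using xc hc closed(1)[OF c(2)] closed(1)[OF c(3)] by (simp add: R.m_assoc)
      finally show ?thesis
        using R.ring_center_comm[OF x closed(1)[OF c(2)]] R.ring_center_comm[OF h(1) closed(1)[OF c(3)]] by simp
    qed
    finally show ?case by (simp only: R.nat_pow_Suc)
  qed
  from this[of ?m] show ?thesis using R.ring_center_pow[OF h(1), of ?m] by (intro exI[of _ ?m]) auto
qed

lemma element_op_casimir:
  "element_op n r s x (casimir r (r + s) n k f) = casimir r (r + s) n k (element_op n r s x f)"
proof -
  have op: "element_op n r s x f = (\<lambda>c. \<Sum>A\<in>walled_diagrams r s r s. x A * diagram_op n (r + s) (r + s) A f c)" for f
    by (rule ext) (rule element_op_eq_sum)
  show ?thesis
    unfolding op[of f] op[of "casimir r (r + s) n k f"]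
    by (rule ext) (simp only: casimir_sum casimir_scale diagram_op_casimir cong: sum.cong)
qed

text \<open>Fitting's lemma is applied to \<open>x\<close>, the central element of the Casimir
  operator minus \<open>a\<close>. It is not invertible on the block, since it kills
  \<open>w\<close> while \<open>e w\<close> is nonzero. So a power of \<open>x\<close> vanishes on
  the block, and this power multiplies the nonzero vector \<open>e w'\<close> by a power of
  \<open>b - a\<close>.\<close>

lemma casimir_eigenvalues_in_block:
  fixes e :: "diagram \<Rightarrow> 'k::field"
  assumes n: "2 * (r + s) \<le> n"
  defines "R \<equiv> walled_brauer (of_nat n :: 'k) r s"
  assumes e: "primitive_central_idempotent R e"
    and w: "w \<in> supported_on (colorings n (r + s))" "element_op n r s e w \<noteq> 0"
      "casimir r (r + s) n k w = (\<lambda>c. a * w c)"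
    and w': "w' \<in> supported_on (colorings n (r + s))" "element_op n r s e w' \<noteq> 0"
      "casimir r (r + s) n k w' = (\<lambda>c. b * w' c)"
  shows "a = b"
proof -
  interpret R: ring R unfolding R_def by (rule ring_walled_brauer[OF n])
  let ?op = "element_op n r s :: (diagram \<Rightarrow> 'k) \<Rightarrow> _" and ?S = "supported_on (colorings n (r + s)) :: ((nat \<Rightarrow> nat) \<Rightarrow> 'k) set"
  have op_mult: "?op (x \<otimes>\<^bsub>R\<^esub> y) f = ?op x (?op y f)" for x y f
    unfolding R_def by (rule element_op_mult)
  have op_one: "?op \<one>\<^bsub>R\<^esub> f = f" if "f \<in> ?S" for f
    unfolding R_def by (rule element_op_one[OF that])
  have op_zero: "?op x (\<lambda>c. 0) = (\<lambda>c. 0)" for x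
    by (auto simp: element_op_def matrix_op_def)
  from casimir_element[of n r s k, where 'k = 'k]
  obtain z where z_carr: "z \<in> carrier (walled_brauer (of_nat n :: 'k) r s)"
    and z_op: "\<forall>f\<in>?S. ?op z f = casimir r (r + s) n k f" ..
  hence z: "z \<in> carrier R" "\<And>f. f \<in> ?S \<Longrightarrow> ?op z f = casimir r (r + s) n k f"
    by (simp_all add: R_def)
  define x where "x = z - (\<lambda>A. a * \<one>\<^bsub>R\<^esub> A)"
  have one: "(\<lambda>A. a * \<one>\<^bsub>R\<^esub> A) \<in> carrier R"
    using R.one_closed unfolding R_def walled_brauer_simps(1) by (rule supported_on_scale)
  have x_carr: "x \<in> carrier R"
    using z(1) one unfolding x_def R_def walled_brauer_simps(1) by (rule supported_on_simps(4))
  have op_x: "?op x f = (\<lambda>c. casimir r (r + s) n k f c - a * f c)" if f: "f \<in> ?S" for f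
  proof -
    have "?op x f = (\<lambda>c. ?op z f c - a * ?op \<one>\<^bsub>R\<^esub> f c)"
      unfolding x_def by (auto simp: element_op_def matrix_op_def element_matrix_diff element_matrix_scale
        left_diff_distrib sum_subtractf sum_distrib_left mult.assoc)
    thus ?thesis using z(2)[OF f] op_one[OF f] by simp
  qed
  \<comment> \<open>Centrality is checked on operators, where diagrams commute with Casimir
    operators, and transferred to the algebra by faithfulness.\<close>
  have x: "x \<in> ring_center R"
    unfolding ring_center_def
  proof (intro CollectI conjI ballI x_carr)
    fix y assume y: "y \<in> carrier R"
    show "x \<otimes>\<^bsub>R\<^esub> y = y \<otimes>\<^bsub>R\<^esub> x"
    proof (rule element_op_inject[OF n, where \<delta> = "of_nat n"])
      fix f :: "(nat \<Rightarrow> nat) \<Rightarrow> 'k" assume f: "f \<in> ?S"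
      have "?op y (\<lambda>c. casimir r (r + s) n k f c - a * f c) =
        (\<lambda>c. ?op y (casimir r (r + s) n k f) c - a * ?op y f c)"
        by (auto simp: element_op_def matrix_op_def right_diff_distrib sum_subtractf sum_distrib_left mult_ac)
      thus "?op (x \<otimes>\<^bsub>R\<^esub> y) f = ?op (y \<otimes>\<^bsub>R\<^esub> x) f"
        unfolding op_mult op_x[OF f] op_x[OF element_op_supported] element_op_casimir by simp
    qed (use R.m_closed[OF x_carr y] R.m_closed[OF y x_carr] in \<open>simp_all add: R_def\<close>)
  qed
  obtain m h where m: "m \<ge> 1" and h: "h \<in> ring_center R"
    and pow: "x [^]\<^bsub>R\<^esub> (m :: nat) = x [^]\<^bsub>R\<^esub> m \<otimes>\<^bsub>R\<^esub> (x [^]\<^bsub>R\<^esub> m \<otimes>\<^bsub>R\<^esub> h)"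
    using central_power_stable[OF n x[unfolded R_def]] unfolding R_def by blast
  have e_carr: "e \<in> carrier R" and e_center: "e \<in> ring_center R"
    using e by (auto simp: primitive_central_idempotent_def central_idempotent_def ring_center_def)
  have xm: "x [^]\<^bsub>R\<^esub> m \<in> ring_center R" by (rule R.ring_center_pow[OF x])
  have "?op x w = (\<lambda>c. 0)" unfolding op_x[OF w(1)] w(3) by simp
  hence op_pow_w: "?op (x [^]\<^bsub>R\<^esub> m) w = (\<lambda>c. 0)"
    using m op_zero by (cases m) (simp_all add: op_mult)
  have op_pow_w': "?op (x [^]\<^bsub>R\<^esub> i) w' = (\<lambda>c. (b - a) ^ i * w' c)" for i :: nat
  proof (induction i)
    case 0
    show ?case using op_one[OF w'(1)] by simp
  next
    case (Suc i)
    have "?op (x [^]\<^bsub>R\<^esub> Suc i) w' = ?op (x [^]\<^bsub>R\<^esub> i) (\<lambda>c. (b - a) * w' c)"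
      by (simp add: op_mult op_x[OF w'(1)] w'(3) left_diff_distrib)
    also have "\<dots> = (\<lambda>c. (b - a) * ((b - a) ^ i * w' c))" unfolding element_op_scale Suc ..
    finally show ?case unfolding power_Suc mult.assoc .
  qed
  have "x [^]\<^bsub>R\<^esub> m \<otimes>\<^bsub>R\<^esub> e = \<zero>\<^bsub>R\<^esub> \<or> e = x [^]\<^bsub>R\<^esub> m \<otimes>\<^bsub>R\<^esub> (h \<otimes>\<^bsub>R\<^esub> e)"
    by (rule primitive_central_idempotent_fitting[OF R.ring_axioms e x h pow])
  thus ?thesis
  proof
    assume zero: "x [^]\<^bsub>R\<^esub> m \<otimes>\<^bsub>R\<^esub> e = \<zero>\<^bsub>R\<^esub>"
    have "(\<lambda>c. (b - a) ^ m * ?op e w' c) = ?op (e \<otimes>\<^bsub>R\<^esub> x [^]\<^bsub>R\<^esub> m) w'"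
      unfolding op_mult op_pow_w' element_op_scale ..
    also have "e \<otimes>\<^bsub>R\<^esub> x [^]\<^bsub>R\<^esub> m = \<zero>\<^bsub>R\<^esub>" using zero R.ring_center_comm[OF xm e_carr] by simp
    also have "?op \<zero>\<^bsub>R\<^esub> w' = (\<lambda>c. 0)"
      by (auto simp: R_def walled_brauer_simps element_op_def matrix_op_def)
    finally have zero': "(b - a) ^ m * ?op e w' c = 0" for c by (rule fun_cong)
    obtain c where "?op e w' c \<noteq> 0" using w'(2) by (auto simp: fun_eq_iff)
    hence "(b - a) ^ m = 0" using zero'[of c] by simp
    thus ?thesis by simp
  next
    assume eq: "e = x [^]\<^bsub>R\<^esub> m \<otimes>\<^bsub>R\<^esub> (h \<otimes>\<^bsub>R\<^esub> e)"
    have "h \<otimes>\<^bsub>R\<^esub> e \<in> carrier R" using R.ring_center_closed(1)[OF h] e_carr by simp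
    hence "e = (h \<otimes>\<^bsub>R\<^esub> e) \<otimes>\<^bsub>R\<^esub> x [^]\<^bsub>R\<^esub> m" by (rule trans[OF eq R.ring_center_comm[OF xm]])
    hence "?op e w = ?op ((h \<otimes>\<^bsub>R\<^esub> e) \<otimes>\<^bsub>R\<^esub> x [^]\<^bsub>R\<^esub> m) w" by (rule arg_cong)
    also have "\<dots> = (\<lambda>c. 0)" unfolding op_mult op_pow_w op_zero ..
    finally show ?thesis using w(2) by (simp add: zero_fun_def)
  qed
qed

lemma simple_label_cases:
  fixes \<delta> :: "'k::field"
  assumes "lm \<in> simple_labels \<delta> r s"
  obtains t l m where "lm = (l, m)" "t \<le> r" "t \<le> s" "l \<in> partitions (r - t)" "m \<in> partitions (s - t)"
  using assms by (auto simp: simple_labels_def bipartitions_reg_def bipartitions_def)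

theorem corollary10p3:
  fixes p r s :: nat
    and \<delta> :: int
    and lam mu :: "nat list \<times> nat list"
  assumes "CHAR('k::alg_closed_field) = p" and "p > 0"
    and "lam \<in> simple_labels (of_int \<delta> :: 'k) r s"
    and "mu \<in> simple_labels (of_int \<delta> :: 'k) r s"
    and "same_block (walled_brauer (of_int \<delta> :: 'k) r s)
           (simple_module (of_int \<delta>) r s lam) (simple_module (of_int \<delta>) r s mu)"
  shows "bipartition_weight r s mu \<in>
           (\<lambda>w. dot_action \<delta> r s w (bipartition_weight r s lam)) ` affine_weyl_group p r s"
proof -
  obtain t l m where lam: "lam = (l, m)" "t \<le> r" "t \<le> s" "l \<in> partitions (r - t)" "m \<in> partitions (s - t)"
    using simple_label_cases[OF assms(3)] .
  obtain t' l' m' where mu: "mu = (l', m')" "t' \<le> r" "t' \<le> s" "l' \<in> partitions (r - t')" "m' \<in> partitions (s - t')"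
    using simple_label_cases[OF assms(4)] .
  \<comment> \<open>The residue fixes the image of \<open>n\<close> in the field; the multiple of
    \<open>p\<close> pushes \<open>n\<close> above \<open>2 * (r + s)\<close>, as
    \<open>p \<ge> 1\<close>.\<close>
  define n where "n = nat (\<delta> mod int p) + p * (2 * (r + s) + 1)"
  have "int n = \<delta> mod int p + int p * int (2 * (r + s) + 1)"
    unfolding n_def of_nat_add of_nat_mult using assms(2) by simp
  hence n_mod: "int n mod int p = \<delta> mod int p" by (simp only: mod_mult_self2 mod_mod_trivial)
  have "1 * (2 * (r + s) + 1) \<le> p * (2 * (r + s) + 1)" using assms(2) by (intro mult_le_mono1) simp
  hence n: "2 * (r + s) < n" by (simp add: n_def)
  have "(of_int (int n - \<delta>) :: 'k) = 0"
    using n_mod assms(1) by (simp add: of_int_eq_0_iff_char_dvd mod_eq_dvd_iff del: of_int_diff)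
  \<comment> \<open>The algebra and its modules involve \<delta> only through its image in the
    field, so \<open>n\<close> may replace it.\<close>
  hence \<delta>: "of_int \<delta> = (of_nat n :: 'k)" by simp
  interpret lam: cell_label n r s t l m "tensor_space (specht l) (specht m) :: (_ \<Rightarrow> 'k) set"
    using lam n by unfold_locales auto
  interpret mu: cell_label n r s t' l' m' "tensor_space (specht l') (specht m') :: (_ \<Rightarrow> 'k) set"
    using mu n by unfold_locales auto
  let ?R = "walled_brauer (of_nat n :: 'k) r s"
  obtain e where e: "in_block ?R e (simple_module (of_nat n) r s (l, m))"
    "in_block ?R e (simple_module (of_nat n) r s (l', m'))"
    using assms(5) unfolding same_block_def \<delta> lam(1) mu(1) by blast
  have prim: "primitive_central_idempotent ?R e" using e(1) by (simp add: in_block_def)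
  have scalars: "lam.scalar k = mu.scalar k" for k
  proof -
    obtain w where w: "w \<in> supported_on (colorings n (r + s))" "element_op n r s e w \<noteq> 0"
      "casimir r (r + s) n k w = (\<lambda>c. lam.scalar k * w c)"
      using lam.block_witness[OF e(1)] by blast
    obtain w' where w': "w' \<in> supported_on (colorings n (r + s))" "element_op n r s e w' \<noteq> 0"
      "casimir r (r + s) n k w' = (\<lambda>c. mu.scalar k * w' c)"
      using mu.block_witness[OF e(2)] by blast
    show ?thesis by (rule casimir_eigenvalues_in_block[OF _ prim w w']) (use n in simp)
  qed
  have len: "length l \<le> r" "length m \<le> s" "length l' \<le> r" "length m' \<le> s"
    using length_partition lam(4,5) mu(4,5) by fastforce+
  have res: "card {i \<in> {1..n}. (int (part l i) - int (part m (n + 1 - i)) + int (n - i)) mod int p = v mod int p} =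
    card {i \<in> {1..n}. (int (part l' i) - int (part m' (n + 1 - i)) + int (n - i)) mod int p = v mod int p}" for v
  proof (rule scalars_determine_residues[OF assms(1,2)])
    show "bipartition_gl_weight n l m i + of_nat (n - i) =
      (of_int (int (part l i) - int (part m (n + 1 - i)) + int (n - i)) :: 'k)" for i
      by (simp add: bipartition_gl_weight_def)
    show "bipartition_gl_weight n l' m' i + of_nat (n - i) =
      (of_int (int (part l' i) - int (part m' (n + 1 - i)) + int (n - i)) :: 'k)" for i
      by (simp add: bipartition_gl_weight_def)
    show "(\<Sum>i\<in>{1..n}. diagonal_scalar n (bipartition_gl_weight n l m) k i) =
      (\<Sum>i\<in>{1..n}. diagonal_scalar n (bipartition_gl_weight n l' m') k i :: 'k)" for k
      using scalars[of k] unfolding lam.scalar_def mu.scalar_def .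
  qed
  have "sum_list l = r - t" "sum_list m = s - t" "sum_list l' = r - t'" "sum_list m' = s - t'"
    using lam(4,5) mu(4,5) by (simp_all add: partitions_def)
  \<comment> \<open>Both differences equal \<open>s - r\<close>, although \<open>t\<close> and
    \<open>t'\<close> may differ.\<close>
  hence "int (sum_list m) - int (sum_list l) = int (sum_list m') - int (sum_list l')"
    using lam(2,3) mu(2,3) by simp
  thus ?thesis
    by (rule dot_orbit_if_gl_residues_eq[OF lam(1) len(1,2) mu(1) len(3,4) _ _ n_mod res]) (use n in simp)
qed

end
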